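(* For any small Grothendieck site $I$, the Grothendieck topos $\mathrm{Sh}(I,\mathbf{Set})$ is a Bass--Serre category.
   Context: For a category $\mathbf{C}$ with finite limits (terminal object $*$), $\mathrm{Grp}(\mathbf{C})$ is the category of group objects in $\mathbf{C}$. Action Barr-exactness. In a regular category $\mathbf{D}$, if $H\in\mathrm{Grp}(\mathbf{D})$ acts on $Y\in\mathbf{D}$ (with action map $a\colon H\times Y\to Y$), then the image $R\hookrightarrow Y\times Y$ in the (regular epi)-mono factorisation of $(a,\mathrm{pr}_Y)\colon H\times Y\to Y\times Y$ is a congruence (internal equivalence relation) on $Y$. A regular category $\mathbf{D}$ is action Barr-exact if every such congruence is effective (has a coequaliser and is the kernel pair of it). $\mathbf{C}$ is locally action Barr-exact if every slice $\mathbf{C}_{/Y}$ is action Barr-exact. Bass--Serre category. A category $\mathbf{C}$ is Bass--Serre if: (1) $\mathbf{C}$ is locally action Barr-exact, has a terminal object, and has coequalisers, which are preserved by $C\times(-)$ for every $C\in\mathbf{C}$; (2) $\mathrm{Grp}(\mathbf{C})$ has coequalisers and $\mathbf{C}$-internal coproducts, i.e. for each $C\in\mathbf{C}$ the functor $\mathrm{Grp}(\mathbf{C})\to\mathrm{Grp}(\mathbf{C}_{/C})$, $K\mapsto K\times C$, has a left adjoint $\operatorname{colim}_{C^\delta}$; moreover for every $C$ and $H\in\mathrm{Grp}(\mathbf{C}_{/C})$, $H$ generates $\operatorname{colim}_{C^\delta}H$, meaning that $(\operatorname{colim}_{C^\delta}H)\times H\rightrightarrows\operatorname{colim}_{C^\delta}H\to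 *$ is a coequaliser in $\mathbf{C}$, where the two maps are the projection and the map (canonical map $H\to\operatorname{colim}_{C^\delta}H$ on the second factor, followed by multiplication). Here the canonical map is the unit $H\to(\operatorname{colim}_{C^\delta}H)\times C$ followed by the projection. *)

theory Defs
  imports Main "HOL-Library.FuncSet" "HOL-Library.Equipollence"
begin

section \<open>Categories, functors and adjunctions\<close>

text \<open>
  A category is given by carrier sets of objects and arrows.  \<open>Comp\<close> is written in the usual
  order: \<open>g \<cdot>\<^bsub>C\<^esub> f\<close> is \<open>g\<close> after \<open>f\<close>.  Everything is relativised to the carriers.
\<close>

record ('o, 'a) cat =
  Obj :: "'o set"
  Arr :: "'a set"
  Dom :: "'a \<Rightarrow> 'o"
  Cod :: "'a \<Rightarrow> 'o"
  Id :: "'o \<Rightarrow> 'a"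
  Comp :: "'a \<Rightarrow> 'a \<Rightarrow> 'a" (infixl "\<cdot>\<index>" 70)

definition hom :: "('o, 'a) cat \<Rightarrow> 'o \<Rightarrow> 'o \<Rightarrow> 'a set" where
  "hom C A B = {f \<in> Arr C. Dom C f = A \<and> Cod C f = B}"

locale category =
  fixes C :: "('o, 'a) cat" (structure)
  assumes dom_in: "f \<in> Arr C \<Longrightarrow> Dom C f \<in> Obj C"
    and cod_in: "f \<in> Arr C \<Longrightarrow> Cod C f \<in> Obj C"
    and id_in: "A \<in> Obj C \<Longrightarrow> Id C A \<in> hom C A A"
    and comp_in: "f \<in> hom C X Y \<Longrightarrow> g \<in> hom C Y Z \<Longrightarrow> g \<cdot> f \<in> hom C X Z"
    and id_left: "f \<in> hom C X Y \<Longrightarrow> Id C Y \<cdot> f = f"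
    and id_right: "f \<in> hom C X Y \<Longrightarrow> f \<cdot> Id C X = f"
    and comp_assoc: "f \<in> hom C W X \<Longrightarrow> g \<in> hom C X Y \<Longrightarrow> h \<in> hom C Y Z \<Longrightarrow>
      (h \<cdot> g) \<cdot> f = h \<cdot> (g \<cdot> f)"

definition opposite :: "('o, 'a) cat \<Rightarrow> ('o, 'a) cat" where
  "opposite C = \<lparr>Obj = Obj C, Arr = Arr C, Dom = Cod C, Cod = Dom C, Id = Id C,
     Comp = (\<lambda>g f. f \<cdot>\<^bsub>C\<^esub> g)\<rparr>"

definition full_subcategory :: "('o, 'a) cat \<Rightarrow> 'o set \<Rightarrow> ('o, 'a) cat" where
  "full_subcategory C S = \<lparr>Obj = Obj C \<inter> S, Arr = {f \<in> Arr C. Dom C f \<in> S \<and> Cod C f \<in> S},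
     Dom = Dom C, Cod = Cod C, Id = Id C, Comp = Comp C\<rparr>"

text \<open>
  Several categories below have arrows \<open>(A, f, B)\<close> that carry their domain and codomain along with
  some underlying datum \<open>f\<close>.
\<close>

definition mid :: "'x \<times> 'y \<times> 'z \<Rightarrow> 'y" where
  "mid t = fst (snd t)"

record ('o1, 'a1, 'o2, 'a2) ftor =
  fobj :: "'o1 \<Rightarrow> 'o2"
  farr :: "'a1 \<Rightarrow> 'a2"

definition is_functor ::
  "('o1, 'a1) cat \<Rightarrow> ('o2, 'a2) cat \<Rightarrow> ('o1, 'a1, 'o2, 'a2) ftor \<Rightarrow> bool" where
  "is_functor D E F \<longleftrightarrow>
     (\<forall>A\<in>Obj D. fobj F A \<in> Obj E) \<and>
     (\<forall>f\<in>Arr D. farr F f \<in> hom E (fobj F (Dom D f)) (fobj F (Cod D f))) \<and>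
     (\<forall>A\<in>Obj D. farr F (Id D A) = Id E (fobj F A)) \<and>
     (\<forall>f\<in>Arr D. \<forall>g\<in>Arr D. Dom D g = Cod D f \<longrightarrow> farr F (g \<cdot>\<^bsub>D\<^esub> f) = farr F g \<cdot>\<^bsub>E\<^esub> farr F f)"

definition id_ftor :: "('o, 'a, 'o, 'a) ftor" where
  "id_ftor = \<lparr>fobj = (\<lambda>A. A), farr = (\<lambda>f. f)\<rparr>"

definition comp_ftor ::
  "('o2, 'a2, 'o3, 'a3) ftor \<Rightarrow> ('o1, 'a1, 'o2, 'a2) ftor \<Rightarrow> ('o1, 'a1, 'o3, 'a3) ftor" where
  "comp_ftor G F = \<lparr>fobj = (\<lambda>A. fobj G (fobj F A)), farr = (\<lambda>f. farr G (farr F f))\<rparr>"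

definition nat_trans ::
  "('o1, 'a1) cat \<Rightarrow> ('o2, 'a2) cat \<Rightarrow> ('o1, 'a1, 'o2, 'a2) ftor \<Rightarrow> ('o1, 'a1, 'o2, 'a2) ftor \<Rightarrow>
    ('o1 \<Rightarrow> 'a2) \<Rightarrow> bool" where
  "nat_trans D E F G \<eta> \<longleftrightarrow>
     (\<forall>A\<in>Obj D. \<eta> A \<in> hom E (fobj F A) (fobj G A)) \<and>
     (\<forall>f\<in>Arr D. \<eta> (Cod D f) \<cdot>\<^bsub>E\<^esub> farr F f = farr G f \<cdot>\<^bsub>E\<^esub> \<eta> (Dom D f))"

text \<open>
  Functors and natural transformations are taken to be \<open>extensional\<close>, so that equality in the
  functor category is equality on the carriers.
\<close>

definition functor_category ::
  "('o1, 'a1) cat \<Rightarrow> ('o2, 'a2) cat \<Rightarrow>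
    (('o1, 'a1, 'o2, 'a2) ftor,
     ('o1, 'a1, 'o2, 'a2) ftor \<times> ('o1 \<Rightarrow> 'a2) \<times> ('o1, 'a1, 'o2, 'a2) ftor) cat" where
  "functor_category D E =
     (let \<F> = {F. is_functor D E F \<and> fobj F \<in> extensional (Obj D) \<and> farr F \<in> extensional (Arr D)}
      in \<lparr>Obj = \<F>,
          Arr = {(F, \<eta>, G). F \<in> \<F> \<and> G \<in> \<F> \<and> nat_trans D E F G \<eta> \<and> \<eta> \<in> extensional (Obj D)},
          Dom = (\<lambda>(F, \<eta>, G). F),
          Cod = (\<lambda>(F, \<eta>, G). G),
          Id = (\<lambda>F. (F, (\<lambda>A\<in>Obj D. Id E (fobj F A)), F)),
          Comp = (\<lambda>(G', \<theta>, H) (F, \<eta>, G). (F, (\<lambda>A\<in>Obj D. \<theta> A \<cdot>\<^bsub>E\<^esub> \<eta> A), H))\<rparr>)"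

text \<open>\<open>L\<close> is left adjoint to \<open>R\<close>, with unit \<open>\<eta>\<close>.\<close>

definition left_adjoint ::
  "('o1, 'a1) cat \<Rightarrow> ('o2, 'a2) cat \<Rightarrow> ('o1, 'a1, 'o2, 'a2) ftor \<Rightarrow> ('o2, 'a2, 'o1, 'a1) ftor \<Rightarrow>
    ('o1 \<Rightarrow> 'a1) \<Rightarrow> bool" where
  "left_adjoint D E L R \<eta> \<longleftrightarrow>
     is_functor D E L \<and> is_functor E D R \<and> nat_trans D D id_ftor (comp_ftor R L) \<eta> \<and>
     (\<forall>X\<in>Obj D. \<forall>Y\<in>Obj E. \<forall>f\<in>hom D X (fobj R Y).
        \<exists>!g. g \<in> hom E (fobj L X) Y \<and> farr R g \<cdot>\<^bsub>D\<^esub> \<eta> X = f)"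


section \<open>Limits and colimits\<close>

definition is_terminal :: "('o, 'a) cat \<Rightarrow> 'o \<Rightarrow> bool" where
  "is_terminal C T \<longleftrightarrow> T \<in> Obj C \<and> (\<forall>X\<in>Obj C. \<exists>!f. f \<in> hom C X T)"

definition is_product :: "('o, 'a) cat \<Rightarrow> 'o \<Rightarrow> 'o \<Rightarrow> 'o \<Rightarrow> 'a \<Rightarrow> 'a \<Rightarrow> bool" where
  "is_product C A B P p q \<longleftrightarrow>
     P \<in> Obj C \<and> p \<in> hom C P A \<and> q \<in> hom C P B \<and>
     (\<forall>X\<in>Obj C. \<forall>f\<in>hom C X A. \<forall>g\<in>hom C X B.
        \<exists>!h. h \<in> hom C X P \<and> p \<cdot>\<^bsub>C\<^esub> h = f \<and> q \<cdot>\<^bsub>C\<^esub> h = g)"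

definition is_equaliser :: "('o, 'a) cat \<Rightarrow> 'a \<Rightarrow> 'a \<Rightarrow> 'a \<Rightarrow> bool" where
  "is_equaliser C f g e \<longleftrightarrow>
     f \<in> Arr C \<and> g \<in> hom C (Dom C f) (Cod C f) \<and>
     e \<in> Arr C \<and> Cod C e = Dom C f \<and> f \<cdot>\<^bsub>C\<^esub> e = g \<cdot>\<^bsub>C\<^esub> e \<and>
     (\<forall>X\<in>Obj C. \<forall>h\<in>hom C X (Dom C f). f \<cdot>\<^bsub>C\<^esub> h = g \<cdot>\<^bsub>C\<^esub> h \<longrightarrow>
        (\<exists>!k. k \<in> hom C X (Dom C e) \<and> e \<cdot>\<^bsub>C\<^esub> k = h))"

definition is_coequaliser :: "('o, 'a) cat \<Rightarrow> 'a \<Rightarrow> 'a \<Rightarrow> 'a \<Rightarrow> bool" where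
  "is_coequaliser C f g q \<longleftrightarrow>
     f \<in> Arr C \<and> g \<in> hom C (Dom C f) (Cod C f) \<and>
     q \<in> Arr C \<and> Dom C q = Cod C f \<and> q \<cdot>\<^bsub>C\<^esub> f = q \<cdot>\<^bsub>C\<^esub> g \<and>
     (\<forall>X\<in>Obj C. \<forall>h\<in>hom C (Cod C f) X. h \<cdot>\<^bsub>C\<^esub> f = h \<cdot>\<^bsub>C\<^esub> g \<longrightarrow>
        (\<exists>!k. k \<in> hom C (Cod C q) X \<and> k \<cdot>\<^bsub>C\<^esub> q = h))"

definition is_pullback :: "('o, 'a) cat \<Rightarrow> 'a \<Rightarrow> 'a \<Rightarrow> 'a \<Rightarrow> 'a \<Rightarrow> bool" where
  "is_pullback C f g p q \<longleftrightarrow>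
     f \<in> Arr C \<and> g \<in> Arr C \<and> Cod C f = Cod C g \<and>
     p \<in> Arr C \<and> Cod C p = Dom C f \<and> q \<in> hom C (Dom C p) (Dom C g) \<and>
     f \<cdot>\<^bsub>C\<^esub> p = g \<cdot>\<^bsub>C\<^esub> q \<and>
     (\<forall>X\<in>Obj C. \<forall>h\<in>hom C X (Dom C f). \<forall>k\<in>hom C X (Dom C g). f \<cdot>\<^bsub>C\<^esub> h = g \<cdot>\<^bsub>C\<^esub> k \<longrightarrow>
        (\<exists>!l. l \<in> hom C X (Dom C p) \<and> p \<cdot>\<^bsub>C\<^esub> l = h \<and> q \<cdot>\<^bsub>C\<^esub> l = k))"

definition has_finite_limits :: "('o, 'a) cat \<Rightarrow> bool" where
  "has_finite_limits C \<longleftrightarrow>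
     (\<exists>T. is_terminal C T) \<and>
     (\<forall>A\<in>Obj C. \<forall>B\<in>Obj C. \<exists>P p q. is_product C A B P p q) \<and>
     (\<forall>f\<in>Arr C. \<forall>g\<in>hom C (Dom C f) (Cod C f). \<exists>e. is_equaliser C f g e)"

definition has_coequalisers :: "('o, 'a) cat \<Rightarrow> bool" where
  "has_coequalisers C \<longleftrightarrow>
     (\<forall>f\<in>Arr C. \<forall>g\<in>hom C (Dom C f) (Cod C f). \<exists>q. is_coequaliser C f g q)"

text \<open>
  A choice of terminal object and of binary products (meaningful if these exist), used to express
  internal algebraic structure.
\<close>

definition terminal :: "('o, 'a) cat \<Rightarrow> 'o" where
  "terminal C = (SOME T. is_terminal C T)"

definition bang :: "('o, 'a) cat \<Rightarrow> 'o \<Rightarrow> 'a" where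
  "bang C X = (THE f. f \<in> hom C X (terminal C))"

definition prod_cone :: "('o, 'a) cat \<Rightarrow> 'o \<Rightarrow> 'o \<Rightarrow> 'o \<times> 'a \<times> 'a" where
  "prod_cone C A B = (SOME (P, p, q). is_product C A B P p q)"

definition prd :: "('o, 'a) cat \<Rightarrow> 'o \<Rightarrow> 'o \<Rightarrow> 'o" where
  "prd C A B = fst (prod_cone C A B)"

definition pr1 :: "('o, 'a) cat \<Rightarrow> 'o \<Rightarrow> 'o \<Rightarrow> 'a" where
  "pr1 C A B = fst (snd (prod_cone C A B))"

definition pr2 :: "('o, 'a) cat \<Rightarrow> 'o \<Rightarrow> 'o \<Rightarrow> 'a" where
  "pr2 C A B = snd (snd (prod_cone C A B))"

definition pair :: "('o, 'a) cat \<Rightarrow> 'a \<Rightarrow> 'a \<Rightarrow> 'a" where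
  "pair C f g = (THE h. h \<in> hom C (Dom C f) (prd C (Cod C f) (Cod C g)) \<and>
     pr1 C (Cod C f) (Cod C g) \<cdot>\<^bsub>C\<^esub> h = f \<and> pr2 C (Cod C f) (Cod C g) \<cdot>\<^bsub>C\<^esub> h = g)"

definition prd_map :: "('o, 'a) cat \<Rightarrow> 'a \<Rightarrow> 'a \<Rightarrow> 'a" where
  "prd_map C f g =
     pair C (f \<cdot>\<^bsub>C\<^esub> pr1 C (Dom C f) (Dom C g)) (g \<cdot>\<^bsub>C\<^esub> pr2 C (Dom C f) (Dom C g))"


section \<open>Slices and group objects\<close>

definition slice :: "('o, 'a) cat \<Rightarrow> 'o \<Rightarrow> ('a, 'a \<times> 'a \<times> 'a) cat" where
  "slice C Y = \<lparr>
     Obj = {p \<in> Arr C. Cod C p = Y},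
     Arr = {(p, f, q). p \<in> Arr C \<and> Cod C p = Y \<and> q \<in> Arr C \<and> Cod C q = Y \<and>
              f \<in> hom C (Dom C p) (Dom C q) \<and> q \<cdot>\<^bsub>C\<^esub> f = p},
     Dom = (\<lambda>(p, f, q). p),
     Cod = (\<lambda>(p, f, q). q),
     Id = (\<lambda>p. (p, Id C (Dom C p), p)),
     Comp = (\<lambda>(q', g, r) (p, f, q). (p, g \<cdot>\<^bsub>C\<^esub> f, r))\<rparr>"

record ('o, 'a) group_data =
  gobj :: 'o
  gmult :: 'a
  gunit :: 'a
  ginv :: 'a

definition is_group_object :: "('o, 'a) cat \<Rightarrow> ('o, 'a) group_data \<Rightarrow> bool" where
  "is_group_object C H \<longleftrightarrow>
     (let G = gobj H; m = gmult H; e = gunit H; i = ginv H;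
          GG = prd C G G;
          x = pr1 C G G \<cdot>\<^bsub>C\<^esub> pr1 C GG G;
          y = pr2 C G G \<cdot>\<^bsub>C\<^esub> pr1 C GG G;
          z = pr2 C GG G;
          one = e \<cdot>\<^bsub>C\<^esub> bang C G
      in G \<in> Obj C \<and> m \<in> hom C GG G \<and> e \<in> hom C (terminal C) G \<and> i \<in> hom C G G \<and>
         m \<cdot>\<^bsub>C\<^esub> pair C (m \<cdot>\<^bsub>C\<^esub> pair C x y) z = m \<cdot>\<^bsub>C\<^esub> pair C x (m \<cdot>\<^bsub>C\<^esub> pair C y z) \<and>
         m \<cdot>\<^bsub>C\<^esub> pair C one (Id C G) = Id C G \<and>
         m \<cdot>\<^bsub>C\<^esub> pair C (Id C G) one = Id C G \<and>
         m \<cdot>\<^bsub>C\<^esub> pair C i (Id C G) = one \<and>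
         m \<cdot>\<^bsub>C\<^esub> pair C (Id C G) i = one)"

definition group_hom :: "('o, 'a) cat \<Rightarrow> ('o, 'a) group_data \<Rightarrow> ('o, 'a) group_data \<Rightarrow> 'a \<Rightarrow> bool" where
  "group_hom C G H f \<longleftrightarrow>
     f \<in> hom C (gobj G) (gobj H) \<and> f \<cdot>\<^bsub>C\<^esub> gmult G = gmult H \<cdot>\<^bsub>C\<^esub> prd_map C f f"

definition Grp :: "('o, 'a) cat \<Rightarrow>
    (('o, 'a) group_data, ('o, 'a) group_data \<times> 'a \<times> ('o, 'a) group_data) cat" where
  "Grp C = \<lparr>
     Obj = {G. is_group_object C G},
     Arr = {(G, f, H). is_group_object C G \<and> is_group_object C H \<and> group_hom C G H f},
     Dom = (\<lambda>(G, f, H). G),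
     Cod = (\<lambda>(G, f, H). H),
     Id = (\<lambda>G. (G, Id C (gobj G), G)),
     Comp = (\<lambda>(H', g, K) (G, f, H). (G, g \<cdot>\<^bsub>C\<^esub> f, K))\<rparr>"

definition is_action :: "('o, 'a) cat \<Rightarrow> ('o, 'a) group_data \<Rightarrow> 'o \<Rightarrow> 'a \<Rightarrow> bool" where
  "is_action C H Y a \<longleftrightarrow>
     (let G = gobj H; GG = prd C G G;
          x = pr1 C G G \<cdot>\<^bsub>C\<^esub> pr1 C GG Y;
          y = pr2 C G G \<cdot>\<^bsub>C\<^esub> pr1 C GG Y;
          z = pr2 C GG Y
      in Y \<in> Obj C \<and> a \<in> hom C (prd C G Y) Y \<and>
         a \<cdot>\<^bsub>C\<^esub> pair C (gmult H \<cdot>\<^bsub>C\<^esub> pair C x y) z = a \<cdot>\<^bsub>C\<^esub> pair C x (a \<cdot>\<^bsub>C\<^esub> pair C y z) \<and>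
         a \<cdot>\<^bsub>C\<^esub> pair C (gunit H \<cdot>\<^bsub>C\<^esub> bang C Y) (Id C Y) = Id C Y)"


section \<open>Regular categories and action Barr-exactness\<close>

definition mono_arr :: "('o, 'a) cat \<Rightarrow> 'a \<Rightarrow> bool" where
  "mono_arr C r \<longleftrightarrow> r \<in> Arr C \<and>
     (\<forall>X\<in>Obj C. \<forall>f\<in>hom C X (Dom C r). \<forall>g\<in>hom C X (Dom C r). r \<cdot>\<^bsub>C\<^esub> f = r \<cdot>\<^bsub>C\<^esub> g \<longrightarrow> f = g)"

definition regular_epi :: "('o, 'a) cat \<Rightarrow> 'a \<Rightarrow> bool" where
  "regular_epi C q \<longleftrightarrow> (\<exists>f g. is_coequaliser C f g q)"

definition regular_category :: "('o, 'a) cat \<Rightarrow> bool" where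
  "regular_category C \<longleftrightarrow>
     category C \<and> has_finite_limits C \<and>
     (\<forall>f p q. is_pullback C f f p q \<longrightarrow> (\<exists>c. is_coequaliser C p q c)) \<and>
     (\<forall>f g p q. is_pullback C f g p q \<and> regular_epi C f \<longrightarrow> regular_epi C q)"

text \<open>\<open>r1\<close> and \<open>r2\<close> are the two legs of an internal relation.\<close>

definition effective :: "('o, 'a) cat \<Rightarrow> 'a \<Rightarrow> 'a \<Rightarrow> bool" where
  "effective C r1 r2 \<longleftrightarrow> (\<exists>c. is_coequaliser C r1 r2 c \<and> is_pullback C c c r1 r2)"

definition action_barr_exact :: "('o, 'a) cat \<Rightarrow> bool" where
  "action_barr_exact D \<longleftrightarrow>
     regular_category D \<and>
     (\<forall>H Y a q r. is_group_object D H \<and> is_action D H Y a \<and>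
        regular_epi D q \<and> mono_arr D r \<and> r \<in> hom D (Cod D q) (prd D Y Y) \<and>
        r \<cdot>\<^bsub>D\<^esub> q = pair D a (pr2 D (gobj H) Y) \<longrightarrow>
        effective D (pr1 D Y Y \<cdot>\<^bsub>D\<^esub> r) (pr2 D Y Y \<cdot>\<^bsub>D\<^esub> r))"

definition locally_action_barr_exact :: "('o, 'a) cat \<Rightarrow> bool" where
  "locally_action_barr_exact C \<longleftrightarrow> (\<forall>Y\<in>Obj C. action_barr_exact (slice C Y))"


section \<open>Bass--Serre categories\<close>

text \<open>
  The group object \<open>K \<times> c\<close> of the slice over \<open>c\<close>.  Its underlying object is the projection
  \<open>p: K \<times> c \<rightarrow> c\<close>; the legs \<open>u\<close>, \<open>v\<close> below are the projections of the fibre product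
  \<open>(K \<times> c) \<times>\<^sub>c (K \<times> c)\<close>, which is the chosen product of \<open>p\<close> with itself in the slice, and
  \<open>t\<close> is the chosen terminal object of the slice (an isomorphism onto \<open>c\<close>).
\<close>

definition times_group :: "('o, 'a) cat \<Rightarrow> 'o \<Rightarrow> ('o, 'a) group_data \<Rightarrow>
    ('a, 'a \<times> 'a \<times> 'a) group_data" where
  "times_group C c K =
     (let k = pr1 C (gobj K) c; p = pr2 C (gobj K) c;
          pp = prd (slice C c) p p;
          u = mid (pr1 (slice C c) p p); v = mid (pr2 (slice C c) p p);
          t = terminal (slice C c)
      in \<lparr>gobj = p,
          gmult = (pp, pair C (gmult K \<cdot>\<^bsub>C\<^esub> pair C (k \<cdot>\<^bsub>C\<^esub> u) (k \<cdot>\<^bsub>C\<^esub> v)) (p \<cdot>\<^bsub>C\<^esub> u), p),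
          gunit = (t, pair C (gunit K \<cdot>\<^bsub>C\<^esub> bang C (Dom C t)) t, p),
          ginv = (p, pair C (ginv K \<cdot>\<^bsub>C\<^esub> k) p, p)\<rparr>)"

definition times_functor :: "('o, 'a) cat \<Rightarrow> 'o \<Rightarrow>
    (('o, 'a) group_data, ('o, 'a) group_data \<times> 'a \<times> ('o, 'a) group_data,
     ('a, 'a \<times> 'a \<times> 'a) group_data,
     ('a, 'a \<times> 'a \<times> 'a) group_data \<times> ('a \<times> 'a \<times> 'a) \<times> ('a, 'a \<times> 'a \<times> 'a) group_data) ftor" where
  "times_functor C c = \<lparr>
     fobj = times_group C c,
     farr = (\<lambda>(K, f, L). (times_group C c K,
       (pr2 C (gobj K) c, prd_map C f (Id C c), pr2 C (gobj L) c), times_group C c L))\<rparr>"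

text \<open>
  The canonical map from (the total space of) \<open>H\<close> to \<open>K\<close> induced by an arrow
  \<open>\<eta>: H \<rightarrow> K \<times> c\<close> of group objects over \<open>c\<close>: the inner \<open>mid\<close> extracts the arrow of the slice,
  the outer one the arrow of \<open>C\<close>.
\<close>

definition canonical_map :: "('o, 'a) cat \<Rightarrow> 'o \<Rightarrow> ('o, 'a) group_data \<Rightarrow>
    ('a, 'a \<times> 'a \<times> 'a) group_data \<times> ('a \<times> 'a \<times> 'a) \<times> ('a, 'a \<times> 'a \<times> 'a) group_data \<Rightarrow> 'a" where
  "canonical_map C c K \<eta> = pr1 C (gobj K) c \<cdot>\<^bsub>C\<^esub> mid (mid \<eta>)"

text \<open>\<open>k: X \<rightarrow> K\<close> generates \<open>K\<close>: the diagram \<open>K \<times> X \<rightrightarrows> K \<rightarrow> *\<close> is a coequaliser.\<close>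

definition generates :: "('o, 'a) cat \<Rightarrow> ('o, 'a) group_data \<Rightarrow> 'a \<Rightarrow> bool" where
  "generates C K k \<longleftrightarrow>
     (let G = gobj K; X = Dom C k
      in is_coequaliser C (pr1 C G X)
           (gmult K \<cdot>\<^bsub>C\<^esub> pair C (pr1 C G X) (k \<cdot>\<^bsub>C\<^esub> pr2 C G X)) (bang C G))"

definition bass_serre :: "('o, 'a) cat \<Rightarrow> bool" where
  "bass_serre C \<longleftrightarrow>
     category C \<and>
     locally_action_barr_exact C \<and> (\<exists>T. is_terminal C T) \<and> has_coequalisers C \<and>
     (\<forall>c\<in>Obj C. \<forall>f g q. is_coequaliser C f g q \<longrightarrow>
        is_coequaliser C (prd_map C (Id C c) f) (prd_map C (Id C c) g) (prd_map C (Id C c) q)) \<and>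
     has_coequalisers (Grp C) \<and>
     (\<forall>c\<in>Obj C. \<exists>colim \<eta>.
        left_adjoint (Grp (slice C c)) (Grp C) colim (times_functor C c) \<eta> \<and>
        (\<forall>H\<in>Obj (Grp (slice C c)).
           generates C (fobj colim H) (canonical_map C c (fobj colim H) (\<eta> H))))"


section \<open>Small sets\<close>

text \<open>
  \<open>Set\<close> is the category of the small sets, where smallness is membership in a collection \<open>U\<close> of
  subsets of an arbitrary type: the analogue of sets in a Grothendieck universe, up to bijection.
  Only the closure properties below are required.  A collection that is in addition closed
  under power sets and small unions has products of every family indexed by a small set (see
  \<open>has_products_if_universe\<close> below); but such a collection is of inaccessible size and need not exist
  in HOL, whereas these properties can always be realised (\<open>set_universe_UNIV\<close>,
  \<open>has_products_UNIV\<close>).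
\<close>

definition set_universe :: "'u set set \<Rightarrow> bool" where
  "set_universe U \<longleftrightarrow> (\<exists>A\<in>U. infinite A) \<and> (\<forall>A\<in>U. \<forall>B. B \<lesssim> A \<longrightarrow> B \<in> U)"

definition has_products :: "'u set set \<Rightarrow> 'x set \<Rightarrow> bool" where
  "has_products U X \<longleftrightarrow> (\<forall>A. (\<forall>x\<in>X. A x \<in> U) \<longrightarrow> (\<exists>P\<in>U. P \<approx> (\<Pi>\<^sub>E x\<in>X. A x)))"

lemma has_products_if_universe:
  fixes U :: "'u set set" and X :: "'x set"
  assumes U: "set_universe U"
    and pow: "\<And>A. A \<in> U \<Longrightarrow> \<exists>P\<in>U. P \<approx> Pow A"
    and union: "\<And>A B. A \<in> U \<Longrightarrow> (\<And>a. a \<in> A \<Longrightarrow> B a \<in> U) \<Longrightarrow> \<exists>S\<in>U. S \<approx> Sigma A B"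
    and small: "A0 \<in> U" "X \<approx> A0"
  shows "has_products U X"
  unfolding has_products_def
proof (intro allI impI)
  fix A :: "'x \<Rightarrow> 'u set"
  assume A: "\<forall>x\<in>X. A x \<in> U"
  obtain h where h: "bij_betw h A0 X"
    using eqpoll_sym[OF small(2)] by (auto simp: eqpoll_def)
  define \<Phi> where "\<Phi> = (\<lambda>f :: 'x \<Rightarrow> 'u. {(a, f (h a)) | a. a \<in> A0})"
  have img: "\<Phi> ` (\<Pi>\<^sub>E x\<in>X. A x) \<subseteq> Pow (Sigma A0 (A \<circ> h))"
    using h by (auto simp: \<Phi>_def bij_betw_def)
  have inj: "inj_on \<Phi> (\<Pi>\<^sub>E x\<in>X. A x)"
  proof (rule inj_onI)
    fix f g assume fg: "f \<in> (\<Pi>\<^sub>E x\<in>X. A x)" "g \<in> (\<Pi>\<^sub>E x\<in>X. A x)" "\<Phi> f = \<Phi> g"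
    have "f (h a) = g (h a)" if "a \<in> A0" for a
    proof -
      have "(a, f (h a)) \<in> \<Phi> g"
        using that fg(3) by (auto simp: \<Phi>_def)
      then show ?thesis by (auto simp: \<Phi>_def)
    qed
    then have "f x = g x" if "x \<in> X" for x
      using that h by (force simp: bij_betw_def)
    then show "f = g" using fg(1,2) by (rule PiE_ext[rotated 2])
  qed
  have le: "(\<Pi>\<^sub>E x\<in>X. A x) \<lesssim> Pow (Sigma A0 (A \<circ> h))"
    using img inj by (auto simp: lepoll_def)
  have "\<And>a. a \<in> A0 \<Longrightarrow> (A \<circ> h) a \<in> U"
    using A h by (auto simp: bij_betw_def)
  then obtain S where S: "S \<in> U" "S \<approx> Sigma A0 (A \<circ> h)"
    using union[OF small(1)] by blast
  obtain P where P: "P \<in> U" "P \<approx> Pow S" using pow[OF S(1)] by blast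
  have "Pow S \<approx> Pow (Sigma A0 (A \<circ> h))"
    using S(2) unfolding eqpoll_def by (meson bij_betw_Pow)
  then have "(\<Pi>\<^sub>E x\<in>X. A x) \<lesssim> P"
    using le P(2) by (meson eqpoll_sym eqpoll_trans lepoll_trans1 lepoll_trans2)
  then obtain B where B: "B \<subseteq> P" "(\<Pi>\<^sub>E x\<in>X. A x) \<approx> B"
    by (auto simp: eqpoll_def lepoll_def bij_betw_def)
  have "B \<in> U"
    using U P(1) B(1) subset_imp_lepoll unfolding set_universe_def by blast
  then show "\<exists>P\<in>U. P \<approx> (\<Pi>\<^sub>E x\<in>X. A x)" using B(2) eqpoll_sym by blast
qed

lemma set_universe_UNIV: "infinite (UNIV :: 'u set) \<Longrightarrow> set_universe (UNIV :: 'u set set)"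
  unfolding set_universe_def by blast

lemma has_products_UNIV:
  fixes X :: "'x set"
  shows "has_products (UNIV :: ('x + nat \<Rightarrow> bool) set set) X"
  unfolding has_products_def
proof (intro allI impI)
  fix A :: "'x \<Rightarrow> ('x + nat \<Rightarrow> bool) set"
  let ?T = "UNIV :: ('x + nat) set"
  have "range (Inr :: nat \<Rightarrow> 'x + nat) \<subseteq> ?T" by simp
  then have inf: "infinite ?T"
    by (metis finite_imageD infinite_UNIV_nat infinite_super inj_Inr)
  have "?T \<times> ?T \<approx> ?T"
    using card_of_Times_same_infinite[OF inf] card_of_ordIso unfolding eqpoll_def by blast
  then obtain e :: "('x + nat) \<times> ('x + nat) \<Rightarrow> 'x + nat" where e: "inj e"
    by (auto simp: eqpoll_def bij_betw_def)
  define \<Phi> :: "('x \<Rightarrow> 'x + nat \<Rightarrow> bool) \<Rightarrow> 'x + nat \<Rightarrow> bool"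
    where "\<Phi> = (\<lambda>f z. \<exists>x y. z = e (Inl x, y) \<and> f x y)"
  have ev: "\<Phi> f (e (Inl x, y)) = f x y" for f x y
    using e by (auto simp: \<Phi>_def dest: injD)
  have "inj \<Phi>"
  proof (rule injI)
    fix f g assume "\<Phi> f = \<Phi> g"
    then have "f x y = g x y" for x y
      by (metis ev)
    then show "f = g" by (intro ext)
  qed
  then have "inj_on \<Phi> (\<Pi>\<^sub>E x\<in>X. A x)" by (rule inj_on_subset) simp
  then have "\<Phi> ` (\<Pi>\<^sub>E x\<in>X. A x) \<approx> (\<Pi>\<^sub>E x\<in>X. A x)"
    by (rule inj_on_image_eqpoll_self)
  then show "\<exists>P\<in>UNIV :: ('x + nat \<Rightarrow> bool) set set. P \<approx> (\<Pi>\<^sub>E x\<in>X. A x)"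
    by (rule bexI) simp
qed

definition set_cat :: "'u set set \<Rightarrow> ('u set, 'u set \<times> ('u \<Rightarrow> 'u) \<times> 'u set) cat" where
  "set_cat U = \<lparr>
     Obj = U,
     Arr = {(A, f, B). A \<in> U \<and> B \<in> U \<and> f \<in> A \<rightarrow>\<^sub>E B},
     Dom = (\<lambda>(A, f, B). A),
     Cod = (\<lambda>(A, f, B). B),
     Id = (\<lambda>A. (A, (\<lambda>x\<in>A. x), A)),
     Comp = (\<lambda>(B', g, D) (A, f, B). (A, compose A g f, D))\<rparr>"


section \<open>Sites and sheaves\<close>

definition sieve :: "('o, 'a) cat \<Rightarrow> 'o \<Rightarrow> 'a set \<Rightarrow> bool" where
  "sieve I c S \<longleftrightarrow>
     S \<subseteq> {f \<in> Arr I. Cod I f = c} \<and>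
     (\<forall>f\<in>S. \<forall>g\<in>Arr I. Cod I g = Dom I f \<longrightarrow> f \<cdot>\<^bsub>I\<^esub> g \<in> S)"

definition pull_sieve :: "('o, 'a) cat \<Rightarrow> 'a \<Rightarrow> 'a set \<Rightarrow> 'a set" where
  "pull_sieve I f S = {g \<in> Arr I. Cod I g = Dom I f \<and> f \<cdot>\<^bsub>I\<^esub> g \<in> S}"

definition grothendieck_site :: "('o, 'a) cat \<Rightarrow> ('o \<Rightarrow> 'a set set) \<Rightarrow> bool" where
  "grothendieck_site I J \<longleftrightarrow>
     category I \<and>
     (\<forall>c\<in>Obj I. \<forall>S\<in>J c. sieve I c S) \<and>
     (\<forall>c\<in>Obj I. {f \<in> Arr I. Cod I f = c} \<in> J c) \<and>
     (\<forall>f\<in>Arr I. \<forall>S\<in>J (Cod I f). pull_sieve I f S \<in> J (Dom I f)) \<and>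
     (\<forall>c\<in>Obj I. \<forall>S\<in>J c. \<forall>R. sieve I c R \<and> (\<forall>f\<in>S. pull_sieve I f R \<in> J (Dom I f)) \<longrightarrow> R \<in> J c)"

text \<open>\<open>mid (farr F f)\<close> is the restriction function of the presheaf \<open>F\<close> along \<open>f\<close>.\<close>

definition is_sheaf :: "('o, 'a) cat \<Rightarrow> ('o \<Rightarrow> 'a set set) \<Rightarrow>
    ('o, 'a, 'u set, 'u set \<times> ('u \<Rightarrow> 'u) \<times> 'u set) ftor \<Rightarrow> bool" where
  "is_sheaf I J F \<longleftrightarrow>
     (\<forall>c\<in>Obj I. \<forall>S\<in>J c. \<forall>x.
        (\<forall>f\<in>S. x f \<in> fobj F (Dom I f)) \<and>
        (\<forall>f\<in>S. \<forall>g\<in>Arr I. Cod I g = Dom I f \<longrightarrow> mid (farr F g) (x f) = x (f \<cdot>\<^bsub>I\<^esub> g)) \<longrightarrow>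
        (\<exists>!y. y \<in> fobj F c \<and> (\<forall>f\<in>S. mid (farr F f) y = x f)))"

definition Sh :: "('o, 'a) cat \<Rightarrow> ('o \<Rightarrow> 'a set set) \<Rightarrow> 'u set set \<Rightarrow>
    (('o, 'a, 'u set, 'u set \<times> ('u \<Rightarrow> 'u) \<times> 'u set) ftor,
     ('o, 'a, 'u set, 'u set \<times> ('u \<Rightarrow> 'u) \<times> 'u set) ftor \<times>
     ('o \<Rightarrow> 'u set \<times> ('u \<Rightarrow> 'u) \<times> 'u set) \<times>
     ('o, 'a, 'u set, 'u set \<times> ('u \<Rightarrow> 'u) \<times> 'u set) ftor) cat" where
  "Sh I J U = full_subcategory (functor_category (opposite I) (set_cat U)) {F. is_sheaf I J F}"

end

theory Submission
  imports Defs
begin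

text \<open>
  Everything is done with elements.  A category of sheaves is described by the sets of elements of
  its objects at the stages of a site, on which arrows act faithfully and fully; slices are of the
  same kind, over the category of elements of the base, so the exactness properties need to be
  proved only once.  Regular epimorphisms are the locally surjective maps, and the quotient of a
  sheaf by a local equivalence relation has exactly that relation as its kernel; for a group action
  the relation ``locally in the same orbit'' is one, whence action Barr-exactness.

  Colimits are obtained by the solution-set idea: take the sheaf (or all group terms over it) and
  identify two elements when every test map agrees on them.  Smallness of the group terms takes the
  place of normal forms in free products, and since such a group consists locally of terms in the
  generators, it is generated by them in the sense of the paper.
\<close>

section \<open>Small sets\<close>

text \<open>Agreement under all tests can serve as a definition because the tests range over arrows
  of one fixed category, so the relation is stated without first choosing a set of representatives
  among them. It is an equivalence relation stable under restriction for trivial reasons, and it is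
  local because every test takes values in a sheaf, where equality is local. Sheafifying therefore
  adds no identification, and the kernel of the quotient is known exactly.

  The obstacle is size. \<open>U\<close> need be closed neither under power sets nor under small
  unions; the products at hand are those indexed by arrows of the site. This dictates how a quotient
  is encoded: a section is determined by a partial choice of one representative for each arrow into
  a stage, and such choices form a product of the available kind. In a slice the total space is a
  sum over the points of the base, and it is kept small by bounding the fibres over all these points
  by one set. This uniform bound has to survive every construction, which is why it is carried along
  as \<open>bounded_family\<close>.\<close>

definition small :: "'u set set \<Rightarrow> 'v set \<Rightarrow> bool" where
  "small U A \<longleftrightarrow> (\<exists>B\<in>U. A \<lesssim> B)"

lemma small_lepoll: "small U B \<Longrightarrow> A \<lesssim> B \<Longrightarrow> small U A"
  unfolding small_def using lepoll_trans by blast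

lemma small_inj: "small U B \<Longrightarrow> inj_on f A \<Longrightarrow> f ` A \<subseteq> B \<Longrightarrow> small U A"
  using small_lepoll[of U B A] unfolding lepoll_def by blast

lemma small_mem: "A \<in> U \<Longrightarrow> small U A"
  unfolding small_def by blast

text \<open>Cardinal arithmetic needs an infinite bound, which absorbs squares, an added point and
  the formation of terms. A finite bound is exchanged for the infinite member that every universe
  has.\<close>

lemma small_infinite:
  assumes "set_universe U" "small U A"
  obtains B where "B \<in> U" "infinite B" "A \<lesssim> B"
proof -
  obtain C where C: "C \<in> U" "A \<lesssim> C" using assms(2) unfolding small_def by blast
  obtain N where N: "N \<in> U" "infinite N" using assms(1) unfolding set_universe_def by blast
  show ?thesis
  proof (cases "infinite C")
    case True then show ?thesis using C that by blast
  next
    case False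
    then have "C \<lesssim> N" using finite_lepoll_infinite N(2) by blast
    then show ?thesis using that N C lepoll_trans by blast
  qed
qed

text \<open>Cardinals are comparable, so the larger of two infinite bounds dominates both factors,
  and an infinite set is as large as its square.\<close>

lemma small_Times:
  fixes U :: "'u set set"
  assumes U: "set_universe U" and A: "small U A" and B: "small U B"
  shows "small U (A \<times> B)"
proof -
  obtain A' where A': "A' \<in> U" "infinite A'" "A \<lesssim> A'" using small_infinite[OF U A] by blast
  obtain B' where B': "B' \<in> U" "infinite B'" "B \<lesssim> B'" using small_infinite[OF U B] by blast
  have sq: "X \<times> X \<lesssim> X" if "infinite X" for X :: "'u set"
    using card_of_Times_same_infinite[OF that] card_of_ordIso
    by (metis eqpoll_def eqpoll_imp_lepoll)
  have "A' \<lesssim> B' \<or> B' \<lesssim> A'"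
    unfolding lepoll_def by (metis card_of_ordLeq ordLeq_total card_of_Well_order)
  then obtain M where "M \<in> U" "infinite M" "A \<lesssim> M" "B \<lesssim> M"
    using A' B' lepoll_trans by metis
  then have "A \<times> B \<lesssim> M \<times> M" "M \<times> M \<lesssim> M"
    using times_lepoll_mono sq by blast+
  then show ?thesis using \<open>M \<in> U\<close> unfolding small_def using lepoll_trans by blast
qed

lemma option_lepoll:
  assumes "A \<lesssim> B"
  shows "insert None (Some ` A) \<lesssim> insert None (Some ` B)"
proof -
  obtain f where f: "inj_on f A" "f ` A \<subseteq> B" using assms unfolding lepoll_def by blast
  then show ?thesis
    unfolding lepoll_def by (intro exI[of _ "map_option f"]) (auto simp: inj_on_def)
qed

lemma small_option:
  assumes U: "set_universe U" and A: "small U A"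
  shows "small U (insert None (Some ` A))"
proof -
  obtain B where B: "B \<in> U" "infinite B" "A \<lesssim> B" using small_infinite[OF U A] by blast
  have "insert None (Some ` A) \<lesssim> insert None (Some ` B)" by (rule option_lepoll[OF B(3)])
  also have "insert None (Some ` B) \<lesssim> Some ` B"
    using infinite_insert_eqpoll[of "Some ` B" None] B(2)
    by (simp add: eqpoll_imp_lepoll finite_image_iff)
  also have "Some ` B \<lesssim> B" by (rule image_lepoll)
  finally show ?thesis using B(1) unfolding small_def by blast
qed

text \<open>Group words are kept as terms, so that the group operations need no normal forms.\<close>

datatype 'v gterm = Gen 'v | Unit | Mul "'v gterm" "'v gterm" | Inv "'v gterm"

text \<open>A Goedel numbering with values in an infinite set: \<open>j\<close> packs a constructor
  tag with two codes, and \<open>b\<close> fills the argument places that a constructor lacks.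
  Injectivity of \<open>j\<close> makes the code readable one constructor at a time.\<close>

primrec gterm_code :: "(nat \<times> 'b \<times> 'b \<Rightarrow> 'b) \<Rightarrow> ('v \<Rightarrow> 'b) \<Rightarrow> 'b \<Rightarrow> 'v gterm \<Rightarrow> 'b" where
  "gterm_code j e b (Gen v) = j (0, e v, b)"
| "gterm_code j e b Unit = j (1, b, b)"
| "gterm_code j e b (Mul x y) = j (2, gterm_code j e b x, gterm_code j e b y)"
| "gterm_code j e b (Inv x) = j (3, gterm_code j e b x, b)"

lemma small_gterms:
  assumes U: "set_universe U" and A: "small U A"
  shows "small U {w. set_gterm w \<subseteq> A}"
proof -
  obtain B where B: "B \<in> U" "infinite B" "A \<lesssim> B" using small_infinite[OF U A] by blast
  then obtain e where e: "inj_on e A" "e ` A \<subseteq> B" unfolding lepoll_def by blast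
  have sq: "B \<times> B \<lesssim> B"
    using card_of_Times_same_infinite[OF B(2)] card_of_ordIso
    by (metis eqpoll_def eqpoll_imp_lepoll)
  \<comment> \<open>The tags are natural numbers, so an infinite \<open>B\<close> absorbs them
    together with the pair of arguments; this yields the packing function \<open>j\<close>.\<close>
  have "(UNIV :: nat set) \<lesssim> B" using B(2) infinite_le_lepoll by blast
  then have "(UNIV :: nat set) \<times> B \<times> B \<lesssim> B \<times> B"
    by (intro times_lepoll_mono sq)
  then have "(UNIV :: nat set) \<times> B \<times> B \<lesssim> B" using sq lepoll_trans by blast
  then obtain j where j: "inj_on j (UNIV \<times> B \<times> B)" "j ` ((UNIV :: nat set) \<times> B \<times> B) \<subseteq> B"
    unfolding lepoll_def by blast
  obtain b where b: "b \<in> B" using B(2) by fastforce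
  let ?c = "gterm_code j e b"
  have jin: "j (n, x, y) \<in> B" if "x \<in> B" "y \<in> B" for n x y using j(2) that by blast
  have in_B: "set_gterm w \<subseteq> A \<Longrightarrow> ?c w \<in> B" for w
    by (induction w) (use e b in \<open>auto intro!: jin\<close>)
  have jj: "j (n, x, y) = j (n', x', y') \<longleftrightarrow> n = n' \<and> x = x' \<and> y = y'"
    if "x \<in> B" "y \<in> B" "x' \<in> B" "y' \<in> B" for n n' x x' y y'
    using inj_on_eq_iff[OF j(1)] that by simp
  have "set_gterm w \<subseteq> A \<Longrightarrow> set_gterm w' \<subseteq> A \<Longrightarrow> ?c w = ?c w' \<Longrightarrow> w = w'" for w w'
  proof (induction w arbitrary: w')
    case (Gen x)
    then show ?case using e b in_B by (cases w') (auto simp: jj image_subset_iff dest: inj_onD)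
  next
    case Unit
    then show ?case using e b in_B by (cases w') (auto simp: jj image_subset_iff)
  next
    case (Mul w1 w2)
    then show ?case using e b in_B by (cases w') (auto simp: jj image_subset_iff)
  next
    case (Inv w)
    then show ?case using e b in_B by (cases w') (auto simp: jj image_subset_iff)
  qed
  then have "inj_on ?c {w. set_gterm w \<subseteq> A}" by (auto intro: inj_onI)
  then show ?thesis using in_B small_mem[OF B(1)] by (blast intro: small_inj)
qed

lemma gterms_lepoll:
  assumes "A \<lesssim> B"
  shows "{w. set_gterm w \<subseteq> A} \<lesssim> {w. set_gterm w \<subseteq> B}"
proof -
  obtain f where f: "inj_on f A" "f ` A \<subseteq> B" using assms unfolding lepoll_def by blast
  have "inj_on (map_gterm f) {w. set_gterm w \<subseteq> A}"
  proof (rule inj_onI)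
    fix v w assume v: "v \<in> {w. set_gterm w \<subseteq> A}" and w: "w \<in> {w. set_gterm w \<subseteq> A}"
      and e: "map_gterm f v = map_gterm f w"
    show "v = w"
    proof (rule gterm.inj_map_strong[OF _ e])
      show "x = y" if "x \<in> set_gterm v" "y \<in> set_gterm w" "f x = f y" for x y
        using inj_onD[OF f(1) that(3)] that v w by blast
    qed
  qed
  moreover have "map_gterm f ` {w. set_gterm w \<subseteq> A} \<subseteq> {w. set_gterm w \<subseteq> B}"
    using f(2) by (fastforce simp: gterm.set_map)
  ultimately show ?thesis unfolding lepoll_def by blast
qed

section \<open>Size of dependent products\<close>

lemma PiE_lepoll:
  assumes "\<And>x. x \<in> X \<Longrightarrow> A x \<lesssim> B x"
  shows "Pi\<^sub>E X A \<lesssim> Pi\<^sub>E X B"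
proof -
  have "\<forall>x\<in>X. \<exists>e. inj_on e (A x) \<and> e ` A x \<subseteq> B x" using assms unfolding lepoll_def by blast
  from bchoice[OF this] obtain e where e: "\<And>x. x \<in> X \<Longrightarrow> inj_on (e x) (A x) \<and> e x ` A x \<subseteq> B x"
    by blast
  show ?thesis
    unfolding lepoll_def
  proof (intro exI conjI)
    show "inj_on (\<lambda>f. \<lambda>x\<in>X. e x (f x)) (Pi\<^sub>E X A)"
    proof (rule inj_onI)
      fix f g assume fg: "f \<in> Pi\<^sub>E X A" "g \<in> Pi\<^sub>E X A"
        and eq: "(\<lambda>x\<in>X. e x (f x)) = (\<lambda>x\<in>X. e x (g x))"
      show "f = g"
      proof (rule PiE_ext[OF fg])
        fix x assume x: "x \<in> X"
        have "e x (f x) = e x (g x)" using fun_cong[OF eq, of x] x by simp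
        then show "f x = g x"
          using inj_onD[OF conjunct1[OF e[OF x]]] PiE_mem[OF fg(1) x] PiE_mem[OF fg(2) x] by blast
      qed
    qed
    show "(\<lambda>f. \<lambda>x\<in>X. e x (f x)) ` Pi\<^sub>E X A \<subseteq> Pi\<^sub>E X B"
    proof (clarify, rule PiE_I)
      fix f x assume f: "f \<in> Pi\<^sub>E X A" and x: "x \<in> X"
      show "(\<lambda>x\<in>X. e x (f x)) x \<in> B x" using e[OF x] PiE_mem[OF f x] x by auto
    qed simp
  qed
qed

text \<open>Filling the factors outside \<open>Y\<close> with a singleton changes the product only
  by a bijection. This passes from products over all arrows of a site to products over the arrows
  into one stage.\<close>

lemma has_products_subset:
  assumes U: "set_universe U" and "has_products U X" "Y \<subseteq> X"
  shows "has_products U Y"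
  unfolding has_products_def
proof (intro allI impI)
  fix A assume A: "\<forall>y\<in>Y. A y \<in> U"
  obtain N where N: "N \<in> U" "infinite N" using U unfolding set_universe_def by blast
  then obtain n where n: "n \<in> N" by fastforce
  \<comment> \<open>A universe is closed downwards under \<open>\<lesssim>\<close>, hence contains
    the singletons inside its infinite member; this one is the neutral factor.\<close>
  have "{n} \<in> U" using U N n singleton_lepoll unfolding set_universe_def
    by (meson empty_subsetI insert_subset subset_imp_lepoll)
  define A' where "A' = (\<lambda>x. if x \<in> Y then A x else {n})"
  have "\<forall>x\<in>X. A' x \<in> U" using A \<open>{n} \<in> U\<close> unfolding A'_def by simp
  then obtain Q where Q: "Q \<in> U" "Q \<approx> (\<Pi>\<^sub>E x\<in>X. A' x)"
    using assms(2) unfolding has_products_def by blast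
  have "bij_betw (\<lambda>f. restrict f Y) (\<Pi>\<^sub>E x\<in>X. A' x) (\<Pi>\<^sub>E y\<in>Y. A y)"
  proof (rule bij_betw_byWitness[where f' = "\<lambda>f. \<lambda>x\<in>X. if x \<in> Y then f x else n"])
    show "\<forall>f\<in>Pi\<^sub>E X A'. (\<lambda>x\<in>X. if x \<in> Y then restrict f Y x else n) = f"
    proof
      fix f assume f: "f \<in> Pi\<^sub>E X A'"
      have "f x = n" if "x \<in> X" "x \<notin> Y" for x
        using PiE_mem[OF f that(1)] that(2) unfolding A'_def by simp
      moreover have "f x = undefined" if "x \<notin> X" for x using f that by (auto simp: PiE_def extensional_def)
      ultimately show "(\<lambda>x\<in>X. if x \<in> Y then restrict f Y x else n) = f"
        by (auto simp: fun_eq_iff)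
    qed
  qed (use \<open>Y \<subseteq> X\<close> in \<open>auto simp: A'_def fun_eq_iff PiE_def Pi_def extensional_def\<close>)
  then have "(\<Pi>\<^sub>E x\<in>X. A' x) \<approx> (\<Pi>\<^sub>E y\<in>Y. A y)" unfolding eqpoll_def by blast
  then show "\<exists>P\<in>U. P \<approx> (\<Pi>\<^sub>E y\<in>Y. A y)" using Q eqpoll_trans by blast
qed

section \<open>Sites and sheaves valued in arbitrary types\<close>

locale site =
  fixes K :: "('t, 'm) cat" and J :: "'t \<Rightarrow> 'm set set"
  assumes site: "grothendieck_site K J"
begin

sublocale K: category K
  using site unfolding grothendieck_site_def by blast

abbreviation kcomp (infixl "\<odot>" 70) where "m \<odot> n \<equiv> m \<cdot>\<^bsub>K\<^esub> n"

lemma arr_dom [simp]: "m \<in> Arr K \<Longrightarrow> Dom K m \<in> Obj K"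
  by (rule K.dom_in)

lemma arr_cod [simp]: "m \<in> Arr K \<Longrightarrow> Cod K m \<in> Obj K"
  by (rule K.cod_in)

lemma arr_id [simp]:
  "t \<in> Obj K \<Longrightarrow> Id K t \<in> Arr K" "t \<in> Obj K \<Longrightarrow> Dom K (Id K t) = t" "t \<in> Obj K \<Longrightarrow> Cod K (Id K t) = t"
  using K.id_in[of t] unfolding hom_def by auto

lemma arr_comp [simp]:
  assumes "m \<in> Arr K" "n \<in> Arr K" "Cod K n = Dom K m"
  shows "m \<odot> n \<in> Arr K" "Dom K (m \<odot> n) = Dom K n" "Cod K (m \<odot> n) = Cod K m"
  using K.comp_in[of n "Dom K n" "Dom K m" m "Cod K m"] assms unfolding hom_def by auto

lemma comp_id [simp]:
  "m \<in> Arr K \<Longrightarrow> Cod K m = t \<Longrightarrow> Id K t \<odot> m = m"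
  "m \<in> Arr K \<Longrightarrow> Dom K m = t \<Longrightarrow> m \<odot> Id K t = m"
  using K.id_left[of m "Dom K m" t] K.id_right[of m t "Cod K m"] unfolding hom_def by auto

lemma comp_assoc [simp]:
  assumes "m \<in> Arr K" "n \<in> Arr K" "k \<in> Arr K" "Cod K n = Dom K m" "Cod K k = Dom K n"
  shows "m \<odot> n \<odot> k = m \<odot> (n \<odot> k)"
  using K.comp_assoc[of k "Dom K k" "Dom K n" n "Dom K m" m "Cod K m"] assms unfolding hom_def by auto

section \<open>Local truth\<close>

definition into :: "'t \<Rightarrow> 'm set" where
  "into t = {m \<in> Arr K. Cod K m = t}"

lemma into_iff [simp]: "m \<in> into t \<longleftrightarrow> m \<in> Arr K \<and> Cod K m = t"
  unfolding into_def by simp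

text \<open>Local truth as a modality. It asks for some cover with \<open>Q\<close> on all its
  arrows, rather than for the arrows with \<open>Q\<close> to form a cover, because \<open>Q\<close>
  need not be stable under composition. The lemmas below are the rules of this modality and spare
  explicit sieves later on.\<close>

definition cov :: "'t \<Rightarrow> ('m \<Rightarrow> bool) \<Rightarrow> bool" where
  "cov t Q \<longleftrightarrow> (\<exists>S\<in>J t. \<forall>m\<in>S. Q m)"

lemma covering_sieve: "t \<in> Obj K \<Longrightarrow> S \<in> J t \<Longrightarrow> sieve K t S"
proof -
  have "\<forall>c\<in>Obj K. \<forall>S\<in>J c. sieve K c S"
    using site unfolding grothendieck_site_def by (elim conjE)
  then show "t \<in> Obj K \<Longrightarrow> S \<in> J t \<Longrightarrow> sieve K t S" by simp
qed

lemma covering_arr: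
  assumes "t \<in> Obj K" "S \<in> J t" "m \<in> S" shows "m \<in> Arr K" "Cod K m = t"
proof -
  have "S \<subseteq> {f \<in> Arr K. Cod K f = t}"
    using covering_sieve[OF assms(1,2)] unfolding sieve_def by (elim conjE)
  then show "m \<in> Arr K" "Cod K m = t" using assms(3) by auto
qed

lemma covering_comp:
  assumes "t \<in> Obj K" "S \<in> J t" "m \<in> S" "n \<in> Arr K" "Cod K n = Dom K m" shows "m \<odot> n \<in> S"
proof -
  have "\<forall>f\<in>S. \<forall>g\<in>Arr K. Cod K g = Dom K f \<longrightarrow> f \<odot> g \<in> S"
    using covering_sieve[OF assms(1,2)] unfolding sieve_def by (elim conjE)
  then show ?thesis using assms(3-) by simp
qed

lemma into_covers: "t \<in> Obj K \<Longrightarrow> into t \<in> J t"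
proof -
  have "\<forall>c\<in>Obj K. {f \<in> Arr K. Cod K f = c} \<in> J c"
    using site unfolding grothendieck_site_def by (elim conjE)
  then show "t \<in> Obj K \<Longrightarrow> into t \<in> J t" unfolding into_def by simp
qed

lemma pull_covers: "m \<in> Arr K \<Longrightarrow> S \<in> J (Cod K m) \<Longrightarrow> pull_sieve K m S \<in> J (Dom K m)"
proof -
  have "\<forall>f\<in>Arr K. \<forall>S\<in>J (Cod K f). pull_sieve K f S \<in> J (Dom K f)"
    using site unfolding grothendieck_site_def by (elim conjE)
  then show "m \<in> Arr K \<Longrightarrow> S \<in> J (Cod K m) \<Longrightarrow> pull_sieve K m S \<in> J (Dom K m)" by simp
qed

lemma trans_covers:
  assumes "t \<in> Obj K" "S \<in> J t" "sieve K t R" "\<And>m. m \<in> S \<Longrightarrow> pull_sieve K m R \<in> J (Dom K m)"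
  shows "R \<in> J t"
proof -
  have "\<forall>c\<in>Obj K. \<forall>S\<in>J c. \<forall>R. sieve K c R \<and> (\<forall>f\<in>S. pull_sieve K f R \<in> J (Dom K f)) \<longrightarrow> R \<in> J c"
    using site unfolding grothendieck_site_def by (elim conjE)
  from this[rule_format, OF assms(1,2), of R] show ?thesis using assms(3,4) by blast
qed

text \<open>An arrow of the smaller sieve pulls the larger one back to the maximal sieve, which
  covers, so the transitivity axiom applies.\<close>

lemma sieve_superset_covers:
  assumes t: "t \<in> Obj K" and S: "S \<in> J t" and R: "sieve K t R" "S \<subseteq> R"
  shows "R \<in> J t"
proof (rule trans_covers[OF t S R(1)])
  fix m assume m: "m \<in> S"
  have "pull_sieve K m R = into (Dom K m)"
    using covering_comp[OF t S m] covering_arr[OF t S m] R(2) unfolding pull_sieve_def into_def by auto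
  then show "pull_sieve K m R \<in> J (Dom K m)" using into_covers covering_arr[OF t S m] by simp
qed

lemma cov_mono:
  assumes "t \<in> Obj K" "cov t Q" "\<And>m. m \<in> Arr K \<Longrightarrow> Cod K m = t \<Longrightarrow> Q m \<Longrightarrow> R m"
  shows "cov t R"
proof -
  obtain S where S: "S \<in> J t" "\<forall>m\<in>S. Q m" using assms(2) unfolding cov_def by blast
  have "\<forall>m\<in>S. R m" using assms(3) covering_arr[OF assms(1) S(1)] S(2) by simp
  then show ?thesis using S(1) unfolding cov_def by (intro bexI)
qed

lemma cov_all:
  assumes "t \<in> Obj K" "\<And>m. m \<in> Arr K \<Longrightarrow> Cod K m = t \<Longrightarrow> R m"
  shows "cov t R"
  unfolding cov_def
proof (rule bexI[OF _ into_covers[OF assms(1)]], rule ballI)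
  show "R m" if "m \<in> into t" for m using assms(2) that by simp
qed

text \<open>Intersections of covers are not among the axioms. They cover because along an arrow of
  \<open>S\<close> the sieve \<open>S \<inter> T\<close> pulls back to the same sieve as
  \<open>T\<close>, to which stability and then transitivity apply.\<close>

lemma cov_conj:
  assumes t: "t \<in> Obj K" and "cov t Q" "cov t R"
  shows "cov t (\<lambda>m. Q m \<and> R m)"
proof -
  obtain S T where S: "S \<in> J t" "\<forall>m\<in>S. Q m" and T: "T \<in> J t" "\<forall>m\<in>T. R m"
    using assms unfolding cov_def by blast
  have "sieve K t (S \<inter> T)"
    using covering_sieve[OF t S(1)] covering_sieve[OF t T(1)] unfolding sieve_def by blast
  moreover have "pull_sieve K m (S \<inter> T) \<in> J (Dom K m)" if m: "m \<in> S" for m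
  proof -
    have "pull_sieve K m (S \<inter> T) = pull_sieve K m T"
      using covering_comp[OF t S(1) m] unfolding pull_sieve_def by blast
    then show ?thesis using pull_covers[of m T] T covering_arr[OF t S(1) m] by simp
  qed
  ultimately have "S \<inter> T \<in> J t" using trans_covers[OF t S(1)] by blast
  then show ?thesis using S T unfolding cov_def by blast
qed

lemma cov_pull:
  assumes m: "m \<in> Arr K" and "cov (Cod K m) Q"
  shows "cov (Dom K m) (\<lambda>n. Q (m \<odot> n))"
proof -
  obtain S where S: "S \<in> J (Cod K m)" "\<forall>m\<in>S. Q m" using assms(2) unfolding cov_def by blast
  then have "\<forall>n\<in>pull_sieve K m S. Q (m \<odot> n)" unfolding pull_sieve_def by simp
  then show ?thesis using pull_covers[OF m S(1)] unfolding cov_def by blast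
qed

text \<open>Idempotence of the modality. With a cover chosen on the domain of each arrow of the
  first cover, the composites form a sieve whose pullback along an arrow of the first cover contains
  the chosen one; transitivity does the rest.\<close>

lemma cov_trans:
  assumes t: "t \<in> Obj K" and c: "cov t (\<lambda>m. cov (Dom K m) (\<lambda>n. Q (m \<odot> n)))"
  shows "cov t Q"
proof -
  obtain S where S: "S \<in> J t" "\<forall>m\<in>S. \<exists>T\<in>J (Dom K m). \<forall>n\<in>T. Q (m \<odot> n)"
    using c unfolding cov_def by blast
  then obtain T where T: "\<And>m. m \<in> S \<Longrightarrow> T m \<in> J (Dom K m)" "\<And>m n. m \<in> S \<Longrightarrow> n \<in> T m \<Longrightarrow> Q (m \<odot> n)"
    by metis
  note Sa = covering_arr[OF t S(1)]
  have Ta: "n \<in> Arr K" "Cod K n = Dom K m" if "m \<in> S" "n \<in> T m" for m n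
    using covering_arr[OF arr_dom[OF Sa(1)] T(1)] that by blast+
  define R where "R = {m \<odot> n | m n. m \<in> S \<and> n \<in> T m}"
  have "sieve K t R"
    unfolding sieve_def
  proof (intro conjI ballI impI)
    show "R \<subseteq> {f \<in> Arr K. Cod K f = t}" unfolding R_def using Sa Ta by auto
  next
    fix f g assume f: "f \<in> R" and g: "g \<in> Arr K" "Cod K g = Dom K f"
    obtain m n where mn: "f = m \<odot> n" "m \<in> S" "n \<in> T m" using f unfolding R_def by blast
    then have "n \<odot> g \<in> T m"
      using covering_comp[OF arr_dom[OF Sa(1)[OF mn(2)]] T(1)[OF mn(2)] mn(3) g(1)] g(2)
        Sa[OF mn(2)] Ta[OF mn(2,3)] by simp
    moreover have "f \<odot> g = m \<odot> (n \<odot> g)"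
      unfolding mn(1) using g mn(1) Sa[OF mn(2)] Ta[OF mn(2,3)] by (intro comp_assoc) simp_all
    ultimately show "f \<odot> g \<in> R" unfolding R_def using mn(2) by blast
  qed
  moreover have "pull_sieve K m R \<in> J (Dom K m)" if m: "m \<in> S" for m
  proof (rule sieve_superset_covers[OF arr_dom[OF Sa(1)[OF m]] T(1)[OF m]])
    have "f \<odot> g \<in> R" if "f \<in> R" "g \<in> Arr K" "Cod K g = Dom K f" for f g
      using \<open>sieve K t R\<close> that unfolding sieve_def by blast
    then show "sieve K (Dom K m) (pull_sieve K m R)"
      unfolding sieve_def pull_sieve_def using Sa(1)[OF m] by (auto simp flip: comp_assoc)
    show "T m \<subseteq> pull_sieve K m R"
      unfolding pull_sieve_def R_def using m Ta[OF m] by auto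
  qed
  ultimately have "R \<in> J t" by (rule trans_covers[OF t S(1)])
  moreover have "\<forall>f\<in>R. Q f" using T(2) unfolding R_def by blast
  ultimately show ?thesis unfolding cov_def by (intro bexI)
qed

text \<open>Gluing needs one definite sieve as index set of the matching family. Stability of
  \<open>Q\<close> under composition makes the set of all its arrows a sieve, and it contains a
  cover.\<close>

lemma cov_sieve:
  assumes t: "t \<in> Obj K" and "cov t Q"
    and "\<And>m n. m \<in> Arr K \<Longrightarrow> Cod K m = t \<Longrightarrow> n \<in> Arr K \<Longrightarrow> Cod K n = Dom K m \<Longrightarrow> Q m \<Longrightarrow> Q (m \<odot> n)"
  shows "{m \<in> Arr K. Cod K m = t \<and> Q m} \<in> J t"
proof -
  obtain S where S: "S \<in> J t" "\<forall>m\<in>S. Q m" using assms(2) unfolding cov_def by blast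
  show ?thesis
    by (rule sieve_superset_covers[OF t S(1)])
      (use assms(3) S(2) covering_arr[OF t S(1)] in \<open>auto simp: sieve_def\<close>)
qed

section \<open>Presheaves and sheaves as families of sets\<close>

definition psh :: "('t \<Rightarrow> 'v set) \<Rightarrow> ('m \<Rightarrow> 'v \<Rightarrow> 'v) \<Rightarrow> bool" where
  "psh P r \<longleftrightarrow>
     (\<forall>m\<in>Arr K. \<forall>x\<in>P (Cod K m). r m x \<in> P (Dom K m)) \<and>
     (\<forall>t\<in>Obj K. \<forall>x\<in>P t. r (Id K t) x = x) \<and>
     (\<forall>m\<in>Arr K. \<forall>n\<in>Arr K. Cod K n = Dom K m \<longrightarrow> (\<forall>x\<in>P (Cod K m). r (m \<odot> n) x = r n (r m x)))"

text \<open>Values lie in an arbitrary type, so that sets of terms, of pairs or of sections can be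
  treated as sheaves before they are copied into the type of \<open>U\<close>. The gluing clause
  follows \<open>is_sheaf\<close> literally, which later identifies the two notions by mere
  unfolding.\<close>

definition sheaf :: "('t \<Rightarrow> 'v set) \<Rightarrow> ('m \<Rightarrow> 'v \<Rightarrow> 'v) \<Rightarrow> bool" where
  "sheaf P r \<longleftrightarrow> psh P r \<and>
     (\<forall>t\<in>Obj K. \<forall>S\<in>J t. \<forall>x.
        (\<forall>m\<in>S. x m \<in> P (Dom K m)) \<and>
        (\<forall>m\<in>S. \<forall>n\<in>Arr K. Cod K n = Dom K m \<longrightarrow> r n (x m) = x (m \<odot> n)) \<longrightarrow>
        (\<exists>!y. y \<in> P t \<and> (\<forall>m\<in>S. r m y = x m)))"

definition natural ::
  "('t \<Rightarrow> 'v set) \<Rightarrow> ('m \<Rightarrow> 'v \<Rightarrow> 'v) \<Rightarrow> ('t \<Rightarrow> 'w set) \<Rightarrow> ('m \<Rightarrow> 'w \<Rightarrow> 'w) \<Rightarrow> ('t \<Rightarrow> 'v \<Rightarrow> 'w) \<Rightarrow> bool" where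
  "natural P r Q s \<phi> \<longleftrightarrow>
     (\<forall>t\<in>Obj K. \<forall>x\<in>P t. \<phi> t x \<in> Q t) \<and>
     (\<forall>m\<in>Arr K. \<forall>x\<in>P (Cod K m). \<phi> (Dom K m) (r m x) = s m (\<phi> (Cod K m) x))"

text \<open>The sheaf-theoretic form of surjectivity, also applied to sources that are only
  presheaves, such as families of terms.\<close>

definition locally_surj :: "('t \<Rightarrow> 'v set) \<Rightarrow> ('t \<Rightarrow> 'w set) \<Rightarrow> ('m \<Rightarrow> 'w \<Rightarrow> 'w) \<Rightarrow> ('t \<Rightarrow> 'v \<Rightarrow> 'w) \<Rightarrow> bool" where
  "locally_surj P Q s \<eta> \<longleftrightarrow>
     (\<forall>t\<in>Obj K. \<forall>y\<in>Q t. cov t (\<lambda>m. \<exists>x\<in>P (Dom K m). \<eta> (Dom K m) x = s m y))"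

lemma psh_mem: "psh P r \<Longrightarrow> m \<in> Arr K \<Longrightarrow> x \<in> P (Cod K m) \<Longrightarrow> r m x \<in> P (Dom K m)"
  unfolding psh_def by blast

lemma psh_id: "psh P r \<Longrightarrow> t \<in> Obj K \<Longrightarrow> x \<in> P t \<Longrightarrow> r (Id K t) x = x"
  unfolding psh_def by blast

lemma psh_comp: "psh P r \<Longrightarrow> m \<in> Arr K \<Longrightarrow> n \<in> Arr K \<Longrightarrow> Cod K n = Dom K m \<Longrightarrow> x \<in> P (Cod K m) \<Longrightarrow>
    r (m \<odot> n) x = r n (r m x)"
  unfolding psh_def by blast

lemma sheaf_psh: "sheaf P r \<Longrightarrow> psh P r"
  unfolding sheaf_def by blast

lemma natural_mem: "natural P r Q s \<phi> \<Longrightarrow> t \<in> Obj K \<Longrightarrow> x \<in> P t \<Longrightarrow> \<phi> t x \<in> Q t"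
  unfolding natural_def by blast

lemma natural_res: "natural P r Q s \<phi> \<Longrightarrow> m \<in> Arr K \<Longrightarrow> x \<in> P (Cod K m) \<Longrightarrow>
    \<phi> (Dom K m) (r m x) = s m (\<phi> (Cod K m) x)"
  unfolding natural_def by blast

lemma locally_surjD: "locally_surj P Q s \<eta> \<Longrightarrow> t \<in> Obj K \<Longrightarrow> y \<in> Q t \<Longrightarrow>
    cov t (\<lambda>m. \<exists>x\<in>P (Dom K m). \<eta> (Dom K m) x = s m y)"
  unfolding locally_surj_def by blast

text \<open>Both elements glue the restrictions of \<open>x\<close>, and the sheaf axiom allows only
  one such element. Most equations below are proved by this rule, on a cover where the elements have
  a convenient form.\<close>

lemma sheaf_eqI:
  assumes P: "sheaf P r" and t: "t \<in> Obj K" and xy: "x \<in> P t" "y \<in> P t"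
    and c: "cov t (\<lambda>m. r m x = r m y)"
  shows "x = y"
proof -
  obtain S where S: "S \<in> J t" "\<forall>m\<in>S. r m x = r m y" using c unfolding cov_def by blast
  note p = sheaf_psh[OF P]
  have "\<exists>!z. z \<in> P t \<and> (\<forall>m\<in>S. r m z = r m x)"
  proof (rule P[unfolded sheaf_def, THEN conjunct2, rule_format, OF t S(1)], intro conjI ballI impI)
    fix m assume "m \<in> S"
    then have m: "m \<in> Arr K" "Cod K m = t" using covering_arr[OF t S(1)] by blast+
    show "r m x \<in> P (Dom K m)" using psh_mem[OF p m(1)] m xy by simp
    fix n assume "n \<in> Arr K" "Cod K n = Dom K m"
    then show "r n (r m x) = r (m \<odot> n) x" using psh_comp[OF p m(1)] m xy by simp
  qed
  then show ?thesis using S xy by metis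
qed

text \<open>Gluing, with the matching family given as a functional relation \<open>\<Phi>\<close> stable under restriction.\<close>

lemma sheaf_glue:
  assumes P: "sheaf P r" and t: "t \<in> Obj K"
    and c: "cov t (\<lambda>m. \<exists>z\<in>P (Dom K m). \<Phi> m z)"
    and u: "\<And>m z z'. m \<in> Arr K \<Longrightarrow> Cod K m = t \<Longrightarrow> z \<in> P (Dom K m) \<Longrightarrow> z' \<in> P (Dom K m) \<Longrightarrow>
      \<Phi> m z \<Longrightarrow> \<Phi> m z' \<Longrightarrow> z = z'"
    and n: "\<And>m n z. m \<in> Arr K \<Longrightarrow> Cod K m = t \<Longrightarrow> n \<in> Arr K \<Longrightarrow> Cod K n = Dom K m \<Longrightarrow>
      z \<in> P (Dom K m) \<Longrightarrow> \<Phi> m z \<Longrightarrow> \<Phi> (m \<odot> n) (r n z)"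
  shows "\<exists>y\<in>P t. (\<forall>m z. m \<in> Arr K \<longrightarrow> Cod K m = t \<longrightarrow> z \<in> P (Dom K m) \<longrightarrow> \<Phi> m z \<longrightarrow> r m y = z) \<and>
    cov t (\<lambda>m. \<Phi> m (r m y))"
proof -
  note p = sheaf_psh[OF P]
  define S where "S = {m \<in> Arr K. Cod K m = t \<and> (\<exists>z\<in>P (Dom K m). \<Phi> m z)}"
  have S: "S \<in> J t"
    unfolding S_def
  proof (rule cov_sieve[OF t c])
    fix m k assume *: "m \<in> Arr K" "Cod K m = t" "k \<in> Arr K" "Cod K k = Dom K m" "\<exists>z\<in>P (Dom K m). \<Phi> m z"
    then obtain z where z: "z \<in> P (Dom K m)" "\<Phi> m z" by blast
    have "\<Phi> (m \<odot> k) (r k z)" by (rule n[OF *(1-4) z])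
    then show "\<exists>z\<in>P (Dom K (m \<odot> k)). \<Phi> (m \<odot> k) z"
      using psh_mem[OF p *(3), of z] z * by auto
  qed
  \<comment> \<open>The choice is arbitrary only in form: by \<open>u\<close> there is a single
    value on each arrow, so compatibility of the chosen values follows from stability of
    \<open>\<Phi>\<close>.\<close>
  define x where "x m = (SOME z. z \<in> P (Dom K m) \<and> \<Phi> m z)" for m
  have x: "x m \<in> P (Dom K m)" "\<Phi> m (x m)" if "m \<in> S" for m
  proof -
    have "\<exists>z. z \<in> P (Dom K m) \<and> \<Phi> m z" using that unfolding S_def by blast
    from someI_ex[OF this] show "x m \<in> P (Dom K m)" "\<Phi> m (x m)" unfolding x_def by simp_all
  qed
  have "\<exists>!y. y \<in> P t \<and> (\<forall>m\<in>S. r m y = x m)"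
  proof (rule P[unfolded sheaf_def, THEN conjunct2, rule_format, OF t S], intro conjI ballI impI)
    fix m assume m: "m \<in> S"
    show "x m \<in> P (Dom K m)" using x m by blast
    fix k assume k: "k \<in> Arr K" "Cod K k = Dom K m"
    have m': "m \<in> Arr K" "Cod K m = t" using m unfolding S_def by blast+
    have mk: "m \<odot> k \<in> S" using covering_comp[OF t S m k] .
    show "r k (x m) = x (m \<odot> k)"
    proof (rule u[of "m \<odot> k"])
      show "\<Phi> (m \<odot> k) (r k (x m))" using n[OF m' k x(1)[OF m] x(2)[OF m]] .
      show "r k (x m) \<in> P (Dom K (m \<odot> k))" using psh_mem[OF p k(1), of "x m"] x(1)[OF m] k m' by simp
    qed (use x[OF mk] m' k in auto)
  qed
  then obtain y where y: "y \<in> P t" "\<forall>m\<in>S. r m y = x m" by blast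
  have 1: "r m y = z" if "m \<in> Arr K" "Cod K m = t" "z \<in> P (Dom K m)" "\<Phi> m z" for m z
  proof -
    have "m \<in> S" unfolding S_def using that by blast
    then show ?thesis using y u[OF that(1,2,3) x(1) that(4) x(2)] by simp
  qed
  have 2: "cov t (\<lambda>m. \<Phi> m (r m y))"
    unfolding cov_def using S y x by (intro bexI[of _ S] ballI) simp_all
  show ?thesis
    by (rule bexI[OF _ y(1)]) (use 1 2 in simp)
qed

end

section \<open>Sheafified quotients\<close>

text \<open>
  A section over \<open>t\<close> of the sheaf associated with \<open>P / E\<close> is represented, without any quotient
  or colimit, by the set of all \<open>(m, x)\<close> such that its restriction along \<open>m\<close> is the class of \<open>x\<close>.
\<close>

locale presheaf_quotient = site K J
  for K :: "('t, 'm) cat" and J :: "'t \<Rightarrow> 'm set set" +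
  fixes P :: "'t \<Rightarrow> 'v set" and r :: "'m \<Rightarrow> 'v \<Rightarrow> 'v" and E :: "'t \<Rightarrow> 'v \<Rightarrow> 'v \<Rightarrow> bool"
  assumes presheaf: "psh P r"
    and E_refl: "t \<in> Obj K \<Longrightarrow> x \<in> P t \<Longrightarrow> E t x x"
    and E_sym: "t \<in> Obj K \<Longrightarrow> x \<in> P t \<Longrightarrow> y \<in> P t \<Longrightarrow> E t x y \<Longrightarrow> E t y x"
    and E_trans: "t \<in> Obj K \<Longrightarrow> x \<in> P t \<Longrightarrow> y \<in> P t \<Longrightarrow> z \<in> P t \<Longrightarrow> E t x y \<Longrightarrow> E t y z \<Longrightarrow> E t x z"
    and E_res: "m \<in> Arr K \<Longrightarrow> x \<in> P (Cod K m) \<Longrightarrow> y \<in> P (Cod K m) \<Longrightarrow> E (Cod K m) x y \<Longrightarrow>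
      E (Dom K m) (r m x) (r m y)"
    and E_local: "t \<in> Obj K \<Longrightarrow> x \<in> P t \<Longrightarrow> y \<in> P t \<Longrightarrow> cov t (\<lambda>m. E (Dom K m) (r m x) (r m y)) \<Longrightarrow> E t x y"
begin

lemma r_mem [simp]: "m \<in> Arr K \<Longrightarrow> x \<in> P (Cod K m) \<Longrightarrow> r m x \<in> P (Dom K m)"
  by (rule psh_mem[OF presheaf])

lemma r_mem' [simp]: "m \<in> Arr K \<Longrightarrow> Cod K m = t \<Longrightarrow> x \<in> P t \<Longrightarrow> r m x \<in> P (Dom K m)"
  using r_mem by blast

lemma r_comp: "m \<in> Arr K \<Longrightarrow> n \<in> Arr K \<Longrightarrow> Cod K n = Dom K m \<Longrightarrow> x \<in> P (Cod K m) \<Longrightarrow>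
    r n (r m x) = r (m \<odot> n) x"
  by (rule psh_comp[OF presheaf, symmetric])

text \<open>The last clause forces a section to contain every representative that is correct on a
  cover. Sections that agree locally are then equal as sets, and no further quotient has to be
  taken. Representatives are asked for only locally, because a section of a quotient need not lift
  globally.\<close>

definition is_section :: "'t \<Rightarrow> ('m \<times> 'v) set \<Rightarrow> bool" where
  "is_section t W \<longleftrightarrow>
     (\<forall>m x. (m, x) \<in> W \<longrightarrow> m \<in> into t \<and> x \<in> P (Dom K m)) \<and>
     (\<forall>m x y. (m, x) \<in> W \<longrightarrow> (m, y) \<in> W \<longrightarrow> E (Dom K m) x y) \<and>
     (\<forall>m x n. (m, x) \<in> W \<longrightarrow> n \<in> into (Dom K m) \<longrightarrow> (m \<odot> n, r n x) \<in> W) \<and>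
     cov t (\<lambda>m. \<exists>x. (m, x) \<in> W) \<and>
     (\<forall>m\<in>into t. \<forall>x\<in>P (Dom K m).
        cov (Dom K m) (\<lambda>n. \<exists>z. (m \<odot> n, z) \<in> W \<and> E (Dom K n) (r n x) z) \<longrightarrow> (m, x) \<in> W)"

definition restr :: "'m \<Rightarrow> ('m \<times> 'v) set \<Rightarrow> ('m \<times> 'v) set" where
  "restr h W = {(n, x). n \<in> into (Dom K h) \<and> (h \<odot> n, x) \<in> W}"

text \<open>The unit of sheafification, composed with the passage to classes.\<close>

definition \<iota> :: "'t \<Rightarrow> 'v \<Rightarrow> ('m \<times> 'v) set" where
  "\<iota> t x = {(m, y). m \<in> into t \<and> y \<in> P (Dom K m) \<and> E (Dom K m) (r m x) y}"

lemma section_memD: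
  assumes "is_section t W" "(m, x) \<in> W"
  shows "m \<in> Arr K" "Cod K m = t" "x \<in> P (Dom K m)"
proof -
  have "\<forall>m x. (m, x) \<in> W \<longrightarrow> m \<in> into t \<and> x \<in> P (Dom K m)"
    using assms(1) unfolding is_section_def by (elim conjE)
  then have "m \<in> into t \<and> x \<in> P (Dom K m)" using assms(2) by simp
  then show "m \<in> Arr K" "Cod K m = t" "x \<in> P (Dom K m)" by simp_all
qed

lemma section_func:
  assumes "is_section t W" "(m, x) \<in> W" "(m, y) \<in> W"
  shows "E (Dom K m) x y"
proof -
  have "\<forall>m x y. (m, x) \<in> W \<longrightarrow> (m, y) \<in> W \<longrightarrow> E (Dom K m) x y"
    using assms(1) unfolding is_section_def by (elim conjE)
  from this[rule_format, OF assms(2,3)] show ?thesis .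
qed

lemma section_res:
  assumes "is_section t W" "(m, x) \<in> W" "n \<in> Arr K" "Cod K n = Dom K m"
  shows "(m \<odot> n, r n x) \<in> W"
proof -
  have "\<forall>m x n. (m, x) \<in> W \<longrightarrow> n \<in> into (Dom K m) \<longrightarrow> (m \<odot> n, r n x) \<in> W"
    using assms(1) unfolding is_section_def by (elim conjE)
  from this[rule_format, OF assms(2)] show ?thesis using assms(3,4) by simp
qed

lemma section_cov:
  assumes "is_section t W"
  shows "cov t (\<lambda>m. \<exists>x. (m, x) \<in> W)"
  using assms unfolding is_section_def by (elim conjE)

lemma section_closed:
  assumes "is_section t W" "m \<in> Arr K" "Cod K m = t" "x \<in> P (Dom K m)"
    and "cov (Dom K m) (\<lambda>n. \<exists>z. (m \<odot> n, z) \<in> W \<and> E (Dom K n) (r n x) z)"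
  shows "(m, x) \<in> W"
proof -
  have "\<forall>m\<in>into t. \<forall>x\<in>P (Dom K m).
      cov (Dom K m) (\<lambda>n. \<exists>z. (m \<odot> n, z) \<in> W \<and> E (Dom K n) (r n x) z) \<longrightarrow> (m, x) \<in> W"
    using assms(1) unfolding is_section_def by (elim conjE)
  from this[rule_format, OF _ assms(4,5)] show ?thesis using assms(2,3) by simp
qed

lemma section_saturated:
  assumes W: "is_section t W" and mx: "(m, x) \<in> W" and y: "y \<in> P (Dom K m)" "E (Dom K m) x y"
  shows "(m, y) \<in> W"
proof (rule section_closed[OF W _ _ y(1)])
  note d = section_memD[OF W mx]
  show "m \<in> Arr K" "Cod K m = t" using d by auto
  show "cov (Dom K m) (\<lambda>n. \<exists>z. (m \<odot> n, z) \<in> W \<and> E (Dom K n) (r n y) z)"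
  proof (rule cov_all)
    fix n assume n: "n \<in> Arr K" "Cod K n = Dom K m"
    have "E (Dom K m) y x" by (rule E_sym) (use d y in simp_all)
    then have "E (Dom K n) (r n y) (r n x)" using E_res[OF n(1)] n d y by simp
    then show "\<exists>z. (m \<odot> n, z) \<in> W \<and> E (Dom K n) (r n y) z" using section_res[OF W mx n] by blast
  qed (use d in simp)
qed

lemma restr_iff [simp]: "(n, x) \<in> restr h W \<longleftrightarrow> n \<in> Arr K \<and> Cod K n = Dom K h \<and> (h \<odot> n, x) \<in> W"
  unfolding restr_def by simp

lemma \<iota>_iff [simp]: "(m, y) \<in> \<iota> t x \<longleftrightarrow> m \<in> Arr K \<and> Cod K m = t \<and> y \<in> P (Dom K m) \<and> E (Dom K m) (r m x) y"
  unfolding \<iota>_def by simp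

text \<open>One representative on \<open>m\<close> determines the section there: functionality gives
  one inclusion, saturation the other. As representatives exist locally, this yields local
  surjectivity of \<iota>.\<close>

lemma restr_eq_\<iota>:
  assumes W: "is_section t W" and mx: "(m, x) \<in> W"
  shows "restr m W = \<iota> (Dom K m) x"
proof (rule set_eqI, clarify)
  fix n y
  note d = section_memD[OF W mx]
  show "(n, y) \<in> restr m W \<longleftrightarrow> (n, y) \<in> \<iota> (Dom K m) x"
  proof
    assume "(n, y) \<in> restr m W"
    then have n: "n \<in> Arr K" "Cod K n = Dom K m" "(m \<odot> n, y) \<in> W" by auto
    show "(n, y) \<in> \<iota> (Dom K m) x"
      using section_func[OF W section_res[OF W mx n(1,2)] n(3)] section_memD[OF W n(3)] n d by simp
  next
    assume "(n, y) \<in> \<iota> (Dom K m) x"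
    then have n: "n \<in> Arr K" "Cod K n = Dom K m" "y \<in> P (Dom K n)" "E (Dom K n) (r n x) y" by auto
    then show "(n, y) \<in> restr m W"
      using section_saturated[OF W section_res[OF W mx n(1,2)], of y] d by simp
  qed
qed

lemma section_restr:
  assumes h: "h \<in> Arr K" and W: "is_section (Cod K h) W"
  shows "is_section (Dom K h) (restr h W)"
  unfolding is_section_def
proof (intro conjI allI impI ballI)
  fix m x assume mx: "(m, x) \<in> restr h W"
  then have m: "m \<in> Arr K" "Cod K m = Dom K h" "(h \<odot> m, x) \<in> W" by auto
  then show "m \<in> into (Dom K h)" "x \<in> P (Dom K m)" using section_memD[OF W m(3)] h by auto
  show "E (Dom K m) x y" if "(m, y) \<in> restr h W" for y
    using section_func[OF W m(3), of y] that m h by simp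
  show "(m \<odot> n, r n x) \<in> restr h W" if "n \<in> into (Dom K m)" for n
    using section_res[OF W m(3), of n] that m h by simp
next
  show "cov (Dom K h) (\<lambda>m. \<exists>x. (m, x) \<in> restr h W)"
    by (rule cov_mono[OF _ cov_pull[OF h section_cov[OF W]]]) (use h in auto)
next
  fix m x assume m: "m \<in> into (Dom K h)" and x: "x \<in> P (Dom K m)"
    and c: "cov (Dom K m) (\<lambda>n. \<exists>z. (m \<odot> n, z) \<in> restr h W \<and> E (Dom K n) (r n x) z)"
  have "cov (Dom K (h \<odot> m)) (\<lambda>n. \<exists>z. (h \<odot> m \<odot> n, z) \<in> W \<and> E (Dom K n) (r n x) z)"
    using c m h by (auto elim!: cov_mono[rotated])
  then show "(m, x) \<in> restr h W" using section_closed[OF W, of "h \<odot> m" x] m h x by simp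
qed

text \<open>Locality of \<open>E\<close> enters here: a candidate that is correct on a cover is
  related to \<open>r m x\<close> on that cover, hence related outright, and this is the closure
  clause.\<close>

lemma section_\<iota>:
  assumes t: "t \<in> Obj K" and x: "x \<in> P t"
  shows "is_section t (\<iota> t x)"
  unfolding is_section_def
proof (intro conjI allI impI ballI)
  fix m y assume my: "(m, y) \<in> \<iota> t x"
  then have m: "m \<in> Arr K" "Cod K m = t" "y \<in> P (Dom K m)" "E (Dom K m) (r m x) y" by auto
  then show "m \<in> into t" "y \<in> P (Dom K m)" by auto
  show "E (Dom K m) y z" if "(m, z) \<in> \<iota> t x" for z
  proof (rule E_trans[of _ y "r m x" z])
      show "E (Dom K m) y (r m x)" by (rule E_sym[OF _ _ _ m(4)]) (use m x in simp_all)
    qed (use that m x in simp_all)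
  show "(m \<odot> n, r n y) \<in> \<iota> t x" if "n \<in> into (Dom K m)" for n
    using that m x E_res[of n "r m x" y] by (auto simp: r_comp)
next
  show "cov t (\<lambda>m. \<exists>y. (m, y) \<in> \<iota> t x)"
    by (rule cov_all[OF t]) (use x in \<open>auto intro!: exI[of _ "r _ x"] E_refl\<close>)
next
  fix m y assume m: "m \<in> into t" and y: "y \<in> P (Dom K m)"
    and c: "cov (Dom K m) (\<lambda>n. \<exists>z. (m \<odot> n, z) \<in> \<iota> t x \<and> E (Dom K n) (r n y) z)"
  have "E (Dom K m) (r m x) y"
  proof (rule E_local)
    show "cov (Dom K m) (\<lambda>n. E (Dom K n) (r n (r m x)) (r n y))"
    proof (rule cov_mono[OF _ c])
      fix n assume n: "n \<in> Arr K" "Cod K n = Dom K m"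
        and "\<exists>z. (m \<odot> n, z) \<in> \<iota> t x \<and> E (Dom K n) (r n y) z"
      then obtain z where z: "z \<in> P (Dom K n)" "E (Dom K n) (r (m \<odot> n) x) z" "E (Dom K n) (r n y) z"
        using m by auto
      show "E (Dom K n) (r n (r m x)) (r n y)"
      proof (rule E_trans[of _ _ z])
        show "E (Dom K n) (r n (r m x)) z" using z(2) n m x by (simp add: r_comp)
        show "E (Dom K n) z (r n y)" by (rule E_sym[OF _ _ _ z(3)]) (use n y z in simp_all)
      qed (use n m x y z in simp_all)
    qed (use m in simp)
  qed (use m x y in auto)
  then show "(m, y) \<in> \<iota> t x" using m y by simp
qed

lemma restr_\<iota>:
  assumes "h \<in> Arr K" "x \<in> P (Cod K h)" shows "restr h (\<iota> (Cod K h) x) = \<iota> (Dom K h) (r h x)"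
  using assms by (auto simp: r_comp)

text \<open>Reading off the representatives on the identity arrow recovers \<open>E\<close>. Thus
  the associated sheaf identifies exactly what \<open>E\<close> does, which is the source of all
  exact descriptions of kernels below.\<close>

lemma \<iota>_eq_iff:
  assumes t: "t \<in> Obj K" and x: "x \<in> P t" and y: "y \<in> P t"
  shows "\<iota> t x = \<iota> t y \<longleftrightarrow> E t x y"
proof
  note i = psh_id[OF presheaf t]
  assume "\<iota> t x = \<iota> t y"
  moreover have "(Id K t, y) \<in> \<iota> t y" using t y E_refl[OF t y] by (simp add: i)
  ultimately have "(Id K t, y) \<in> \<iota> t x" by simp
  then show "E t x y" using t x by (simp add: i)
next
  assume xy: "E t x y"
  have "E (Dom K m) (r m x) z \<longleftrightarrow> E (Dom K m) (r m y) z"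
    if m: "m \<in> Arr K" "Cod K m = t" "z \<in> P (Dom K m)" for m z
  proof -
    have a: "E (Dom K m) (r m x) (r m y)" using E_res[OF m(1)] m x y xy by simp
    have b: "E (Dom K m) (r m y) (r m x)" by (rule E_sym[OF _ _ _ a]) (use m x y in simp_all)
    have rx: "r m x \<in> P (Dom K m)" "r m y \<in> P (Dom K m)" using m x y by auto
    show ?thesis
      using E_trans[OF arr_dom[OF m(1)] rx(1) rx(2) m(3) a] E_trans[OF arr_dom[OF m(1)] rx(2) rx(1) m(3) b] by blast
  qed
  then show "\<iota> t x = \<iota> t y" by (intro set_eqI, clarify) (simp add: conj_commute cong: conj_cong)
qed

section \<open>Separatedness and gluing for the associated sheaf\<close>

lemma psh_sections: "psh (\<lambda>t. {W. is_section t W}) restr"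
  unfolding psh_def
proof (intro conjI ballI impI)
  show "restr m W \<in> {W. is_section (Dom K m) W}" if "m \<in> Arr K" "W \<in> {W. is_section (Cod K m) W}" for m W
    using section_restr that by simp
next
  fix t W assume t: "t \<in> Obj K" and "W \<in> {W. is_section t W}"
  then have W: "is_section t W" by simp
  show "restr (Id K t) W = W"
  proof (rule set_eqI, clarify)
    fix n x
    show "(n, x) \<in> restr (Id K t) W \<longleftrightarrow> (n, x) \<in> W"
    proof
      assume "(n, x) \<in> W"
      then show "(n, x) \<in> restr (Id K t) W" using section_memD[OF W \<open>(n, x) \<in> W\<close>] t by simp
    qed (use t in auto)
  qed
next
  fix m n W assume "m \<in> Arr K" "n \<in> Arr K" "Cod K n = Dom K m"
  then show "restr (m \<odot> n) W = restr n (restr m W)"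
    by (intro set_eqI, clarify) (simp cong: conj_cong)
qed

text \<open>A representative in \<open>V\<close> restricts to representatives in \<open>W\<close>
  over the given cover, and the closure clause of \<open>W\<close> takes it back. Applied in both
  directions this is separatedness.\<close>

lemma section_subset:
  assumes t: "t \<in> Obj K" and V: "is_section t V" and W: "is_section t W"
    and c: "cov t (\<lambda>m. restr m V = restr m W)"
  shows "V \<subseteq> W"
proof clarify
  fix m x assume mx: "(m, x) \<in> V"
  note d = section_memD[OF V mx]
  have c': "cov (Dom K m) (\<lambda>n. restr (m \<odot> n) V = restr (m \<odot> n) W)"
    using cov_pull[OF d(1)] c d by simp
  show "(m, x) \<in> W"
  proof (rule section_closed[OF W d], rule cov_mono[OF _ c'])
    fix n assume n: "n \<in> Arr K" "Cod K n = Dom K m" "restr (m \<odot> n) V = restr (m \<odot> n) W"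
    have "(m \<odot> n, r n x) \<in> V" using section_res[OF V mx n(1,2)] .
    \<comment> \<open>Restrictions are compared as sets of representatives, so membership of the
      composite \<open>m \<odot> n\<close> is rephrased as membership of the identity arrow in the
      restriction.\<close>
    then have "(Id K (Dom K n), r n x) \<in> restr (m \<odot> n) V" using n(1,2) d by simp
    then have "(Id K (Dom K n), r n x) \<in> restr (m \<odot> n) W" by (simp only: n(3))
    then have "(m \<odot> n, r n x) \<in> W" using n(1,2) d by simp
    moreover have "E (Dom K n) (r n x) (r n x)" using E_refl n(1,2) d by simp
    ultimately show "\<exists>z. (m \<odot> n, z) \<in> W \<and> E (Dom K n) (r n x) z" by blast
  qed (use d in simp)
qed

text \<open>The condition on a representative is itself local, so the closure clause for the result
  holds by transitivity of covers. The arrow \<open>m\<close> need not lie in \<open>S\<close>; only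
  its composites with some cover do.\<close>

definition glued :: "'t \<Rightarrow> 'm set \<Rightarrow> ('m \<Rightarrow> ('m \<times> 'v) set) \<Rightarrow> ('m \<times> 'v) set" where
  "glued t S w = {(m, x). m \<in> into t \<and> x \<in> P (Dom K m) \<and>
     cov (Dom K m) (\<lambda>n. m \<odot> n \<in> S \<and> w (m \<odot> n) = \<iota> (Dom K n) (r n x))}"

lemma glued_iff: "(m, x) \<in> glued t S w \<longleftrightarrow> m \<in> Arr K \<and> Cod K m = t \<and> x \<in> P (Dom K m) \<and>
     cov (Dom K m) (\<lambda>n. m \<odot> n \<in> S \<and> w (m \<odot> n) = \<iota> (Dom K n) (r n x))"
  unfolding glued_def by simp

lemma
  assumes t: "t \<in> Obj K" and S: "S \<in> J t" and w: "\<And>m. m \<in> S \<Longrightarrow> is_section (Dom K m) (w m)"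
    and ww: "\<And>m n. m \<in> S \<Longrightarrow> n \<in> Arr K \<Longrightarrow> Cod K n = Dom K m \<Longrightarrow> restr n (w m) = w (m \<odot> n)"
  shows section_glued: "is_section t (glued t S w)"
    and restr_glued: "m \<in> S \<Longrightarrow> restr m (glued t S w) = w m"
proof -
  note Sa = covering_arr[OF t S]
  \<comment> \<open>For representatives taken from the given family the maximal cover suffices, by
    compatibility of the family. This supplies the local inhabitants and one half of the restriction
    formula.\<close>
  have w_glued: "(m \<odot> n, x) \<in> glued t S w" if m: "m \<in> S" and nx: "(n, x) \<in> w m" for m n x
  proof -
    note d = section_memD[OF w[OF m] nx] and m' = Sa[OF m]
    have mn: "m \<odot> n \<in> S" using covering_comp[OF t S m d(1,2)] .
    have e: "w (m \<odot> n) = \<iota> (Dom K n) x" using ww[OF m d(1,2)] restr_eq_\<iota>[OF w[OF m] nx] by simp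
    have "m \<odot> n \<odot> k \<in> S \<and> w (m \<odot> n \<odot> k) = \<iota> (Dom K k) (r k x)" if k: "k \<in> Arr K" "Cod K k = Dom K n" for k
    proof
      have k': "Cod K k = Dom K (m \<odot> n)" using k m' d by simp
      show "m \<odot> n \<odot> k \<in> S" using covering_comp[OF t S mn k(1) k'] .
      show "w (m \<odot> n \<odot> k) = \<iota> (Dom K k) (r k x)"
        using ww[OF mn k(1) k'] e restr_\<iota>[OF k(1)] d k by simp
    qed
    then show ?thesis unfolding glued_iff using m' d by (auto intro!: cov_all)
  qed
  show *: "is_section t (glued t S w)"
    unfolding is_section_def
  proof (intro conjI allI impI ballI)
    fix m x assume mx: "(m, x) \<in> glued t S w"
    then have m: "m \<in> Arr K" "Cod K m = t" "x \<in> P (Dom K m)"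
      and c: "cov (Dom K m) (\<lambda>n. m \<odot> n \<in> S \<and> w (m \<odot> n) = \<iota> (Dom K n) (r n x))"
      unfolding glued_iff by auto
    show "m \<in> into t" "x \<in> P (Dom K m)" using m by auto
    show "E (Dom K m) x y" if "(m, y) \<in> glued t S w" for y
    proof -
      have y: "y \<in> P (Dom K m)"
        and c': "cov (Dom K m) (\<lambda>n. m \<odot> n \<in> S \<and> w (m \<odot> n) = \<iota> (Dom K n) (r n y))"
        using that unfolding glued_iff by auto
      show ?thesis
      proof (rule E_local, use m y in simp_all, rule cov_mono[OF _ cov_conj[OF _ c c']])
        fix n assume n: "n \<in> Arr K" "Cod K n = Dom K m"
          and "(m \<odot> n \<in> S \<and> w (m \<odot> n) = \<iota> (Dom K n) (r n x)) \<and> m \<odot> n \<in> S \<and> w (m \<odot> n) = \<iota> (Dom K n) (r n y)"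
        then have "\<iota> (Dom K n) (r n x) = \<iota> (Dom K n) (r n y)" by metis
        then show "E (Dom K n) (r n x) (r n y)" using \<iota>_eq_iff[of "Dom K n" "r n x" "r n y"] n m y by simp
      qed (use m in simp_all)
    qed
    show "(m \<odot> n, r n x) \<in> glued t S w" if n: "n \<in> into (Dom K m)" for n
    proof -
      have "cov (Dom K n) (\<lambda>k. m \<odot> (n \<odot> k) \<in> S \<and> w (m \<odot> (n \<odot> k)) = \<iota> (Dom K (n \<odot> k)) (r (n \<odot> k) x))"
        by (rule cov_pull) (use n c in auto)
      then have "cov (Dom K n) (\<lambda>k. m \<odot> n \<odot> k \<in> S \<and> w (m \<odot> n \<odot> k) = \<iota> (Dom K k) (r k (r n x)))"
        by (rule cov_mono[rotated]) (use n m in \<open>auto simp: r_comp\<close>)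
      then show ?thesis unfolding glued_iff using m n by auto
    qed
  next
    show "cov t (\<lambda>m. \<exists>x. (m, x) \<in> glued t S w)"
    proof (rule cov_trans[OF t])
      show "cov t (\<lambda>m. cov (Dom K m) (\<lambda>n. \<exists>x. (m \<odot> n, x) \<in> glued t S w))"
        unfolding cov_def[of t]
      proof (intro bexI[OF _ S] ballI)
        fix m assume m: "m \<in> S"
        show "cov (Dom K m) (\<lambda>n. \<exists>x. (m \<odot> n, x) \<in> glued t S w)"
        proof (rule cov_mono[OF _ section_cov[OF w[OF m]]])
            fix n assume "\<exists>x. (n, x) \<in> w m"
            then show "\<exists>x. (m \<odot> n, x) \<in> glued t S w" using w_glued[OF m] by blast
          qed (use Sa[OF m] in simp)
      qed
    qed
  next
    fix m x assume m: "m \<in> into t" and x: "x \<in> P (Dom K m)"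
      and c: "cov (Dom K m) (\<lambda>n. \<exists>z. (m \<odot> n, z) \<in> glued t S w \<and> E (Dom K n) (r n x) z)"
    \<comment> \<open>Each \<open>z\<close> brings its own cover on which it represents the family.
      The two layers of covers collapse, and \<open>x\<close> may replace \<open>z\<close> because
      related elements have the same class.\<close>
    have "cov (Dom K m) (\<lambda>n. m \<odot> n \<in> S \<and> w (m \<odot> n) = \<iota> (Dom K n) (r n x))"
    proof (rule cov_trans, use m in simp, rule cov_mono[OF _ c])
      fix n assume n: "n \<in> Arr K" "Cod K n = Dom K m"
        and "\<exists>z. (m \<odot> n, z) \<in> glued t S w \<and> E (Dom K n) (r n x) z"
      then obtain z where z: "(m \<odot> n, z) \<in> glued t S w" "E (Dom K n) (r n x) z" by blast
      have zP: "z \<in> P (Dom K n)"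
        and cz: "cov (Dom K n) (\<lambda>k. m \<odot> n \<odot> k \<in> S \<and> w (m \<odot> n \<odot> k) = \<iota> (Dom K k) (r k z))"
        using z(1) n m unfolding glued_iff by auto
      show "cov (Dom K n) (\<lambda>k. m \<odot> (n \<odot> k) \<in> S \<and> w (m \<odot> (n \<odot> k)) = \<iota> (Dom K (n \<odot> k)) (r (n \<odot> k) x))"
      proof (rule cov_mono[OF _ cz])
        fix k assume k: "k \<in> Arr K" "Cod K k = Dom K n"
          "m \<odot> n \<odot> k \<in> S \<and> w (m \<odot> n \<odot> k) = \<iota> (Dom K k) (r k z)"
        have "\<iota> (Dom K k) (r k z) = \<iota> (Dom K k) (r k (r n x))"
        proof (subst \<iota>_eq_iff)
          have "E (Dom K n) z (r n x)" by (rule E_sym[OF _ _ _ z(2)]) (use n x zP in simp_all)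
          then show "E (Dom K k) (r k z) (r k (r n x))" using E_res[OF k(1)] k n x zP by simp
        qed (use k n x zP in auto)
        then show "m \<odot> (n \<odot> k) \<in> S \<and> w (m \<odot> (n \<odot> k)) = \<iota> (Dom K (n \<odot> k)) (r (n \<odot> k) x)"
          using k n m x by (simp add: r_comp)
      qed (use n in simp)
    qed (use m in simp)
    then show "(m, x) \<in> glued t S w" unfolding glued_iff using m x by simp
  qed
  show "restr m (glued t S w) = w m" if m: "m \<in> S"
  proof (rule set_eqI, clarify)
    fix n x
    note m' = Sa[OF m]
    show "(n, x) \<in> restr m (glued t S w) \<longleftrightarrow> (n, x) \<in> w m"
    proof
      assume "(n, x) \<in> w m"
      then show "(n, x) \<in> restr m (glued t S w)"
        using w_glued[OF m] section_memD[OF w[OF m]] by simp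
    next
      assume "(n, x) \<in> restr m (glued t S w)"
      then have n: "n \<in> Arr K" "Cod K n = Dom K m" and g: "(m \<odot> n, x) \<in> glued t S w" by auto
      then have x: "x \<in> P (Dom K n)"
        and c: "cov (Dom K n) (\<lambda>k. m \<odot> n \<odot> k \<in> S \<and> w (m \<odot> n \<odot> k) = \<iota> (Dom K k) (r k x))"
        unfolding glued_iff using m' by auto
      show "(n, x) \<in> w m"
      proof (rule section_closed[OF w[OF m] n x], rule cov_mono[OF _ c])
        fix k assume k: "k \<in> Arr K" "Cod K k = Dom K n"
          "m \<odot> n \<odot> k \<in> S \<and> w (m \<odot> n \<odot> k) = \<iota> (Dom K k) (r k x)"
        have E: "E (Dom K k) (r k x) (r k x)" using E_refl k x by simp
        have "restr (n \<odot> k) (w m) = \<iota> (Dom K k) (r k x)" using ww[OF m, of "n \<odot> k"] k n m' by simp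
        moreover have "(Id K (Dom K k), r k x) \<in> \<iota> (Dom K k) (r k x)"
          using k x E psh_id[OF presheaf, of "Dom K k" "r k x"] by simp
        ultimately have "(Id K (Dom K k), r k x) \<in> restr (n \<odot> k) (w m)" by simp
        then have "(n \<odot> k, r k x) \<in> w m" using k n by simp
        then show "\<exists>z. (n \<odot> k, z) \<in> w m \<and> E (Dom K k) (r k x) z" using E by blast
      qed (use n in simp)
    qed
  qed
qed

lemma sheaf_sections: "sheaf (\<lambda>t. {W. is_section t W}) restr"
  unfolding sheaf_def
proof (intro conjI ballI allI impI psh_sections, elim conjE)
  fix t S w assume t: "t \<in> Obj K" and S: "S \<in> J t" and "\<forall>m\<in>S. w m \<in> {W. is_section (Dom K m) W}"
    and "\<forall>m\<in>S. \<forall>n\<in>Arr K. Cod K n = Dom K m \<longrightarrow> restr n (w m) = w (m \<odot> n)"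
  then have w: "\<And>m. m \<in> S \<Longrightarrow> is_section (Dom K m) (w m)"
    "\<And>m n. m \<in> S \<Longrightarrow> n \<in> Arr K \<Longrightarrow> Cod K n = Dom K m \<Longrightarrow> restr n (w m) = w (m \<odot> n)" by auto
  show "\<exists>!V. V \<in> {W. is_section t W} \<and> (\<forall>m\<in>S. restr m V = w m)"
  proof (rule ex1I[of _ "glued t S w"])
    show g: "glued t S w \<in> {W. is_section t W} \<and> (\<forall>m\<in>S. restr m (glued t S w) = w m)"
      using section_glued[OF t S w] restr_glued[OF t S w] by blast
    fix V assume V: "V \<in> {W. is_section t W} \<and> (\<forall>m\<in>S. restr m V = w m)"
    have "cov t (\<lambda>m. restr m V = restr m (glued t S w))" "cov t (\<lambda>m. restr m (glued t S w) = restr m V)"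
      unfolding cov_def using S V g by (auto intro!: bexI[of _ S])
    then show "V = glued t S w"
      using section_subset[OF t, of V "glued t S w"] section_subset[OF t, of "glued t S w" V] V g by blast
  qed
qed

lemma \<iota>_natural: "natural P r (\<lambda>t. {W. is_section t W}) restr \<iota>"
  unfolding natural_def using section_\<iota> restr_\<iota> by auto

lemma \<iota>_locally_surj: "locally_surj P (\<lambda>t. {W. is_section t W}) restr \<iota>"
  unfolding locally_surj_def
proof (intro ballI)
  fix t W assume t: "t \<in> Obj K" and "W \<in> {W. is_section t W}"
  then have W: "is_section t W" by simp
  show "cov t (\<lambda>m. \<exists>x\<in>P (Dom K m). \<iota> (Dom K m) x = restr m W)"
  proof (rule cov_mono[OF t section_cov[OF W]])
    fix m assume "\<exists>x. (m, x) \<in> W"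
    then obtain x where x: "(m, x) \<in> W" by blast
    show "\<exists>x\<in>P (Dom K m). \<iota> (Dom K m) x = restr m W"
      by (rule bexI[of _ x]) (use restr_eq_\<iota>[OF W x] section_memD[OF W x] in simp_all)
  qed
qed

text \<open>One representative per arrow, where there is one, already determines a section, because
  saturation recovers all others; \<open>None\<close> marks the arrows without a representative.
  This is the estimate that keeps quotients small.\<close>

lemma sections_lepoll:
  assumes t: "t \<in> Obj K"
  shows "{W. is_section t W} \<lesssim> (\<Pi>\<^sub>E m\<in>into t. insert None (Some ` P (Dom K m)))"
proof -
  define c where "c W = (\<lambda>m\<in>into t. if \<exists>x. (m, x) \<in> W then Some (SOME x. (m, x) \<in> W) else None)"
    for W :: "('m \<times> 'v) set"
  have c: "\<exists>z. (m, z) \<in> W \<and> c W m = Some z" if "is_section t W" "(m, x) \<in> W" for W m x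
  proof -
    have "m \<in> into t" using section_memD[OF that] by simp
    then show ?thesis using that(2) someI[of "\<lambda>x. (m, x) \<in> W" x] unfolding c_def by auto
  qed
  have c': "(m, z) \<in> W" if "m \<in> into t" "c W m = Some z" for W m z
    using that someI_ex[of "\<lambda>x. (m, x) \<in> W"] unfolding c_def by (auto split: if_splits)
  \<comment> \<open>The two choices agree on every composite \<open>m \<odot> n\<close>. The chosen
    element there lies in \<open>W\<close> and is related to the restriction of \<open>x\<close>, so
    the closure clause of \<open>W\<close> applies with the maximal cover.\<close>
  have sub: "V \<subseteq> W" if V: "is_section t V" and W: "is_section t W" and eq: "c V = c W" for V W
  proof clarify
    fix m x assume mx: "(m, x) \<in> V"
    note d = section_memD[OF V mx]
    show "(m, x) \<in> W"
    proof (rule section_closed[OF W d], rule cov_all)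
      fix n assume n: "n \<in> Arr K" "Cod K n = Dom K m"
      have mn: "(m \<odot> n, r n x) \<in> V" using section_res[OF V mx n] .
      obtain z where z: "(m \<odot> n, z) \<in> V" "c V (m \<odot> n) = Some z" using c[OF V mn] by blast
      have "(m \<odot> n, z) \<in> W" using c'[of "m \<odot> n" W z] z eq n d by simp
      moreover have "E (Dom K n) (r n x) z"
        using section_func[OF V mn z(1)] arr_comp(2)[OF d(1) n] by simp
      ultimately show "\<exists>z. (m \<odot> n, z) \<in> W \<and> E (Dom K n) (r n x) z" by blast
    qed (use d in simp)
  qed
  show ?thesis
    unfolding lepoll_def
  proof (intro exI conjI)
    show "inj_on c {W. is_section t W}"
    proof (rule inj_onI, clarify)
      show "V = W" if "is_section t V" "is_section t W" "c V = c W" for V W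
        using sub[OF that] sub[OF that(2,1) that(3)[symmetric]] by (rule subset_antisym)
    qed
    show "c ` {W. is_section t W} \<subseteq> (\<Pi>\<^sub>E m\<in>into t. insert None (Some ` P (Dom K m)))"
    proof clarify
      fix W assume W: "is_section t W"
      show "c W \<in> (\<Pi>\<^sub>E m\<in>into t. insert None (Some ` P (Dom K m)))"
      proof (rule PiE_I)
        fix m assume m: "m \<in> into t"
        show "c W m \<in> insert None (Some ` P (Dom K m))"
        proof (cases "c W m")
          case (Some x)
          then show ?thesis using section_memD(3)[OF W c'[OF m Some]] by simp
        qed simp
      qed (unfold c_def restrict_def, simp only: if_False)
    qed
  qed
qed

end

context site
begin

text \<open>Transport of structure along stagewise bijections. It copies a sheaf into another value
  type, and it also exchanges restriction maps that agree on the carriers.\<close>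

lemma sheaf_transport:
  assumes P: "sheaf P r" and e: "natural P r Q s e"
    and bij: "\<And>t. t \<in> Obj K \<Longrightarrow> bij_betw (e t) (P t) (Q t)"
  shows "sheaf Q s"
proof -
  note p = sheaf_psh[OF P]
  define i where "i t = the_inv_into (P t) (e t)" for t
  have i: "i t y \<in> P t" "e t (i t y) = y" if "t \<in> Obj K" "y \<in> Q t" for t y
    using bij[OF that(1)] that(2) unfolding i_def bij_betw_def
    by (auto intro: the_inv_into_into f_the_inv_into_f)
  have inj: "x = y" if "t \<in> Obj K" "x \<in> P t" "y \<in> P t" "e t x = e t y" for t x y
    using bij[OF that(1)] that(2-4) unfolding bij_betw_def by (meson inj_onD)
  have s: "s m y = e (Dom K m) (r m (i (Cod K m) y))" if "m \<in> Arr K" "y \<in> Q (Cod K m)" for m y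
    using natural_res[OF e that(1), of "i (Cod K m) y"] i[of "Cod K m" y] that by simp
  have "psh Q s"
    unfolding psh_def
  proof (intro conjI ballI impI)
    show sQ: "s m y \<in> Q (Dom K m)" if "m \<in> Arr K" "y \<in> Q (Cod K m)" for m y
      unfolding s[OF that] by (rule natural_mem[OF e _ psh_mem[OF p that(1)]]) (use that i in auto)
    show "s (Id K t) y = y" if t: "t \<in> Obj K" and y: "y \<in> Q t" for t y
      using s[of "Id K t" y] t y psh_id[OF p t] i[OF t y] by simp
    fix m n y assume mn: "m \<in> Arr K" "n \<in> Arr K" "Cod K n = Dom K m" and y: "y \<in> Q (Cod K m)"
    let ?x = "i (Cod K m) y"
    have x: "?x \<in> P (Cod K m)" "e (Cod K m) ?x = y" using i mn y by auto
    have "s (m \<odot> n) y = e (Dom K n) (r (m \<odot> n) ?x)"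
      using natural_res[OF e, of "m \<odot> n" ?x] x mn by simp
    also have "\<dots> = e (Dom K n) (r n (r m ?x))" using psh_comp[OF p mn x(1)] by simp
    also have "\<dots> = s n (e (Dom K m) (r m ?x))"
      using natural_res[OF e mn(2), of "r m ?x"] psh_mem[OF p mn(1) x(1)] mn by simp
    also have "\<dots> = s n (s m y)" using natural_res[OF e mn(1) x(1)] x(2) by simp
    finally show "s (m \<odot> n) y = s n (s m y)" .
  qed
  moreover have "\<exists>!y. y \<in> Q t \<and> (\<forall>m\<in>S. s m y = x m)"
    if t: "t \<in> Obj K" and S: "S \<in> J t" and x: "\<forall>m\<in>S. x m \<in> Q (Dom K m)"
      and xx: "\<forall>m\<in>S. \<forall>n\<in>Arr K. Cod K n = Dom K m \<longrightarrow> s n (x m) = x (m \<odot> n)" for t S x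
  proof -
    note Sa = covering_arr[OF t S]
    have xi: "i (Dom K m) (x m) \<in> P (Dom K m)" "e (Dom K m) (i (Dom K m) (x m)) = x m" if "m \<in> S" for m
      using i[of "Dom K m" "x m"] x that Sa[OF that] by auto
    have "\<exists>!y. y \<in> P t \<and> (\<forall>m\<in>S. r m y = i (Dom K m) (x m))"
    proof (rule P[unfolded sheaf_def, THEN conjunct2, rule_format, OF t S], intro conjI ballI impI)
      show "i (Dom K m) (x m) \<in> P (Dom K m)" if "m \<in> S" for m using xi that by blast
      fix m n assume m: "m \<in> S" and n: "n \<in> Arr K" "Cod K n = Dom K m"
      have mn: "m \<odot> n \<in> S" using covering_comp[OF t S m n] .
      have Dmn: "Dom K (m \<odot> n) = Dom K n" using Sa[OF m] n by simp
      have "e (Dom K n) (r n (i (Dom K m) (x m))) = s n (x m)"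
        using natural_res[OF e n(1), of "i (Dom K m) (x m)"] xi[OF m] n by simp
      also have "\<dots> = x (m \<odot> n)" using xx m n by simp
      also have "\<dots> = e (Dom K n) (i (Dom K n) (x (m \<odot> n)))" using xi[OF mn] Dmn by simp
      finally show "r n (i (Dom K m) (x m)) = i (Dom K (m \<odot> n)) (x (m \<odot> n))"
        using inj[of "Dom K n"] xi[OF mn] psh_mem[OF p n(1)] xi[OF m] n Dmn by simp
    qed
    then obtain y where y: "y \<in> P t" "\<And>m. m \<in> S \<Longrightarrow> r m y = i (Dom K m) (x m)"
      and uniq: "\<And>z. z \<in> P t \<Longrightarrow> \<forall>m\<in>S. r m z = i (Dom K m) (x m) \<Longrightarrow> z = y" by metis
    show ?thesis
    proof (rule ex1I[of _ "e t y"], intro conjI ballI)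
      show "e t y \<in> Q t" using natural_mem[OF e t y(1)] .
      show "s m (e t y) = x m" if "m \<in> S" for m
        using natural_res[OF e, of m y] Sa[OF that] y(1) y(2)[OF that] xi[OF that] by simp
    next
      fix z assume z: "z \<in> Q t \<and> (\<forall>m\<in>S. s m z = x m)"
      have zi: "i t z \<in> P t" "e t (i t z) = z" using i[OF t] z by auto
      have "i t z = y"
      proof (rule uniq[OF zi(1)], rule ballI)
        fix m assume m: "m \<in> S"
        have "e (Dom K m) (r m (i t z)) = x m"
          using natural_res[OF e, of m "i t z"] Sa[OF m] zi z m by simp
        then show "r m (i t z) = i (Dom K m) (x m)"
          using inj[of "Dom K m" "r m (i t z)"] xi[OF m] psh_mem[OF p, of m "i t z"] Sa[OF m] zi by simp
      qed
      then show "z = e t y" using zi by simp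
    qed
  qed
  ultimately show ?thesis unfolding sheaf_def by simp
qed

end

section \<open>Categories of sheaves, presented by elements\<close>

text \<open>The bound is a member of \<open>U\<close> at every index, not just at values of
  \<open>\<pi>\<close>, so that it can be handed to \<open>into_bound\<close> as it stands.\<close>

definition bounded_family :: "'t set \<Rightarrow> 'u set set \<Rightarrow> ('t \<Rightarrow> 'b) \<Rightarrow> ('t \<Rightarrow> 'v set) \<Rightarrow> bool" where
  "bounded_family T U \<pi> P \<longleftrightarrow> (\<exists>\<beta>. (\<forall>b. \<beta> b \<in> U) \<and> (\<forall>t\<in>T. P t \<lesssim> \<beta> (\<pi> t)))"

text \<open>Bounds are usually built in another type, as pairs or terms; a choice of members of
  \<open>U\<close> above them brings them back.\<close>

lemma bounded_familyI:
  fixes \<beta> :: "'b \<Rightarrow> 'w set"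
  assumes \<beta>: "\<And>b. small U (\<beta> b)" and P: "\<And>t. t \<in> T \<Longrightarrow> P t \<lesssim> \<beta> (\<pi> t)"
  shows "bounded_family T U \<pi> P"
proof -
  have "\<forall>b. \<exists>B\<in>U. \<beta> b \<lesssim> B" using \<beta> unfolding small_def by blast
  then have "\<exists>\<gamma>. \<forall>b. \<gamma> b \<in> U \<and> \<beta> b \<lesssim> \<gamma> b" by (intro choice) blast
  then obtain \<gamma> where "\<forall>b. \<gamma> b \<in> U \<and> \<beta> b \<lesssim> \<gamma> b" by blast
  then show ?thesis
    unfolding bounded_family_def by (intro exI[of _ \<gamma>]) (use P lepoll_trans in blast)
qed

lemma bounded_familyE:
  assumes "bounded_family T U \<pi> P"
  obtains \<beta> where "\<forall>b. \<beta> b \<in> U" "\<forall>t\<in>T. P t \<lesssim> \<beta> (\<pi> t)"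
  using assms unfolding bounded_family_def by blast

lemma bounded_family_const:
  "small U A \<Longrightarrow> (\<And>t. t \<in> T \<Longrightarrow> P t \<lesssim> A) \<Longrightarrow> bounded_family T U \<pi> P"
  by (rule bounded_familyI)

lemma bounded_family_Times:
  assumes U: "set_universe U" and P: "bounded_family T U \<pi> P" and Q: "bounded_family T U \<pi> Q"
  shows "bounded_family T U \<pi> (\<lambda>t. P t \<times> Q t)"
proof -
  obtain \<beta> where b: "\<forall>b. \<beta> b \<in> U" "\<forall>t\<in>T. P t \<lesssim> \<beta> (\<pi> t)" by (rule bounded_familyE[OF P])
  obtain \<gamma> where g: "\<forall>b. \<gamma> b \<in> U" "\<forall>t\<in>T. Q t \<lesssim> \<gamma> (\<pi> t)" by (rule bounded_familyE[OF Q])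
  show ?thesis
  proof (rule bounded_familyI[of U "\<lambda>b. \<beta> b \<times> \<gamma> b"])
    show "small U (\<beta> x \<times> \<gamma> x)" for x
      by (rule small_Times[OF U]) (use b(1) g(1) in \<open>simp_all add: small_mem\<close>)
    show "P t \<times> Q t \<lesssim> \<beta> (\<pi> t) \<times> \<gamma> (\<pi> t)" if "t \<in> T" for t
      by (rule times_lepoll_mono) (use b(2) g(2) that in simp_all)
  qed
qed

lemma bounded_family_lepoll:
  assumes P: "bounded_family T U \<pi> P" and Q: "\<And>t. t \<in> T \<Longrightarrow> Q t \<lesssim> P t"
  shows "bounded_family T U \<pi> Q"
  using P Q lepoll_trans unfolding bounded_family_def by meson

lemma bounded_family_gterms:
  assumes U: "set_universe U" and P: "bounded_family T U \<pi> P"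
  shows "bounded_family T U \<pi> (\<lambda>t. {w. set_gterm w \<subseteq> P t})"
proof -
  obtain \<beta> where b: "\<forall>b. \<beta> b \<in> U" "\<forall>t\<in>T. P t \<lesssim> \<beta> (\<pi> t)" by (rule bounded_familyE[OF P])
  show ?thesis
    by (rule bounded_familyI[of U "\<lambda>b. {w. set_gterm w \<subseteq> \<beta> b}"])
      (use b in \<open>auto intro: small_gterms[OF U] small_mem gterms_lepoll\<close>)
qed

text \<open>
  \<open>D\<close> is a category of sheaves on \<open>(K, J)\<close> up to equivalence: \<open>el X t\<close> is the set of elements
  of \<open>X\<close> at stage \<open>t\<close>.  Slices of \<open>D\<close> are again of this form, over the category of elements
  of the base.  As \<open>U\<close> need not be closed under small sums, the total space of a family of
  small sets over a small base can be large; hence representability is required only of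
  families bounded uniformly over each fibre of \<open>\<pi>\<close>, where \<open>\<pi>\<close> forgets the point of the base.
\<close>

locale sheaf_cat = site K J
  for K :: "('t, 'm) cat" and J :: "'t \<Rightarrow> 'm set set" +
  fixes D :: "('o, 'a) cat" and U :: "'u set set"
    and el :: "'o \<Rightarrow> 't \<Rightarrow> 'u set" and res :: "'o \<Rightarrow> 'm \<Rightarrow> 'u \<Rightarrow> 'u" and app :: "'a \<Rightarrow> 't \<Rightarrow> 'u \<Rightarrow> 'u"
    and \<pi> :: "'t \<Rightarrow> 'b"
  assumes D_category: "category D"
    and universe: "set_universe U"
    and into_bound: "(\<And>b. \<beta> b \<in> U) \<Longrightarrow>
      bounded_family (Obj K) U \<pi> (\<lambda>t. \<Pi>\<^sub>E m\<in>into t. \<beta> (\<pi> (Dom K m)))"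
    and el_bounded: "X \<in> Obj D \<Longrightarrow> bounded_family (Obj K) U \<pi> (el X)"
    and el_sheaf: "X \<in> Obj D \<Longrightarrow> sheaf (el X) (res X)"
    and app_natural: "f \<in> hom D X Y \<Longrightarrow> natural (el X) (res X) (el Y) (res Y) (app f)"
    and app_id: "X \<in> Obj D \<Longrightarrow> t \<in> Obj K \<Longrightarrow> x \<in> el X t \<Longrightarrow> app (Id D X) t x = x"
    and app_comp: "f \<in> hom D X Y \<Longrightarrow> g \<in> hom D Y Z \<Longrightarrow> t \<in> Obj K \<Longrightarrow> x \<in> el X t \<Longrightarrow>
      app (g \<cdot>\<^bsub>D\<^esub> f) t x = app g t (app f t x)"
    and faithful: "f \<in> hom D X Y \<Longrightarrow> g \<in> hom D X Y \<Longrightarrow>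
      (\<And>t x. t \<in> Obj K \<Longrightarrow> x \<in> el X t \<Longrightarrow> app f t x = app g t x) \<Longrightarrow> f = g"
    and full: "X \<in> Obj D \<Longrightarrow> Y \<in> Obj D \<Longrightarrow> natural (el X) (res X) (el Y) (res Y) \<phi> \<Longrightarrow>
      \<exists>f\<in>hom D X Y. \<forall>t\<in>Obj K. \<forall>x\<in>el X t. app f t x = \<phi> t x"
    and represent: "sheaf (P :: 't \<Rightarrow> 'u set) r \<Longrightarrow> bounded_family (Obj K) U \<pi> P \<Longrightarrow>
      \<exists>X\<in>Obj D. \<exists>\<theta>. natural P r (el X) (res X) \<theta> \<and> (\<forall>t\<in>Obj K. bij_betw (\<theta> t) (P t) (el X t))"
begin

sublocale D: category D
  by (rule D_category)

lemma homD: "f \<in> hom D X Y \<Longrightarrow> f \<in> Arr D \<and> Dom D f = X \<and> Cod D f = Y \<and> X \<in> Obj D \<and> Y \<in> Obj D"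
  using D.dom_in D.cod_in unfolding hom_def by auto

lemma homI: "f \<in> Arr D \<Longrightarrow> f \<in> hom D (Dom D f) (Cod D f)"
  unfolding hom_def by simp

lemma app_mem: "f \<in> hom D X Y \<Longrightarrow> t \<in> Obj K \<Longrightarrow> x \<in> el X t \<Longrightarrow> app f t x \<in> el Y t"
  using natural_mem[OF app_natural] .

lemma app_res: "f \<in> hom D X Y \<Longrightarrow> m \<in> Arr K \<Longrightarrow> Cod K m = t \<Longrightarrow> x \<in> el X t \<Longrightarrow>
    app f (Dom K m) (res X m x) = res Y m (app f t x)"
  using natural_res[OF app_natural] by blast

lemma el_psh: "X \<in> Obj D \<Longrightarrow> psh (el X) (res X)"
  using sheaf_psh[OF el_sheaf] .

lemma res_mem: "X \<in> Obj D \<Longrightarrow> m \<in> Arr K \<Longrightarrow> Cod K m = t \<Longrightarrow> x \<in> el X t \<Longrightarrow> res X m x \<in> el X (Dom K m)"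
  using psh_mem[OF el_psh] by blast

lemma res_id: "X \<in> Obj D \<Longrightarrow> t \<in> Obj K \<Longrightarrow> x \<in> el X t \<Longrightarrow> res X (Id K t) x = x"
  using psh_id[OF el_psh] .

lemma res_comp: "X \<in> Obj D \<Longrightarrow> m \<in> Arr K \<Longrightarrow> n \<in> Arr K \<Longrightarrow> Cod K n = Dom K m \<Longrightarrow> x \<in> el X (Cod K m) \<Longrightarrow>
    res X (m \<odot> n) x = res X n (res X m x)"
  using psh_comp[OF el_psh] .

lemma el_eqI: "X \<in> Obj D \<Longrightarrow> t \<in> Obj K \<Longrightarrow> x \<in> el X t \<Longrightarrow> y \<in> el X t \<Longrightarrow>
    cov t (\<lambda>m. res X m x = res X m y) \<Longrightarrow> x = y"
  using sheaf_eqI[OF el_sheaf] .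

section \<open>Realising sheaves and quotients as objects\<close>

abbreviation bounded :: "('t \<Rightarrow> 'v set) \<Rightarrow> bool" where
  "bounded P \<equiv> bounded_family (Obj K) U \<pi> P"

text \<open>Arrows into \<open>t\<close> embed as indicator functions in the product of copies of
  one infinite member of \<open>U\<close>, which \<open>into_bound\<close> controls.\<close>

lemma into_small:
  assumes t: "t \<in> Obj K"
  shows "small U (into t)"
proof -
  obtain N where N: "N \<in> U" "infinite N" using universe unfolding set_universe_def by blast
  obtain a where a: "a \<in> N" using N(2) by fastforce
  obtain b where b: "b \<in> N" "b \<noteq> a" using infinite_remove[OF N(2), of a] by (metis Diff_iff finite.emptyI insertI1 ex_in_conv)
  obtain \<beta> where \<beta>: "\<forall>b. \<beta> b \<in> U" "\<forall>t\<in>Obj K. (\<Pi>\<^sub>E m\<in>into t. N) \<lesssim> \<beta> (\<pi> t)"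
    by (rule bounded_familyE[OF into_bound[of "\<lambda>_. N", OF N(1)]])
  have inj: "inj_on (\<lambda>m. \<lambda>n\<in>into t. if n = m then a else b) (into t)"
  proof (rule inj_onI)
    fix m m' assume m: "m \<in> into t"
      and "(\<lambda>n\<in>into t. if n = m then a else b) = (\<lambda>n\<in>into t. if n = m' then a else b)"
    from fun_cong[OF this(2), of m] show "m = m'" using m b(2) by (auto split: if_splits)
  qed
  have img: "(\<lambda>m. \<lambda>n\<in>into t. if n = m then a else b) ` into t \<subseteq> (\<Pi>\<^sub>E m\<in>into t. N)"
    using a b(1) by (simp add: image_subset_iff)
  have "small U (\<Pi>\<^sub>E m\<in>into t. N)" unfolding small_def using \<beta> t by blast
  then show ?thesis by (rule small_inj[OF _ inj img])
qed

text \<open>\<open>represent\<close> speaks of sheaves with values in the type of \<open>U\<close>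
  only. Embedding every stage in its bound and transporting the structure extends it to arbitrary
  value types.\<close>

lemma realise:
  fixes P :: "'t \<Rightarrow> 'v set"
  assumes P: "sheaf P r" and sm: "bounded P"
  obtains X \<theta> where "X \<in> Obj D" "natural P r (el X) (res X) \<theta>"
    "\<And>t. t \<in> Obj K \<Longrightarrow> bij_betw (\<theta> t) (P t) (el X t)"
proof -
  obtain \<beta> where \<beta>: "\<forall>b. \<beta> b \<in> U" "\<forall>t\<in>Obj K. P t \<lesssim> \<beta> (\<pi> t)" by (rule bounded_familyE[OF sm])
  have "\<forall>t\<in>Obj K. \<exists>e. inj_on e (P t) \<and> e ` P t \<subseteq> \<beta> (\<pi> t)" using \<beta>(2) unfolding lepoll_def by blast
  from bchoice[OF this] obtain e where e: "\<And>t. t \<in> Obj K \<Longrightarrow> inj_on (e t) (P t)"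
    "\<And>t. t \<in> Obj K \<Longrightarrow> e t ` P t \<subseteq> \<beta> (\<pi> t)"
    by blast
  have eb: "bounded (\<lambda>t. e t ` P t)"
  proof (rule bounded_familyI[of U \<beta>])
    show "small U (\<beta> b)" for b using \<beta>(1) by (simp add: small_mem)
    show "e t ` P t \<lesssim> \<beta> (\<pi> t)" if "t \<in> Obj K" for t by (rule subset_imp_lepoll[OF e(2)[OF that]])
  qed
  \<comment> \<open>Restriction on the copy is conjugated by the embeddings, so that these become
    natural by construction.\<close>
  define s where "s m y = e (Dom K m) (r m (the_inv_into (P (Cod K m)) (e (Cod K m)) y))" for m y
  have nat: "natural P r (\<lambda>t. e t ` P t) s e"
    unfolding natural_def s_def using the_inv_into_f_f[OF e(1)] by auto
  have bij: "bij_betw (e t) (P t) (e t ` P t)" if "t \<in> Obj K" for t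
    using e(1)[OF that] by (simp add: bij_betw_def)
  have "sheaf (\<lambda>t. e t ` P t) s" by (rule sheaf_transport[OF P nat bij])
  from represent[OF this eb] obtain X \<theta> where X: "X \<in> Obj D"
    "natural (\<lambda>t. e t ` P t) s (el X) (res X) \<theta>" "\<forall>t\<in>Obj K. bij_betw (\<theta> t) (e t ` P t) (el X t)" by blast
  show ?thesis
  proof (rule that[OF X(1), of "\<lambda>t. \<theta> t \<circ> e t"])
    show "natural P r (el X) (res X) (\<lambda>t. \<theta> t \<circ> e t)"
      unfolding natural_def
      using natural_mem[OF X(2)] natural_res[OF X(2)] natural_res[OF nat] by auto
    show "bij_betw (\<theta> t \<circ> e t) (P t) (el X t)" if "t \<in> Obj K" for t
      using bij_betw_trans[OF bij] X(3) that by blast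
  qed
qed

text \<open>Representables, coequalisers and universal groups all come from this lemma. It combines
  the associated sheaf, whose kernel is exactly \<open>E\<close>, with the size estimate for its
  sections.\<close>

lemma quotient_exists:
  fixes P :: "'t \<Rightarrow> 'v set"
  assumes Q: "presheaf_quotient K J P r E" and sm: "bounded P"
  obtains X \<eta> where "X \<in> Obj D" "natural P r (el X) (res X) \<eta>" "locally_surj P (el X) (res X) \<eta>"
    "\<And>t x y. t \<in> Obj K \<Longrightarrow> x \<in> P t \<Longrightarrow> y \<in> P t \<Longrightarrow> \<eta> t x = \<eta> t y \<longleftrightarrow> E t x y"
proof -
  interpret Q: presheaf_quotient K J P r E by (rule Q)
  obtain \<beta> where \<beta>: "\<forall>b. \<beta> b \<in> U" "\<forall>t\<in>Obj K. P t \<lesssim> \<beta> (\<pi> t)" by (rule bounded_familyE[OF sm])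
  \<comment> \<open>One point is added to each bound for the code \<open>None\<close>. The enlarged
    bound still depends on the value of \<open>\<pi>\<close> alone, as \<open>into_bound\<close>
    requires.\<close>
  have "\<forall>b. \<exists>B. B \<in> U \<and> insert None (Some ` \<beta> b) \<lesssim> B"
    using small_option[OF universe small_mem] \<beta>(1) unfolding small_def by blast
  from choice[OF this] obtain \<gamma> where \<gamma>: "\<And>b. \<gamma> b \<in> U" "\<And>b. insert None (Some ` \<beta> b) \<lesssim> \<gamma> b"
    by blast
  have sm': "bounded (\<lambda>t. {W. Q.is_section t W})"
  proof (rule bounded_family_lepoll[OF into_bound[of \<gamma>, OF \<gamma>(1)]])
    fix t assume t: "t \<in> Obj K"
    have "{W. Q.is_section t W} \<lesssim> (\<Pi>\<^sub>E m\<in>into t. insert None (Some ` P (Dom K m)))"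
      by (rule Q.sections_lepoll[OF t])
    also have "\<dots> \<lesssim> (\<Pi>\<^sub>E m\<in>into t. \<gamma> (\<pi> (Dom K m)))"
    proof (rule PiE_lepoll)
      fix m assume "m \<in> into t"
      then have "P (Dom K m) \<lesssim> \<beta> (\<pi> (Dom K m))" using \<beta>(2) by simp
      from lepoll_trans[OF option_lepoll[OF this] \<gamma>(2)]
      show "insert None (Some ` P (Dom K m)) \<lesssim> \<gamma> (\<pi> (Dom K m))" .
    qed
    finally show "{W. Q.is_section t W} \<lesssim> (\<Pi>\<^sub>E m\<in>into t. \<gamma> (\<pi> (Dom K m)))" .
  qed
  obtain X \<theta> where X: "X \<in> Obj D" and \<theta>: "natural (\<lambda>t. {W. Q.is_section t W}) Q.restr (el X) (res X) \<theta>"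
    and b: "\<And>t. t \<in> Obj K \<Longrightarrow> bij_betw (\<theta> t) {W. Q.is_section t W} (el X t)"
    using realise[OF Q.sheaf_sections sm'] by blast
  note \<iota> = natural_mem[OF Q.\<iota>_natural] natural_res[OF Q.\<iota>_natural]
  show ?thesis
  proof (rule that[OF X, of "\<lambda>t x. \<theta> t (Q.\<iota> t x)"])
    show "natural P r (el X) (res X) (\<lambda>t x. \<theta> t (Q.\<iota> t x))"
      unfolding natural_def
    proof (intro conjI ballI)
      show "\<theta> t (Q.\<iota> t x) \<in> el X t" if "t \<in> Obj K" "x \<in> P t" for t x
        using natural_mem[OF \<theta>] \<iota>(1) that by blast
      show "\<theta> (Dom K m) (Q.\<iota> (Dom K m) (r m x)) = res X m (\<theta> (Cod K m) (Q.\<iota> (Cod K m) x))"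
        if m: "m \<in> Arr K" and x: "x \<in> P (Cod K m)" for m x
        using natural_res[OF \<theta> m, of "Q.\<iota> (Cod K m) x"] \<iota>(1)[OF arr_cod[OF m] x] \<iota>(2)[OF m x] by simp
    qed
    show "locally_surj P (el X) (res X) (\<lambda>t x. \<theta> t (Q.\<iota> t x))"
      unfolding locally_surj_def
    proof (intro ballI)
      fix t y assume t: "t \<in> Obj K" and y: "y \<in> el X t"
      then obtain W where W: "W \<in> {W. Q.is_section t W}" "y = \<theta> t W"
        using b[OF t] unfolding bij_betw_def by blast
      show "cov t (\<lambda>m. \<exists>x\<in>P (Dom K m). \<theta> (Dom K m) (Q.\<iota> (Dom K m) x) = res X m y)"
      proof (rule cov_mono[OF t locally_surjD[OF Q.\<iota>_locally_surj t W(1)]])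
        fix m assume m: "m \<in> Arr K" "Cod K m = t" and "\<exists>x\<in>P (Dom K m). Q.\<iota> (Dom K m) x = Q.restr m W"
        then obtain x where x: "x \<in> P (Dom K m)" "Q.\<iota> (Dom K m) x = Q.restr m W" by blast
        show "\<exists>x\<in>P (Dom K m). \<theta> (Dom K m) (Q.\<iota> (Dom K m) x) = res X m y"
          by (rule bexI[OF _ x(1)]) (use x(2) W natural_res[OF \<theta> m(1), of W] m(2) in simp)
      qed
    qed
    fix t x y assume *: "t \<in> Obj K" "x \<in> P t" "y \<in> P t"
    have "\<theta> t (Q.\<iota> t x) = \<theta> t (Q.\<iota> t y) \<longleftrightarrow> Q.\<iota> t x = Q.\<iota> t y"
      using inj_on_eq_iff[OF bij_betw_imp_inj_on[OF b[OF *(1)]]] \<iota>(1)[OF *(1,2)] \<iota>(1)[OF *(1,3)] by blast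
    then show "\<theta> t (Q.\<iota> t x) = \<theta> t (Q.\<iota> t y) \<longleftrightarrow> E t x y" using Q.\<iota>_eq_iff[OF *] by simp
  qed
qed

text \<open>Every element of \<open>X\<close> has preimages on a cover. Their images in
  \<open>Y\<close> are independent of the choice by \<open>ker\<close>, hence compatible, and they
  glue because \<open>Y\<close> is a sheaf. Only a presheaf is asked of the source, so operations on
  terms descend in the same way as arrows do.\<close>

lemma descend:
  assumes X: "X \<in> Obj D" and Y: "Y \<in> Obj D" and p: "psh P r"
    and \<eta>: "natural P r (el X) (res X) \<eta>" and ls: "locally_surj P (el X) (res X) \<eta>"
    and \<phi>: "natural P r (el Y) (res Y) \<phi>"
    and ker: "\<And>t x y. t \<in> Obj K \<Longrightarrow> x \<in> P t \<Longrightarrow> y \<in> P t \<Longrightarrow> \<eta> t x = \<eta> t y \<Longrightarrow> \<phi> t x = \<phi> t y"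
  obtains f where "f \<in> hom D X Y" "\<And>t x. t \<in> Obj K \<Longrightarrow> x \<in> P t \<Longrightarrow> app f t (\<eta> t x) = \<phi> t x"
proof -
  \<comment> \<open>The value at \<open>y\<close> is characterised on all arrows where
    \<open>y\<close> has a preimage, not on one cover. The description is then visibly stable under
    restriction, and naturality of \<open>F\<close> follows from uniqueness.\<close>
  define good where "good t y z \<longleftrightarrow> z \<in> el Y t \<and>
    (\<forall>m x. m \<in> Arr K \<longrightarrow> Cod K m = t \<longrightarrow> x \<in> P (Dom K m) \<longrightarrow> \<eta> (Dom K m) x = res X m y \<longrightarrow> res Y m z = \<phi> (Dom K m) x)"
    for t y z
  have ex: "\<exists>z. good t y z" if t: "t \<in> Obj K" and y: "y \<in> el X t" for t y
  proof -
    have "\<exists>z\<in>el Y t. (\<forall>m z'. m \<in> Arr K \<longrightarrow> Cod K m = t \<longrightarrow> z' \<in> el Y (Dom K m) \<longrightarrow>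
        (\<exists>x\<in>P (Dom K m). \<eta> (Dom K m) x = res X m y \<and> \<phi> (Dom K m) x = z') \<longrightarrow> res Y m z = z') \<and>
      cov t (\<lambda>m. \<exists>x\<in>P (Dom K m). \<eta> (Dom K m) x = res X m y \<and> \<phi> (Dom K m) x = res Y m z)"
    proof (rule sheaf_glue[OF el_sheaf[OF Y] t])
      show "cov t (\<lambda>m. \<exists>z\<in>el Y (Dom K m). \<exists>x\<in>P (Dom K m). \<eta> (Dom K m) x = res X m y \<and> \<phi> (Dom K m) x = z)"
        by (rule cov_mono[OF t locally_surjD[OF ls t y]]) (use natural_mem[OF \<phi>] in auto)
    next
      fix m z z' assume m: "m \<in> Arr K"
        and "\<exists>x\<in>P (Dom K m). \<eta> (Dom K m) x = res X m y \<and> \<phi> (Dom K m) x = z"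
        and "\<exists>x\<in>P (Dom K m). \<eta> (Dom K m) x = res X m y \<and> \<phi> (Dom K m) x = z'"
      then obtain x x' where "x \<in> P (Dom K m)" "x' \<in> P (Dom K m)" "\<eta> (Dom K m) x = \<eta> (Dom K m) x'"
        "\<phi> (Dom K m) x = z" "\<phi> (Dom K m) x' = z'" by auto
      then show "z = z'" using ker[of "Dom K m" x x'] m by simp
    next
      fix m n z assume m: "m \<in> Arr K" "Cod K m = t" and n: "n \<in> Arr K" "Cod K n = Dom K m"
        and "\<exists>x\<in>P (Dom K m). \<eta> (Dom K m) x = res X m y \<and> \<phi> (Dom K m) x = z"
      then obtain x where x: "x \<in> P (Dom K m)" "\<eta> (Dom K m) x = res X m y" "\<phi> (Dom K m) x = z" by blast
      show "\<exists>x\<in>P (Dom K (m \<odot> n)). \<eta> (Dom K (m \<odot> n)) x = res X (m \<odot> n) y \<and> \<phi> (Dom K (m \<odot> n)) x = res Y n z"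
      proof (rule bexI[of _ "r n x"])
        show "r n x \<in> P (Dom K (m \<odot> n))" using psh_mem[OF p n(1)] x n m by simp
        show "\<eta> (Dom K (m \<odot> n)) (r n x) = res X (m \<odot> n) y \<and> \<phi> (Dom K (m \<odot> n)) (r n x) = res Y n z"
          using natural_res[OF \<eta> n(1), of x] natural_res[OF \<phi> n(1), of x] x n m
            res_comp[OF X m(1) n, of y] y by simp
      qed
    qed
    then obtain z where z: "z \<in> el Y t" "\<forall>m z'. m \<in> Arr K \<longrightarrow> Cod K m = t \<longrightarrow> z' \<in> el Y (Dom K m) \<longrightarrow>
        (\<exists>x\<in>P (Dom K m). \<eta> (Dom K m) x = res X m y \<and> \<phi> (Dom K m) x = z') \<longrightarrow> res Y m z = z'" by blast
    have "good t y z"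
      unfolding good_def
    proof (intro conjI allI impI z(1))
      fix m x assume m: "m \<in> Arr K" "Cod K m = t" and x: "x \<in> P (Dom K m)" "\<eta> (Dom K m) x = res X m y"
      show "res Y m z = \<phi> (Dom K m) x"
        by (rule z(2)[rule_format, OF m]) (use natural_mem[OF \<phi> _ x(1)] x m in auto)
    qed
    then show ?thesis by blast
  qed
  have uniq: "z = z'" if t: "t \<in> Obj K" and y: "y \<in> el X t" and "good t y z" "good t y z'" for t y z z'
  proof (rule el_eqI[OF Y t])
    show "z \<in> el Y t" "z' \<in> el Y t" using that(3,4) unfolding good_def by auto
    show "cov t (\<lambda>m. res Y m z = res Y m z')"
    proof (rule cov_mono[OF t locally_surjD[OF ls t y]])
      fix m assume m: "m \<in> Arr K" "Cod K m = t" and "\<exists>x\<in>P (Dom K m). \<eta> (Dom K m) x = res X m y"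
      then obtain x where x: "x \<in> P (Dom K m)" "\<eta> (Dom K m) x = res X m y" by blast
      show "res Y m z = res Y m z'"
        using that(3)[unfolded good_def, THEN conjunct2, rule_format, OF m x]
          that(4)[unfolded good_def, THEN conjunct2, rule_format, OF m x] by simp
    qed
  qed
  define F where "F t y = (SOME z. good t y z)" for t y
  have F: "good t y (F t y)" if "t \<in> Obj K" "y \<in> el X t" for t y
    unfolding F_def by (rule someI_ex[OF ex[OF that]])
  have F\<eta>: "F t (\<eta> t x) = \<phi> t x" if t: "t \<in> Obj K" and x: "x \<in> P t" for t x
  proof (rule uniq[OF t _ F])
    show "\<eta> t x \<in> el X t" using natural_mem[OF \<eta> t x] .
    show "good t (\<eta> t x) (\<phi> t x)"
      unfolding good_def
    proof (intro conjI allI impI)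
      show "\<phi> t x \<in> el Y t" using natural_mem[OF \<phi> t x] .
      fix m x' assume m: "m \<in> Arr K" "Cod K m = t" and x': "x' \<in> P (Dom K m)" "\<eta> (Dom K m) x' = res X m (\<eta> t x)"
      have "\<eta> (Dom K m) x' = \<eta> (Dom K m) (r m x)" using natural_res[OF \<eta> m(1), of x] x x' m by simp
      then have "\<phi> (Dom K m) x' = \<phi> (Dom K m) (r m x)"
        using ker[of "Dom K m" x' "r m x"] psh_mem[OF p m(1), of x] x x' m by simp
      then show "res Y m (\<phi> t x) = \<phi> (Dom K m) x'" using natural_res[OF \<phi> m(1), of x] x m by simp
    qed
  qed (use t natural_mem[OF \<eta> t x] in auto)
  have "natural (el X) (res X) (el Y) (res Y) F"
    unfolding natural_def
  proof (intro conjI ballI)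
    show "F t y \<in> el Y t" if "t \<in> Obj K" "y \<in> el X t" for t y
      using F[OF that] unfolding good_def by blast
    fix m y assume m: "m \<in> Arr K" and y: "y \<in> el X (Cod K m)"
    have rm: "res X m y \<in> el X (Dom K m)" using res_mem[OF X m refl y] .
    have g: "good (Cod K m) y (F (Cod K m) y)" using F m y by simp
    show "F (Dom K m) (res X m y) = res Y m (F (Cod K m) y)"
    proof (rule uniq[OF _ rm F[OF _ rm]])
      show "good (Dom K m) (res X m y) (res Y m (F (Cod K m) y))"
        unfolding good_def
      proof (intro conjI allI impI)
        have FY: "F (Cod K m) y \<in> el Y (Cod K m)" using g unfolding good_def by blast
        then show "res Y m (F (Cod K m) y) \<in> el Y (Dom K m)" using res_mem[OF Y m refl] by blast
        fix n x assume n: "n \<in> Arr K" "Cod K n = Dom K m" and x: "x \<in> P (Dom K n)" "\<eta> (Dom K n) x = res X n (res X m y)"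
        have "res Y (m \<odot> n) (F (Cod K m) y) = \<phi> (Dom K (m \<odot> n)) x"
          by (rule g[unfolded good_def, THEN conjunct2, rule_format])
            (use m n x y res_comp[OF X m n] in simp_all)
        then show "res Y n (res Y m (F (Cod K m) y)) = \<phi> (Dom K n) x"
          using res_comp[OF Y m n FY] m n by simp
      qed
    qed (use m in auto)
  qed
  from full[OF X Y this] obtain f where f: "f \<in> hom D X Y" "\<forall>t\<in>Obj K. \<forall>x\<in>el X t. app f t x = F t x" by blast
  show ?thesis
  proof (rule that[OF f(1)])
    show "app f t (\<eta> t x) = \<phi> t x" if "t \<in> Obj K" "x \<in> P t" for t x
      using f(2) natural_mem[OF \<eta> that] F\<eta>[OF that] that by simp
  qed
qed

text \<open>Equality in the target is local, and locally every argument is a value of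
  \<open>\<eta>\<close>.\<close>

lemma locally_surj_cancel:
  assumes f: "f \<in> hom D X Y" and g: "g \<in> hom D X Y" and ls: "locally_surj P (el X) (res X) \<eta>"
    and eq: "\<And>t x. t \<in> Obj K \<Longrightarrow> x \<in> P t \<Longrightarrow> app f t (\<eta> t x) = app g t (\<eta> t x)"
  shows "f = g"
proof (rule faithful[OF f g])
  fix t y assume t: "t \<in> Obj K" and y: "y \<in> el X t"
  have Y: "Y \<in> Obj D" using homD[OF f] by blast
  show "app f t y = app g t y"
  proof (rule el_eqI[OF Y t app_mem[OF f t y] app_mem[OF g t y]], rule cov_mono[OF t locally_surjD[OF ls t y]])
    fix m assume m: "m \<in> Arr K" "Cod K m = t" and "\<exists>x\<in>P (Dom K m). \<eta> (Dom K m) x = res X m y"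
    then obtain x where x: "x \<in> P (Dom K m)" "\<eta> (Dom K m) x = res X m y" by blast
    show "res Y m (app f t y) = res Y m (app g t y)"
      using eq[of "Dom K m" x] app_res[OF f m y] app_res[OF g m y] x m by simp
  qed
qed

end

section \<open>Limits\<close>

context sheaf_cat
begin

text \<open>The sheafified representable presheaf of \<open>t\<close>, with its universal element.\<close>

lemma yoneda:
  assumes t: "t \<in> Obj K"
  obtains X u where "X \<in> Obj D" "u \<in> el X t"
    "\<And>Y y. Y \<in> Obj D \<Longrightarrow> y \<in> el Y t \<Longrightarrow> \<exists>f\<in>hom D X Y. app f t u = y"
    "\<And>Y f g. f \<in> hom D X Y \<Longrightarrow> g \<in> hom D X Y \<Longrightarrow> app f t u = app g t u \<Longrightarrow> f = g"
proof -
  define P where "P s = {m \<in> into t. Dom K m = s}" for s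
  \<comment> \<open>Two arrows are identified when no object of the category tells their
    restrictions apart. This relation is local, and it makes evaluation at any given element of
    \<open>Y\<close> descend by definition.\<close>
  define E where "E (s :: 't) m m' \<longleftrightarrow> (\<forall>Y\<in>Obj D. \<forall>y\<in>el Y t. res Y m y = res Y m' y)" for s m m'
  have P [simp]: "m \<in> P s \<longleftrightarrow> m \<in> Arr K \<and> Cod K m = t \<and> Dom K m = s" for m s
    unfolding P_def by auto
  have p: "psh P (\<lambda>n m. m \<odot> n)" unfolding psh_def by simp
  have q: "presheaf_quotient K J P (\<lambda>n m. m \<odot> n) E"
  proof (unfold_locales, rule p)
    fix n m m' assume n: "n \<in> Arr K" and m: "m \<in> P (Cod K n)" "m' \<in> P (Cod K n)" and e: "E (Cod K n) m m'"
    show "E (Dom K n) (m \<odot> n) (m' \<odot> n)"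
      unfolding E_def
    proof (intro ballI)
      fix Y y assume "Y \<in> Obj D" "y \<in> el Y t"
      then show "res Y (m \<odot> n) y = res Y (m' \<odot> n) y"
        using e n m unfolding E_def by (simp add: res_comp)
    qed
  next
    fix s m m' assume s: "s \<in> Obj K" and m: "m \<in> P s" "m' \<in> P s" and c: "cov s (\<lambda>n. E (Dom K n) (m \<odot> n) (m' \<odot> n))"
    show "E s m m'"
      unfolding E_def
    proof (intro ballI)
      fix Y y assume Y: "Y \<in> Obj D" "y \<in> el Y t"
      show "res Y m y = res Y m' y"
      proof (rule el_eqI[OF Y(1) s])
        show "res Y m y \<in> el Y s" "res Y m' y \<in> el Y s"
          using res_mem[OF Y(1) _ _ Y(2), of m] res_mem[OF Y(1) _ _ Y(2), of m'] m by simp_all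
        show "cov s (\<lambda>n. res Y n (res Y m y) = res Y n (res Y m' y))"
        proof (rule cov_mono[OF s c])
          fix n assume n: "n \<in> Arr K" "Cod K n = s" "E (Dom K n) (m \<odot> n) (m' \<odot> n)"
          then have "res Y (m \<odot> n) y = res Y (m' \<odot> n) y" using Y unfolding E_def by blast
          then show "res Y n (res Y m y) = res Y n (res Y m' y)" using n m Y by (simp add: res_comp)
        qed
      qed
    qed
  qed (auto simp: E_def)
  have bP: "bounded P"
    by (rule bounded_family_const[OF into_small[OF t]]) (auto simp: P_def intro: subset_imp_lepoll)
  obtain X \<eta> where X: "X \<in> Obj D" and \<eta>: "natural P (\<lambda>n m. m \<odot> n) (el X) (res X) \<eta>"
    and ls: "locally_surj P (el X) (res X) \<eta>"
    and ker: "\<And>s x y. s \<in> Obj K \<Longrightarrow> x \<in> P s \<Longrightarrow> y \<in> P s \<Longrightarrow> \<eta> s x = \<eta> s y \<longleftrightarrow> E s x y"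
    by (rule quotient_exists[OF q bP], rule that; (assumption | blast))
  define u where "u = \<eta> t (Id K t)"
  have u: "u \<in> el X t" unfolding u_def using natural_mem[OF \<eta> t] t by simp
  have ru: "\<eta> s m = res X m u" if "m \<in> P s" "s \<in> Obj K" for m s
    using natural_res[OF \<eta>, of m "Id K t"] that t unfolding u_def by simp
  show ?thesis
  proof (rule that[OF X u])
    fix Y y assume Y: "Y \<in> Obj D" and y: "y \<in> el Y t"
    have \<phi>: "natural P (\<lambda>n m. m \<odot> n) (el Y) (res Y) (\<lambda>s m. res Y m y)"
      unfolding natural_def
    proof (intro conjI ballI)
      show "res Y m y \<in> el Y s" if "s \<in> Obj K" "m \<in> P s" for s m
        using res_mem[OF Y, of m t y] y that by simp
      show "res Y (m \<odot> n) y = res Y n (res Y m y)" if "n \<in> Arr K" "m \<in> P (Cod K n)" for m n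
        using res_comp[OF Y, of m n y] y that by simp
    qed
    obtain f where f: "f \<in> hom D X Y" "\<And>s m. s \<in> Obj K \<Longrightarrow> m \<in> P s \<Longrightarrow> app f s (\<eta> s m) = res Y m y"
      by (rule descend[OF X Y p \<eta> ls \<phi>]) (use ker Y y in \<open>auto simp: E_def\<close>)
    have "app f t u = y" unfolding u_def using f(2)[OF t, of "Id K t"] t res_id[OF Y t y] by simp
    then show "\<exists>f\<in>hom D X Y. app f t u = y" using f(1) by blast
  next
    fix Y f g assume f: "f \<in> hom D X Y" and g: "g \<in> hom D X Y" and eq: "app f t u = app g t u"
    show "f = g"
    proof (rule locally_surj_cancel[OF f g ls])
      fix s m assume s: "s \<in> Obj K" and m: "m \<in> P s"
      show "app f s (\<eta> s m) = app g s (\<eta> s m)"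
        using ru[OF m s] app_res[OF f, of m t u] app_res[OF g, of m t u] eq u m by simp
    qed
  qed
qed

text \<open>A monomorphism is tested by arrows; the sheafified representable turns two elements at
  one stage into two arrows with the same composite.\<close>

lemma mono_inj:
  assumes r: "mono_arr D r" "r \<in> hom D X Y" and t: "t \<in> Obj K" and x: "x \<in> el X t" "y \<in> el X t"
    and eq: "app r t x = app r t y"
  shows "x = y"
proof -
  obtain Z u where Z: "Z \<in> Obj D" "u \<in> el Z t"
    and ex: "\<And>Y y. Y \<in> Obj D \<Longrightarrow> y \<in> el Y t \<Longrightarrow> \<exists>f\<in>hom D Z Y. app f t u = y"
    and un: "\<And>Y f g. f \<in> hom D Z Y \<Longrightarrow> g \<in> hom D Z Y \<Longrightarrow> app f t u = app g t u \<Longrightarrow> f = g"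
    using yoneda[OF t] by blast
  have X: "X \<in> Obj D" "Dom D r = X" using homD[OF r(2)] by auto
  obtain f g where f: "f \<in> hom D Z X" "app f t u = x" and g: "g \<in> hom D Z X" "app g t u = y"
    using ex[OF X(1)] x by metis
  have "r \<cdot>\<^bsub>D\<^esub> f = r \<cdot>\<^bsub>D\<^esub> g"
    by (rule un[OF D.comp_in[OF f(1) r(2)] D.comp_in[OF g(1) r(2)]])
      (simp add: app_comp[OF f(1) r(2) t Z(2)] app_comp[OF g(1) r(2) t Z(2)] f g eq)
  then have "f = g" using r(1) Z(1) f(1) g(1) X(2) unfolding mono_arr_def by blast
  then show ?thesis using f g by simp
qed

lemma terminal_el:
  assumes T: "is_terminal D T" and t: "t \<in> Obj K"
  shows "\<exists>!x. x \<in> el T t"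
proof -
  obtain Z u where Z: "Z \<in> Obj D" "u \<in> el Z t"
    and ex: "\<And>Y y. Y \<in> Obj D \<Longrightarrow> y \<in> el Y t \<Longrightarrow> \<exists>f\<in>hom D Z Y. app f t u = y"
    and un: "\<And>Y f g. f \<in> hom D Z Y \<Longrightarrow> g \<in> hom D Z Y \<Longrightarrow> app f t u = app g t u \<Longrightarrow> f = g"
    using yoneda[OF t] by blast
  have TO: "T \<in> Obj D" using T unfolding is_terminal_def by blast
  have "\<exists>!f. f \<in> hom D Z T" using T Z(1) unfolding is_terminal_def by blast
  then obtain f where f: "f \<in> hom D Z T" "\<And>g. g \<in> hom D Z T \<Longrightarrow> g = f" by auto
  show ?thesis
  proof (rule ex1I)
    show "app f t u \<in> el T t" using app_mem[OF f(1) t Z(2)] .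
    fix x assume "x \<in> el T t"
    then obtain g where "g \<in> hom D Z T" "app g t u = x" using ex[OF TO] by blast
    then show "x = app f t u" using f(2) by blast
  qed
qed

text \<open>Common core of products and pullbacks: elements at \<open>t\<close> are arrows out of
  the sheafified representable, so a universal property for arrows becomes one for elements. The
  premise \<open>cone\<close> is required only at a generic element \<open>u\<close>; that
  \<open>u\<close> detects equality of arrows lets an equation between elements be lifted to the
  commuting square of a pullback.\<close>

lemma cone_el:
  assumes t: "t \<in> Obj K" and p: "p \<in> hom D P A" and q: "q \<in> hom D P B"
    and a: "a \<in> el A t" and b: "b \<in> el B t"
    and cone: "\<And>Z f g u. Z \<in> Obj D \<Longrightarrow> f \<in> hom D Z A \<Longrightarrow> g \<in> hom D Z B \<Longrightarrow>
      u \<in> el Z t \<Longrightarrow> (\<And>Y h k. h \<in> hom D Z Y \<Longrightarrow> k \<in> hom D Z Y \<Longrightarrow> app h t u = app k t u \<Longrightarrow> h = k) \<Longrightarrow>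
      app f t u = a \<Longrightarrow> app g t u = b \<Longrightarrow> \<exists>!h. h \<in> hom D Z P \<and> p \<cdot>\<^bsub>D\<^esub> h = f \<and> q \<cdot>\<^bsub>D\<^esub> h = g"
  shows "\<exists>!z. z \<in> el P t \<and> app p t z = a \<and> app q t z = b"
proof -
  obtain Z u where Z: "Z \<in> Obj D" "u \<in> el Z t"
    and ex: "\<And>Y y. Y \<in> Obj D \<Longrightarrow> y \<in> el Y t \<Longrightarrow> \<exists>f\<in>hom D Z Y. app f t u = y"
    and un: "\<And>Y f g. f \<in> hom D Z Y \<Longrightarrow> g \<in> hom D Z Y \<Longrightarrow> app f t u = app g t u \<Longrightarrow> f = g"
    using yoneda[OF t] by blast
  have O: "P \<in> Obj D" "A \<in> Obj D" "B \<in> Obj D" using homD[OF p] homD[OF q] by auto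
  obtain f where f: "f \<in> hom D Z A" "app f t u = a" using ex[OF O(2) a] by blast
  obtain g where g: "g \<in> hom D Z B" "app g t u = b" using ex[OF O(3) b] by blast
  have e: "\<exists>!h. h \<in> hom D Z P \<and> p \<cdot>\<^bsub>D\<^esub> h = f \<and> q \<cdot>\<^bsub>D\<^esub> h = g"
    by (rule cone[OF Z(1) f(1) g(1) Z(2) un f(2) g(2)])
  then obtain h where h: "h \<in> hom D Z P" "p \<cdot>\<^bsub>D\<^esub> h = f" "q \<cdot>\<^bsub>D\<^esub> h = g" by blast
  show ?thesis
  proof (rule ex1I[of _ "app h t u"], intro conjI)
    show "app h t u \<in> el P t" using app_mem[OF h(1) t Z(2)] .
    show "app p t (app h t u) = a" using app_comp[OF h(1) p t Z(2)] h f by simp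
    show "app q t (app h t u) = b" using app_comp[OF h(1) q t Z(2)] h g by simp
    fix z assume z: "z \<in> el P t \<and> app p t z = a \<and> app q t z = b"
    then obtain k where k: "k \<in> hom D Z P" "app k t u = z" using ex[OF O(1)] by blast
    have "p \<cdot>\<^bsub>D\<^esub> k = f" by (rule un[OF D.comp_in[OF k(1) p] f(1)]) (use z k f app_comp[OF k(1) p t Z(2)] in simp)
    moreover have "q \<cdot>\<^bsub>D\<^esub> k = g" by (rule un[OF D.comp_in[OF k(1) q] g(1)]) (use z k g app_comp[OF k(1) q t Z(2)] in simp)
    ultimately have "k = h" using e k(1) h by blast
    then show "z = app h t u" using k by simp
  qed
qed

lemma product_el:
  assumes P: "is_product D A B P p q" and t: "t \<in> Obj K" and a: "a \<in> el A t" and b: "b \<in> el B t"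
  shows "\<exists>!z. z \<in> el P t \<and> app p t z = a \<and> app q t z = b"
  by (rule cone_el[OF t _ _ a b]) (use P in \<open>simp_all add: is_product_def\<close>)

lemma pullback_el:
  assumes P: "is_pullback D f g p q" and t: "t \<in> Obj K" and a: "a \<in> el (Dom D f) t" and b: "b \<in> el (Dom D g) t"
    and eq: "app f t a = app g t b"
  shows "\<exists>!z. z \<in> el (Dom D p) t \<and> app p t z = a \<and> app q t z = b"
proof (rule cone_el[OF t _ _ a b])
  have fg: "f \<in> hom D (Dom D f) (Cod D f)" "g \<in> hom D (Dom D g) (Cod D f)"
    using P unfolding is_pullback_def hom_def by auto
  show "p \<in> hom D (Dom D p) (Dom D f)" "q \<in> hom D (Dom D p) (Dom D g)"
    using P unfolding is_pullback_def hom_def by auto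
  fix Z h k u assume Z: "Z \<in> Obj D" and h: "h \<in> hom D Z (Dom D f)" and k: "k \<in> hom D Z (Dom D g)" and u: "u \<in> el Z t"
    and un: "\<And>Y h k. h \<in> hom D Z Y \<Longrightarrow> k \<in> hom D Z Y \<Longrightarrow> app h t u = app k t u \<Longrightarrow> h = k"
    and hu: "app h t u = a" "app k t u = b"
  have "f \<cdot>\<^bsub>D\<^esub> h = g \<cdot>\<^bsub>D\<^esub> k"
    by (rule un[OF D.comp_in[OF h fg(1)] D.comp_in[OF k fg(2)]])
      (simp add: app_comp[OF h fg(1) t u] app_comp[OF k fg(2) t u] hu eq)
  moreover have "\<forall>X\<in>Obj D. \<forall>h\<in>hom D X (Dom D f). \<forall>k\<in>hom D X (Dom D g). f \<cdot>\<^bsub>D\<^esub> h = g \<cdot>\<^bsub>D\<^esub> k \<longrightarrow>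
      (\<exists>!l. l \<in> hom D X (Dom D p) \<and> p \<cdot>\<^bsub>D\<^esub> l = h \<and> q \<cdot>\<^bsub>D\<^esub> l = k)"
    using P unfolding is_pullback_def by (elim conjE)
  ultimately show "\<exists>!l. l \<in> hom D Z (Dom D p) \<and> p \<cdot>\<^bsub>D\<^esub> l = h \<and> q \<cdot>\<^bsub>D\<^esub> l = k"
    using Z h k by blast
qed

text \<open>The converse passage, from elements to arrows. Solutions that are unique at each stage
  are automatically natural, so fullness assembles them into an arrow.\<close>

lemma joint_lift:
  assumes p: "p \<in> hom D X A" and q: "q \<in> hom D X B" and f: "f \<in> hom D Z A" and g: "g \<in> hom D Z B"
    and ex: "\<And>t z. t \<in> Obj K \<Longrightarrow> z \<in> el Z t \<Longrightarrow> \<exists>!w. w \<in> el X t \<and> app p t w = app f t z \<and> app q t w = app g t z"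
  shows "\<exists>!h. h \<in> hom D Z X \<and> p \<cdot>\<^bsub>D\<^esub> h = f \<and> q \<cdot>\<^bsub>D\<^esub> h = g"
proof -
  define \<phi> where "\<phi> t z = (THE w. w \<in> el X t \<and> app p t w = app f t z \<and> app q t w = app g t z)" for t z
  have \<phi>: "\<phi> t z \<in> el X t \<and> app p t (\<phi> t z) = app f t z \<and> app q t (\<phi> t z) = app g t z"
    if "t \<in> Obj K" "z \<in> el Z t" for t z
    unfolding \<phi>_def by (rule theI'[OF ex[OF that]])
  have \<phi>u: "w = \<phi> t z"
    if "t \<in> Obj K" "z \<in> el Z t" "w \<in> el X t" "app p t w = app f t z" "app q t w = app g t z" for t z w
    using ex[OF that(1,2)] \<phi>[OF that(1,2)] that(3-) by blast
  have O: "X \<in> Obj D" "Z \<in> Obj D" using homD[OF p] homD[OF f] by auto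
  have "natural (el Z) (res Z) (el X) (res X) \<phi>"
    unfolding natural_def
  proof (intro conjI ballI)
    show "\<phi> t z \<in> el X t" if "t \<in> Obj K" "z \<in> el Z t" for t z using \<phi>[OF that] by blast
    fix m z assume m: "m \<in> Arr K" and z: "z \<in> el Z (Cod K m)"
    have w: "\<phi> (Cod K m) z \<in> el X (Cod K m)" using \<phi> m z by simp
    show "\<phi> (Dom K m) (res Z m z) = res X m (\<phi> (Cod K m) z)"
      by (rule \<phi>u[symmetric])
        (use m z w \<phi>[of "Cod K m" z] in \<open>simp_all add: res_mem[OF O(1) m refl w] res_mem[OF O(2) m refl z]
          app_res[OF p m refl w] app_res[OF q m refl w] app_res[OF f m refl z] app_res[OF g m refl z]\<close>)
  qed
  from full[OF O(2,1) this] obtain h where h: "h \<in> hom D Z X" "\<forall>t\<in>Obj K. \<forall>z\<in>el Z t. app h t z = \<phi> t z" by blast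
  show ?thesis
  proof (rule ex1I[of _ h], intro conjI h(1))
    show "p \<cdot>\<^bsub>D\<^esub> h = f"
      by (rule faithful[OF D.comp_in[OF h(1) p] f]) (use h(2) \<phi> in \<open>simp add: app_comp[OF h(1) p]\<close>)
    show "q \<cdot>\<^bsub>D\<^esub> h = g"
      by (rule faithful[OF D.comp_in[OF h(1) q] g]) (use h(2) \<phi> in \<open>simp add: app_comp[OF h(1) q]\<close>)
    fix k assume k: "k \<in> hom D Z X \<and> p \<cdot>\<^bsub>D\<^esub> k = f \<and> q \<cdot>\<^bsub>D\<^esub> k = g"
    then have kh: "k \<in> hom D Z X" by blast
    show "k = h"
    proof (rule faithful[OF kh h(1)])
      fix t z assume t: "t \<in> Obj K" and z: "z \<in> el Z t"
      have "app k t z = \<phi> t z"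
        by (rule \<phi>u[OF t z app_mem[OF kh t z]]) (use k app_comp[OF kh p t z] app_comp[OF kh q t z] in auto)
      then show "app k t z = app h t z" using h(2) t z by simp
    qed
  qed
qed

text \<open>A predicate that is stable and local cuts a subsheaf out of the product. Products,
  equalisers, kernel pairs and local images are all instances, and the pair of legs is jointly
  injective by the uniqueness in the last clause.\<close>

lemma relation_exists:
  assumes A: "A \<in> Obj D" and B: "B \<in> Obj D"
    and C_res: "\<And>m a b. m \<in> Arr K \<Longrightarrow> a \<in> el A (Cod K m) \<Longrightarrow> b \<in> el B (Cod K m) \<Longrightarrow> C (Cod K m) a b \<Longrightarrow>
      C (Dom K m) (res A m a) (res B m b)"
    and C_local: "\<And>t a b. t \<in> Obj K \<Longrightarrow> a \<in> el A t \<Longrightarrow> b \<in> el B t \<Longrightarrow>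
      cov t (\<lambda>m. C (Dom K m) (res A m a) (res B m b)) \<Longrightarrow> C t a b"
  obtains X p q where "p \<in> hom D X A" "q \<in> hom D X B"
    "\<And>t z. t \<in> Obj K \<Longrightarrow> z \<in> el X t \<Longrightarrow> C t (app p t z) (app q t z)"
    "\<And>t a b. t \<in> Obj K \<Longrightarrow> a \<in> el A t \<Longrightarrow> b \<in> el B t \<Longrightarrow> C t a b \<Longrightarrow>
      \<exists>!z. z \<in> el X t \<and> app p t z = a \<and> app q t z = b"
proof -
  define P where "P t = {(a, b). a \<in> el A t \<and> b \<in> el B t \<and> C t a b}" for t
  define r where "r m = map_prod (res A m) (res B m)" for m
  have P [simp]: "(a, b) \<in> P t \<longleftrightarrow> a \<in> el A t \<and> b \<in> el B t \<and> C t a b" for a b t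
    unfolding P_def by simp
  have r [simp]: "r m (a, b) = (res A m a, res B m b)" for m a b unfolding r_def by simp
  have p: "psh P r"
    unfolding psh_def
  proof (intro conjI ballI)
    show "r m z \<in> P (Dom K m)" if "m \<in> Arr K" "z \<in> P (Cod K m)" for m z
      using that C_res res_mem[OF A that(1) refl] res_mem[OF B that(1) refl] by (cases z) simp
    show "r (Id K t) z = z" if "t \<in> Obj K" "z \<in> P t" for t z
      using that res_id[OF A] res_id[OF B] by (cases z) simp
    show "Cod K n = Dom K m \<longrightarrow> (\<forall>z\<in>P (Cod K m). r (m \<odot> n) z = r n (r m z))" if "m \<in> Arr K" "n \<in> Arr K" for m n
      using that res_comp[OF A that] res_comp[OF B that] by auto
  qed
  have "sheaf P r"
    unfolding sheaf_def
  proof (intro conjI p ballI allI impI, elim conjE)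
    fix t S x assume t: "t \<in> Obj K" and S: "S \<in> J t" and x: "\<forall>m\<in>S. x m \<in> P (Dom K m)"
      and xx: "\<forall>m\<in>S. \<forall>n\<in>Arr K. Cod K n = Dom K m \<longrightarrow> r n (x m) = x (m \<odot> n)"
    have x1: "x m = (fst (x m), snd (x m))" for m by simp
    have x': "fst (x m) \<in> el A (Dom K m) \<and> snd (x m) \<in> el B (Dom K m) \<and> C (Dom K m) (fst (x m)) (snd (x m))" if "m \<in> S" for m
      using bspec[OF x that] P[of "fst (x m)" "snd (x m)"] by simp
    have xx': "res A n (fst (x m)) = fst (x (m \<odot> n)) \<and> res B n (snd (x m)) = snd (x (m \<odot> n))"
      if "m \<in> S" "n \<in> Arr K" "Cod K n = Dom K m" for m n
      using xx[rule_format, OF that, symmetric] r[of n "fst (x m)" "snd (x m)"] by simp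
    have "\<exists>!a. a \<in> el A t \<and> (\<forall>m\<in>S. res A m a = fst (x m))"
      by (rule el_sheaf[OF A, unfolded sheaf_def, THEN conjunct2, rule_format, OF t S]) (use x' xx' in blast)
    then obtain a where a: "a \<in> el A t" "\<forall>m\<in>S. res A m a = fst (x m)"
      and ua: "\<And>a'. a' \<in> el A t \<and> (\<forall>m\<in>S. res A m a' = fst (x m)) \<Longrightarrow> a' = a" by auto
    have "\<exists>!b. b \<in> el B t \<and> (\<forall>m\<in>S. res B m b = snd (x m))"
      by (rule el_sheaf[OF B, unfolded sheaf_def, THEN conjunct2, rule_format, OF t S]) (use x' xx' in blast)
    then obtain b where b: "b \<in> el B t" "\<forall>m\<in>S. res B m b = snd (x m)"
      and ub: "\<And>b'. b' \<in> el B t \<and> (\<forall>m\<in>S. res B m b' = snd (x m)) \<Longrightarrow> b' = b" by auto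
    have "C t a b"
      by (rule C_local[OF t a(1) b(1)], unfold cov_def, rule bexI[OF _ S]) (use x' a(2) b(2) in simp)
    show "\<exists>!y. y \<in> P t \<and> (\<forall>m\<in>S. r m y = x m)"
    proof (rule ex1I[of _ "(a, b)"])
      show "(a, b) \<in> P t \<and> (\<forall>m\<in>S. r m (a, b) = x m)" using a b \<open>C t a b\<close> by simp
      fix y assume y: "y \<in> P t \<and> (\<forall>m\<in>S. r m y = x m)"
      obtain a' b' where y': "y = (a', b')" by (cases y)
      have rx: "x m = (res A m a', res B m b')" if "m \<in> S" for m using y y' that by simp
      have "a' = a" by (rule ua) (use y y' rx in simp)
      moreover have "b' = b" by (rule ub) (use y y' rx in simp)
      ultimately show "y = (a, b)" using y' by simp
    qed
  qed
  moreover have "bounded P"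
    by (rule bounded_family_lepoll[OF bounded_family_Times[OF universe el_bounded[OF A] el_bounded[OF B]]])
      (auto simp: P_def intro: subset_imp_lepoll)
  ultimately obtain X \<theta> where X: "X \<in> Obj D" and \<theta>: "natural P r (el X) (res X) \<theta>"
    and bij: "\<And>t. t \<in> Obj K \<Longrightarrow> bij_betw (\<theta> t) (P t) (el X t)"
    using realise by blast
  define i where "i t = the_inv_into (P t) (\<theta> t)" for t
  have i1: "i t z \<in> P t" and i2: "\<theta> t (i t z) = z" if "t \<in> Obj K" "z \<in> el X t" for t z
    using bij[OF that(1)] that(2) unfolding i_def bij_betw_def
    by (auto intro!: the_inv_into_into f_the_inv_into_f)
  have i3: "i t (\<theta> t y) = y" if "t \<in> Obj K" "y \<in> P t" for t y
    using bij[OF that(1)] that(2) unfolding i_def bij_betw_def by (simp add: the_inv_into_f_f)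
  have ir: "i (Dom K m) (res X m z) = r m (i (Cod K m) z)" if "m \<in> Arr K" "z \<in> el X (Cod K m)" for m z
  proof -
    have "res X m z = \<theta> (Dom K m) (r m (i (Cod K m) z))"
      using natural_res[OF \<theta> that(1) i1] i2 that by simp
    then show ?thesis using i3 psh_mem[OF p that(1) i1] that by simp
  qed
  have i1': "fst (i t z) \<in> el A t \<and> snd (i t z) \<in> el B t \<and> C t (fst (i t z)) (snd (i t z))"
    if "t \<in> Obj K" "z \<in> el X t" for t z
    using i1[OF that] P[of "fst (i t z)" "snd (i t z)"] by simp
  have ir': "fst (i (Dom K m) (res X m z)) = res A m (fst (i (Cod K m) z)) \<and>
      snd (i (Dom K m) (res X m z)) = res B m (snd (i (Cod K m) z))" if "m \<in> Arr K" "z \<in> el X (Cod K m)" for m z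
    using ir[OF that] r[of m "fst (i (Cod K m) z)" "snd (i (Cod K m) z)"] by simp
  have "natural (el X) (res X) (el A) (res A) (\<lambda>t z. fst (i t z))"
    unfolding natural_def using i1' ir' by simp
  from full[OF X A this] obtain f where f: "f \<in> hom D X A" "\<forall>t\<in>Obj K. \<forall>z\<in>el X t. app f t z = fst (i t z)" by blast
  have "natural (el X) (res X) (el B) (res B) (\<lambda>t z. snd (i t z))"
    unfolding natural_def using i1' ir' by simp
  from full[OF X B this] obtain g where g: "g \<in> hom D X B" "\<forall>t\<in>Obj K. \<forall>z\<in>el X t. app g t z = snd (i t z)" by blast
  show ?thesis
  proof (rule that[OF f(1) g(1)])
    show "C t (app f t z) (app g t z)" if "t \<in> Obj K" "z \<in> el X t" for t z
      using i1'[OF that] f(2) g(2) that by simp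
    fix t a b assume t: "t \<in> Obj K" and ab: "a \<in> el A t" "b \<in> el B t" "C t a b"
    have \<theta>X: "\<theta> t (a, b) \<in> el X t" using natural_mem[OF \<theta> t] ab by simp
    show "\<exists>!z. z \<in> el X t \<and> app f t z = a \<and> app g t z = b"
    proof (rule ex1I[of _ "\<theta> t (a, b)"])
      show "\<theta> t (a, b) \<in> el X t \<and> app f t (\<theta> t (a, b)) = a \<and> app g t (\<theta> t (a, b)) = b"
        using \<theta>X f(2) g(2) t i3[OF t, of "(a, b)"] ab by simp
      fix z assume z: "z \<in> el X t \<and> app f t z = a \<and> app g t z = b"
      then have "i t z = (a, b)"
        using f(2)[rule_format, OF t, of z] g(2)[rule_format, OF t, of z] by (simp add: prod_eq_iff)
      then show "z = \<theta> t (a, b)" using i2[OF t] z by metis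
    qed
  qed
qed

section \<open>Existence of finite limits\<close>

lemma terminal_exists: "\<exists>T. is_terminal D T"
proof -
  have "sheaf (\<lambda>_. {()}) (\<lambda>_ _. ())" unfolding sheaf_def psh_def by auto
  moreover have "small U {()}"
  proof -
    obtain N where "N \<in> U" "infinite N" using universe unfolding set_universe_def by blast
    then show ?thesis unfolding small_def using finite_lepoll_infinite by blast
  qed
  moreover have "bounded (\<lambda>_. {()})" by (rule bounded_family_const[OF \<open>small U {()}\<close>]) simp
  ultimately obtain T \<theta> where T: "T \<in> Obj D" and b: "\<And>t. t \<in> Obj K \<Longrightarrow> bij_betw (\<theta> t) {()} (el T t)"
    using realise[of "\<lambda>_. {()}" "\<lambda>_ _. ()"] by blast
  have T1: "el T t = {\<theta> t ()}" if "t \<in> Obj K" for t using b[OF that] by (auto simp: bij_betw_def)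
  have "\<exists>!f. f \<in> hom D X T" if X: "X \<in> Obj D" for X
  proof -
    have "natural (el X) (res X) (el T) (res T) (\<lambda>t _. \<theta> t ())"
      unfolding natural_def
    proof (intro conjI ballI)
      show "\<theta> t () \<in> el T t" if "t \<in> Obj K" for t using T1[OF that] by simp
      show "\<theta> (Dom K m) () = res T m (\<theta> (Cod K m) ())" if "m \<in> Arr K" for m
        using res_mem[OF T that refl, of "\<theta> (Cod K m) ()"] T1[of "Cod K m"] T1[of "Dom K m"] that by simp
    qed
    then obtain f where f: "f \<in> hom D X T" using full[OF X T] by blast
    show ?thesis
    proof (rule ex1I, rule f)
      fix g assume g: "g \<in> hom D X T"
      show "g = f"
        by (rule faithful[OF g f]) (use app_mem[OF f] app_mem[OF g] T1 in auto)
    qed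
  qed
  then show ?thesis unfolding is_terminal_def using T by blast
qed

lemma product_exists:
  assumes A: "A \<in> Obj D" and B: "B \<in> Obj D"
  shows "\<exists>P p q. is_product D A B P p q"
proof -
  obtain X p q where p: "p \<in> hom D X A" and q: "q \<in> hom D X B"
    and ex: "\<And>t a b. t \<in> Obj K \<Longrightarrow> a \<in> el A t \<Longrightarrow> b \<in> el B t \<Longrightarrow> \<exists>!z. z \<in> el X t \<and> app p t z = a \<and> app q t z = b"
    by (rule relation_exists[OF A B, of "\<lambda>_ _ _. True"]) auto
  have "is_product D A B X p q"
    unfolding is_product_def
  proof (intro conjI ballI p q)
    show "X \<in> Obj D" using homD[OF p] by blast
    show "\<exists>!h. h \<in> hom D Z X \<and> p \<cdot>\<^bsub>D\<^esub> h = f \<and> q \<cdot>\<^bsub>D\<^esub> h = g" if f: "f \<in> hom D Z A" and g: "g \<in> hom D Z B" for Z f g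
      by (rule joint_lift[OF p q f g], rule ex) (use app_mem[OF f] app_mem[OF g] in auto)
  qed
  then show ?thesis by blast
qed

lemma equaliser_exists:
  assumes f: "f \<in> hom D A B" and g: "g \<in> hom D A B"
  shows "\<exists>e. is_equaliser D f g e"
proof -
  have AB: "A \<in> Obj D" "B \<in> Obj D" using homD[OF f] by auto
  \<comment> \<open>The equaliser is cut out of \<open>A\<close> times itself by also requiring
    equal coordinates. The two legs then coincide, and the universal property of the pair becomes
    that of a single arrow.\<close>
  obtain X p q where p: "p \<in> hom D X A" and q: "q \<in> hom D X A"
    and pq: "\<And>t z. t \<in> Obj K \<Longrightarrow> z \<in> el X t \<Longrightarrow> app p t z = app q t z \<and> app f t (app p t z) = app g t (app p t z)"
    and ex: "\<And>t a b. t \<in> Obj K \<Longrightarrow> a \<in> el A t \<Longrightarrow> b \<in> el A t \<Longrightarrow> a = b \<and> app f t a = app g t a \<Longrightarrow>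
      \<exists>!z. z \<in> el X t \<and> app p t z = a \<and> app q t z = b"
  proof (rule relation_exists[OF AB(1) AB(1), of "\<lambda>t a b. a = b \<and> app f t a = app g t a"])
    fix m a b assume "m \<in> Arr K" "a \<in> el A (Cod K m)" "a = b \<and> app f (Cod K m) a = app g (Cod K m) a"
    then show "res A m a = res A m b \<and> app f (Dom K m) (res A m a) = app g (Dom K m) (res A m a)"
      using app_res[OF f _ refl, of m a] app_res[OF g _ refl, of m a] by metis
  next
    fix t a b assume t: "t \<in> Obj K" and a: "a \<in> el A t" and b: "b \<in> el A t"
      and c: "cov t (\<lambda>m. res A m a = res A m b \<and> app f (Dom K m) (res A m a) = app g (Dom K m) (res A m a))"
    have "a = b" by (rule el_eqI[OF AB(1) t a b], rule cov_mono[OF t c]) simp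
    moreover have "app f t a = app g t a"
      by (rule el_eqI[OF AB(2) t app_mem[OF f t a] app_mem[OF g t a]], rule cov_mono[OF t c])
        (use a in \<open>simp add: app_res[OF f] app_res[OF g]\<close>)
    ultimately show "a = b \<and> app f t a = app g t a" by simp
  qed auto
  have "is_equaliser D f g p"
    unfolding is_equaliser_def
  proof (intro conjI ballI impI)
    show "f \<in> Arr D" "g \<in> hom D (Dom D f) (Cod D f)" "p \<in> Arr D" "Cod D p = Dom D f"
      using homD[OF f] homD[OF p] g by auto
    show "f \<cdot>\<^bsub>D\<^esub> p = g \<cdot>\<^bsub>D\<^esub> p"
      by (rule faithful[OF D.comp_in[OF p f] D.comp_in[OF p g]]) (simp add: app_comp[OF p f] app_comp[OF p g] pq[THEN conjunct2])
    fix Z h assume h': "h \<in> hom D Z (Dom D f)" and eq: "f \<cdot>\<^bsub>D\<^esub> h = g \<cdot>\<^bsub>D\<^esub> h"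
    have h: "h \<in> hom D Z A" using h' homD[OF f] by simp
    have "\<exists>!k. k \<in> hom D Z X \<and> p \<cdot>\<^bsub>D\<^esub> k = h \<and> q \<cdot>\<^bsub>D\<^esub> k = h"
    proof (rule joint_lift[OF p q h h], rule ex)
      fix t z assume t: "t \<in> Obj K" and z: "z \<in> el Z t"
      show "app h t z \<in> el A t" "app h t z \<in> el A t" using app_mem[OF h t z] by auto
      show "app h t z = app h t z \<and> app f t (app h t z) = app g t (app h t z)"
        using eq app_comp[OF h f t z] app_comp[OF h g t z] by metis
    qed
    moreover have "p = q" by (rule faithful[OF p q]) (use pq in blast)
    ultimately show "\<exists>!k. k \<in> hom D Z (Dom D p) \<and> p \<cdot>\<^bsub>D\<^esub> k = h" using homD[OF p] by simp
  qed
  then show ?thesis by blast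
qed

lemma kernel_pair_exists:
  assumes f: "f \<in> hom D A B"
  obtains X p q where "p \<in> hom D X A" "q \<in> hom D X A" "f \<cdot>\<^bsub>D\<^esub> p = f \<cdot>\<^bsub>D\<^esub> q"
    "\<And>t a b. t \<in> Obj K \<Longrightarrow> a \<in> el A t \<Longrightarrow> b \<in> el A t \<Longrightarrow> app f t a = app f t b \<Longrightarrow>
      \<exists>z. z \<in> el X t \<and> app p t z = a \<and> app q t z = b"
proof -
  have AB: "A \<in> Obj D" "B \<in> Obj D" using homD[OF f] by auto
  obtain X p q where p: "p \<in> hom D X A" and q: "q \<in> hom D X A"
    and pq: "\<And>t z. t \<in> Obj K \<Longrightarrow> z \<in> el X t \<Longrightarrow> app f t (app p t z) = app f t (app q t z)"
    and ex: "\<And>t a b. t \<in> Obj K \<Longrightarrow> a \<in> el A t \<Longrightarrow> b \<in> el A t \<Longrightarrow> app f t a = app f t b \<Longrightarrow>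
      \<exists>!z. z \<in> el X t \<and> app p t z = a \<and> app q t z = b"
  proof (rule relation_exists[OF AB(1) AB(1), of "\<lambda>t a b. app f t a = app f t b"])
    fix m a b assume "m \<in> Arr K" "a \<in> el A (Cod K m)" "b \<in> el A (Cod K m)" "app f (Cod K m) a = app f (Cod K m) b"
    then show "app f (Dom K m) (res A m a) = app f (Dom K m) (res A m b)"
      by (simp add: app_res[OF f _ refl])
  next
    fix t a b assume t: "t \<in> Obj K" and a: "a \<in> el A t" and b: "b \<in> el A t"
      and c: "cov t (\<lambda>m. app f (Dom K m) (res A m a) = app f (Dom K m) (res A m b))"
    show "app f t a = app f t b"
      by (rule el_eqI[OF AB(2) t app_mem[OF f t a] app_mem[OF f t b]], rule cov_mono[OF t c])
        (use a b in \<open>simp add: app_res[OF f]\<close>)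
  qed auto
  show ?thesis
  proof (rule that[OF p q])
    show "f \<cdot>\<^bsub>D\<^esub> p = f \<cdot>\<^bsub>D\<^esub> q"
      by (rule faithful[OF D.comp_in[OF p f] D.comp_in[OF q f]]) (use pq in \<open>simp add: app_comp[OF p f] app_comp[OF q f]\<close>)
  qed (use ex in blast)
qed

lemma finite_limits: "has_finite_limits D"
  unfolding has_finite_limits_def
  using terminal_exists product_exists equaliser_exists[OF homI] by blast

lemma pullbackI:
  assumes f: "f \<in> hom D A C" and g: "g \<in> hom D B C" and p: "p \<in> hom D P A" and q: "q \<in> hom D P B"
    and eq: "f \<cdot>\<^bsub>D\<^esub> p = g \<cdot>\<^bsub>D\<^esub> q"
    and ex: "\<And>t a b. t \<in> Obj K \<Longrightarrow> a \<in> el A t \<Longrightarrow> b \<in> el B t \<Longrightarrow> app f t a = app g t b \<Longrightarrow>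
      \<exists>!z. z \<in> el P t \<and> app p t z = a \<and> app q t z = b"
  shows "is_pullback D f g p q"
  unfolding is_pullback_def
proof (intro conjI ballI impI)
  show "f \<in> Arr D" "g \<in> Arr D" "Cod D f = Cod D g" "p \<in> Arr D" "Cod D p = Dom D f" "q \<in> hom D (Dom D p) (Dom D g)"
    using homD[OF f] homD[OF g] homD[OF p] q by auto
  show "f \<cdot>\<^bsub>D\<^esub> p = g \<cdot>\<^bsub>D\<^esub> q" by (rule eq)
  fix Z h k assume "h \<in> hom D Z (Dom D f)" "k \<in> hom D Z (Dom D g)" and e: "f \<cdot>\<^bsub>D\<^esub> h = g \<cdot>\<^bsub>D\<^esub> k"
  then have h: "h \<in> hom D Z A" and k: "k \<in> hom D Z B" using homD[OF f] homD[OF g] by auto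
  have "\<exists>!l. l \<in> hom D Z P \<and> p \<cdot>\<^bsub>D\<^esub> l = h \<and> q \<cdot>\<^bsub>D\<^esub> l = k"
  proof (rule joint_lift[OF p q h k], rule ex)
    fix t z assume t: "t \<in> Obj K" and z: "z \<in> el Z t"
    show "app f t (app h t z) = app g t (app k t z)"
      using e app_comp[OF h f t z] app_comp[OF k g t z] by metis
    show "app h t z \<in> el A t" "app k t z \<in> el B t" using app_mem[OF h t z] app_mem[OF k t z] by simp_all
  qed
  then show "\<exists>!l. l \<in> hom D Z (Dom D p) \<and> p \<cdot>\<^bsub>D\<^esub> l = h \<and> q \<cdot>\<^bsub>D\<^esub> l = k" using homD[OF p] by simp
qed

end

section \<open>Coequalisers and regularity\<close>

context sheaf_cat
begin

lemma comp_app_eq: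
  assumes "h \<cdot>\<^bsub>D\<^esub> f = k" "f \<in> hom D X Y" "h \<in> hom D Y Z" "t \<in> Obj K" "x \<in> el X t"
  shows "app h t (app f t x) = app k t x"
  using app_comp[OF assms(2-5)] unfolding assms(1) by (rule sym)

lemma comp_eq_app_eq:
  assumes "h \<cdot>\<^bsub>D\<^esub> f = h' \<cdot>\<^bsub>D\<^esub> g" "f \<in> hom D X Y" "h \<in> hom D Y Z" "g \<in> hom D X Y'" "h' \<in> hom D Y' Z"
    "t \<in> Obj K" "x \<in> el X t"
  shows "app h t (app f t x) = app h' t (app g t x)"
  using comp_app_eq[OF assms(1-3,6,7)] app_comp[OF assms(4-7)] by (rule trans)

lemma locally_surj_cong:
  assumes "locally_surj P Q s \<eta>" "\<And>t x. t \<in> Obj K \<Longrightarrow> x \<in> P t \<Longrightarrow> \<eta>' t x = \<eta> t x"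
  shows "locally_surj P Q s \<eta>'"
  unfolding locally_surj_def
proof (intro ballI)
  fix t y assume t: "t \<in> Obj K" and y: "y \<in> Q t"
  show "cov t (\<lambda>m. \<exists>x\<in>P (Dom K m). \<eta>' (Dom K m) x = s m y)"
    by (rule cov_mono[OF t locally_surjD[OF assms(1) t y]]) (use assms(2) in auto)
qed

lemma quotient_map:
  assumes Y: "Y \<in> Obj D" and E: "presheaf_quotient K J (el Y) (res Y) E"
  obtains Q q where "q \<in> hom D Y Q" "locally_surj (el Y) (el Q) (res Q) (app q)"
    "\<And>t x y. t \<in> Obj K \<Longrightarrow> x \<in> el Y t \<Longrightarrow> y \<in> el Y t \<Longrightarrow> app q t x = app q t y \<longleftrightarrow> E t x y"
proof -
  obtain Q \<eta> where Q: "Q \<in> Obj D" and \<eta>: "natural (el Y) (res Y) (el Q) (res Q) \<eta>"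
    and ls: "locally_surj (el Y) (el Q) (res Q) \<eta>"
    and ker: "\<And>t x y. t \<in> Obj K \<Longrightarrow> x \<in> el Y t \<Longrightarrow> y \<in> el Y t \<Longrightarrow> \<eta> t x = \<eta> t y \<longleftrightarrow> E t x y"
    by (rule quotient_exists[OF E el_bounded[OF Y]], rule that; (assumption | blast))
  obtain q where q: "q \<in> hom D Y Q" "\<forall>t\<in>Obj K. \<forall>x\<in>el Y t. app q t x = \<eta> t x"
    using full[OF Y Q \<eta>] by blast
  show ?thesis
    by (rule that[OF q(1) locally_surj_cong[OF ls]]) (use q(2) ker in auto)
qed

text \<open>The kernel premise is tested against every \<open>h\<close> that coequalises
  \<open>f\<close> and \<open>g\<close>, which replaces an explicit description of the generated
  equivalence relation by chains. It is what makes \<open>h\<close> descend along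
  \<open>q\<close>.\<close>

lemma coequaliserI:
  assumes f: "f \<in> hom D X Y" and g: "g \<in> hom D X Y" and q: "q \<in> hom D Y Q" and eq: "q \<cdot>\<^bsub>D\<^esub> f = q \<cdot>\<^bsub>D\<^esub> g"
    and ls: "locally_surj (el Y) (el Q) (res Q) (app q)"
    and ker: "\<And>t x y Z h. t \<in> Obj K \<Longrightarrow> x \<in> el Y t \<Longrightarrow> y \<in> el Y t \<Longrightarrow> app q t x = app q t y \<Longrightarrow>
      h \<in> hom D Y Z \<Longrightarrow> h \<cdot>\<^bsub>D\<^esub> f = h \<cdot>\<^bsub>D\<^esub> g \<Longrightarrow> app h t x = app h t y"
  shows "is_coequaliser D f g q"
  unfolding is_coequaliser_def
proof (intro conjI ballI impI)
  show "f \<in> Arr D" "g \<in> hom D (Dom D f) (Cod D f)" "q \<in> Arr D" "Dom D q = Cod D f"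
    using homD[OF f] homD[OF q] g by auto
  show "q \<cdot>\<^bsub>D\<^esub> f = q \<cdot>\<^bsub>D\<^esub> g" by (rule eq)
  fix Z h assume Z: "Z \<in> Obj D" and "h \<in> hom D (Cod D f) Z" and hh: "h \<cdot>\<^bsub>D\<^esub> f = h \<cdot>\<^bsub>D\<^esub> g"
  then have h: "h \<in> hom D Y Z" using homD[OF f] by simp
  have Y: "Y \<in> Obj D" and Q: "Q \<in> Obj D" and CQ: "Cod D q = Q" using homD[OF q] by auto
  obtain k where k: "k \<in> hom D Q Z" "\<And>t x. t \<in> Obj K \<Longrightarrow> x \<in> el Y t \<Longrightarrow> app k t (app q t x) = app h t x"
    by (rule descend[OF Q Z el_psh[OF Y] app_natural[OF q] ls app_natural[OF h] ker[OF _ _ _ _ h hh]];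
        (assumption | (rule that; (assumption | blast))))
  show "\<exists>!k. k \<in> hom D (Cod D q) Z \<and> k \<cdot>\<^bsub>D\<^esub> q = h"
    unfolding CQ
  proof (rule ex1I[of _ k], intro conjI k(1))
    show "k \<cdot>\<^bsub>D\<^esub> q = h"
      by (rule faithful[OF D.comp_in[OF q k(1)] h]) (simp add: app_comp[OF q k(1)] k(2))
    fix k' assume k': "k' \<in> hom D Q Z \<and> k' \<cdot>\<^bsub>D\<^esub> q = h"
    then have k'h: "k' \<in> hom D Q Z" by blast
    show "k' = k"
    proof (rule locally_surj_cancel[OF k'h k(1) ls])
      fix t x assume t: "t \<in> Obj K" and x: "x \<in> el Y t"
      show "app k' t (app q t x) = app k t (app q t x)"
        using app_comp[OF q k'h t x] k(2)[OF t x] k' by simp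
    qed
  qed
qed

lemma coequalisers: "has_coequalisers D"
  unfolding has_coequalisers_def
proof (intro ballI)
  fix f g assume "f \<in> Arr D" and g: "g \<in> hom D (Dom D f) (Cod D f)"
  define X where "X = Dom D f"
  define Y where "Y = Cod D f"
  have f: "f \<in> hom D X Y" and g: "g \<in> hom D X Y"
    using \<open>f \<in> Arr D\<close> g unfolding X_def Y_def by (auto intro: homI)
  have Y: "Y \<in> Obj D" using homD[OF f] by blast
  \<comment> \<open>The generated relation from above: elements are identified when every
    coequalising arrow identifies them. The kernel premise of \<open>coequaliserI\<close> then holds
    by definition, and so does the relation between the values of \<open>f\<close> and
    \<open>g\<close>.\<close>
  define E where "E t x y \<longleftrightarrow> (\<forall>Z. \<forall>h\<in>hom D Y Z. h \<cdot>\<^bsub>D\<^esub> f = h \<cdot>\<^bsub>D\<^esub> g \<longrightarrow> app h t x = app h t y)" for t x y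
  have ED: "app h t x = app h t y" if "E t x y" "h \<in> hom D Y Z" "h \<cdot>\<^bsub>D\<^esub> f = h \<cdot>\<^bsub>D\<^esub> g" for t x y h Z
    using that unfolding E_def by blast
  have "presheaf_quotient K J (el Y) (res Y) E"
  proof (unfold_locales, rule el_psh[OF Y])
    fix m x y assume m: "m \<in> Arr K" and x: "x \<in> el Y (Cod K m)" and y: "y \<in> el Y (Cod K m)" and e: "E (Cod K m) x y"
    show "E (Dom K m) (res Y m x) (res Y m y)"
      unfolding E_def
    proof (intro allI ballI impI)
      fix Z h assume h: "h \<in> hom D Y Z" "h \<cdot>\<^bsub>D\<^esub> f = h \<cdot>\<^bsub>D\<^esub> g"
      show "app h (Dom K m) (res Y m x) = app h (Dom K m) (res Y m y)"
        using ED[OF e h] app_res[OF h(1) m refl x] app_res[OF h(1) m refl y] by simp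
    qed
  next
    fix t x y assume t: "t \<in> Obj K" and x: "x \<in> el Y t" and y: "y \<in> el Y t"
      and c: "cov t (\<lambda>m. E (Dom K m) (res Y m x) (res Y m y))"
    show "E t x y"
      unfolding E_def
    proof (intro allI ballI impI)
      fix Z h assume h: "h \<in> hom D Y Z" "h \<cdot>\<^bsub>D\<^esub> f = h \<cdot>\<^bsub>D\<^esub> g"
      have Z: "Z \<in> Obj D" using homD[OF h(1)] by blast
      show "app h t x = app h t y"
      proof (rule el_eqI[OF Z t app_mem[OF h(1) t x] app_mem[OF h(1) t y]], rule cov_mono[OF t c])
        fix m assume m: "m \<in> Arr K" "Cod K m = t" and e: "E (Dom K m) (res Y m x) (res Y m y)"
        show "res Z m (app h t x) = res Z m (app h t y)"
          using ED[OF e h] app_res[OF h(1) m x] app_res[OF h(1) m y] by simp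
      qed
    qed
  qed (auto simp: E_def)
  note quot = this
  obtain Q q where q: "q \<in> hom D Y Q"
    and ls: "locally_surj (el Y) (el Q) (res Q) (app q)"
    and ker: "\<And>t x y. t \<in> Obj K \<Longrightarrow> x \<in> el Y t \<Longrightarrow> y \<in> el Y t \<Longrightarrow> app q t x = app q t y \<longleftrightarrow> E t x y"
    by (rule quotient_map[OF Y quot], rule that; (assumption | blast))
  have "is_coequaliser D f g q"
  proof (rule coequaliserI[OF f g q _ ls])
    show "q \<cdot>\<^bsub>D\<^esub> f = q \<cdot>\<^bsub>D\<^esub> g"
    proof (rule faithful[OF D.comp_in[OF f q] D.comp_in[OF g q]])
      fix t x assume t: "t \<in> Obj K" and x: "x \<in> el X t"
      have "E t (app f t x) (app g t x)"
        unfolding E_def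
      proof (intro allI ballI impI)
        fix Z h assume h: "h \<in> hom D Y Z" "h \<cdot>\<^bsub>D\<^esub> f = h \<cdot>\<^bsub>D\<^esub> g"
        show "app h t (app f t x) = app h t (app g t x)"
          by (rule comp_eq_app_eq[OF h(2) f h(1) g h(1) t x])
      qed
      then show "app (q \<cdot>\<^bsub>D\<^esub> f) t x = app (q \<cdot>\<^bsub>D\<^esub> g) t x"
        using ker[OF t app_mem[OF f t x] app_mem[OF g t x]] app_comp[OF f q t x] app_comp[OF g q t x] by simp
    qed
    fix t x y Z h assume "t \<in> Obj K" "x \<in> el Y t" "y \<in> el Y t" "app q t x = app q t y"
      and h: "h \<in> hom D Y Z" "h \<cdot>\<^bsub>D\<^esub> f = h \<cdot>\<^bsub>D\<^esub> g"
    then have "E t x y" using ker by simp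
    then show "app h t x = app h t y" using ED h by simp
  qed
  then show "\<exists>q. is_coequaliser D f g q" by blast
qed

lemma coequaliser_univ:
  assumes c: "is_coequaliser D f g q" and h: "h \<in> hom D (Cod D f) Z" and e: "h \<cdot>\<^bsub>D\<^esub> f = h \<cdot>\<^bsub>D\<^esub> g"
  shows "\<exists>!k. k \<in> hom D (Cod D q) Z \<and> k \<cdot>\<^bsub>D\<^esub> q = h"
proof -
  have Z: "Z \<in> Obj D" using homD[OF h] by simp
  have "\<forall>X\<in>Obj D. \<forall>h\<in>hom D (Cod D f) X. h \<cdot>\<^bsub>D\<^esub> f = h \<cdot>\<^bsub>D\<^esub> g \<longrightarrow> (\<exists>!k. k \<in> hom D (Cod D q) X \<and> k \<cdot>\<^bsub>D\<^esub> q = h)"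
    using c unfolding is_coequaliser_def by (elim conjE)
  from this[rule_format, OF Z h e] show ?thesis .
qed

text \<open>The quotient by \<open>E\<close> coequalises \<open>f\<close> and \<open>g\<close>, so
  it factors through \<open>q\<close>; what \<open>q\<close> identifies is therefore identified in
  that quotient, whose kernel is \<open>E\<close>. In other words, the kernel of a coequaliser is
  least among the local equivalence relations containing the values of \<open>f\<close> and
  \<open>g\<close>.\<close>

lemma coequaliser_kernel:
  assumes q: "is_coequaliser D f g q" and f: "f \<in> hom D X Y"
    and E: "presheaf_quotient K J (el Y) (res Y) E"
    and fg: "\<And>t z. t \<in> Obj K \<Longrightarrow> z \<in> el X t \<Longrightarrow> E t (app f t z) (app g t z)"
    and t: "t \<in> Obj K" and x: "x \<in> el Y t" and y: "y \<in> el Y t" and eq: "app q t x = app q t y"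
  shows "E t x y"
proof -
  have g: "g \<in> hom D X Y" and qh: "q \<in> hom D Y (Cod D q)" and Y: "Y \<in> Obj D"
    using q homD[OF f] unfolding is_coequaliser_def hom_def by auto
  obtain Q p where p: "p \<in> hom D Y Q"
    and ker: "\<And>t x y. t \<in> Obj K \<Longrightarrow> x \<in> el Y t \<Longrightarrow> y \<in> el Y t \<Longrightarrow> app p t x = app p t y \<longleftrightarrow> E t x y"
    by (rule quotient_map[OF Y E], rule that; (assumption | blast))
  have "p \<cdot>\<^bsub>D\<^esub> f = p \<cdot>\<^bsub>D\<^esub> g"
  proof (rule faithful[OF D.comp_in[OF f p] D.comp_in[OF g p]])
    fix t z assume t: "t \<in> Obj K" and z: "z \<in> el X t"
    show "app (p \<cdot>\<^bsub>D\<^esub> f) t z = app (p \<cdot>\<^bsub>D\<^esub> g) t z"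
      using ker[OF t app_mem[OF f t z] app_mem[OF g t z]] fg[OF t z] app_comp[OF f p t z] app_comp[OF g p t z] by simp
  qed
  then have "\<exists>!k. k \<in> hom D (Cod D q) Q \<and> k \<cdot>\<^bsub>D\<^esub> q = p"
    by (rule coequaliser_univ[OF q, rotated]) (use p homD[OF f] in simp)
  then obtain k where k: "k \<in> hom D (Cod D q) Q" "k \<cdot>\<^bsub>D\<^esub> q = p" by auto
  have "app p t x = app p t y"
    by (simp only: comp_app_eq[OF k(2) qh k(1), symmetric] t x y eq)
  then show ?thesis using ker[OF t x y] by simp
qed

text \<open>The local image of \<open>q\<close> is a subobject through which \<open>q\<close>
  factors. Since \<open>q\<close> is a coequaliser, the factorisation extends to all of
  \<open>Q\<close> and splits the inclusion of the image, so the image is everything.\<close>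

lemma regular_epi_locally_surj:
  assumes "regular_epi D q" and q: "q \<in> hom D Y Q"
  shows "locally_surj (el Y) (el Q) (res Q) (app q)"
proof -
  obtain f g where c: "is_coequaliser D f g q" using assms(1) unfolding regular_epi_def by blast
  define X where "X = Dom D f"
  have f: "f \<in> hom D X Y" and g: "g \<in> hom D X Y" and qfg: "q \<cdot>\<^bsub>D\<^esub> f = q \<cdot>\<^bsub>D\<^esub> g"
    using c homD[OF q] unfolding is_coequaliser_def hom_def X_def by auto
  have univ: "\<exists>!k. k \<in> hom D Q Z \<and> k \<cdot>\<^bsub>D\<^esub> q = h" if "h \<in> hom D Y Z" "h \<cdot>\<^bsub>D\<^esub> f = h \<cdot>\<^bsub>D\<^esub> g" for h Z
    using coequaliser_univ[OF c, of h Z] that homD[OF f] homD[OF q] by simp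
  have Y: "Y \<in> Obj D" and Q: "Q \<in> Obj D" using homD[OF q] by auto
  \<comment> \<open>Being locally in the image is a local condition, unlike being in the image;
    hence it cuts out a subsheaf, realised on the diagonal of \<open>Q\<close> times itself.\<close>
  define I where "I t b \<longleftrightarrow> cov t (\<lambda>m. \<exists>x\<in>el Y (Dom K m). app q (Dom K m) x = res Q m b)" for t b
  obtain M p p' where p: "p \<in> hom D M Q" and p': "p' \<in> hom D M Q"
    and pp': "\<And>t z. t \<in> Obj K \<Longrightarrow> z \<in> el M t \<Longrightarrow> app p t z = app p' t z \<and> I t (app p t z)"
    and ex: "\<And>t a b. t \<in> Obj K \<Longrightarrow> a \<in> el Q t \<Longrightarrow> b \<in> el Q t \<Longrightarrow> a = b \<and> I t a \<Longrightarrow>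
      \<exists>!z. z \<in> el M t \<and> app p t z = a \<and> app p' t z = b"
  proof (rule relation_exists[OF Q Q, of "\<lambda>t a b. a = b \<and> I t a"])
    fix m a b assume m: "m \<in> Arr K" and a: "a \<in> el Q (Cod K m)" and ab: "a = b \<and> I (Cod K m) a"
    have "cov (Dom K m) (\<lambda>n. \<exists>x\<in>el Y (Dom K (m \<odot> n)). app q (Dom K (m \<odot> n)) x = res Q (m \<odot> n) a)"
      using cov_pull[OF m] ab unfolding I_def by blast
    then have "I (Dom K m) (res Q m a)"
      unfolding I_def by (rule cov_mono[OF arr_dom[OF m]]) (use m a in \<open>simp add: res_comp[OF Q]\<close>)
    then show "res Q m a = res Q m b \<and> I (Dom K m) (res Q m a)" using ab by simp
  next
    fix t a b assume t: "t \<in> Obj K" and a: "a \<in> el Q t" and b: "b \<in> el Q t"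
      and c: "cov t (\<lambda>m. res Q m a = res Q m b \<and> I (Dom K m) (res Q m a))"
    have "a = b" by (rule el_eqI[OF Q t a b], rule cov_mono[OF t c]) simp
    moreover have "I t a"
      unfolding I_def
    proof (rule cov_trans[OF t], rule cov_mono[OF t c])
      fix m assume m: "m \<in> Arr K" "Cod K m = t" and "res Q m a = res Q m b \<and> I (Dom K m) (res Q m a)"
      then have "cov (Dom K m) (\<lambda>n. \<exists>x\<in>el Y (Dom K n). app q (Dom K n) x = res Q n (res Q m a))"
        unfolding I_def by blast
      then show "cov (Dom K m) (\<lambda>n. \<exists>x\<in>el Y (Dom K (m \<odot> n)). app q (Dom K (m \<odot> n)) x = res Q (m \<odot> n) a)"
        by (rule cov_mono[OF arr_dom[OF m(1)]]) (use m a in \<open>simp add: res_comp[OF Q]\<close>)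
    qed
    ultimately show "a = b \<and> I t a" by simp
  qed auto
  have pi: "z = w" if "t \<in> Obj K" "z \<in> el M t" "w \<in> el M t" "app p t z = app p t w" for t z w
  proof -
    note a = app_mem[OF p that(1,2)]
    have u: "\<exists>!v. v \<in> el M t \<and> app p t v = app p t z \<and> app p' t v = app p t z"
      by (rule ex[OF that(1) a a]) (use pp'[OF that(1,2)] in blast)
    have z: "z \<in> el M t \<and> app p t z = app p t z \<and> app p' t z = app p t z"
      using pp'[OF that(1,2)] that(2) by simp
    have w: "w \<in> el M t \<and> app p t w = app p t z \<and> app p' t w = app p t z"
      using pp'[OF that(1,3)] that(3,4) by simp
    show ?thesis by (rule ex1E[OF u]) (use z w in metis)
  qed
  have "\<exists>!h. h \<in> hom D Y M \<and> p \<cdot>\<^bsub>D\<^esub> h = q \<and> p' \<cdot>\<^bsub>D\<^esub> h = q"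
  proof (rule joint_lift[OF p p' q q], rule ex)
    fix t y assume t: "t \<in> Obj K" and y: "y \<in> el Y t"
    show "app q t y \<in> el Q t" "app q t y \<in> el Q t" using app_mem[OF q t y] by auto
    have "I t (app q t y)"
      unfolding I_def
    proof (rule cov_all[OF t], rule bexI)
      fix m assume m: "m \<in> Arr K" "Cod K m = t"
      show "app q (Dom K m) (res Y m y) = res Q m (app q t y)" using app_res[OF q m y] .
      show "res Y m y \<in> el Y (Dom K m)" using res_mem[OF Y m y] .
    qed
    then show "app q t y = app q t y \<and> I t (app q t y)" by simp
  qed
  then obtain h where h: "h \<in> hom D Y M" and ph: "p \<cdot>\<^bsub>D\<^esub> h = q" by blast
  have phe: "app p t (app h t y) = app q t y" if "t \<in> Obj K" "y \<in> el Y t" for t y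
    by (rule comp_app_eq[OF ph h p that])
  have "h \<cdot>\<^bsub>D\<^esub> f = h \<cdot>\<^bsub>D\<^esub> g"
  proof (rule faithful[OF D.comp_in[OF f h] D.comp_in[OF g h]])
    fix t x assume t: "t \<in> Obj K" and x: "x \<in> el X t"
    note fx = app_mem[OF f t x] and gx = app_mem[OF g t x]
    have "app q t (app f t x) = app q t (app g t x)" by (rule comp_eq_app_eq[OF qfg f q g q t x])
    then have "app h t (app f t x) = app h t (app g t x)"
      by (intro pi[OF t app_mem[OF h t fx] app_mem[OF h t gx]]) (simp add: phe[OF t fx] phe[OF t gx])
    then show "app (h \<cdot>\<^bsub>D\<^esub> f) t x = app (h \<cdot>\<^bsub>D\<^esub> g) t x"
      using app_comp[OF f h t x] app_comp[OF g h t x] by simp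
  qed
  from univ[OF h this] obtain k where k: "k \<in> hom D Q M" "k \<cdot>\<^bsub>D\<^esub> q = h" by blast
  have "(p \<cdot>\<^bsub>D\<^esub> k) \<cdot>\<^bsub>D\<^esub> q = q" using D.comp_assoc[OF q k(1) p] k(2) ph by simp
  moreover have "Id D Q \<cdot>\<^bsub>D\<^esub> q = q" using D.id_left[OF q] .
  \<comment> \<open>Both the composite of \<open>p\<close> with \<open>k\<close> and the identity
    are factorisations of \<open>q\<close> through itself, and such a factorisation is
    unique.\<close>
  ultimately have pk: "p \<cdot>\<^bsub>D\<^esub> k = Id D Q"
    using univ[OF q qfg] D.comp_in[OF k(1) p] D.id_in[OF Q] by metis
  show ?thesis
    unfolding locally_surj_def
  proof (intro ballI)
    fix t y assume t: "t \<in> Obj K" and y: "y \<in> el Q t"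
    have "app p t (app k t y) = y" using comp_app_eq[OF pk k(1) p t y] unfolding app_id[OF Q t y] .
    then have "I t y" using pp'[OF t app_mem[OF k(1) t y], THEN conjunct2] by (simp only:)
    then show "cov t (\<lambda>m. \<exists>x\<in>el Y (Dom K m). app q (Dom K m) x = res Q m y)" unfolding I_def .
  qed
qed

text \<open>The arrow is the coequaliser of its kernel pair: two identified elements are the
  coordinates of an element of the kernel pair, on which every coequalising arrow agrees.\<close>

lemma locally_surj_regular_epi:
  assumes q: "q \<in> hom D Y Q" and ls: "locally_surj (el Y) (el Q) (res Q) (app q)"
  shows "regular_epi D q"
proof -
  obtain X p p' where p: "p \<in> hom D X Y" and p': "p' \<in> hom D X Y" and e: "q \<cdot>\<^bsub>D\<^esub> p = q \<cdot>\<^bsub>D\<^esub> p'"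
    and ex: "\<And>t a b. t \<in> Obj K \<Longrightarrow> a \<in> el Y t \<Longrightarrow> b \<in> el Y t \<Longrightarrow> app q t a = app q t b \<Longrightarrow>
      \<exists>z. z \<in> el X t \<and> app p t z = a \<and> app p' t z = b"
    by (rule kernel_pair_exists[OF q], rule that; (assumption | blast))
  have "is_coequaliser D p p' q"
  proof (rule coequaliserI[OF p p' q e ls])
    fix t x y Z h assume t: "t \<in> Obj K" and xy: "x \<in> el Y t" "y \<in> el Y t" "app q t x = app q t y"
      and h: "h \<in> hom D Y Z" "h \<cdot>\<^bsub>D\<^esub> p = h \<cdot>\<^bsub>D\<^esub> p'"
    obtain z where z: "z \<in> el X t" "app p t z = x" "app p' t z = y" using ex[OF t xy] by blast
    show "app h t x = app h t y"
      using comp_eq_app_eq[OF h(2) p h(1) p' h(1) t z(1)] unfolding z(2,3) .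
  qed
  then show ?thesis unfolding regular_epi_def by blast
qed

lemma regular: "regular_category D"
  unfolding regular_category_def
proof (intro conjI allI impI D_category finite_limits)
  fix f p q assume "is_pullback D f f p q"
  then have "p \<in> Arr D" "q \<in> hom D (Dom D p) (Cod D p)" unfolding is_pullback_def by auto
  then show "\<exists>c. is_coequaliser D p q c" using coequalisers unfolding has_coequalisers_def by blast
next
  fix f g p q assume "is_pullback D f g p q \<and> regular_epi D f"
  then have pb: "is_pullback D f g p q" and re: "regular_epi D f" by auto
  define A where "A = Dom D f" define B where "B = Dom D g" define C where "C = Cod D f" define P where "P = Dom D p"
  have f: "f \<in> hom D A C" and g: "g \<in> hom D B C" and p: "p \<in> hom D P A" and q: "q \<in> hom D P B"
    using pb unfolding is_pullback_def hom_def A_def B_def C_def P_def by auto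
  have B: "B \<in> Obj D" using homD[OF g] by blast
  show "regular_epi D q"
  proof (rule locally_surj_regular_epi[OF q], unfold locally_surj_def, intro ballI)
    fix t b assume t: "t \<in> Obj K" and b: "b \<in> el B t"
    show "cov t (\<lambda>m. \<exists>x\<in>el P (Dom K m). app q (Dom K m) x = res B m b)"
    proof (rule cov_mono[OF t locally_surjD[OF regular_epi_locally_surj[OF re f] t app_mem[OF g t b]]])
      fix m assume m: "m \<in> Arr K" "Cod K m = t" and "\<exists>x\<in>el A (Dom K m). app f (Dom K m) x = res C m (app g t b)"
      then obtain a where a: "a \<in> el A (Dom K m)" "app f (Dom K m) a = res C m (app g t b)" by blast
      \<comment> \<open>A local preimage of the image of \<open>b\<close> and the restriction of
        \<open>b\<close> agree over the common target, so they form an element of the pullback;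
        local surjectivity is pulled back with it.\<close>
      have "app f (Dom K m) a = app g (Dom K m) (res B m b)" using a app_res[OF g m b] by simp
      then show "\<exists>x\<in>el P (Dom K m). app q (Dom K m) x = res B m b"
        using pullback_el[OF pb arr_dom[OF m(1)], of a "res B m b"] a(1) res_mem[OF B m b]
        unfolding A_def B_def P_def by blast
    qed
  qed
qed

section \<open>Chosen products and terminal object\<close>

lemma prd_is_product:
  assumes "A \<in> Obj D" "B \<in> Obj D"
  shows "is_product D A B (prd D A B) (pr1 D A B) (pr2 D A B)"
proof -
  obtain P p q where "is_product D A B P p q" using product_exists[OF assms] by blast
  then have "\<exists>c. case c of (P, p, q) \<Rightarrow> is_product D A B P p q" by (intro exI[of _ "(P, p, q)"]) simp
  from someI_ex[OF this] show ?thesis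
    unfolding prd_def pr1_def pr2_def prod_cone_def case_prod_unfold .
qed

lemma prd_obj [simp]: "A \<in> Obj D \<Longrightarrow> B \<in> Obj D \<Longrightarrow> prd D A B \<in> Obj D"
  using prd_is_product unfolding is_product_def by blast

lemma pr1_hom: "A \<in> Obj D \<Longrightarrow> B \<in> Obj D \<Longrightarrow> pr1 D A B \<in> hom D (prd D A B) A"
  using prd_is_product unfolding is_product_def by blast

lemma pr2_hom: "A \<in> Obj D \<Longrightarrow> B \<in> Obj D \<Longrightarrow> pr2 D A B \<in> hom D (prd D A B) B"
  using prd_is_product unfolding is_product_def by blast

text \<open>The chosen product is opaque. Naming its elements by their coordinates lets later
  equations be computed by rewriting.\<close>

definition tup :: "'o \<Rightarrow> 'o \<Rightarrow> 't \<Rightarrow> 'u \<Rightarrow> 'u \<Rightarrow> 'u" where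
  "tup A B t a b = (THE z. z \<in> el (prd D A B) t \<and> app (pr1 D A B) t z = a \<and> app (pr2 D A B) t z = b)"

lemma tup:
  assumes AB: "A \<in> Obj D" "B \<in> Obj D" and t: "t \<in> Obj K" and ab: "a \<in> el A t" "b \<in> el B t"
  shows tup_mem: "tup A B t a b \<in> el (prd D A B) t"
    and pr1_tup: "app (pr1 D A B) t (tup A B t a b) = a"
    and pr2_tup: "app (pr2 D A B) t (tup A B t a b) = b"
  using theI'[OF product_el[OF prd_is_product[OF AB] t ab]] unfolding tup_def by auto

lemma prd_eqI:
  assumes AB: "A \<in> Obj D" "B \<in> Obj D" and t: "t \<in> Obj K" and zw: "z \<in> el (prd D A B) t" "w \<in> el (prd D A B) t"
    and "app (pr1 D A B) t z = app (pr1 D A B) t w" "app (pr2 D A B) t z = app (pr2 D A B) t w"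
  shows "z = w"
  using product_el[OF prd_is_product[OF AB] t app_mem[OF pr1_hom[OF AB] t zw(1)] app_mem[OF pr2_hom[OF AB] t zw(1)]]
    assms(4-) by auto

lemma prd_eta:
  assumes AB: "A \<in> Obj D" "B \<in> Obj D" and t: "t \<in> Obj K" and z: "z \<in> el (prd D A B) t"
  shows "tup A B t (app (pr1 D A B) t z) (app (pr2 D A B) t z) = z"
  by (rule prd_eqI[OF AB t])
    (use z in \<open>simp_all add: tup[OF AB t app_mem[OF pr1_hom[OF AB] t z] app_mem[OF pr2_hom[OF AB] t z]]\<close>)

lemma prd_elE:
  assumes AB: "A \<in> Obj D" "B \<in> Obj D" and t: "t \<in> Obj K" and z: "z \<in> el (prd D A B) t"
  obtains a b where "a \<in> el A t" "b \<in> el B t" "z = tup A B t a b"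
  using prd_eta[OF assms] app_mem[OF pr1_hom[OF AB] t z] app_mem[OF pr2_hom[OF AB] t z] that by metis

lemma tup_res:
  assumes AB: "A \<in> Obj D" "B \<in> Obj D" and m: "m \<in> Arr K" "Cod K m = t" and ab: "a \<in> el A t" "b \<in> el B t"
  shows "res (prd D A B) m (tup A B t a b) = tup A B (Dom K m) (res A m a) (res B m b)"
proof -
  have t: "t \<in> Obj K" using m by auto
  have a': "res A m a \<in> el A (Dom K m)" "res B m b \<in> el B (Dom K m)" using res_mem m AB ab by auto
  note z = tup_mem[OF AB t ab]
  show ?thesis
    by (rule prd_eqI[OF AB arr_dom[OF m(1)] res_mem[OF prd_obj[OF AB] m z] tup_mem[OF AB arr_dom[OF m(1)] a']])
      (simp_all add: app_res[OF pr1_hom[OF AB] m z] app_res[OF pr2_hom[OF AB] m z] tup[OF AB t ab] tup[OF AB arr_dom[OF m(1)] a'])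
qed

lemma pair_hom_app:
  assumes f: "f \<in> hom D X A" and g: "g \<in> hom D X B"
  shows pair_hom: "pair D f g \<in> hom D X (prd D A B)"
    and pair_app: "t \<in> Obj K \<Longrightarrow> x \<in> el X t \<Longrightarrow> app (pair D f g) t x = tup A B t (app f t x) (app g t x)"
proof -
  have AB: "A \<in> Obj D" "B \<in> Obj D" and X: "X \<in> Obj D" and fd: "Dom D f = X" "Cod D f = A" "Cod D g = B"
    using homD[OF f] homD[OF g] by auto
  have "\<exists>!h. h \<in> hom D X (prd D A B) \<and> pr1 D A B \<cdot>\<^bsub>D\<^esub> h = f \<and> pr2 D A B \<cdot>\<^bsub>D\<^esub> h = g"
    using prd_is_product[OF AB] X f g unfolding is_product_def by simp
  from theI'[OF this] have h: "pair D f g \<in> hom D X (prd D A B)"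
    "pr1 D A B \<cdot>\<^bsub>D\<^esub> pair D f g = f" "pr2 D A B \<cdot>\<^bsub>D\<^esub> pair D f g = g"
    unfolding pair_def fd by auto
  show "pair D f g \<in> hom D X (prd D A B)" by (rule h)
  show "app (pair D f g) t x = tup A B t (app f t x) (app g t x)" if t: "t \<in> Obj K" and x: "x \<in> el X t"
    by (rule prd_eqI[OF AB t app_mem[OF h(1) t x] tup_mem[OF AB t app_mem[OF f t x] app_mem[OF g t x]]])
      (simp_all only: comp_app_eq[OF h(2,1) pr1_hom[OF AB] t x] comp_app_eq[OF h(3,1) pr2_hom[OF AB] t x]
        tup[OF AB t app_mem[OF f t x] app_mem[OF g t x]])
qed

lemma prd_map_hom_app:
  assumes f: "f \<in> hom D A A'" and g: "g \<in> hom D B B'"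
  shows prd_map_hom: "prd_map D f g \<in> hom D (prd D A B) (prd D A' B')"
    and prd_map_app: "t \<in> Obj K \<Longrightarrow> a \<in> el A t \<Longrightarrow> b \<in> el B t \<Longrightarrow>
      app (prd_map D f g) t (tup A B t a b) = tup A' B' t (app f t a) (app g t b)"
proof -
  have AB: "A \<in> Obj D" "B \<in> Obj D" and d: "Dom D f = A" "Dom D g = B" using homD[OF f] homD[OF g] by auto
  note h = D.comp_in[OF pr1_hom[OF AB] f] D.comp_in[OF pr2_hom[OF AB] g]
  show "prd_map D f g \<in> hom D (prd D A B) (prd D A' B')"
    unfolding prd_map_def d by (rule pair_hom[OF h])
  show "app (prd_map D f g) t (tup A B t a b) = tup A' B' t (app f t a) (app g t b)"
    if t: "t \<in> Obj K" and ab: "a \<in> el A t" "b \<in> el B t"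
    unfolding prd_map_def d
    by (simp add: pair_app[OF h t tup_mem[OF AB t ab]] app_comp[OF pr1_hom[OF AB] f t tup_mem[OF AB t ab]]
        app_comp[OF pr2_hom[OF AB] g t tup_mem[OF AB t ab]] tup[OF AB t ab])
qed

section \<open>The chosen terminal object\<close>

lemma terminal: "is_terminal D (terminal D)"
  unfolding terminal_def by (rule someI_ex[OF terminal_exists])

lemma terminal_obj [simp]: "terminal D \<in> Obj D"
  using terminal unfolding is_terminal_def by blast

definition pt :: "'t \<Rightarrow> 'u" where "pt t = (THE x. x \<in> el (terminal D) t)"

lemma pt_mem: "t \<in> Obj K \<Longrightarrow> pt t \<in> el (terminal D) t"
  unfolding pt_def by (rule theI'[OF terminal_el[OF terminal]])

lemma pt_unique: "t \<in> Obj K \<Longrightarrow> x \<in> el (terminal D) t \<Longrightarrow> x = pt t"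
  using terminal_el[OF terminal] pt_mem by blast

lemma bang_hom: "X \<in> Obj D \<Longrightarrow> bang D X \<in> hom D X (terminal D)"
proof -
  assume X: "X \<in> Obj D"
  have "\<forall>X\<in>Obj D. \<exists>!f. f \<in> hom D X (terminal D)"
    using terminal unfolding is_terminal_def by (elim conjE)
  from theI'[OF bspec[OF this X]] show ?thesis unfolding bang_def .
qed

lemma bang_app: "X \<in> Obj D \<Longrightarrow> t \<in> Obj K \<Longrightarrow> x \<in> el X t \<Longrightarrow> app (bang D X) t x = pt t"
  by (rule pt_unique) (auto intro: app_mem[OF bang_hom])

text \<open>The classical reason is that products with \<open>c\<close> have a right adjoint. Here
  the exponential is avoided: an arrow out of the product with \<open>Y\<close> that coequalises
  induces on \<open>Y\<close> the relation that its transpose would have as kernel, and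
  \<open>coequaliser_kernel\<close> shows that this relation contains the kernel of
  \<open>q\<close>.\<close>

lemma product_preserves_coequaliser:
  assumes c: "c \<in> Obj D" and cq: "is_coequaliser D f g q"
  shows "is_coequaliser D (prd_map D (Id D c) f) (prd_map D (Id D c) g) (prd_map D (Id D c) q)"
proof -
  define X where "X = Dom D f" define Y where "Y = Cod D f" define Q where "Q = Cod D q"
  have f: "f \<in> hom D X Y" and g: "g \<in> hom D X Y" and q: "q \<in> hom D Y Q" and e: "q \<cdot>\<^bsub>D\<^esub> f = q \<cdot>\<^bsub>D\<^esub> g"
    using cq unfolding is_coequaliser_def hom_def X_def Y_def Q_def by auto
  have O: "X \<in> Obj D" "Y \<in> Obj D" "Q \<in> Obj D" using homD[OF f] homD[OF q] by auto
  note i = D.id_in[OF c]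
  note F = prd_map_hom[OF i f] and G = prd_map_hom[OF i g] and H = prd_map_hom[OF i q]
  have re: "regular_epi D q" using cq unfolding regular_epi_def by blast
  have qf: "app q t (app f t x) = app q t (app g t x)" if "t \<in> Obj K" "x \<in> el X t" for t x
    by (rule comp_eq_app_eq[OF e f q g q that])
  show ?thesis
  proof (rule coequaliserI[OF F G H])
    show "prd_map D (Id D c) q \<cdot>\<^bsub>D\<^esub> prd_map D (Id D c) f = prd_map D (Id D c) q \<cdot>\<^bsub>D\<^esub> prd_map D (Id D c) g"
    proof (rule faithful[OF D.comp_in[OF F H] D.comp_in[OF G H]])
      fix t z assume t: "t \<in> Obj K" and z: "z \<in> el (prd D c X) t"
      obtain a x where a: "a \<in> el c t" and x: "x \<in> el X t" and zz: "z = tup c X t a x"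
        using prd_elE[OF c O(1) t z] by blast
      show "app (prd_map D (Id D c) q \<cdot>\<^bsub>D\<^esub> prd_map D (Id D c) f) t z = app (prd_map D (Id D c) q \<cdot>\<^bsub>D\<^esub> prd_map D (Id D c) g) t z"
        using app_comp[OF F H t z] app_comp[OF G H t z] a x
        by (simp add: zz prd_map_app[OF i f t a x] prd_map_app[OF i g t a x] app_id[OF c t a]
            prd_map_app[OF i q t a] app_mem[OF f t x] app_mem[OF g t x] qf[OF t x])
    qed
    show "locally_surj (el (prd D c Y)) (el (prd D c Q)) (res (prd D c Q)) (app (prd_map D (Id D c) q))"
      unfolding locally_surj_def
    proof (intro ballI)
      fix t z assume t: "t \<in> Obj K" and z: "z \<in> el (prd D c Q) t"
      obtain a b where a: "a \<in> el c t" and b: "b \<in> el Q t" and zz: "z = tup c Q t a b"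
        using prd_elE[OF c O(3) t z] by blast
      show "cov t (\<lambda>m. \<exists>x\<in>el (prd D c Y) (Dom K m). app (prd_map D (Id D c) q) (Dom K m) x = res (prd D c Q) m z)"
      proof (rule cov_mono[OF t locally_surjD[OF regular_epi_locally_surj[OF re q] t b]])
        fix m assume m: "m \<in> Arr K" "Cod K m = t" and "\<exists>x\<in>el Y (Dom K m). app q (Dom K m) x = res Q m b"
        then obtain y where y: "y \<in> el Y (Dom K m)" "app q (Dom K m) y = res Q m b" by blast
        note a' = res_mem[OF c m a] and s = arr_dom[OF m(1)]
        show "\<exists>x\<in>el (prd D c Y) (Dom K m). app (prd_map D (Id D c) q) (Dom K m) x = res (prd D c Q) m z"
          by (rule bexI[OF _ tup_mem[OF c O(2) s a' y(1)]])
            (simp add: zz tup_res[OF c O(3) m a b] prd_map_app[OF i q s a' y(1)] app_id[OF c s a'] y(2))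
      qed
    qed
    fix t z w Z h assume t: "t \<in> Obj K" and z: "z \<in> el (prd D c Y) t" and w: "w \<in> el (prd D c Y) t"
      and zw: "app (prd_map D (Id D c) q) t z = app (prd_map D (Id D c) q) t w"
      and h: "h \<in> hom D (prd D c Y) Z" and hh: "h \<cdot>\<^bsub>D\<^esub> prd_map D (Id D c) f = h \<cdot>\<^bsub>D\<^esub> prd_map D (Id D c) g"
    obtain a y where a: "a \<in> el c t" and y: "y \<in> el Y t" and zz: "z = tup c Y t a y"
      using prd_elE[OF c O(2) t z] by blast
    obtain a' y' where a': "a' \<in> el c t" and y': "y' \<in> el Y t" and ww: "w = tup c Y t a' y'"
      using prd_elE[OF c O(2) t w] by blast
    have "tup c Q t a (app q t y) = tup c Q t a' (app q t y')"
      using zw prd_map_app[OF i q t a y] prd_map_app[OF i q t a' y'] app_id[OF c t a] app_id[OF c t a'] zz ww by simp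
    then have aa: "a = a'" and qq: "app q t y = app q t y'"
      using pr1_tup[OF c O(3) t a app_mem[OF q t y]] pr1_tup[OF c O(3) t a' app_mem[OF q t y']]
        pr2_tup[OF c O(3) t a app_mem[OF q t y]] pr2_tup[OF c O(3) t a' app_mem[OF q t y']] by metis+
    have Z: "Z \<in> Obj D" using homD[OF h] by blast
    \<comment> \<open>Equality of the transposes of \<open>h\<close> at \<open>y\<close> and
      \<open>y'\<close>. The parameter \<open>a\<close> ranges over all later stages, as an element
      of an exponential does; this makes the relation stable under restriction.\<close>
    define E where "E s y y' \<longleftrightarrow> (\<forall>m\<in>into s. \<forall>a\<in>el c (Dom K m).
        app h (Dom K m) (tup c Y (Dom K m) a (res Y m y)) = app h (Dom K m) (tup c Y (Dom K m) a (res Y m y')))" for s y y'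
    have ED: "app h s (tup c Y s a y) = app h s (tup c Y s a y')" if "E s y y'" "s \<in> Obj K" "y \<in> el Y s" "y' \<in> el Y s" "a \<in> el c s" for s y y' a
      using that(1)[unfolded E_def, rule_format, of "Id K s" a] that res_id[OF O(2)] by simp
    have "presheaf_quotient K J (el Y) (res Y) E"
    proof (unfold_locales, rule el_psh[OF O(2)])
      fix m x y assume m: "m \<in> Arr K" and x: "x \<in> el Y (Cod K m)" and y: "y \<in> el Y (Cod K m)" and e: "E (Cod K m) x y"
      show "E (Dom K m) (res Y m x) (res Y m y)"
        unfolding E_def
      proof (intro ballI)
        fix n a assume n: "n \<in> into (Dom K m)" and a: "a \<in> el c (Dom K n)"
        show "app h (Dom K n) (tup c Y (Dom K n) a (res Y n (res Y m x))) = app h (Dom K n) (tup c Y (Dom K n) a (res Y n (res Y m y)))"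
          using e[unfolded E_def, rule_format, of "m \<odot> n" a] n m a x y by (simp add: res_comp[OF O(2)])
      qed
    next
      fix s x y assume s: "s \<in> Obj K" and x: "x \<in> el Y s" and y: "y \<in> el Y s"
        and cv: "cov s (\<lambda>m. E (Dom K m) (res Y m x) (res Y m y))"
      show "E s x y"
        unfolding E_def
      proof (intro ballI)
        fix m a assume "m \<in> into s" and a: "a \<in> el c (Dom K m)"
        then have m: "m \<in> Arr K" "Cod K m = s" by auto
        note d = arr_dom[OF m(1)] and xm = res_mem[OF O(2) m x] and ym = res_mem[OF O(2) m y]
        note tx = tup_mem[OF c O(2) d a xm] and ty = tup_mem[OF c O(2) d a ym]
        show "app h (Dom K m) (tup c Y (Dom K m) a (res Y m x)) = app h (Dom K m) (tup c Y (Dom K m) a (res Y m y))"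
        proof (rule el_eqI[OF Z d app_mem[OF h d tx] app_mem[OF h d ty]])
          have cm: "cov (Dom K m) (\<lambda>n. E (Dom K (m \<odot> n)) (res Y (m \<odot> n) x) (res Y (m \<odot> n) y))"
            using cov_pull[OF m(1)] cv m(2) by blast
          show "cov (Dom K m) (\<lambda>n. res Z n (app h (Dom K m) (tup c Y (Dom K m) a (res Y m x))) =
              res Z n (app h (Dom K m) (tup c Y (Dom K m) a (res Y m y))))"
          proof (rule cov_mono[OF d cm])
            fix n assume n: "n \<in> Arr K" "Cod K n = Dom K m" and "E (Dom K (m \<odot> n)) (res Y (m \<odot> n) x) (res Y (m \<odot> n) y)"
            then have e: "E (Dom K n) (res Y n (res Y m x)) (res Y n (res Y m y))"
              using m x y by (simp add: res_comp[OF O(2)])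
            have "app h (Dom K n) (tup c Y (Dom K n) (res c n a) (res Y n (res Y m x))) =
                app h (Dom K n) (tup c Y (Dom K n) (res c n a) (res Y n (res Y m y)))"
              by (rule ED[OF e arr_dom[OF n(1)] res_mem[OF O(2) n xm] res_mem[OF O(2) n ym] res_mem[OF c n a]])
            then show "res Z n (app h (Dom K m) (tup c Y (Dom K m) a (res Y m x))) =
                res Z n (app h (Dom K m) (tup c Y (Dom K m) a (res Y m y)))"
              using app_res[OF h n tx] app_res[OF h n ty] tup_res[OF c O(2) n a xm] tup_res[OF c O(2) n a ym] by simp
          qed
        qed
      qed
    qed (auto simp: E_def)
    moreover have "E s (app f s x) (app g s x)" if s: "s \<in> Obj K" and x: "x \<in> el X s" for s x
      unfolding E_def
    proof (intro ballI)
      fix m a assume "m \<in> into s" and a: "a \<in> el c (Dom K m)"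
      then have m: "m \<in> Arr K" "Cod K m = s" by auto
      note d = arr_dom[OF m(1)] and xm = res_mem[OF O(1) m x]
      note tx = tup_mem[OF c O(1) d a xm]
      show "app h (Dom K m) (tup c Y (Dom K m) a (res Y m (app f s x))) = app h (Dom K m) (tup c Y (Dom K m) a (res Y m (app g s x)))"
        using app_comp[OF F h d tx] app_comp[OF G h d tx] hh
          prd_map_app[OF i f d a xm] prd_map_app[OF i g d a xm] app_id[OF c d a] app_res[OF f m x] app_res[OF g m x]
        by simp
    qed
    ultimately have "E t y y'" by (rule coequaliser_kernel[OF cq f _ _ t y y' qq])
    then show "app h t z = app h t w" using ED[OF _ t y y' a] aa zz ww by simp
  qed
qed

end

section \<open>Group objects and actions\<close>

context sheaf_cat
begin

section \<open>Group operations on elements\<close>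

definition gmul :: "('o, 'a) group_data \<Rightarrow> 't \<Rightarrow> 'u \<Rightarrow> 'u \<Rightarrow> 'u" where
  "gmul H t x y = app (gmult H) t (tup (gobj H) (gobj H) t x y)"

definition gone :: "('o, 'a) group_data \<Rightarrow> 't \<Rightarrow> 'u" where
  "gone H t = app (gunit H) t (pt t)"

definition gin :: "('o, 'a) group_data \<Rightarrow> 't \<Rightarrow> 'u \<Rightarrow> 'u" where
  "gin H t x = app (ginv H) t x"

text \<open>Typing is separated from the laws so that membership and naturality of the operations
  are available while the laws of a new group are still to be checked.\<close>

definition group_typed :: "('o, 'a) group_data \<Rightarrow> bool" where
  "group_typed H \<longleftrightarrow> gobj H \<in> Obj D \<and> gmult H \<in> hom D (prd D (gobj H) (gobj H)) (gobj H) \<and>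
     gunit H \<in> hom D (terminal D) (gobj H) \<and> ginv H \<in> hom D (gobj H) (gobj H)"

lemma group_typedD:
  assumes "group_typed H"
  shows "gobj H \<in> Obj D" "gmult H \<in> hom D (prd D (gobj H) (gobj H)) (gobj H)"
    "gunit H \<in> hom D (terminal D) (gobj H)" "ginv H \<in> hom D (gobj H) (gobj H)"
  using assms unfolding group_typed_def by auto

lemma gmul_mem:
  assumes H: "group_typed H" and t: "t \<in> Obj K" and xy: "x \<in> el (gobj H) t" "y \<in> el (gobj H) t"
  shows "gmul H t x y \<in> el (gobj H) t"
  unfolding gmul_def
  by (rule app_mem[OF group_typedD(2)[OF H] t tup_mem[OF group_typedD(1)[OF H] group_typedD(1)[OF H] t xy]])

lemma gone_mem: "group_typed H \<Longrightarrow> t \<in> Obj K \<Longrightarrow> gone H t \<in> el (gobj H) t"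
  unfolding gone_def by (rule app_mem[OF group_typedD(3) _ pt_mem])

lemma gin_mem: "group_typed H \<Longrightarrow> t \<in> Obj K \<Longrightarrow> x \<in> el (gobj H) t \<Longrightarrow> gin H t x \<in> el (gobj H) t"
  unfolding gin_def by (rule app_mem[OF group_typedD(4)])

lemma gmul_res:
  assumes H: "group_typed H" and m: "m \<in> Arr K" "Cod K m = t" and xy: "x \<in> el (gobj H) t" "y \<in> el (gobj H) t"
  shows "res (gobj H) m (gmul H t x y) = gmul H (Dom K m) (res (gobj H) m x) (res (gobj H) m y)"
proof -
  have t: "t \<in> Obj K" using m by auto
  note G = group_typedD(1)[OF H]
  show ?thesis
    unfolding gmul_def
    using app_res[OF group_typedD(2)[OF H] m tup_mem[OF G G t xy]] tup_res[OF G G m xy] by simp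
qed

lemma gone_res:
  assumes H: "group_typed H" and m: "m \<in> Arr K" "Cod K m = t"
  shows "res (gobj H) m (gone H t) = gone H (Dom K m)"
proof -
  have t: "t \<in> Obj K" using m by auto
  have "res (terminal D) m (pt t) = pt (Dom K m)"
    by (rule pt_unique) (use m t in \<open>auto intro: res_mem pt_mem\<close>)
  then show ?thesis
    unfolding gone_def using app_res[OF group_typedD(3)[OF H] m pt_mem[OF t]] by simp
qed

lemma gin_res:
  assumes H: "group_typed H" and m: "m \<in> Arr K" "Cod K m = t" and x: "x \<in> el (gobj H) t"
  shows "res (gobj H) m (gin H t x) = gin H (Dom K m) (res (gobj H) m x)"
  unfolding gin_def using app_res[OF group_typedD(4)[OF H] m x] by simp

definition group_laws :: "('o, 'a) group_data \<Rightarrow> bool" where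
  "group_laws H \<longleftrightarrow>
     (\<forall>t\<in>Obj K. \<forall>x\<in>el (gobj H) t. \<forall>y\<in>el (gobj H) t. \<forall>z\<in>el (gobj H) t.
        gmul H t (gmul H t x y) z = gmul H t x (gmul H t y z)) \<and>
     (\<forall>t\<in>Obj K. \<forall>x\<in>el (gobj H) t. gmul H t (gone H t) x = x) \<and>
     (\<forall>t\<in>Obj K. \<forall>x\<in>el (gobj H) t. gmul H t x (gone H t) = x) \<and>
     (\<forall>t\<in>Obj K. \<forall>x\<in>el (gobj H) t. gmul H t (gin H t x) x = gone H t) \<and>
     (\<forall>t\<in>Obj K. \<forall>x\<in>el (gobj H) t. gmul H t x (gin H t x) = gone H t)"

lemma hom_eq_iff:
  assumes "f \<in> hom D X Y" "g \<in> hom D X Y"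
  shows "f = g \<longleftrightarrow> (\<forall>t\<in>Obj K. \<forall>x\<in>el X t. app f t x = app g t x)"
  using faithful[OF assms] by blast

lemma all_prd_iff:
  assumes "A \<in> Obj D" "B \<in> Obj D" "t \<in> Obj K"
  shows "(\<forall>z\<in>el (prd D A B) t. Q z) \<longleftrightarrow> (\<forall>a\<in>el A t. \<forall>b\<in>el B t. Q (tup A B t a b))"
proof
  show "\<forall>z\<in>el (prd D A B) t. Q z \<Longrightarrow> \<forall>a\<in>el A t. \<forall>b\<in>el B t. Q (tup A B t a b)"
    using tup_mem[OF assms] by simp
  assume r: "\<forall>a\<in>el A t. \<forall>b\<in>el B t. Q (tup A B t a b)"
  show "\<forall>z\<in>el (prd D A B) t. Q z"
  proof
    fix z assume "z \<in> el (prd D A B) t"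
    then obtain a b where "a \<in> el A t" "b \<in> el B t" "z = tup A B t a b" by (rule prd_elE[OF assms])
    then show "Q z" using r by simp
  qed
qed

text \<open>Each diagram is an equation of arrows, hence by faithfulness a pointwise equation, and
  the elements of the iterated products are tuples. From here on groups are handled as families of
  ordinary groups.\<close>

lemma group_object_iff: "is_group_object D H \<longleftrightarrow> group_typed H \<and> group_laws H"
proof (cases "group_typed H")
  case False
  then show ?thesis unfolding is_group_object_def group_typed_def Let_def by auto
next
  case True
  define G where "G = gobj H"
  define m where "m = gmult H"
  define GG where "GG = prd D G G"
  define x where "x = pr1 D G G \<cdot>\<^bsub>D\<^esub> pr1 D GG G"
  define y where "y = pr2 D G G \<cdot>\<^bsub>D\<^esub> pr1 D GG G"
  define z where "z = pr2 D GG G"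
  define e where "e = gunit H \<cdot>\<^bsub>D\<^esub> bang D G"
  note ty = group_typedD[OF True, folded G_def m_def]
  note G = ty(1)
  have GG: "GG \<in> Obj D" unfolding GG_def using G by simp
  note p1 = pr1_hom[OF G G, folded GG_def] and p2 = pr2_hom[OF G G, folded GG_def]
    and q1 = pr1_hom[OF GG G] and q2 = pr2_hom[OF GG G]
  note m = ty(2)[folded GG_def]
  have xh: "x \<in> hom D (prd D GG G) G" unfolding x_def by (rule D.comp_in[OF q1 p1])
  have yh: "y \<in> hom D (prd D GG G) G" unfolding y_def by (rule D.comp_in[OF q1 p2])
  have zh: "z \<in> hom D (prd D GG G) G" unfolding z_def by (rule q2)
  have eh: "e \<in> hom D G G" unfolding e_def by (rule D.comp_in[OF bang_hom[OF G] ty(3)])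
  note ih = D.id_in[OF G]
  have mh: "m \<cdot>\<^bsub>D\<^esub> pair D f g \<in> hom D X G" if "f \<in> hom D X G" "g \<in> hom D X G" for f g X
    by (rule D.comp_in[OF pair_hom[OF that, folded GG_def] m])
  have ma: "app (m \<cdot>\<^bsub>D\<^esub> pair D f g) t w = gmul H t (app f t w) (app g t w)"
    if "f \<in> hom D X G" "g \<in> hom D X G" "t \<in> Obj K" "w \<in> el X t" for f g X t w
    using app_comp[OF pair_hom[OF that(1,2), folded GG_def] m that(3,4)] pair_app[OF that]
    unfolding gmul_def G_def m_def by simp
  have ea: "app e t w = gone H t" if "t \<in> Obj K" "w \<in> el G t" for t w
    unfolding e_def gone_def using app_comp[OF bang_hom[OF G] ty(3) that] bang_app[OF G that] by simp
  have xyz: "app x t (tup GG G t (tup G G t a b) c) = a" "app y t (tup GG G t (tup G G t a b) c) = b"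
    "app z t (tup GG G t (tup G G t a b) c) = c"
    if "t \<in> Obj K" "a \<in> el G t" "b \<in> el G t" "c \<in> el G t" for t a b c
  proof -
    note u = tup_mem[OF G G that(1,2,3), folded GG_def]
    note w = tup_mem[OF GG G that(1) u that(4)]
    show "app x t (tup GG G t (tup G G t a b) c) = a"
      unfolding x_def app_comp[OF q1 p1 that(1) w] pr1_tup[OF GG G that(1) u that(4)]
      by (rule pr1_tup[OF G G that(1-3)])
    show "app y t (tup GG G t (tup G G t a b) c) = b"
      unfolding y_def app_comp[OF q1 p2 that(1) w] pr1_tup[OF GG G that(1) u that(4)]
      by (rule pr2_tup[OF G G that(1-3)])
    show "app z t (tup GG G t (tup G G t a b) c) = c"
      unfolding z_def by (rule pr2_tup[OF GG G that(1) u that(4)])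
  qed
  have "m \<cdot>\<^bsub>D\<^esub> pair D (m \<cdot>\<^bsub>D\<^esub> pair D x y) z = m \<cdot>\<^bsub>D\<^esub> pair D x (m \<cdot>\<^bsub>D\<^esub> pair D y z) \<longleftrightarrow>
      (\<forall>t\<in>Obj K. \<forall>w\<in>el (prd D GG G) t. gmul H t (gmul H t (app x t w) (app y t w)) (app z t w) =
        gmul H t (app x t w) (gmul H t (app y t w) (app z t w)))"
    by (simp add: hom_eq_iff[OF mh[OF mh[OF xh yh] zh] mh[OF xh mh[OF yh zh]]] ma[OF mh[OF xh yh] zh]
        ma[OF xh mh[OF yh zh]] ma[OF xh yh] ma[OF yh zh])
  also have "\<dots> \<longleftrightarrow> (\<forall>t\<in>Obj K. \<forall>x\<in>el G t. \<forall>y\<in>el G t. \<forall>z\<in>el G t.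
        gmul H t (gmul H t x y) z = gmul H t x (gmul H t y z))"
    using all_prd_iff[OF GG G] all_prd_iff[OF G G, folded GG_def] xyz by simp
  finally have 1: "m \<cdot>\<^bsub>D\<^esub> pair D (m \<cdot>\<^bsub>D\<^esub> pair D x y) z = m \<cdot>\<^bsub>D\<^esub> pair D x (m \<cdot>\<^bsub>D\<^esub> pair D y z) \<longleftrightarrow>
      (\<forall>t\<in>Obj K. \<forall>x\<in>el G t. \<forall>y\<in>el G t. \<forall>z\<in>el G t. gmul H t (gmul H t x y) z = gmul H t x (gmul H t y z))" .
  note ida = app_id[OF G]
  have 2: "m \<cdot>\<^bsub>D\<^esub> pair D e (Id D G) = Id D G \<longleftrightarrow> (\<forall>t\<in>Obj K. \<forall>x\<in>el G t. gmul H t (gone H t) x = x)"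
    by (simp add: hom_eq_iff[OF mh[OF eh ih] ih] ma[OF eh ih] ea ida)
  have 3: "m \<cdot>\<^bsub>D\<^esub> pair D (Id D G) e = Id D G \<longleftrightarrow> (\<forall>t\<in>Obj K. \<forall>x\<in>el G t. gmul H t x (gone H t) = x)"
    by (simp add: hom_eq_iff[OF mh[OF ih eh] ih] ma[OF ih eh] ea ida)
  have 4: "m \<cdot>\<^bsub>D\<^esub> pair D (ginv H) (Id D G) = e \<longleftrightarrow> (\<forall>t\<in>Obj K. \<forall>x\<in>el G t. gmul H t (gin H t x) x = gone H t)"
    by (simp add: hom_eq_iff[OF mh[OF ty(4) ih] eh] ma[OF ty(4) ih] ea ida gin_def)
  have 5: "m \<cdot>\<^bsub>D\<^esub> pair D (Id D G) (ginv H) = e \<longleftrightarrow> (\<forall>t\<in>Obj K. \<forall>x\<in>el G t. gmul H t x (gin H t x) = gone H t)"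
    by (simp add: hom_eq_iff[OF mh[OF ih ty(4)] eh] ma[OF ih ty(4)] ea ida gin_def)
  have "is_group_object D H \<longleftrightarrow> group_typed H \<and>
      m \<cdot>\<^bsub>D\<^esub> pair D (m \<cdot>\<^bsub>D\<^esub> pair D x y) z = m \<cdot>\<^bsub>D\<^esub> pair D x (m \<cdot>\<^bsub>D\<^esub> pair D y z) \<and>
      m \<cdot>\<^bsub>D\<^esub> pair D e (Id D G) = Id D G \<and> m \<cdot>\<^bsub>D\<^esub> pair D (Id D G) e = Id D G \<and>
      m \<cdot>\<^bsub>D\<^esub> pair D (ginv H) (Id D G) = e \<and> m \<cdot>\<^bsub>D\<^esub> pair D (Id D G) (ginv H) = e"
    unfolding is_group_object_def group_typed_def Let_def x_def y_def z_def e_def m_def GG_def G_def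
    by (simp only: conj_assoc)
  then show ?thesis unfolding 1 2 3 4 5 unfolding group_laws_def G_def .
qed

lemma group_objectD:
  assumes "is_group_object D H"
  shows group_object_typed: "group_typed H"
    and gmul_assoc: "t \<in> Obj K \<Longrightarrow> x \<in> el (gobj H) t \<Longrightarrow> y \<in> el (gobj H) t \<Longrightarrow> z \<in> el (gobj H) t \<Longrightarrow>
      gmul H t (gmul H t x y) z = gmul H t x (gmul H t y z)"
    and gmul_one_left: "t \<in> Obj K \<Longrightarrow> x \<in> el (gobj H) t \<Longrightarrow> gmul H t (gone H t) x = x"
    and gmul_one_right: "t \<in> Obj K \<Longrightarrow> x \<in> el (gobj H) t \<Longrightarrow> gmul H t x (gone H t) = x"
    and gmul_inv_left: "t \<in> Obj K \<Longrightarrow> x \<in> el (gobj H) t \<Longrightarrow> gmul H t (gin H t x) x = gone H t"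
    and gmul_inv_right: "t \<in> Obj K \<Longrightarrow> x \<in> el (gobj H) t \<Longrightarrow> gmul H t x (gin H t x) = gone H t"
  using assms unfolding group_object_iff group_laws_def by simp_all

lemma group_obj: "is_group_object D H \<Longrightarrow> gobj H \<in> Obj D"
  using group_typedD(1)[OF group_object_typed] .

lemma group_hom_iff:
  assumes G: "is_group_object D G" and H: "is_group_object D H"
  shows "group_hom D G H f \<longleftrightarrow> f \<in> hom D (gobj G) (gobj H) \<and>
    (\<forall>t\<in>Obj K. \<forall>x\<in>el (gobj G) t. \<forall>y\<in>el (gobj G) t. app f t (gmul G t x y) = gmul H t (app f t x) (app f t y))"
proof (cases "f \<in> hom D (gobj G) (gobj H)")
  case True
  note O = group_obj[OF G]
  note mG = group_typedD(2)[OF group_object_typed[OF G]] and mH = group_typedD(2)[OF group_object_typed[OF H]]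
  note ff = prd_map_hom[OF True True]
  have "f \<cdot>\<^bsub>D\<^esub> gmult G = gmult H \<cdot>\<^bsub>D\<^esub> prd_map D f f \<longleftrightarrow>
    (\<forall>t\<in>Obj K. \<forall>z\<in>el (prd D (gobj G) (gobj G)) t. app f t (app (gmult G) t z) = app (gmult H) t (app (prd_map D f f) t z))"
    by (simp add: hom_eq_iff[OF D.comp_in[OF mG True] D.comp_in[OF ff mH]] app_comp[OF mG True] app_comp[OF ff mH])
  also have "\<dots> \<longleftrightarrow> (\<forall>t\<in>Obj K. \<forall>x\<in>el (gobj G) t. \<forall>y\<in>el (gobj G) t.
      app f t (gmul G t x y) = gmul H t (app f t x) (app f t y))"
    by (simp add: all_prd_iff[OF O O] prd_map_app[OF True True] gmul_def)
  finally show ?thesis unfolding group_hom_def using True by simp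
qed (simp add: group_hom_def)

lemma group_homD:
  assumes "group_hom D G H f" "is_group_object D G" "is_group_object D H"
  shows group_hom_hom: "f \<in> hom D (gobj G) (gobj H)"
    and group_hom_mul: "t \<in> Obj K \<Longrightarrow> x \<in> el (gobj G) t \<Longrightarrow> y \<in> el (gobj G) t \<Longrightarrow>
      app f t (gmul G t x y) = gmul H t (app f t x) (app f t y)"
  using assms(1) unfolding group_hom_iff[OF assms(2,3)] by simp_all

section \<open>Elementary group theory at one stage\<close>

lemma group_idem:
  assumes H: "is_group_object D H" and t: "t \<in> Obj K" and x: "x \<in> el (gobj H) t" and xx: "gmul H t x x = x"
  shows "x = gone H t"
proof -
  note ty = group_object_typed[OF H]
  have "gone H t = gmul H t (gin H t x) (gmul H t x x)" using gmul_inv_left[OF H t x] xx by simp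
  also have "\<dots> = x"
    using gmul_assoc[OF H t gin_mem[OF ty t x] x x] gmul_inv_left[OF H t x] gmul_one_left[OF H t x] by simp
  finally show ?thesis by simp
qed

lemma group_inv_unique:
  assumes H: "is_group_object D H" and t: "t \<in> Obj K" and x: "x \<in> el (gobj H) t" and y: "y \<in> el (gobj H) t"
    and e: "gmul H t x y = gone H t"
  shows "x = gin H t y"
proof -
  note ty = group_object_typed[OF H]
  have "gin H t y = gmul H t (gmul H t x y) (gin H t y)" using e gmul_one_left[OF H t gin_mem[OF ty t y]] by simp
  also have "\<dots> = x"
    using gmul_assoc[OF H t x y gin_mem[OF ty t y]] gmul_inv_right[OF H t y] gmul_one_right[OF H t x] by simp
  finally show ?thesis by simp
qed

text \<open>\<open>group_hom\<close> asks for multiplicativity only. The unit goes to an idempotent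
  of a group, which is the unit, and inverses are unique.\<close>

lemma group_hom_one_inv:
  assumes f: "group_hom D G H f" and G: "is_group_object D G" and H: "is_group_object D H" and t: "t \<in> Obj K"
  shows group_hom_one: "app f t (gone G t) = gone H t"
    and group_hom_inv: "x \<in> el (gobj G) t \<Longrightarrow> app f t (gin G t x) = gin H t (app f t x)"
proof -
  note fh = group_hom_hom[OF f G H] and m = group_hom_mul[OF f G H t]
  note ty = group_object_typed[OF G]
  note o = gone_mem[OF ty t]
  show 1: "app f t (gone G t) = gone H t"
    by (rule group_idem[OF H t app_mem[OF fh t o]]) (simp add: m[OF o o, symmetric] gmul_one_left[OF G t o])
  show "app f t (gin G t x) = gin H t (app f t x)" if x: "x \<in> el (gobj G) t"
    by (rule group_inv_unique[OF H t app_mem[OF fh t gin_mem[OF ty t x]] app_mem[OF fh t x]])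
      (simp add: m[OF gin_mem[OF ty t x] x, symmetric] gmul_inv_left[OF G t x] 1)
qed

section \<open>Actions and their orbit congruences\<close>

lemma action_laws:
  assumes H: "is_group_object D H" and a: "is_action D H Y a"
  defines "G \<equiv> gobj H"
  shows action_obj: "Y \<in> Obj D" and action_hom: "a \<in> hom D (prd D G Y) Y"
    and action_mul: "t \<in> Obj K \<Longrightarrow> h \<in> el G t \<Longrightarrow> k \<in> el G t \<Longrightarrow> y \<in> el Y t \<Longrightarrow>
      app a t (tup G Y t (gmul H t h k) y) = app a t (tup G Y t h (app a t (tup G Y t k y)))"
    and action_one: "t \<in> Obj K \<Longrightarrow> y \<in> el Y t \<Longrightarrow> app a t (tup G Y t (gone H t) y) = y"
proof -
  define GG where "GG = prd D G G"
  define x where "x = pr1 D G G \<cdot>\<^bsub>D\<^esub> pr1 D GG Y"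
  define y where "y = pr2 D G G \<cdot>\<^bsub>D\<^esub> pr1 D GG Y"
  define z where "z = pr2 D GG Y"
  have d: "Y \<in> Obj D" "a \<in> hom D (prd D G Y) Y"
    "a \<cdot>\<^bsub>D\<^esub> pair D (gmult H \<cdot>\<^bsub>D\<^esub> pair D x y) z = a \<cdot>\<^bsub>D\<^esub> pair D x (a \<cdot>\<^bsub>D\<^esub> pair D y z)"
    "a \<cdot>\<^bsub>D\<^esub> pair D (gunit H \<cdot>\<^bsub>D\<^esub> bang D Y) (Id D Y) = Id D Y"
    using a unfolding is_action_def Let_def G_def GG_def x_def y_def z_def by blast+
  note ty = group_typedD[OF group_object_typed[OF H], folded G_def]
  note G = ty(1) and Y = d(1)
  have GG: "GG \<in> Obj D" unfolding GG_def using G by simp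
  note p1 = pr1_hom[OF G G, folded GG_def] and p2 = pr2_hom[OF G G, folded GG_def]
    and q1 = pr1_hom[OF GG Y] and q2 = pr2_hom[OF GG Y]
  have xh: "x \<in> hom D (prd D GG Y) G" unfolding x_def by (rule D.comp_in[OF q1 p1])
  have yh: "y \<in> hom D (prd D GG Y) G" unfolding y_def by (rule D.comp_in[OF q1 p2])
  have zh: "z \<in> hom D (prd D GG Y) Y" unfolding z_def by (rule q2)
  have mxy: "gmult H \<cdot>\<^bsub>D\<^esub> pair D x y \<in> hom D (prd D GG Y) G" by (rule D.comp_in[OF pair_hom[OF xh yh] ty(2)])
  have ayz: "a \<cdot>\<^bsub>D\<^esub> pair D y z \<in> hom D (prd D GG Y) Y" by (rule D.comp_in[OF pair_hom[OF yh zh] d(2)])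
  show "Y \<in> Obj D" "a \<in> hom D (prd D G Y) Y" by (rule d)+
  show "app a t (tup G Y t (gmul H t h k) v) = app a t (tup G Y t h (app a t (tup G Y t k v)))"
    if t: "t \<in> Obj K" and h: "h \<in> el G t" and k: "k \<in> el G t" and v: "v \<in> el Y t" for t h k v
  proof -
    note u = tup_mem[OF G G t h k, folded GG_def]
    note w = tup_mem[OF GG Y t u v]
    let ?w = "tup GG Y t (tup G G t h k) v"
    have xw: "app x t ?w = h"
      unfolding x_def app_comp[OF q1 p1 t w] pr1_tup[OF GG Y t u v] by (rule pr1_tup[OF G G t h k])
    have yw: "app y t ?w = k"
      unfolding y_def app_comp[OF q1 p2 t w] pr1_tup[OF GG Y t u v] by (rule pr2_tup[OF G G t h k])
    have zw: "app z t ?w = v"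
      unfolding z_def by (rule pr2_tup[OF GG Y t u v])
    have m: "app (gmult H \<cdot>\<^bsub>D\<^esub> pair D x y) t ?w = gmul H t h k"
      unfolding app_comp[OF pair_hom[OF xh yh] ty(2) t w] pair_app[OF xh yh t w] xw yw
      unfolding gmul_def G_def ..
    have n: "app (a \<cdot>\<^bsub>D\<^esub> pair D y z) t ?w = app a t (tup G Y t k v)"
      unfolding app_comp[OF pair_hom[OF yh zh] d(2) t w] pair_app[OF yh zh t w] yw zw ..
    show ?thesis
      using comp_eq_app_eq[OF d(3) pair_hom[OF mxy zh] d(2) pair_hom[OF xh ayz] d(2) t w]
      unfolding pair_app[OF mxy zh t w] pair_app[OF xh ayz t w] m n xw zw .
  qed
  show "app a t (tup G Y t (gone H t) v) = v" if t: "t \<in> Obj K" and v: "v \<in> el Y t" for t v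
  proof -
    have e: "gunit H \<cdot>\<^bsub>D\<^esub> bang D Y \<in> hom D Y G" by (rule D.comp_in[OF bang_hom[OF Y] ty(3)])
    have ev: "app (gunit H \<cdot>\<^bsub>D\<^esub> bang D Y) t v = gone H t"
      unfolding gone_def app_comp[OF bang_hom[OF Y] ty(3) t v] bang_app[OF Y t v] ..
    show ?thesis
      using comp_app_eq[OF d(4) pair_hom[OF e D.id_in[OF Y]] d(2) t v]
      unfolding pair_app[OF e D.id_in[OF Y] t v] ev app_id[OF Y t v] .
  qed
qed

text \<open>
  Two elements are identified by the image of the action iff they are locally in one orbit; this
  description makes the congruence visibly an equivalence relation.
\<close>

lemma action_effective:
  assumes H: "is_group_object D H" and a: "is_action D H Y a" and qe: "regular_epi D q"
    and rm: "mono_arr D r" and rh: "r \<in> hom D (Cod D q) (prd D Y Y)"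
    and rq: "r \<cdot>\<^bsub>D\<^esub> q = pair D a (pr2 D (gobj H) Y)"
  shows "effective D (pr1 D Y Y \<cdot>\<^bsub>D\<^esub> r) (pr2 D Y Y \<cdot>\<^bsub>D\<^esub> r)"
proof -
  define G where "G = gobj H"
  define R where "R = Cod D q"
  note Y = action_obj[OF H a] and ah = action_hom[OF H a, folded G_def]
  note amul = action_mul[OF H a, folded G_def] and aone = action_one[OF H a, folded G_def]
  note ty = group_object_typed[OF H]
  have G: "G \<in> Obj D" unfolding G_def by (rule group_obj[OF H])
  note GY = prd_obj[OF G Y] and YY = prd_obj[OF Y Y] and p2 = pr2_hom[OF G Y]
  have ph: "pair D a (pr2 D G Y) \<in> hom D (prd D G Y) (prd D Y Y)" by (rule pair_hom[OF ah p2])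
  have r: "r \<in> hom D R (prd D Y Y)" using rh R_def by simp
  have qa: "q \<in> Arr D" using qe unfolding regular_epi_def is_coequaliser_def by blast
  \<comment> \<open>The definition of action exactness leaves the domain of \<open>q\<close>
    implicit; it is read off from the equation \<open>rq\<close>.\<close>
  have q: "q \<in> hom D (prd D G Y) R"
  proof -
    have q0: "q \<in> hom D (Dom D q) R" unfolding R_def by (rule homI[OF qa])
    have "r \<cdot>\<^bsub>D\<^esub> q \<in> hom D (Dom D q) (prd D Y Y)" by (rule D.comp_in[OF q0 r])
    then have "Dom D q = prd D G Y" using ph homD unfolding rq G_def by metis
    then show ?thesis using q0 by simp
  qed
  define r1 where "r1 = pr1 D Y Y \<cdot>\<^bsub>D\<^esub> r"
  define r2 where "r2 = pr2 D Y Y \<cdot>\<^bsub>D\<^esub> r"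
  have r1: "r1 \<in> hom D R Y" unfolding r1_def by (rule D.comp_in[OF r pr1_hom[OF Y Y]])
  have r2: "r2 \<in> hom D R Y" unfolding r2_def by (rule D.comp_in[OF r pr2_hom[OF Y Y]])
  have R: "R \<in> Obj D" using homD[OF r] by blast
  have r12: "app r t z = tup Y Y t (app r1 t z) (app r2 t z)" if "t \<in> Obj K" "z \<in> el R t" for t z
    unfolding r1_def r2_def app_comp[OF r pr1_hom[OF Y Y] that] app_comp[OF r pr2_hom[OF Y Y] that]
    using prd_eta[OF Y Y that(1) app_mem[OF r that]] by simp
  have inj: "z = w" if "t \<in> Obj K" "z \<in> el R t" "w \<in> el R t" "app r1 t z = app r1 t w" "app r2 t z = app r2 t w" for t z w
    using mono_inj[OF rm r that(1-3)] r12 that by simp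
  have qr: "app r1 t (app q t (tup G Y t h y)) = app a t (tup G Y t h y) \<and> app r2 t (app q t (tup G Y t h y)) = y"
    if t: "t \<in> Obj K" and h: "h \<in> el G t" and y: "y \<in> el Y t" for t h y
  proof -
    note w = tup_mem[OF G Y t h y]
    note qw = app_mem[OF q t w]
    have e: "app r t (app q t (tup G Y t h y)) = tup Y Y t (app a t (tup G Y t h y)) y"
      using comp_app_eq[OF rq[folded G_def] q r t w] pair_app[OF ah p2 t w] pr2_tup[OF G Y t h y] by simp
    show ?thesis
      unfolding r1_def r2_def app_comp[OF r pr1_hom[OF Y Y] t qw] app_comp[OF r pr2_hom[OF Y Y] t qw] e
      using tup[OF Y Y t app_mem[OF ah t w] y] by simp
  qed
  define Orb where "Orb t x y \<longleftrightarrow> (\<exists>h\<in>el G t. x = app a t (tup G Y t h y))" for t x y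
  define E where "E t x y \<longleftrightarrow> cov t (\<lambda>m. Orb (Dom K m) (res Y m x) (res Y m y))" for t x y
  have a_res: "res Y m (app a t (tup G Y t h y)) = app a (Dom K m) (tup G Y (Dom K m) (res G m h) (res Y m y))"
    if m: "m \<in> Arr K" "Cod K m = t" and h: "h \<in> el G t" and y: "y \<in> el Y t" for m t h y
    using app_res[OF ah m tup_mem[OF G Y _ h y]] tup_res[OF G Y m h y] m by auto
  have O_res: "Orb (Dom K m) (res Y m x) (res Y m y)"
    if m: "m \<in> Arr K" "Cod K m = t" and y: "y \<in> el Y t" and o: "Orb t x y" for m t x y
    using o a_res[OF m _ y] res_mem[OF G m] unfolding Orb_def by blast
  have O_refl: "Orb t x x" if "t \<in> Obj K" "x \<in> el Y t" for t x
    unfolding Orb_def G_def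
    by (rule bexI[OF _ gone_mem[OF ty that(1)]]) (use aone[OF that] G_def in simp)
  have O_sym: "Orb t y x" if t: "t \<in> Obj K" and y: "y \<in> el Y t" and o: "Orb t x y" for t x y
  proof -
    obtain h where h: "h \<in> el G t" "x = app a t (tup G Y t h y)" using o unfolding Orb_def by blast
    have h': "gin H t h \<in> el G t" using gin_mem[OF ty t] h unfolding G_def by blast
    have "app a t (tup G Y t (gin H t h) x) = y"
      unfolding h(2) amul[OF t h' h(1) y, symmetric]
      using gmul_inv_left[OF H t, folded G_def, OF h(1)] aone[OF t y] by simp
    then show ?thesis unfolding Orb_def using h' by force
  qed
  have O_trans: "Orb t x z" if t: "t \<in> Obj K" and z: "z \<in> el Y t" and o: "Orb t x y" "Orb t y z" for t x y z
  proof -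
    obtain h where h: "h \<in> el G t" "x = app a t (tup G Y t h y)" using o(1) unfolding Orb_def by blast
    obtain k where k: "k \<in> el G t" "y = app a t (tup G Y t k z)" using o(2) unfolding Orb_def by blast
    have "gmul H t h k \<in> el G t" using gmul_mem[OF ty t] h k unfolding G_def by blast
    moreover have "x = app a t (tup G Y t (gmul H t h k) z)" using amul[OF t h(1) k(1) z] h k by simp
    ultimately show ?thesis unfolding Orb_def by blast
  qed
  \<comment> \<open>From \<open>R\<close> to orbits: \<open>q\<close> is locally surjective, so an
    element of \<open>R\<close> comes locally from a pair of a group element and a point. Back:
    local witnesses give local elements of \<open>R\<close>, and these glue since a mono is
    injective on elements and so leaves no choice.\<close>
  have E_iff: "E t x y \<longleftrightarrow> (\<exists>z\<in>el R t. app r1 t z = x \<and> app r2 t z = y)"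
    if t: "t \<in> Obj K" and x: "x \<in> el Y t" and y: "y \<in> el Y t" for t x y
  proof
    assume "\<exists>z\<in>el R t. app r1 t z = x \<and> app r2 t z = y"
    then obtain z where z: "z \<in> el R t" "app r1 t z = x" "app r2 t z = y" by blast
    show "E t x y"
      unfolding E_def
    proof (rule cov_mono[OF t locally_surjD[OF regular_epi_locally_surj[OF qe q] t z(1)]])
      fix m assume m: "m \<in> Arr K" "Cod K m = t" and "\<exists>w\<in>el (prd D G Y) (Dom K m). app q (Dom K m) w = res R m z"
      then obtain w where w: "w \<in> el (prd D G Y) (Dom K m)" "app q (Dom K m) w = res R m z" by blast
      obtain h v where h: "h \<in> el G (Dom K m)" and v: "v \<in> el Y (Dom K m)" and wt: "w = tup G Y (Dom K m) h v"
        by (rule prd_elE[OF G Y arr_dom[OF m(1)] w(1)])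
      have "res Y m x = app a (Dom K m) (tup G Y (Dom K m) h v)" "res Y m y = v"
        using qr[OF arr_dom[OF m(1)] h v] w(2) wt app_res[OF r1 m z(1)] app_res[OF r2 m z(1)] z by simp_all
      then show "Orb (Dom K m) (res Y m x) (res Y m y)" unfolding Orb_def using h by blast
    qed
  next
    assume "E t x y"
    then have c: "cov t (\<lambda>m. Orb (Dom K m) (res Y m x) (res Y m y))" unfolding E_def .
    define \<Phi> where "\<Phi> m z \<longleftrightarrow> app r1 (Dom K m) z = res Y m x \<and> app r2 (Dom K m) z = res Y m y" for m z
    have "\<exists>z\<in>el R t. (\<forall>m w. m \<in> Arr K \<longrightarrow> Cod K m = t \<longrightarrow> w \<in> el R (Dom K m) \<longrightarrow> \<Phi> m w \<longrightarrow> res R m z = w) \<and>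
        cov t (\<lambda>m. \<Phi> m (res R m z))"
    proof (rule sheaf_glue[OF el_sheaf[OF R] t])
      show "cov t (\<lambda>m. \<exists>z\<in>el R (Dom K m). \<Phi> m z)"
      proof (rule cov_mono[OF t c])
        fix m assume m: "m \<in> Arr K" "Cod K m = t" and "Orb (Dom K m) (res Y m x) (res Y m y)"
        then obtain h where h: "h \<in> el G (Dom K m)" "res Y m x = app a (Dom K m) (tup G Y (Dom K m) h (res Y m y))"
          unfolding Orb_def by blast
        note d = arr_dom[OF m(1)] and ym = res_mem[OF Y m y]
        show "\<exists>z\<in>el R (Dom K m). \<Phi> m z"
          by (rule bexI[OF _ app_mem[OF q d tup_mem[OF G Y d h(1) ym]]])
            (use qr[OF d h(1) ym] h(2) \<Phi>_def in simp)
      qed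
      show "z = z'" if "m \<in> Arr K" "z \<in> el R (Dom K m)" "z' \<in> el R (Dom K m)" "\<Phi> m z" "\<Phi> m z'" for m z z'
        by (rule inj[OF arr_dom[OF that(1)] that(2,3)]) (use that(4,5) \<Phi>_def in simp_all)
      show "\<Phi> (m \<odot> n) (res R n z)" if m: "m \<in> Arr K" "Cod K m = t" and n: "n \<in> Arr K" "Cod K n = Dom K m"
        and z: "z \<in> el R (Dom K m)" "\<Phi> m z" for m n z
        using z(2) app_res[OF r1 n z(1)] app_res[OF r2 n z(1)] res_comp[OF Y m(1) n] m n x y unfolding \<Phi>_def by simp
    qed
    then obtain z where z: "z \<in> el R t" and cz: "cov t (\<lambda>m. \<Phi> m (res R m z))" by blast
    have "app r1 t z = x"
      by (rule el_eqI[OF Y t app_mem[OF r1 t z] x], rule cov_mono[OF t cz])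
        (simp add: \<Phi>_def app_res[OF r1 _ _ z, symmetric])
    moreover have "app r2 t z = y"
      by (rule el_eqI[OF Y t app_mem[OF r2 t z] y], rule cov_mono[OF t cz])
        (simp add: \<Phi>_def app_res[OF r2 _ _ z, symmetric])
    ultimately show "\<exists>z\<in>el R t. app r1 t z = x \<and> app r2 t z = y" using z by blast
  qed
  have quot: "presheaf_quotient K J (el Y) (res Y) E"
  proof (unfold_locales, rule el_psh[OF Y])
    show "E t x x" if "t \<in> Obj K" "x \<in> el Y t" for t x
      unfolding E_def by (rule cov_all[OF that(1)]) (use O_refl res_mem[OF Y _ _ that(2)] in auto)
    show "E t y x" if t: "t \<in> Obj K" and x: "x \<in> el Y t" and y: "y \<in> el Y t" and e: "E t x y" for t x y
      using e unfolding E_def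
      by (rule cov_mono[OF t]) (rule O_sym, use res_mem[OF Y _ _ y] in auto)
    show "E t x z" if t: "t \<in> Obj K" and x: "x \<in> el Y t" and y: "y \<in> el Y t" and z: "z \<in> el Y t"
      and e: "E t x y" "E t y z" for t x y z
      unfolding E_def
    proof (rule cov_mono[OF t cov_conj[OF t e[unfolded E_def]]])
      fix m assume m: "m \<in> Arr K" "Cod K m = t"
        and o: "Orb (Dom K m) (res Y m x) (res Y m y) \<and> Orb (Dom K m) (res Y m y) (res Y m z)"
      show "Orb (Dom K m) (res Y m x) (res Y m z)"
        by (rule O_trans[OF arr_dom[OF m(1)] res_mem[OF Y m z] conjunct1[OF o] conjunct2[OF o]])
    qed
    show "E (Dom K m) (res Y m x) (res Y m y)"
      if m: "m \<in> Arr K" and x: "x \<in> el Y (Cod K m)" and y: "y \<in> el Y (Cod K m)" and e: "E (Cod K m) x y" for m x y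
      unfolding E_def
    proof (rule cov_mono[OF arr_dom[OF m] cov_pull[OF m e[unfolded E_def]]])
      fix n assume n: "n \<in> Arr K" "Cod K n = Dom K m"
        and o: "Orb (Dom K (m \<odot> n)) (res Y (m \<odot> n) x) (res Y (m \<odot> n) y)"
      show "Orb (Dom K n) (res Y n (res Y m x)) (res Y n (res Y m y))"
        using o n m by (simp add: res_comp[OF Y m n x] res_comp[OF Y m n y])
    qed
    show "E t x y" if t: "t \<in> Obj K" and x: "x \<in> el Y t" and y: "y \<in> el Y t"
      and c: "cov t (\<lambda>m. E (Dom K m) (res Y m x) (res Y m y))" for t x y
      unfolding E_def
    proof (rule cov_trans[OF t], rule cov_mono[OF t c])
      fix m assume m: "m \<in> Arr K" "Cod K m = t" and e: "E (Dom K m) (res Y m x) (res Y m y)"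
      show "cov (Dom K m) (\<lambda>n. Orb (Dom K (m \<odot> n)) (res Y (m \<odot> n) x) (res Y (m \<odot> n) y))"
      proof (rule cov_mono[OF arr_dom[OF m(1)] e[unfolded E_def]])
        fix n assume n: "n \<in> Arr K" "Cod K n = Dom K m" and o: "Orb (Dom K n) (res Y n (res Y m x)) (res Y n (res Y m y))"
        then show "Orb (Dom K (m \<odot> n)) (res Y (m \<odot> n) x) (res Y (m \<odot> n) y)"
          using m x y by (simp add: res_comp[OF Y m(1) n])
      qed
    qed
  qed
  obtain Q c where c: "c \<in> hom D Y Q" and ls: "locally_surj (el Y) (el Q) (res Q) (app c)"
    and ker: "\<And>t x y. t \<in> Obj K \<Longrightarrow> x \<in> el Y t \<Longrightarrow> y \<in> el Y t \<Longrightarrow> app c t x = app c t y \<longleftrightarrow> E t x y"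
    by (rule quotient_map[OF Y quot], rule that; (assumption | blast))
  have cr: "c \<cdot>\<^bsub>D\<^esub> r1 = c \<cdot>\<^bsub>D\<^esub> r2"
  proof (rule faithful[OF D.comp_in[OF r1 c] D.comp_in[OF r2 c]])
    fix t z assume t: "t \<in> Obj K" and z: "z \<in> el R t"
    have "E t (app r1 t z) (app r2 t z)" using E_iff[OF t app_mem[OF r1 t z] app_mem[OF r2 t z]] z by blast
    then show "app (c \<cdot>\<^bsub>D\<^esub> r1) t z = app (c \<cdot>\<^bsub>D\<^esub> r2) t z"
      using ker[OF t app_mem[OF r1 t z] app_mem[OF r2 t z]] app_comp[OF r1 c t z] app_comp[OF r2 c t z] by simp
  qed
  have "is_coequaliser D r1 r2 c"
  proof (rule coequaliserI[OF r1 r2 c cr ls])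
    fix t x y Z h assume t: "t \<in> Obj K" and x: "x \<in> el Y t" and y: "y \<in> el Y t" and e: "app c t x = app c t y"
      and h: "h \<in> hom D Y Z" "h \<cdot>\<^bsub>D\<^esub> r1 = h \<cdot>\<^bsub>D\<^esub> r2"
    have "E t x y" using ker[OF t x y] e by simp
    then obtain z where z: "z \<in> el R t" "app r1 t z = x" "app r2 t z = y" using E_iff[OF t x y] by blast
    show "app h t x = app h t y"
      using comp_eq_app_eq[OF h(2) r1 h(1) r2 h(1) t z(1)] unfolding z(2,3) .
  qed
  moreover have "is_pullback D c c r1 r2"
  proof (rule pullbackI[OF c c r1 r2 cr])
    fix t x y assume t: "t \<in> Obj K" and x: "x \<in> el Y t" and y: "y \<in> el Y t" and e: "app c t x = app c t y"
    have "E t x y" using ker[OF t x y] e by simp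
    then obtain z where z: "z \<in> el R t" "app r1 t z = x" "app r2 t z = y" using E_iff[OF t x y] by blast
    show "\<exists>!z. z \<in> el R t \<and> app r1 t z = x \<and> app r2 t z = y"
      by (rule ex1I[of _ z]) (use z inj[OF t] in auto)
  qed
  ultimately show ?thesis unfolding effective_def r1_def r2_def by blast
qed

lemma action_barr_exact: "action_barr_exact D"
  unfolding action_barr_exact_def using regular action_effective by blast

end

section \<open>Universal groups\<close>

primrec gterm_eval :: "('b \<Rightarrow> 'b \<Rightarrow> 'b) \<Rightarrow> 'b \<Rightarrow> ('b \<Rightarrow> 'b) \<Rightarrow> ('v \<Rightarrow> 'b) \<Rightarrow> 'v gterm \<Rightarrow> 'b" where
  "gterm_eval m e i \<phi> (Gen v) = \<phi> v"
| "gterm_eval m e i \<phi> Unit = e"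
| "gterm_eval m e i \<phi> (Mul x y) = m (gterm_eval m e i \<phi> x) (gterm_eval m e i \<phi> y)"
| "gterm_eval m e i \<phi> (Inv x) = i (gterm_eval m e i \<phi> x)"

context sheaf_cat
begin

section \<open>Evaluation of group terms\<close>

abbreviation gev :: "('o, 'a) group_data \<Rightarrow> 't \<Rightarrow> ('v \<Rightarrow> 'u) \<Rightarrow> 'v gterm \<Rightarrow> 'u" where
  "gev H t \<phi> w \<equiv> gterm_eval (gmul H t) (gone H t) (gin H t) \<phi> w"

lemma gev_mem:
  assumes H: "group_typed H" and t: "t \<in> Obj K" and \<phi>: "\<And>v. v \<in> A \<Longrightarrow> \<phi> v \<in> el (gobj H) t"
  shows "set_gterm w \<subseteq> A \<Longrightarrow> gev H t \<phi> w \<in> el (gobj H) t"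
  by (induction w) (simp_all add: \<phi> gmul_mem[OF H t] gone_mem[OF H t] gin_mem[OF H t])

lemma gev_res:
  assumes H: "group_typed H" and \<phi>: "natural S s (el (gobj H)) (res (gobj H)) \<phi>"
    and m: "m \<in> Arr K" "Cod K m = t"
  shows "set_gterm w \<subseteq> S t \<Longrightarrow> res (gobj H) m (gev H t (\<phi> t) w) = gev H (Dom K m) (\<phi> (Dom K m)) (map_gterm (s m) w)"
proof (induction w)
  case (Gen v)
  then show ?case using natural_res[OF \<phi> m(1), of v] m(2) by simp
next
  case Unit
  show ?case using gone_res[OF H m] by simp
next
  case (Mul x y)
  have t: "t \<in> Obj K" using m by auto
  have xy: "set_gterm x \<subseteq> S t" "set_gterm y \<subseteq> S t" using Mul.prems by auto
  note e = gev_mem[OF H t natural_mem[OF \<phi> t]]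
  show ?case using gmul_res[OF H m e[OF _ xy(1)] e[OF _ xy(2)]] Mul.IH xy by simp
next
  case (Inv x)
  have t: "t \<in> Obj K" using m by auto
  have x: "set_gterm x \<subseteq> S t" using Inv.prems by auto
  show ?case using gin_res[OF H m gev_mem[OF H t natural_mem[OF \<phi> t] x]] Inv.IH x by simp
qed

lemma gev_hom:
  assumes f: "group_hom D G H f" and G: "is_group_object D G" and H: "is_group_object D H" and t: "t \<in> Obj K"
    and \<phi>: "\<And>v. v \<in> A \<Longrightarrow> \<phi> v \<in> el (gobj G) t" and \<psi>: "\<And>v. v \<in> A \<Longrightarrow> app f t (\<phi> v) = \<psi> v"
  shows "set_gterm w \<subseteq> A \<Longrightarrow> app f t (gev G t \<phi> w) = gev H t \<psi> w"
proof (induction w)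
  case (Mul x y)
  then show ?case
    using group_hom_mul[OF f G H t, of "gev G t \<phi> x" "gev G t \<phi> y"] gev_mem[OF group_object_typed[OF G] t, of A \<phi>] \<phi>
    by simp
next
  case (Inv x)
  then show ?case
    using group_hom_inv[OF f G H t, of "gev G t \<phi> x"] gev_mem[OF group_object_typed[OF G] t, of A \<phi>] \<phi> by simp
qed (simp_all add: \<psi> group_hom_one[OF f G H t])

text \<open>The internal statement that the subgroup generated by the values of
  \<open>\<kappa>\<close> is all of \<open>G\<close>, expressed through terms without forming
  subgroups.\<close>

definition locally_generates ::
  "('t \<Rightarrow> 'v set) \<Rightarrow> ('o, 'a) group_data \<Rightarrow> ('t \<Rightarrow> 'v \<Rightarrow> 'u) \<Rightarrow> bool" where
  "locally_generates S G \<kappa> \<longleftrightarrow> locally_surj (\<lambda>t. {w. set_gterm w \<subseteq> S t}) (el (gobj G)) (res (gobj G))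
     (\<lambda>t w. gev G t (\<kappa> t) w)"

text \<open>Homomorphisms that agree on generators agree on the values of terms, hence locally
  everywhere. This gives uniqueness in all universal properties of groups below.\<close>

lemma group_hom_cancel:
  assumes G: "is_group_object D G" and L: "is_group_object D L" and f: "group_hom D G L f" and g: "group_hom D G L g"
    and gen: "locally_generates S G \<kappa>" and \<kappa>: "natural S s (el (gobj G)) (res (gobj G)) \<kappa>"
    and eq: "\<And>t x. t \<in> Obj K \<Longrightarrow> x \<in> S t \<Longrightarrow> app f t (\<kappa> t x) = app g t (\<kappa> t x)"
  shows "f = g"
proof (rule locally_surj_cancel[OF group_hom_hom[OF f G L] group_hom_hom[OF g G L] gen[unfolded locally_generates_def]])
  fix t w assume t: "t \<in> Obj K" and "w \<in> {w. set_gterm w \<subseteq> S t}"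
  then have w: "set_gterm w \<subseteq> S t" by simp
  note k = natural_mem[OF \<kappa> t]
  show "app f t (gev G t (\<kappa> t) w) = app g t (gev G t (\<kappa> t) w)"
    using gev_hom[OF f G L t k refl w] gev_hom[OF g G L t k eq[OF t, symmetric] w] by simp
qed

text \<open>
  The group generated by \<open>S\<close> subject to all relations that hold in every test group of \<open>\<T>\<close>:
  group terms, identified when all tests agree on them, and sheafified.  Taking relations to be
  what the tests see makes both the group axioms and the universal property immediate.
\<close>

lemma universal_group:
  fixes S :: "'t \<Rightarrow> 'v set"
  assumes S: "psh S s" and sm: "bounded S"
    and tests: "\<And>L \<phi>. (L, \<phi>) \<in> \<T> \<Longrightarrow> is_group_object D L"
      "\<And>L \<phi>. (L, \<phi>) \<in> \<T> \<Longrightarrow> natural S s (el (gobj L)) (res (gobj L)) \<phi>"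
  obtains G \<kappa> where "is_group_object D G" "natural S s (el (gobj G)) (res (gobj G)) \<kappa>"
    "locally_generates S G \<kappa>"
    "\<And>t w w'. t \<in> Obj K \<Longrightarrow> set_gterm w \<subseteq> S t \<Longrightarrow> set_gterm w' \<subseteq> S t \<Longrightarrow>
      (\<And>L \<phi>. (L, \<phi>) \<in> \<T> \<Longrightarrow> gev L t (\<phi> t) w = gev L t (\<phi> t) w') \<Longrightarrow> gev G t (\<kappa> t) w = gev G t (\<kappa> t) w'"
    "\<And>L \<phi>. (L, \<phi>) \<in> \<T> \<Longrightarrow> \<exists>f. group_hom D G L f \<and> (\<forall>t\<in>Obj K. \<forall>x\<in>S t. app f t (\<kappa> t x) = \<phi> t x)"
proof -
  define P where "P t = {w. set_gterm w \<subseteq> S t}" for t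
  define r where "r m = map_gterm (s m)" for m
  define E where "E t w w' \<longleftrightarrow> (\<forall>(L, \<phi>)\<in>\<T>. gev L t (\<phi> t) w = gev L t (\<phi> t) w')" for t w w'
  have P [simp]: "w \<in> P t \<longleftrightarrow> set_gterm w \<subseteq> S t" for w t unfolding P_def by simp
  have ED: "gev L t (\<phi> t) w = gev L t (\<phi> t) w'" if "E t w w'" "(L, \<phi>) \<in> \<T>" for t w w' L \<phi>
    using that unfolding E_def by blast
  have EI: "E t w w'" if "\<And>L \<phi>. (L, \<phi>) \<in> \<T> \<Longrightarrow> gev L t (\<phi> t) w = gev L t (\<phi> t) w'" for t w w'
    using that unfolding E_def by blast
  have Lt: "group_typed L" if "(L, \<phi>) \<in> \<T>" for L \<phi> using group_object_typed[OF tests(1)[OF that]] .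
  have LO: "gobj L \<in> Obj D" if "(L, \<phi>) \<in> \<T>" for L \<phi> using group_obj[OF tests(1)[OF that]] .
  have Lm: "gev L t (\<phi> t) w \<in> el (gobj L) t" if "(L, \<phi>) \<in> \<T>" "t \<in> Obj K" "w \<in> P t" for L \<phi> t w
    by (rule gev_mem[OF Lt[OF that(1)] that(2) natural_mem[OF tests(2)[OF that(1)] that(2)], of "S t"]) (use that(3) in simp_all)
  have Lr: "gev L (Dom K m) (\<phi> (Dom K m)) (r m w) = res (gobj L) m (gev L t (\<phi> t) w)"
    if "(L, \<phi>) \<in> \<T>" "m \<in> Arr K" "Cod K m = t" "w \<in> P t" for L \<phi> m t w
    unfolding r_def by (rule gev_res[OF Lt[OF that(1)] tests(2)[OF that(1)] that(2,3), symmetric]) (use that(4) in simp)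
  have p: "psh P r"
    unfolding psh_def
  proof (intro conjI ballI impI)
    show "r m w \<in> P (Dom K m)" if m: "m \<in> Arr K" and w: "w \<in> P (Cod K m)" for m w
      using psh_mem[OF S m] w by (auto simp: r_def gterm.set_map)
    show "r (Id K t) w = w" if t: "t \<in> Obj K" and w: "w \<in> P t" for t w
      unfolding r_def by (rule gterm.map_ident_strong) (use psh_id[OF S t] w in auto)
    show "r (m \<odot> n) w = r n (r m w)"
      if "m \<in> Arr K" "n \<in> Arr K" "Cod K n = Dom K m" and w: "w \<in> P (Cod K m)" for m n w
      unfolding r_def gterm.map_comp
      by (rule gterm.map_cong0) (use psh_comp[OF S that(1-3)] w in auto)
  qed
  have q: "presheaf_quotient K J P r E"
  proof (unfold_locales, rule p)
    show "E t w w" for t w by (rule EI) simp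
    show "E t w' w" if "E t w w'" for t w w' by (rule EI) (use ED[OF that] in simp)
    show "E t w w''" if "E t w w'" "E t w' w''" for t w w' w'' by (rule EI) (use ED[OF that(1)] ED[OF that(2)] in simp)
    show "E (Dom K m) (r m w) (r m w')"
      if m: "m \<in> Arr K" and w: "w \<in> P (Cod K m)" "w' \<in> P (Cod K m)" "E (Cod K m) w w'" for m w w'
      by (rule EI) (simp add: Lr[OF _ m refl w(1)] Lr[OF _ m refl w(2)] ED[OF w(3)])
    show "E t w w'" if t: "t \<in> Obj K" and w: "w \<in> P t" "w' \<in> P t"
      and c: "cov t (\<lambda>m. E (Dom K m) (r m w) (r m w'))" for t w w'
    proof (rule EI)
      fix L \<phi> assume L: "(L, \<phi>) \<in> \<T>"
      show "gev L t (\<phi> t) w = gev L t (\<phi> t) w'"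
      proof (rule el_eqI[OF LO[OF L] t Lm[OF L t w(1)] Lm[OF L t w(2)]], rule cov_mono[OF t c])
        fix m assume m: "m \<in> Arr K" "Cod K m = t" and e: "E (Dom K m) (r m w) (r m w')"
        show "res (gobj L) m (gev L t (\<phi> t) w) = res (gobj L) m (gev L t (\<phi> t) w')"
          unfolding Lr[OF L m w(1), symmetric] Lr[OF L m w(2), symmetric] by (rule ED[OF e L])
      qed
    qed
  qed
  have smP: "bounded P" unfolding P_def by (rule bounded_family_gterms[OF universe sm])
  obtain X \<eta> where X: "X \<in> Obj D" and \<eta>: "natural P r (el X) (res X) \<eta>" and ls: "locally_surj P (el X) (res X) \<eta>"
    and ker: "\<And>t x y. t \<in> Obj K \<Longrightarrow> x \<in> P t \<Longrightarrow> y \<in> P t \<Longrightarrow> \<eta> t x = \<eta> t y \<longleftrightarrow> E t x y"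
    by (rule quotient_exists[OF q smP]; (assumption | (rule that; (assumption | blast))))
  have \<eta>m: "\<eta> t w \<in> el X t" if "t \<in> Obj K" "w \<in> P t" for t w using natural_mem[OF \<eta> that] .
  have \<eta>r: "\<eta> (Dom K m) (r m w) = res X m (\<eta> t w)" if "m \<in> Arr K" "Cod K m = t" "w \<in> P t" for m t w
    using natural_res[OF \<eta> that(1)] that by simp
  have \<eta>E: "\<eta> t w = \<eta> t w'" if "t \<in> Obj K" "w \<in> P t" "w' \<in> P t"
    "\<And>L \<phi>. (L, \<phi>) \<in> \<T> \<Longrightarrow> gev L t (\<phi> t) w = gev L t (\<phi> t) w'" for t w w'
  proof -
    have "E t w w'" by (rule EI) (rule that(4))
    then show ?thesis using ker[OF that(1-3)] by simp
  qed
  have \<eta>L: "gev L t (\<phi> t) w = gev L t (\<phi> t) w'" if "t \<in> Obj K" "w \<in> P t" "w' \<in> P t" "\<eta> t w = \<eta> t w'" "(L, \<phi>) \<in> \<T>" for L \<phi> t w w'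
    using ker[OF that(1-3)] ED[OF _ that(5)] that(4) by simp
  have rU: "r m Unit = Unit" "r m (Mul w w') = Mul (r m w) (r m w')" "r m (Inv w) = Inv (r m w)" for m w w'
    unfolding r_def by simp_all
  \<comment> \<open>Multiplication has to descend in both variables at once. Pairs of terms map
    locally surjectively onto pairs of elements, because two covers have a common
    refinement.\<close>
  define PP where "PP t = P t \<times> P t" for t
  define rr where "rr m = map_prod (r m) (r m)" for m
  have PP [simp]: "(w, w') \<in> PP t \<longleftrightarrow> w \<in> P t \<and> w' \<in> P t" for w w' t unfolding PP_def by auto
  have rr [simp]: "rr m (w, w') = (r m w, r m w')" for m w w' unfolding rr_def by simp
  have ppsh: "psh PP rr"
    unfolding psh_def
  proof (intro conjI ballI impI)
    show "rr m z \<in> PP (Dom K m)" if "m \<in> Arr K" "z \<in> PP (Cod K m)" for m z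
      using that psh_mem[OF p that(1)] by (cases z) (simp del: P)
    show "rr (Id K t) z = z" if "t \<in> Obj K" "z \<in> PP t" for t z
      using that psh_id[OF p that(1)] by (cases z) (simp del: P)
    show "rr (m \<odot> n) z = rr n (rr m z)" if "m \<in> Arr K" "n \<in> Arr K" "Cod K n = Dom K m" "z \<in> PP (Cod K m)" for m n z
      using that psh_comp[OF p that(1-3)] by (cases z) (simp del: P)
  qed
  define \<eta>2 where "\<eta>2 t z = tup X X t (\<eta> t (fst z)) (\<eta> t (snd z))" for t z
  note XX = prd_obj[OF X X]
  have n2: "natural PP rr (el (prd D X X)) (res (prd D X X)) \<eta>2"
    unfolding natural_def
  proof (intro conjI ballI)
    show "\<eta>2 t z \<in> el (prd D X X) t" if t: "t \<in> Obj K" and z: "z \<in> PP t" for t z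
      unfolding \<eta>2_def using z \<eta>m[OF t] by (cases z) (simp del: P add: tup_mem[OF X X t])
    show "\<eta>2 (Dom K m) (rr m z) = res (prd D X X) m (\<eta>2 (Cod K m) z)" if m: "m \<in> Arr K" and z: "z \<in> PP (Cod K m)" for m z
      unfolding \<eta>2_def using z \<eta>m[OF arr_cod[OF m]] \<eta>r[OF m refl] tup_res[OF X X m refl] by (cases z) (simp del: P)
  qed
  have both: "cov t (\<lambda>m. \<exists>w\<in>P (Dom K m). \<exists>w'\<in>P (Dom K m). \<eta> (Dom K m) w = res X m x \<and> \<eta> (Dom K m) w' = res X m y)"
    if t: "t \<in> Obj K" and x: "x \<in> el X t" and y: "y \<in> el X t" for t x y
    by (rule cov_mono[OF t cov_conj[OF t locally_surjD[OF ls t x] locally_surjD[OF ls t y]]]) blast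
  have ls2: "locally_surj PP (el (prd D X X)) (res (prd D X X)) \<eta>2"
    unfolding locally_surj_def
  proof (intro ballI)
    fix t z assume t: "t \<in> Obj K" and z: "z \<in> el (prd D X X) t"
    obtain x y where xy: "x \<in> el X t" "y \<in> el X t" "z = tup X X t x y" by (rule prd_elE[OF X X t z])
    show "cov t (\<lambda>m. \<exists>v\<in>PP (Dom K m). \<eta>2 (Dom K m) v = res (prd D X X) m z)"
    proof (rule cov_mono[OF t both[OF t xy(1,2)]])
      fix m assume m: "m \<in> Arr K" "Cod K m = t"
        and "\<exists>w\<in>P (Dom K m). \<exists>w'\<in>P (Dom K m). \<eta> (Dom K m) w = res X m x \<and> \<eta> (Dom K m) w' = res X m y"
      then obtain w w' where w: "w \<in> P (Dom K m)" "w' \<in> P (Dom K m)" "\<eta> (Dom K m) w = res X m x" "\<eta> (Dom K m) w' = res X m y"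
        by blast
      show "\<exists>v\<in>PP (Dom K m). \<eta>2 (Dom K m) v = res (prd D X X) m z"
        by (rule bexI[of _ "(w, w')"]) (use w xy(3) tup_res[OF X X m xy(1,2)] \<eta>2_def in \<open>simp_all del: P\<close>)
    qed
  qed
  have tup_inj: "a = c \<and> b = d" if "t \<in> Obj K" "a \<in> el X t" "b \<in> el X t" "c \<in> el X t" "d \<in> el X t" "tup X X t a b = tup X X t c d" for t a b c d
    using tup[OF X X that(1-3)] tup[OF X X that(1,4,5)] that(6) by metis
  have nm: "natural PP rr (el X) (res X) (\<lambda>t z. \<eta> t (Mul (fst z) (snd z)))"
    unfolding natural_def
  proof (intro conjI ballI)
    show "\<eta> t (Mul (fst z) (snd z)) \<in> el X t" if t: "t \<in> Obj K" and z: "z \<in> PP t" for t z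
      using z by (cases z) (auto intro: \<eta>m[OF t])
    show "\<eta> (Dom K m) (Mul (fst (rr m z)) (snd (rr m z))) = res X m (\<eta> (Cod K m) (Mul (fst z) (snd z)))"
      if m: "m \<in> Arr K" and z: "z \<in> PP (Cod K m)" for m z
      using z \<eta>r[OF m refl, of "Mul (fst z) (snd z)"] rU(2) by (cases z) simp
  qed
  \<comment> \<open>\<open>E\<close> is a congruence for the formal product since evaluation in each
    test turns it into the product of the test group.\<close>
  have kerm: "\<eta> t (Mul (fst z) (snd z)) = \<eta> t (Mul (fst z') (snd z'))"
    if t: "t \<in> Obj K" and z: "z \<in> PP t" "z' \<in> PP t" "\<eta>2 t z = \<eta>2 t z'" for t z z'
  proof -
    have z1: "fst z \<in> P t" "snd z \<in> P t" "fst z' \<in> P t" "snd z' \<in> P t" using z unfolding PP_def by auto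
    have e: "\<eta> t (fst z) = \<eta> t (fst z')" "\<eta> t (snd z) = \<eta> t (snd z')"
      using tup_inj[OF t \<eta>m[OF t z1(1)] \<eta>m[OF t z1(2)] \<eta>m[OF t z1(3)] \<eta>m[OF t z1(4)]] z(3) unfolding \<eta>2_def by simp_all
    show ?thesis
      by (rule \<eta>E[OF t]) (use z1 \<eta>L[OF t z1(1,3) e(1)] \<eta>L[OF t z1(2,4) e(2)] in simp_all)
  qed
  obtain mu where mu: "mu \<in> hom D (prd D X X) X"
    and mu2: "\<And>t z. t \<in> Obj K \<Longrightarrow> z \<in> PP t \<Longrightarrow> app mu t (\<eta>2 t z) = \<eta> t (Mul (fst z) (snd z))"
    by (rule descend[OF XX X ppsh n2 ls2 nm kerm]; (assumption | (rule that; (assumption | blast))))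
  have ni: "natural P r (el X) (res X) (\<lambda>t w. \<eta> t (Inv w))"
    unfolding natural_def
  proof (intro conjI ballI)
    show "\<eta> t (Inv w) \<in> el X t" if "t \<in> Obj K" "w \<in> P t" for t w using \<eta>m that by simp
    show "\<eta> (Dom K m) (Inv (r m w)) = res X m (\<eta> (Cod K m) (Inv w))" if m: "m \<in> Arr K" and w: "w \<in> P (Cod K m)" for m w
      using \<eta>r[OF m refl, of "Inv w"] w rU(3) by simp
  qed
  have keri: "\<eta> t (Inv w) = \<eta> t (Inv w')" if t: "t \<in> Obj K" and w: "w \<in> P t" "w' \<in> P t" "\<eta> t w = \<eta> t w'" for t w w'
    by (rule \<eta>E[OF t]) (use w \<eta>L[OF t w] in simp_all)
  obtain iv where iv: "iv \<in> hom D X X" and iv2: "\<And>t w. t \<in> Obj K \<Longrightarrow> w \<in> P t \<Longrightarrow> app iv t (\<eta> t w) = \<eta> t (Inv w)"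
    by (rule descend[OF X X p \<eta> ls ni keri]; (assumption | (rule that; (assumption | blast))))
  \<comment> \<open>The unit needs no descent: it is a constant natural family on the terminal
    object, so fullness suffices.\<close>
  have ne: "natural (el (terminal D)) (res (terminal D)) (el X) (res X) (\<lambda>t _. \<eta> t Unit)"
    unfolding natural_def
  proof (intro conjI ballI)
    show "\<eta> t Unit \<in> el X t" if "t \<in> Obj K" for t using \<eta>m that by simp
    show "\<eta> (Dom K m) Unit = res X m (\<eta> (Cod K m) Unit)" if m: "m \<in> Arr K" for m
      using \<eta>r[OF m refl, of Unit] rU(1) by simp
  qed
  obtain un where un: "un \<in> hom D (terminal D) X" and un2: "\<forall>t\<in>Obj K. \<forall>x\<in>el (terminal D) t. app un t x = \<eta> t Unit"
    using full[OF terminal_obj X ne] by blast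
  define G where "G = \<lparr>gobj = X, gmult = mu, gunit = un, ginv = iv\<rparr>"
  have Gs: "gobj G = X" "gmult G = mu" "gunit G = un" "ginv G = iv" unfolding G_def by simp_all
  have Gt: "group_typed G" unfolding group_typed_def Gs using X mu un iv by simp
  have gm: "gmul G t (\<eta> t w) (\<eta> t w') = \<eta> t (Mul w w')" if "t \<in> Obj K" "w \<in> P t" "w' \<in> P t" for t w w'
    using mu2[OF that(1), of "(w, w')"] that unfolding gmul_def Gs \<eta>2_def by simp
  have go: "gone G t = \<eta> t Unit" if "t \<in> Obj K" for t
    using un2 pt_mem that unfolding gone_def Gs by simp
  have gi: "gin G t (\<eta> t w) = \<eta> t (Inv w)" if "t \<in> Obj K" "w \<in> P t" for t w
    using iv2[OF that] unfolding gin_def Gs .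
  note gr = gmul_res[OF Gt, unfolded Gs] gone_res[OF Gt, unfolded Gs] gin_res[OF Gt, unfolded Gs]
  note gme = gmul_mem[OF Gt, unfolded Gs] and goe = gone_mem[OF Gt, unfolded Gs] and gie = gin_mem[OF Gt, unfolded Gs]
  have laws: "group_laws G"
    unfolding group_laws_def Gs
  proof (intro conjI ballI)
    fix t x y z assume t: "t \<in> Obj K" and x: "x \<in> el X t" and y: "y \<in> el X t" and z: "z \<in> el X t"
    note xy = gme[OF t x y] and yz = gme[OF t y z]
    show "gmul G t (gmul G t x y) z = gmul G t x (gmul G t y z)"
    proof (rule el_eqI[OF X t gme[OF t xy z] gme[OF t x yz]],
        rule cov_mono[OF t cov_conj[OF t both[OF t x y] locally_surjD[OF ls t z]]])
      fix m assume m: "m \<in> Arr K" "Cod K m = t"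
        and "(\<exists>w\<in>P (Dom K m). \<exists>w'\<in>P (Dom K m). \<eta> (Dom K m) w = res X m x \<and> \<eta> (Dom K m) w' = res X m y) \<and>
          (\<exists>w\<in>P (Dom K m). \<eta> (Dom K m) w = res X m z)"
      then obtain a b c where a: "a \<in> P (Dom K m)" "\<eta> (Dom K m) a = res X m x"
        and b: "b \<in> P (Dom K m)" "\<eta> (Dom K m) b = res X m y" and c: "c \<in> P (Dom K m)" "\<eta> (Dom K m) c = res X m z" by blast
      note d = arr_dom[OF m(1)]
      have ab: "Mul a b \<in> P (Dom K m)" "Mul b c \<in> P (Dom K m)" using a b c by simp_all
      \<comment> \<open>Locally the three elements are classes of terms, and associativity of terms
        holds in every test because each test is a group.\<close>
      have "\<eta> (Dom K m) (Mul (Mul a b) c) = \<eta> (Dom K m) (Mul a (Mul b c))"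
      proof (rule \<eta>E[OF d])
        fix L \<phi> assume L: "(L, \<phi>) \<in> \<T>"
        show "gev L (Dom K m) (\<phi> (Dom K m)) (Mul (Mul a b) c) = gev L (Dom K m) (\<phi> (Dom K m)) (Mul a (Mul b c))"
          using gmul_assoc[OF tests(1)[OF L] d Lm[OF L d a(1)] Lm[OF L d b(1)] Lm[OF L d c(1)]] by simp
      qed (use a b c in simp_all)
      then show "res X m (gmul G t (gmul G t x y) z) = res X m (gmul G t x (gmul G t y z))"
        unfolding gr(1)[OF m xy z] gr(1)[OF m x y] gr(1)[OF m x yz] gr(1)[OF m y z] a(2)[symmetric] b(2)[symmetric] c(2)[symmetric]
        using gm[OF d a(1) b(1)] gm[OF d b(1) c(1)] gm[OF d ab(1) c(1)] gm[OF d a(1) ab(2)] by simp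
    qed
  next
    fix t x assume t: "t \<in> Obj K" and x: "x \<in> el X t"
    note o = goe[OF t] and i = gie[OF t x]
    \<comment> \<open>Scheme for the laws in one variable: both sides are natural operations
      computed on classes by the term operations \<open>lw\<close> and \<open>rw\<close>, which
      evaluate equally in every test.\<close>
    have law: "lhs t x = rhs t x"
      if mem: "lhs t x \<in> el X t" "rhs t x \<in> el X t"
        and lr: "\<And>m. m \<in> Arr K \<Longrightarrow> Cod K m = t \<Longrightarrow> res X m (lhs t x) = lhs (Dom K m) (res X m x)"
          "\<And>m. m \<in> Arr K \<Longrightarrow> Cod K m = t \<Longrightarrow> res X m (rhs t x) = rhs (Dom K m) (res X m x)"
        and lw: "\<And>s w. s \<in> Obj K \<Longrightarrow> w \<in> P s \<Longrightarrow> lhs s (\<eta> s w) = \<eta> s (lw w)" "\<And>s w. s \<in> Obj K \<Longrightarrow> w \<in> P s \<Longrightarrow> rhs s (\<eta> s w) = \<eta> s (rw w)"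
          "\<And>s w. w \<in> P s \<Longrightarrow> lw w \<in> P s" "\<And>s w. w \<in> P s \<Longrightarrow> rw w \<in> P s"
        and L: "\<And>L \<phi> s w. (L, \<phi>) \<in> \<T> \<Longrightarrow> s \<in> Obj K \<Longrightarrow> w \<in> P s \<Longrightarrow> gev L s (\<phi> s) (lw w) = gev L s (\<phi> s) (rw w)"
      for lhs rhs lw rw
    proof (rule el_eqI[OF X t mem], rule cov_mono[OF t locally_surjD[OF ls t x]])
      fix m assume m: "m \<in> Arr K" "Cod K m = t" and "\<exists>w\<in>P (Dom K m). \<eta> (Dom K m) w = res X m x"
      then obtain w where w: "w \<in> P (Dom K m)" "\<eta> (Dom K m) w = res X m x" by blast
      note d = arr_dom[OF m(1)]
      have "\<eta> (Dom K m) (lw w) = \<eta> (Dom K m) (rw w)"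
        by (rule \<eta>E[OF d lw(3)[OF w(1)] lw(4)[OF w(1)]]) (rule L[OF _ d w(1)])
      then show "res X m (lhs t x) = res X m (rhs t x)"
        unfolding lr(1)[OF m] lr(2)[OF m] w(2)[symmetric] lw(1)[OF d w(1)] lw(2)[OF d w(1)] .
    qed
    have UP: "Unit \<in> P s" for s by simp
    show "gmul G t (gone G t) x = x"
    proof (rule law[of "\<lambda>t x. gmul G t (gone G t) x" "\<lambda>t x. x" "\<lambda>w. Mul Unit w" "\<lambda>w. w"])
      show "gev L s (\<phi> s) (Mul Unit w) = gev L s (\<phi> s) w" if "(L, \<phi>) \<in> \<T>" "s \<in> Obj K" "w \<in> P s" for L \<phi> s w
        using gmul_one_left[OF tests(1)[OF that(1)] that(2) Lm[OF that]] by simp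
    qed (use gme[OF t o x] x gr(1)[OF _ _ o x] gr(2) gm[OF _ UP] go in simp_all)
    show "gmul G t x (gone G t) = x"
    proof (rule law[of "\<lambda>t x. gmul G t x (gone G t)" "\<lambda>t x. x" "\<lambda>w. Mul w Unit" "\<lambda>w. w"])
      show "gev L s (\<phi> s) (Mul w Unit) = gev L s (\<phi> s) w" if "(L, \<phi>) \<in> \<T>" "s \<in> Obj K" "w \<in> P s" for L \<phi> s w
        using gmul_one_right[OF tests(1)[OF that(1)] that(2) Lm[OF that]] by simp
    qed (use gme[OF t x o] x gr(1)[OF _ _ x o] gr(2) gm[OF _ _ UP] go in simp_all)
    show "gmul G t (gin G t x) x = gone G t"
    proof (rule law[of "\<lambda>t x. gmul G t (gin G t x) x" "\<lambda>t x. gone G t" "\<lambda>w. Mul (Inv w) w" "\<lambda>w. Unit"])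
      show "gev L s (\<phi> s) (Mul (Inv w) w) = gev L s (\<phi> s) Unit" if "(L, \<phi>) \<in> \<T>" "s \<in> Obj K" "w \<in> P s" for L \<phi> s w
        using gmul_inv_left[OF tests(1)[OF that(1)] that(2) Lm[OF that]] by simp
      show "gmul G s (gin G s (\<eta> s w)) (\<eta> s w) = \<eta> s (Mul (Inv w) w)" if "s \<in> Obj K" "w \<in> P s" for s w
        using gi[OF that] gm[OF that(1), of "Inv w" w] that by simp
    qed (use gme[OF t i x] o gr(1)[OF _ _ i x] gr(2) gr(3)[OF _ _ x] go in simp_all)
    show "gmul G t x (gin G t x) = gone G t"
    proof (rule law[of "\<lambda>t x. gmul G t x (gin G t x)" "\<lambda>t x. gone G t" "\<lambda>w. Mul w (Inv w)" "\<lambda>w. Unit"])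
      show "gev L s (\<phi> s) (Mul w (Inv w)) = gev L s (\<phi> s) Unit" if "(L, \<phi>) \<in> \<T>" "s \<in> Obj K" "w \<in> P s" for L \<phi> s w
        using gmul_inv_right[OF tests(1)[OF that(1)] that(2) Lm[OF that]] by simp
      show "gmul G s (\<eta> s w) (gin G s (\<eta> s w)) = \<eta> s (Mul w (Inv w))" if "s \<in> Obj K" "w \<in> P s" for s w
        using gi[OF that] gm[OF that(1), of w "Inv w"] that by simp
    qed (use gme[OF t x i] o gr(1)[OF _ _ x i] gr(2) gr(3)[OF _ _ x] go in simp_all)
  qed
  have Gg: "is_group_object D G" unfolding group_object_iff using Gt laws by blast
  define \<kappa> where "\<kappa> t v = \<eta> t (Gen v)" for t v
  have \<kappa>: "natural S s (el (gobj G)) (res (gobj G)) \<kappa>"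
    unfolding natural_def Gs \<kappa>_def
  proof (intro conjI ballI)
    show "\<eta> t (Gen v) \<in> el X t" if "t \<in> Obj K" "v \<in> S t" for t v by (rule \<eta>m) (use that in simp_all)
    show "\<eta> (Dom K m) (Gen (s m v)) = res X m (\<eta> (Cod K m) (Gen v))" if "m \<in> Arr K" "v \<in> S (Cod K m)" for m v
      using \<eta>r[OF that(1) refl, of "Gen v"] that unfolding r_def by simp
  qed
  \<comment> \<open>Evaluating a term at the generators is taking its class. Local surjectivity of
    \<open>\<eta>\<close> thereby becomes local generation, and equality of classes becomes equality
    of values.\<close>
  have ev: "set_gterm w \<subseteq> S t \<Longrightarrow> gev G t (\<kappa> t) w = \<eta> t w" if t: "t \<in> Obj K" for t w
    by (induction w) (simp_all add: \<kappa>_def go[OF t] gm[OF t] gi[OF t])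
  show ?thesis
  proof (rule that[OF Gg \<kappa>])
    show "locally_generates S G \<kappa>"
      unfolding locally_generates_def Gs P_def[symmetric]
      by (rule locally_surj_cong[OF ls]) (simp add: ev)
    show "gev G t (\<kappa> t) w = gev G t (\<kappa> t) w'"
      if "t \<in> Obj K" "set_gterm w \<subseteq> S t" "set_gterm w' \<subseteq> S t"
        "\<And>L \<phi>. (L, \<phi>) \<in> \<T> \<Longrightarrow> gev L t (\<phi> t) w = gev L t (\<phi> t) w'" for t w w'
      unfolding ev[OF that(1,2)] ev[OF that(1,3)] by (rule \<eta>E[OF that(1)]) (use that in simp_all)
    fix L \<phi> assume L: "(L, \<phi>) \<in> \<T>"
    note LO = LO[OF L] and Lg = tests(1)[OF L]
    \<comment> \<open>Evaluation in a test group respects \<open>E\<close> by the very definition of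
      \<open>E\<close>, so it descends along \<open>\<eta>\<close>; the arrow obtained is the
      required homomorphism.\<close>
    have nL: "natural P r (el (gobj L)) (res (gobj L)) (\<lambda>t w. gev L t (\<phi> t) w)"
      unfolding natural_def using Lm[OF L] Lr[OF L _ refl] by simp
    obtain f where f: "f \<in> hom D X (gobj L)" and f2: "\<And>t w. t \<in> Obj K \<Longrightarrow> w \<in> P t \<Longrightarrow> app f t (\<eta> t w) = gev L t (\<phi> t) w"
      by (rule descend[OF X LO p \<eta> ls nL \<eta>L[OF _ _ _ _ L]]; (assumption | (rule that; (assumption | blast))))
    have "group_hom D G L f"
      unfolding group_hom_iff[OF Gg Lg] Gs
    proof (intro conjI ballI f)
      fix t x y assume t: "t \<in> Obj K" and x: "x \<in> el X t" and y: "y \<in> el X t"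
      note xy = gme[OF t x y] and fx = app_mem[OF f t x] and fy = app_mem[OF f t y]
      note Lt = group_object_typed[OF Lg]
      show "app f t (gmul G t x y) = gmul L t (app f t x) (app f t y)"
      proof (rule el_eqI[OF LO t app_mem[OF f t xy] gmul_mem[OF Lt t fx fy]], rule cov_mono[OF t both[OF t x y]])
        fix m assume m: "m \<in> Arr K" "Cod K m = t"
          and "\<exists>w\<in>P (Dom K m). \<exists>w'\<in>P (Dom K m). \<eta> (Dom K m) w = res X m x \<and> \<eta> (Dom K m) w' = res X m y"
        then obtain a b where a: "a \<in> P (Dom K m)" "\<eta> (Dom K m) a = res X m x"
          and b: "b \<in> P (Dom K m)" "\<eta> (Dom K m) b = res X m y" by blast
        note d = arr_dom[OF m(1)]
        have ab: "Mul a b \<in> P (Dom K m)" using a b by simp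
        show "res (gobj L) m (app f t (gmul G t x y)) = res (gobj L) m (gmul L t (app f t x) (app f t y))"
          unfolding app_res[OF f m xy, symmetric] gr(1)[OF m x y] gmul_res[OF Lt m fx fy]
            app_res[OF f m x, symmetric] app_res[OF f m y, symmetric] a(2)[symmetric] b(2)[symmetric]
            gm[OF d a(1) b(1)] f2[OF d ab] f2[OF d a(1)] f2[OF d b(1)] by simp
      qed
    qed
    moreover have "app f t (\<kappa> t x) = \<phi> t x" if "t \<in> Obj K" "x \<in> S t" for t x
      unfolding \<kappa>_def using f2[OF that(1), of "Gen x"] that by simp
    ultimately show "\<exists>f. group_hom D G L f \<and> (\<forall>t\<in>Obj K. \<forall>x\<in>S t. app f t (\<kappa> t x) = \<phi> t x)" by blast
  qed
qed

text \<open>An arrow that coequalises the two maps is invariant under right multiplication by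
  generators, hence by values of terms. Locally every element is the unit times such a value, so the
  arrow takes the same value as at the unit: it is constant, as the kernel of \<open>bang\<close>
  demands.\<close>

lemma generatesI:
  assumes G: "is_group_object D G" and k: "k \<in> hom D X (gobj G)"
    and gen: "locally_generates (el X) G (app k)"
  shows "generates D G k"
proof -
  define A where "A = gobj G"
  have A: "A \<in> Obj D" and X: "X \<in> Obj D" unfolding A_def using group_obj[OF G] homD[OF k] by auto
  note Gt = group_object_typed[OF G]
  note p1 = pr1_hom[OF A X] and p2 = pr2_hom[OF A X] and b = bang_hom[OF A]
  have k: "k \<in> hom D X A" using k A_def by simp
  define g where "g = gmult G \<cdot>\<^bsub>D\<^esub> pair D (pr1 D A X) (k \<cdot>\<^bsub>D\<^esub> pr2 D A X)"
  have kp: "k \<cdot>\<^bsub>D\<^esub> pr2 D A X \<in> hom D (prd D A X) A" by (rule D.comp_in[OF p2 k])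
  note mu = group_typedD(2)[OF Gt, folded A_def]
  have g: "g \<in> hom D (prd D A X) A" unfolding g_def by (rule D.comp_in[OF pair_hom[OF p1 kp] mu])
  have ga: "app g t (tup A X t a x) = gmul G t a (app k t x)" if t: "t \<in> Obj K" and a: "a \<in> el A t" and x: "x \<in> el X t" for t a x
  proof -
    note w = tup_mem[OF A X t a x]
    show ?thesis
      unfolding g_def app_comp[OF pair_hom[OF p1 kp] mu t w] pair_app[OF p1 kp t w] app_comp[OF p2 k t w] tup[OF A X t a x]
      unfolding gmul_def A_def ..
  qed
  have "is_coequaliser D (pr1 D A X) g (bang D A)"
  proof (rule coequaliserI[OF p1 g b])
    show "bang D A \<cdot>\<^bsub>D\<^esub> pr1 D A X = bang D A \<cdot>\<^bsub>D\<^esub> g"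
    proof (rule faithful[OF D.comp_in[OF p1 b] D.comp_in[OF g b]])
      fix t x assume t: "t \<in> Obj K" and x: "x \<in> el (prd D A X) t"
      show "app (bang D A \<cdot>\<^bsub>D\<^esub> pr1 D A X) t x = app (bang D A \<cdot>\<^bsub>D\<^esub> g) t x"
        unfolding app_comp[OF p1 b t x] app_comp[OF g b t x] bang_app[OF A t app_mem[OF p1 t x]] bang_app[OF A t app_mem[OF g t x]] ..
    qed
    \<comment> \<open>The group has a unit at every stage, so the map to the terminal object is
      surjective already without passing to a cover.\<close>
    show "locally_surj (el A) (el (terminal D)) (res (terminal D)) (app (bang D A))"
      unfolding locally_surj_def
    proof (intro ballI)
      fix t y assume t: "t \<in> Obj K" and y: "y \<in> el (terminal D) t"
      show "cov t (\<lambda>m. \<exists>x\<in>el A (Dom K m). app (bang D A) (Dom K m) x = res (terminal D) m y)"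
      proof (rule cov_all[OF t])
        fix m assume m: "m \<in> Arr K" "Cod K m = t"
        note o = gone_mem[OF Gt arr_dom[OF m(1)], folded A_def]
        show "\<exists>x\<in>el A (Dom K m). app (bang D A) (Dom K m) x = res (terminal D) m y"
          by (rule bexI[OF _ o])
            (simp add: bang_app[OF A _ o] m pt_unique[OF _ res_mem[OF terminal_obj m y]])
      qed
    qed
    fix t x y Z h assume t: "t \<in> Obj K" and x: "x \<in> el A t" and y: "y \<in> el A t"
      and h: "h \<in> hom D A Z" and hh: "h \<cdot>\<^bsub>D\<^esub> pr1 D A X = h \<cdot>\<^bsub>D\<^esub> g"
    have Z: "Z \<in> Obj D" using homD[OF h] by blast
    have step: "app h s (gmul G s a (app k s v)) = app h s a" if "s \<in> Obj K" "a \<in> el A s" "v \<in> el X s" for s a v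
      using comp_eq_app_eq[OF hh p1 h g h that(1) tup_mem[OF A X that]] unfolding ga[OF that] pr1_tup[OF A X that] by simp
    note gme = gmul_mem[OF Gt, folded A_def] and gie = gin_mem[OF Gt, folded A_def] and goe = gone_mem[OF Gt, folded A_def]
    have evm: "gev G s (app k s) w \<in> el A s" if "s \<in> Obj K" "set_gterm w \<subseteq> el X s" for s w
      using gev_mem[OF Gt that(1) app_mem[OF k that(1), unfolded A_def] that(2)] unfolding A_def .
    \<comment> \<open>The left factor stays arbitrary in the induction, since a product is absorbed
      one factor at a time, with the first factor moved into \<open>a\<close>.\<close>
    have ev: "set_gterm w \<subseteq> el X s \<Longrightarrow> a \<in> el A s \<Longrightarrow> app h s (gmul G s a (gev G s (app k s) w)) = app h s a"
      if s: "s \<in> Obj K" for s w a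
    proof (induction w arbitrary: a)
      case (Gen v)
      then show ?case using step[OF s, of a v] by simp
    next
      case Unit
      then show ?case using gmul_one_right[OF G s, folded A_def] by simp
    next
      case (Mul u v)
      have uv: "set_gterm u \<subseteq> el X s" "set_gterm v \<subseteq> el X s" using Mul.prems by auto
      note u = evm[OF s uv(1)] and v = evm[OF s uv(2)]
      have "gmul G s a (gev G s (app k s) (Mul u v)) = gmul G s (gmul G s a (gev G s (app k s) u)) (gev G s (app k s) v)"
        using gmul_assoc[OF G s, folded A_def, OF Mul.prems(2) u v] by simp
      then show ?case using Mul.IH(2)[OF uv(2) gme[OF s Mul.prems(2) u]] Mul.IH(1)[OF uv(1) Mul.prems(2)] by simp
    next
      \<comment> \<open>The induction hypothesis is applied at \<open>a\<close> times the inverse of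
        the value of \<open>u\<close>; multiplying that by the value gives back
        \<open>a\<close>.\<close>
      case (Inv u)
      have us: "set_gterm u \<subseteq> el X s" using Inv.prems by auto
      note u = evm[OF s us] and a = Inv.prems(2)
      let ?u = "gev G s (app k s) u"
      note iu = gie[OF s u]
      have "gmul G s (gmul G s a (gin G s ?u)) ?u = a"
        unfolding gmul_assoc[OF G s, folded A_def, OF a iu u] gmul_inv_left[OF G s, folded A_def, OF u]
        by (rule gmul_one_right[OF G s, folded A_def, OF a])
      then show ?case using Inv.IH[OF us gme[OF s a iu]] by simp
    qed
    have one: "app h t z = app h t (gone G t)" if z: "z \<in> el A t" for z
    proof (rule el_eqI[OF Z t app_mem[OF h t z] app_mem[OF h t goe[OF t]]],
        rule cov_mono[OF t locally_surjD[OF gen[unfolded locally_generates_def, folded A_def] t z]])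
      fix m assume m: "m \<in> Arr K" "Cod K m = t"
        and "\<exists>w\<in>{w. set_gterm w \<subseteq> el X (Dom K m)}. gev G (Dom K m) (app k (Dom K m)) w = res A m z"
      then obtain w where w: "set_gterm w \<subseteq> el X (Dom K m)" "gev G (Dom K m) (app k (Dom K m)) w = res A m z" by blast
      note d = arr_dom[OF m(1)]
      have "app h (Dom K m) (gmul G (Dom K m) (gone G (Dom K m)) (res A m z)) = app h (Dom K m) (gone G (Dom K m))"
        using ev[OF d w(1) goe[OF d]] w(2) by simp
      then have "app h (Dom K m) (res A m z) = app h (Dom K m) (gone G (Dom K m))"
        using gmul_one_left[OF G d, folded A_def, OF res_mem[OF A m z]] by simp
      then show "res Z m (app h t z) = res Z m (app h t (gone G t))"
        using app_res[OF h m z] app_res[OF h m goe[OF t]] gone_res[OF Gt m, folded A_def] by simp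
    qed
    show "app h t x = app h t y" using one[OF x] one[OF y] by simp
  qed
  then show ?thesis unfolding generates_def Let_def A_def g_def using homD[OF k] by simp
qed

end

section \<open>The category of group objects\<close>

context sheaf_cat
begin

lemma Grp_hom_iff: "F \<in> hom (Grp D) G H \<longleftrightarrow>
    (\<exists>f. F = (G, f, H) \<and> is_group_object D G \<and> is_group_object D H \<and> group_hom D G H f)"
  unfolding hom_def Grp_def by auto

lemma Grp_obj [simp]: "G \<in> Obj (Grp D) \<longleftrightarrow> is_group_object D G"
  unfolding Grp_def by simp

lemma Grp_comp [simp]: "(H', g, L) \<cdot>\<^bsub>Grp D\<^esub> (G, f, H) = (G, g \<cdot>\<^bsub>D\<^esub> f, L)"
  unfolding Grp_def by simp

lemma Grp_simps [simp]: "Dom (Grp D) (G, f, H) = G" "Cod (Grp D) (G, f, H) = H" "Id (Grp D) G = (G, Id D (gobj G), G)"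
  unfolding Grp_def by simp_all

lemma group_hom_id: "is_group_object D G \<Longrightarrow> group_hom D G G (Id D (gobj G))"
  unfolding group_hom_iff
  using group_obj[of G] D.id_in gmul_mem[OF group_object_typed] by (simp add: app_id)

lemma group_hom_comp:
  assumes G: "is_group_object D G" and H: "is_group_object D H" and L: "is_group_object D L"
    and f: "group_hom D G H f" and g: "group_hom D H L g"
  shows "group_hom D G L (g \<cdot>\<^bsub>D\<^esub> f)"
proof -
  note fh = group_hom_hom[OF f G H] and gh = group_hom_hom[OF g H L]
  show ?thesis
    unfolding group_hom_iff[OF G L]
  proof (intro conjI ballI D.comp_in[OF fh gh])
    fix t x y assume t: "t \<in> Obj K" and x: "x \<in> el (gobj G) t" and y: "y \<in> el (gobj G) t"
    show "app (g \<cdot>\<^bsub>D\<^esub> f) t (gmul G t x y) = gmul L t (app (g \<cdot>\<^bsub>D\<^esub> f) t x) (app (g \<cdot>\<^bsub>D\<^esub> f) t y)"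
      unfolding app_comp[OF fh gh t x] app_comp[OF fh gh t y]
        app_comp[OF fh gh t gmul_mem[OF group_object_typed[OF G] t x y]] group_hom_mul[OF f G H t x y]
      by (rule group_hom_mul[OF g H L t app_mem[OF fh t x] app_mem[OF fh t y]])
  qed
qed

lemma Grp_category: "category (Grp D)"
proof
  show "Dom (Grp D) f \<in> Obj (Grp D)" if "f \<in> Arr (Grp D)" for f
    using that unfolding Grp_def by auto
  show "Cod (Grp D) f \<in> Obj (Grp D)" if "f \<in> Arr (Grp D)" for f
    using that unfolding Grp_def by auto
  show "Id (Grp D) A \<in> hom (Grp D) A A" if "A \<in> Obj (Grp D)" for A
    unfolding Grp_hom_iff using that group_hom_id by simp
  show "g \<cdot>\<^bsub>Grp D\<^esub> f \<in> hom (Grp D) X Z" if "f \<in> hom (Grp D) X Y" "g \<in> hom (Grp D) Y Z" for f g X Y Z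
    using that group_hom_comp unfolding Grp_hom_iff by auto
  show "Id (Grp D) Y \<cdot>\<^bsub>Grp D\<^esub> f = f" if "f \<in> hom (Grp D) X Y" for f X Y
    using that D.id_left[OF group_hom_hom] unfolding Grp_hom_iff by auto
  show "f \<cdot>\<^bsub>Grp D\<^esub> Id (Grp D) X = f" if "f \<in> hom (Grp D) X Y" for f X Y
    using that D.id_right[OF group_hom_hom] unfolding Grp_hom_iff by auto
  show "(h \<cdot>\<^bsub>Grp D\<^esub> g) \<cdot>\<^bsub>Grp D\<^esub> f = h \<cdot>\<^bsub>Grp D\<^esub> (g \<cdot>\<^bsub>Grp D\<^esub> f)"
    if "f \<in> hom (Grp D) W X" "g \<in> hom (Grp D) X Y" "h \<in> hom (Grp D) Y Z" for f g h W X Y Z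
    using that D.comp_assoc[OF group_hom_hom group_hom_hom group_hom_hom] unfolding Grp_hom_iff by auto
qed

lemma gterm_eval_cong:
  "(\<And>v. v \<in> set_gterm w \<Longrightarrow> \<phi> v = \<psi> v) \<Longrightarrow> gterm_eval m e i \<phi> w = gterm_eval m e i \<psi> w"
  by (induction w) auto

text \<open>Here the generators form an object, so fullness turns the natural family
  \<open>\<kappa>\<close> into an arrow with the same values on terms.\<close>

lemma universal_group_arrow:
  assumes X: "X \<in> Obj D"
    and tests: "\<And>L \<phi>. (L, \<phi>) \<in> \<T> \<Longrightarrow> is_group_object D L"
      "\<And>L \<phi>. (L, \<phi>) \<in> \<T> \<Longrightarrow> natural (el X) (res X) (el (gobj L)) (res (gobj L)) \<phi>"
  obtains G k where "is_group_object D G" "k \<in> hom D X (gobj G)" "locally_generates (el X) G (app k)"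
    "\<And>t w w'. t \<in> Obj K \<Longrightarrow> set_gterm w \<subseteq> el X t \<Longrightarrow> set_gterm w' \<subseteq> el X t \<Longrightarrow>
      (\<And>L \<phi>. (L, \<phi>) \<in> \<T> \<Longrightarrow> gev L t (\<phi> t) w = gev L t (\<phi> t) w') \<Longrightarrow> gev G t (app k t) w = gev G t (app k t) w'"
    "\<And>L \<phi>. (L, \<phi>) \<in> \<T> \<Longrightarrow> \<exists>f. group_hom D G L f \<and> (\<forall>t\<in>Obj K. \<forall>x\<in>el X t. app f t (app k t x) = \<phi> t x)"
proof (rule universal_group[OF el_psh[OF X] el_bounded[OF X] tests])
  fix G \<kappa> assume G: "is_group_object D G" and \<kappa>: "natural (el X) (res X) (el (gobj G)) (res (gobj G)) \<kappa>"
    and gen: "locally_generates (el X) G \<kappa>"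
    and eqs: "\<And>t w w'. t \<in> Obj K \<Longrightarrow> set_gterm w \<subseteq> el X t \<Longrightarrow> set_gterm w' \<subseteq> el X t \<Longrightarrow>
      (\<And>L \<phi>. (L, \<phi>) \<in> \<T> \<Longrightarrow> gev L t (\<phi> t) w = gev L t (\<phi> t) w') \<Longrightarrow> gev G t (\<kappa> t) w = gev G t (\<kappa> t) w'"
    and univ: "\<And>L \<phi>. (L, \<phi>) \<in> \<T> \<Longrightarrow> \<exists>f. group_hom D G L f \<and> (\<forall>t\<in>Obj K. \<forall>x\<in>el X t. app f t (\<kappa> t x) = \<phi> t x)"
  obtain k where k: "k \<in> hom D X (gobj G)" "\<forall>t\<in>Obj K. \<forall>x\<in>el X t. app k t x = \<kappa> t x"
    using full[OF X group_obj[OF G] \<kappa>] by blast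
  have e: "gev G t (app k t) w = gev G t (\<kappa> t) w" if "t \<in> Obj K" "set_gterm w \<subseteq> el X t" for t w
    by (rule gterm_eval_cong) (use k(2) that in auto)
  show thesis
  proof (rule that[OF G k(1)])
    show "locally_generates (el X) G (app k)"
      unfolding locally_generates_def
      by (rule locally_surj_cong[OF gen[unfolded locally_generates_def]]) (simp add: e)
    show "gev G t (app k t) w = gev G t (app k t) w'"
      if "t \<in> Obj K" "set_gterm w \<subseteq> el X t" "set_gterm w' \<subseteq> el X t"
        "\<And>L \<phi>. (L, \<phi>) \<in> \<T> \<Longrightarrow> gev L t (\<phi> t) w = gev L t (\<phi> t) w'" for t w w'
      unfolding e[OF that(1,2)] e[OF that(1,3)] by (rule eqs[OF that(1-3)]) (rule that(4))
    show "\<exists>f. group_hom D G L f \<and> (\<forall>t\<in>Obj K. \<forall>x\<in>el X t. app f t (app k t x) = \<phi> t x)" if "(L, \<phi>) \<in> \<T>" for L \<phi>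
    proof -
      from univ[OF that] obtain f where f: "group_hom D G L f" "\<forall>t\<in>Obj K. \<forall>x\<in>el X t. app f t (\<kappa> t x) = \<phi> t x" by blast
      show ?thesis by (intro exI[of _ f] conjI ballI f(1)) (use f(2) k(2) in simp)
    qed
  qed
qed

text \<open>All elements of \<open>H\<close> serve as generators, and the tests are the
  homomorphisms out of \<open>H\<close> that coequalise. The multiplication of \<open>H\<close> and
  the identification of the two arrows are relations seen by every test, so both hold in the
  universal group.\<close>

lemma Grp_coequalisers: "has_coequalisers (Grp D)"
  unfolding has_coequalisers_def
proof (intro ballI)
  fix F F' assume "F \<in> Arr (Grp D)" and F': "F' \<in> hom (Grp D) (Dom (Grp D) F) (Cod (Grp D) F)"
  then obtain G f H where F: "F = (G, f, H)" and G: "is_group_object D G" and H: "is_group_object D H"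
    and f: "group_hom D G H f" unfolding Grp_def by auto
  obtain g where Fg: "F' = (G, g, H)" and g: "group_hom D G H g"
    using F' unfolding F Grp_hom_iff by auto
  note fh = group_hom_hom[OF f G H] and gh = group_hom_hom[OF g G H] and HO = group_obj[OF H]
  define \<T> where "\<T> = {(L, app h) | L h. is_group_object D L \<and> group_hom D H L h \<and> h \<cdot>\<^bsub>D\<^esub> f = h \<cdot>\<^bsub>D\<^esub> g}"
  have tests: "is_group_object D L" "natural (el (gobj H)) (res (gobj H)) (el (gobj L)) (res (gobj L)) \<phi>"
    if "(L, \<phi>) \<in> \<T>" for L \<phi>
    using that app_natural[OF group_hom_hom[OF _ H]] unfolding \<T>_def by auto
  show "\<exists>q. is_coequaliser (Grp D) F F' q"
  proof (rule universal_group_arrow[OF HO tests])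
    fix Q k assume Q: "is_group_object D Q" and k: "k \<in> hom D (gobj H) (gobj Q)"
      and gen: "locally_generates (el (gobj H)) Q (app k)"
      and eqs: "\<And>t w w'. t \<in> Obj K \<Longrightarrow> set_gterm w \<subseteq> el (gobj H) t \<Longrightarrow> set_gterm w' \<subseteq> el (gobj H) t \<Longrightarrow>
        (\<And>L \<phi>. (L, \<phi>) \<in> \<T> \<Longrightarrow> gev L t (\<phi> t) w = gev L t (\<phi> t) w') \<Longrightarrow> gev Q t (app k t) w = gev Q t (app k t) w'"
      and univ: "\<And>L \<phi>. (L, \<phi>) \<in> \<T> \<Longrightarrow> \<exists>f. group_hom D Q L f \<and> (\<forall>t\<in>Obj K. \<forall>x\<in>el (gobj H) t. app f t (app k t x) = \<phi> t x)"
    have kg: "group_hom D H Q k"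
      unfolding group_hom_iff[OF H Q]
    proof (intro conjI ballI k)
      fix t x y assume t: "t \<in> Obj K" and x: "x \<in> el (gobj H) t" and y: "y \<in> el (gobj H) t"
      note xy = gmul_mem[OF group_object_typed[OF H] t x y]
      \<comment> \<open>The generator of a product and the formal product of generators evaluate
        equally in each test, as tests are homomorphisms on \<open>H\<close>; this makes
        \<open>k\<close> one as well.\<close>
      have "gev Q t (app k t) (Gen (gmul H t x y)) = gev Q t (app k t) (Mul (Gen x) (Gen y))"
      proof (rule eqs[OF t])
        fix L \<phi> assume "(L, \<phi>) \<in> \<T>"
        then obtain h where h: "is_group_object D L" "group_hom D H L h" "\<phi> = app h" unfolding \<T>_def by blast
        show "gev L t (\<phi> t) (Gen (gmul H t x y)) = gev L t (\<phi> t) (Mul (Gen x) (Gen y))"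
          using group_hom_mul[OF h(2) H h(1) t x y] h(3) by simp
      qed (use x y xy in simp_all)
      then show "app k t (gmul H t x y) = gmul Q t (app k t x) (app k t y)" by simp
    qed
    have kfg: "k \<cdot>\<^bsub>D\<^esub> f = k \<cdot>\<^bsub>D\<^esub> g"
    proof (rule faithful[OF D.comp_in[OF fh k] D.comp_in[OF gh k]])
      fix t x assume t: "t \<in> Obj K" and x: "x \<in> el (gobj G) t"
      have "gev Q t (app k t) (Gen (app f t x)) = gev Q t (app k t) (Gen (app g t x))"
      proof (rule eqs[OF t])
        fix L \<phi> assume "(L, \<phi>) \<in> \<T>"
        then obtain h where h: "is_group_object D L" "group_hom D H L h" "\<phi> = app h" "h \<cdot>\<^bsub>D\<^esub> f = h \<cdot>\<^bsub>D\<^esub> g"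
          unfolding \<T>_def by blast
        note hh = group_hom_hom[OF h(2) H h(1)]
        show "gev L t (\<phi> t) (Gen (app f t x)) = gev L t (\<phi> t) (Gen (app g t x))"
          using comp_eq_app_eq[OF h(4) fh hh gh hh t x] h(3) by simp
      qed (use app_mem[OF fh t x] app_mem[OF gh t x] in simp_all)
      then show "app (k \<cdot>\<^bsub>D\<^esub> f) t x = app (k \<cdot>\<^bsub>D\<^esub> g) t x"
        unfolding app_comp[OF fh k t x] app_comp[OF gh k t x] by simp
    qed
    have "is_coequaliser (Grp D) F F' (H, k, Q)"
      unfolding is_coequaliser_def
    proof (intro conjI ballI impI)
      show "F \<in> Arr (Grp D)" "F' \<in> hom (Grp D) (Dom (Grp D) F) (Cod (Grp D) F)" by fact+
      show "(H, k, Q) \<in> Arr (Grp D)" unfolding Grp_def using H Q kg by simp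
      show "Dom (Grp D) (H, k, Q) = Cod (Grp D) F" unfolding F by simp
      show "(H, k, Q) \<cdot>\<^bsub>Grp D\<^esub> F = (H, k, Q) \<cdot>\<^bsub>Grp D\<^esub> F'" unfolding F Fg using kfg by simp
      fix L h' assume "L \<in> Obj (Grp D)" and h': "h' \<in> hom (Grp D) (Cod (Grp D) F) L"
        and e: "h' \<cdot>\<^bsub>Grp D\<^esub> F = h' \<cdot>\<^bsub>Grp D\<^esub> F'"
      then obtain h where hh: "h' = (H, h, L)" and L: "is_group_object D L" and h: "group_hom D H L h"
        unfolding F Grp_hom_iff by auto
      have hfg: "h \<cdot>\<^bsub>D\<^esub> f = h \<cdot>\<^bsub>D\<^esub> g" using e unfolding hh F Fg by simp
      have "(L, app h) \<in> \<T>" unfolding \<T>_def using L h hfg by blast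
      from univ[OF this] obtain l where l: "group_hom D Q L l" "\<forall>t\<in>Obj K. \<forall>x\<in>el (gobj H) t. app l t (app k t x) = app h t x"
        by blast
      note lh = group_hom_hom[OF l(1) Q L] and hom_h = group_hom_hom[OF h H L]
      show "\<exists>!k'. k' \<in> hom (Grp D) (Cod (Grp D) (H, k, Q)) L \<and> k' \<cdot>\<^bsub>Grp D\<^esub> (H, k, Q) = h'"
      proof (rule ex1I[of _ "(Q, l, L)"], intro conjI)
        show "(Q, l, L) \<in> hom (Grp D) (Cod (Grp D) (H, k, Q)) L" unfolding Grp_hom_iff using Q L l by simp
        have "l \<cdot>\<^bsub>D\<^esub> k = h"
          by (rule faithful[OF D.comp_in[OF k lh] hom_h]) (use l(2) app_comp[OF k lh] in simp)
        then show "(Q, l, L) \<cdot>\<^bsub>Grp D\<^esub> (H, k, Q) = h'" unfolding hh by simp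
        fix k' assume "k' \<in> hom (Grp D) (Cod (Grp D) (H, k, Q)) L \<and> k' \<cdot>\<^bsub>Grp D\<^esub> (H, k, Q) = h'"
        then obtain l' where l': "k' = (Q, l', L)" "group_hom D Q L l'" "l' \<cdot>\<^bsub>D\<^esub> k = h"
          unfolding Grp_hom_iff hh by auto
        have "l' = l"
        proof (rule group_hom_cancel[OF Q L l'(2) l(1) gen app_natural[OF k]])
          fix t x assume t: "t \<in> Obj K" and x: "x \<in> el (gobj H) t"
          show "app l' t (app k t x) = app l t (app k t x)"
            using comp_app_eq[OF l'(3) k group_hom_hom[OF l'(2) Q L] t x] l(2) t x by simp
        qed
        then show "k' = (Q, l, L)" using l' by simp
      qed
    qed
    then show ?thesis by blast
  qed
qed

end

section \<open>Left adjoints from universal arrows\<close>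

text \<open>The adjoint is assembled by choice, and generation must hold for exactly the unit that
  is chosen. The predicate \<open>Q\<close> therefore travels with the universal arrow through the
  choice.\<close>

lemma left_adjoint_if_universal_arrows:
  assumes A: "category A" and B: "category B" and R: "is_functor B A R"
    and univ: "\<And>X. X \<in> Obj A \<Longrightarrow> \<exists>L\<in>Obj B. \<exists>\<eta>\<in>hom A X (fobj R L). Q X L \<eta> \<and>
      (\<forall>Y\<in>Obj B. \<forall>f\<in>hom A X (fobj R Y). \<exists>!g. g \<in> hom B L Y \<and> farr R g \<cdot>\<^bsub>A\<^esub> \<eta> = f)"
  shows "\<exists>L \<eta>. left_adjoint A B L R \<eta> \<and> (\<forall>X\<in>Obj A. Q X (fobj L X) (\<eta> X))"
proof -
  interpret A: category A by (rule A)
  interpret B: category B by (rule B)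
  have hA: "f \<in> hom A (Dom A f) (Cod A f)" "Dom A f \<in> Obj A" "Cod A f \<in> Obj A" if "f \<in> Arr A" for f
    using that A.dom_in A.cod_in unfolding hom_def by auto
  define ok where "ok X p \<longleftrightarrow> fst p \<in> Obj B \<and> snd p \<in> hom A X (fobj R (fst p)) \<and> Q X (fst p) (snd p) \<and>
      (\<forall>Y\<in>Obj B. \<forall>f\<in>hom A X (fobj R Y). \<exists>!g. g \<in> hom B (fst p) Y \<and> farr R g \<cdot>\<^bsub>A\<^esub> snd p = f)" for X p
  define p where "p X = (SOME p. ok X p)" for X
  have p: "ok X (p X)" if X: "X \<in> Obj A" for X
  proof -
    from univ[OF X] obtain L \<eta> where "L \<in> Obj B" "\<eta> \<in> hom A X (fobj R L)" "Q X L \<eta>"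
      "\<forall>Y\<in>Obj B. \<forall>f\<in>hom A X (fobj R Y). \<exists>!g. g \<in> hom B L Y \<and> farr R g \<cdot>\<^bsub>A\<^esub> \<eta> = f" by blast
    then have "ok X (L, \<eta>)" unfolding ok_def by simp
    then show ?thesis unfolding p_def by (rule someI)
  qed
  define L where "L X = fst (p X)" for X
  define \<eta> where "\<eta> X = snd (p X)" for X
  have L: "L X \<in> Obj B" and \<eta>: "\<eta> X \<in> hom A X (fobj R (L X))" and QX: "Q X (L X) (\<eta> X)" if "X \<in> Obj A" for X
    using p[OF that] unfolding ok_def L_def \<eta>_def by blast+
  have U: "\<exists>!g. g \<in> hom B (L X) Y \<and> farr R g \<cdot>\<^bsub>A\<^esub> \<eta> X = f" if "X \<in> Obj A" "Y \<in> Obj B" "f \<in> hom A X (fobj R Y)" for X Y f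
  proof -
    have "\<forall>Y\<in>Obj B. \<forall>f\<in>hom A X (fobj R Y). \<exists>!g. g \<in> hom B (L X) Y \<and> farr R g \<cdot>\<^bsub>A\<^esub> \<eta> X = f"
      using p[OF that(1)] unfolding ok_def L_def \<eta>_def by (elim conjE)
    from this[rule_format, OF that(2,3)] show ?thesis .
  qed
  have R1: "fobj R Y \<in> Obj A" if "Y \<in> Obj B" for Y using R that unfolding is_functor_def by simp
  have R2: "farr R g \<in> hom A (fobj R Y) (fobj R Z)" if "g \<in> hom B Y Z" for g Y Z
    using R that unfolding is_functor_def hom_def by auto
  have R3: "farr R (Id B Y) = Id A (fobj R Y)" if "Y \<in> Obj B" for Y using R that unfolding is_functor_def by simp
  have R4: "farr R (g \<cdot>\<^bsub>B\<^esub> f) = farr R g \<cdot>\<^bsub>A\<^esub> farr R f" if "f \<in> hom B X Y" "g \<in> hom B Y Z" for f g X Y Z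
    using R that unfolding is_functor_def hom_def by auto
  define La where "La f = (THE g. g \<in> hom B (L (Dom A f)) (L (Cod A f)) \<and> farr R g \<cdot>\<^bsub>A\<^esub> \<eta> (Dom A f) = \<eta> (Cod A f) \<cdot>\<^bsub>A\<^esub> f)" for f
  have La: "La f \<in> hom B (L X) (L Y)" "farr R (La f) \<cdot>\<^bsub>A\<^esub> \<eta> X = \<eta> Y \<cdot>\<^bsub>A\<^esub> f" if f: "f \<in> hom A X Y" for f X Y
  proof -
    have XY: "Dom A f = X" "Cod A f = Y" "X \<in> Obj A" "Y \<in> Obj A" using f hA[of f] unfolding hom_def by auto
    have "\<exists>!g. g \<in> hom B (L X) (L Y) \<and> farr R g \<cdot>\<^bsub>A\<^esub> \<eta> X = \<eta> Y \<cdot>\<^bsub>A\<^esub> f"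
      by (rule U[OF XY(3) L[OF XY(4)] A.comp_in[OF f \<eta>[OF XY(4)]]])
    from theI'[OF this] show "La f \<in> hom B (L X) (L Y)" "farr R (La f) \<cdot>\<^bsub>A\<^esub> \<eta> X = \<eta> Y \<cdot>\<^bsub>A\<^esub> f"
      unfolding La_def XY by auto
  qed
  \<comment> \<open>Functoriality of the adjoint reduces to this: arrows out of \<open>L X\<close>
    are determined by their composite with the unit.\<close>
  have uniq: "g = g'" if "X \<in> Obj A" "Y \<in> Obj B" "g \<in> hom B (L X) Y" "g' \<in> hom B (L X) Y"
    "farr R g \<cdot>\<^bsub>A\<^esub> \<eta> X = farr R g' \<cdot>\<^bsub>A\<^esub> \<eta> X" for X Y g g'
    using U[OF that(1,2) A.comp_in[OF \<eta>[OF that(1)] R2[OF that(4)]]] that(3-5) by auto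
  define LF where "LF = \<lparr>fobj = L, farr = La\<rparr>"
  have "is_functor A B LF"
    unfolding is_functor_def LF_def ftor.simps
  proof (intro conjI ballI impI)
    show "L X \<in> Obj B" if "X \<in> Obj A" for X using L[OF that] .
    show "La f \<in> hom B (L (Dom A f)) (L (Cod A f))" if "f \<in> Arr A" for f using La(1)[OF hA(1)[OF that]] .
    show "La (Id A X) = Id B (L X)" if X: "X \<in> Obj A" for X
    proof (rule uniq[OF X L[OF X] La(1)[OF A.id_in[OF X]] B.id_in[OF L[OF X]]])
      show "farr R (La (Id A X)) \<cdot>\<^bsub>A\<^esub> \<eta> X = farr R (Id B (L X)) \<cdot>\<^bsub>A\<^esub> \<eta> X"
        unfolding La(2)[OF A.id_in[OF X]] R3[OF L[OF X]] A.id_left[OF \<eta>[OF X]] A.id_right[OF \<eta>[OF X]] ..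
    qed
    fix f g assume fg: "f \<in> Arr A" "g \<in> Arr A" "Dom A g = Cod A f"
    define X where "X = Dom A f" define Y where "Y = Cod A f" define Z where "Z = Cod A g"
    have f: "f \<in> hom A X Y" and g: "g \<in> hom A Y Z" and O: "X \<in> Obj A" "Y \<in> Obj A" "Z \<in> Obj A"
      using hA[OF fg(1)] hA[OF fg(2)] fg(3) unfolding X_def Y_def Z_def by auto
    note gf = A.comp_in[OF f g]
    note LL = B.comp_in[OF La(1)[OF f] La(1)[OF g]]
    show "La (g \<cdot>\<^bsub>A\<^esub> f) = La g \<cdot>\<^bsub>B\<^esub> La f"
    proof (rule uniq[OF O(1) L[OF O(3)] La(1)[OF gf] LL])
      have "farr R (La g \<cdot>\<^bsub>B\<^esub> La f) \<cdot>\<^bsub>A\<^esub> \<eta> X = farr R (La g) \<cdot>\<^bsub>A\<^esub> (farr R (La f) \<cdot>\<^bsub>A\<^esub> \<eta> X)"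
        unfolding R4[OF La(1)[OF f] La(1)[OF g]] by (rule A.comp_assoc[OF \<eta>[OF O(1)] R2[OF La(1)[OF f]] R2[OF La(1)[OF g]]])
      also have "\<dots> = (farr R (La g) \<cdot>\<^bsub>A\<^esub> \<eta> Y) \<cdot>\<^bsub>A\<^esub> f"
        unfolding La(2)[OF f] by (rule A.comp_assoc[OF f \<eta>[OF O(2)] R2[OF La(1)[OF g]], symmetric])
      also have "\<dots> = \<eta> Z \<cdot>\<^bsub>A\<^esub> (g \<cdot>\<^bsub>A\<^esub> f)"
        unfolding La(2)[OF g] by (rule A.comp_assoc[OF f g \<eta>[OF O(3)]])
      finally show "farr R (La (g \<cdot>\<^bsub>A\<^esub> f)) \<cdot>\<^bsub>A\<^esub> \<eta> X = farr R (La g \<cdot>\<^bsub>B\<^esub> La f) \<cdot>\<^bsub>A\<^esub> \<eta> X"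
        unfolding La(2)[OF gf] by simp
    qed
  qed
  moreover have "nat_trans A A id_ftor (comp_ftor R LF) \<eta>"
    unfolding nat_trans_def id_ftor_def comp_ftor_def LF_def ftor.simps
    using \<eta> La(2)[OF hA(1)] by simp
  ultimately have "left_adjoint A B LF R \<eta>"
    unfolding left_adjoint_def using R U unfolding LF_def ftor.simps by simp
  moreover have "\<forall>X\<in>Obj A. Q X (fobj LF X) (\<eta> X)" unfolding LF_def using QX by simp
  ultimately show ?thesis by blast
qed

section \<open>Slices\<close>

locale slice_base = sheaf_cat K J D U el res app \<pi>
  for K :: "('t, 'm) cat" and J and D :: "('o, 'a) cat" and U :: "'u set set"
    and el :: "'o \<Rightarrow> 't \<Rightarrow> 'u set" and res :: "'o \<Rightarrow> 'm \<Rightarrow> 'u \<Rightarrow> 'u" and app :: "'a \<Rightarrow> 't \<Rightarrow> 'u \<Rightarrow> 'u"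
    and \<pi> :: "'t \<Rightarrow> 'b" +
  fixes c :: 'o
  assumes base: "c \<in> Obj D"
begin

text \<open>The category of elements of \<open>c\<close>. An arrow stores only the point over its
  codomain; the point over its domain is the restriction, and a composite keeps the point of the
  outer arrow.\<close>

definition KE :: "('t \<times> 'u, 'm \<times> 'u) cat" where
  "KE = \<lparr>Obj = {(t, y). t \<in> Obj K \<and> y \<in> el c t},
     Arr = {(m, y). m \<in> Arr K \<and> y \<in> el c (Cod K m)},
     Dom = (\<lambda>(m, y). (Dom K m, res c m y)),
     Cod = (\<lambda>(m, y). (Cod K m, y)),
     Id = (\<lambda>(t, y). (Id K t, y)),
     Comp = (\<lambda>(m, y) (n, _). (m \<odot> n, y))\<rparr>"

definition over :: "'u \<Rightarrow> 'm set \<Rightarrow> ('m \<times> 'u) set" where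
  "over y S = (\<lambda>m. (m, y)) ` S"

definition JE :: "'t \<times> 'u \<Rightarrow> ('m \<times> 'u) set set" where
  "JE = (\<lambda>(t, y). over y ` J t)"

text \<open>An object over \<open>c\<close> is seen at stage \<open>(t, y)\<close> as its fibre over
  \<open>y\<close>. This is the usual equivalence of a slice of sheaves with sheaves on the category
  of elements.\<close>

definition elS :: "'a \<Rightarrow> 't \<times> 'u \<Rightarrow> 'u set" where
  "elS p = (\<lambda>(t, y). {x \<in> el (Dom D p) t. app p t x = y})"

definition resS :: "'a \<Rightarrow> 'm \<times> 'u \<Rightarrow> 'u \<Rightarrow> 'u" where
  "resS p = (\<lambda>(m, y). res (Dom D p) m)"

definition appS :: "'a \<times> 'a \<times> 'a \<Rightarrow> 't \<times> 'u \<Rightarrow> 'u \<Rightarrow> 'u" where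
  "appS F = (\<lambda>(t, y). app (mid F) t)"

definition \<pi>S :: "'t \<times> 'u \<Rightarrow> 'b" where
  "\<pi>S v = \<pi> (fst v)"

lemma KE_simps [simp]:
  "(t, y) \<in> Obj KE \<longleftrightarrow> t \<in> Obj K \<and> y \<in> el c t"
  "(m, y) \<in> Arr KE \<longleftrightarrow> m \<in> Arr K \<and> y \<in> el c (Cod K m)"
  "Dom KE (m, y) = (Dom K m, res c m y)" "Cod KE (m, y) = (Cod K m, y)" "Id KE (t, y) = (Id K t, y)"
  "(m, y) \<cdot>\<^bsub>KE\<^esub> (n, z) = (m \<odot> n, y)"
  unfolding KE_def by auto

lemma over_iff [simp]: "(m, z) \<in> over y S \<longleftrightarrow> z = y \<and> m \<in> S"
  unfolding over_def by auto

lemma over_inj: "over y S = over y T \<Longrightarrow> S = T"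
  unfolding over_def by auto

lemma JE_iff: "S' \<in> JE (t, y) \<longleftrightarrow> (\<exists>S\<in>J t. S' = over y S)"
  unfolding JE_def by auto

lemma over_JE [simp]: "over y S \<in> JE (t, y) \<longleftrightarrow> S \<in> J t"
  unfolding JE_iff using over_inj by blast

lemma elS_iff [simp]: "x \<in> elS p (t, y) \<longleftrightarrow> x \<in> el (Dom D p) t \<and> app p t x = y"
  unfolding elS_def by simp

lemma resS_simp [simp]: "resS p (m, y) = res (Dom D p) m"
  unfolding resS_def by simp

lemma appS_simp [simp]: "appS (p, f, q) (t, y) = app f t"
  unfolding appS_def mid_def by simp

lemma category_KE: "category KE"
proof
  note r = res_mem[OF base]
  show "Dom KE f \<in> Obj KE" if "f \<in> Arr KE" for f using that r by (cases f) simp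
  show "Cod KE f \<in> Obj KE" if "f \<in> Arr KE" for f using that by (cases f) simp
  show "Id KE A \<in> hom KE A A" if "A \<in> Obj KE" for A
    using that res_id[OF base] unfolding hom_def by (cases A) simp
  show "g \<cdot>\<^bsub>KE\<^esub> f \<in> hom KE X Z" if "f \<in> hom KE X Y" "g \<in> hom KE Y Z" for f g X Y Z
    using that res_comp[OF base] unfolding hom_def by (cases f; cases g) auto
  show "Id KE Y \<cdot>\<^bsub>KE\<^esub> f = f" if "f \<in> hom KE X Y" for f X Y
    using that unfolding hom_def by (cases f) auto
  show "f \<cdot>\<^bsub>KE\<^esub> Id KE X = f" if "f \<in> hom KE X Y" for f X Y
    using that unfolding hom_def by (cases f) auto
  show "(h \<cdot>\<^bsub>KE\<^esub> g) \<cdot>\<^bsub>KE\<^esub> f = h \<cdot>\<^bsub>KE\<^esub> (g \<cdot>\<^bsub>KE\<^esub> f)"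
    if "f \<in> hom KE W X" "g \<in> hom KE X Y" "h \<in> hom KE Y Z" for f g h W X Y Z
    using that unfolding hom_def by (cases f; cases g; cases h) auto
qed

lemma sieve_over:
  assumes t: "t \<in> Obj K" and y: "y \<in> el c t" and S: "sieve K t S"
  shows "sieve KE (t, y) (over y S)"
  unfolding sieve_def
proof (intro conjI ballI impI)
  have a: "m \<in> Arr K" "Cod K m = t" if "m \<in> S" for m using S that unfolding sieve_def by auto
  show "over y S \<subseteq> {f \<in> Arr KE. Cod KE f = (t, y)}" using a y by auto
  fix f g assume f: "f \<in> over y S" and g: "g \<in> Arr KE" "Cod KE g = Dom KE f"
  obtain m where m: "f = (m, y)" "m \<in> S" using f unfolding over_def by blast
  obtain n z where n: "g = (n, z)" by (cases g)
  have "m \<odot> n \<in> S" using S m g n unfolding sieve_def by auto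
  then show "f \<cdot>\<^bsub>KE\<^esub> g \<in> over y S" unfolding m n by simp
qed

lemma pull_over:
  assumes m: "m \<in> Arr K" and y: "y \<in> el c (Cod K m)"
  shows "pull_sieve KE (m, y) (over y S) = over (res c m y) (pull_sieve K m S)"
proof (rule set_eqI, clarify)
  fix n z
  show "(n, z) \<in> pull_sieve KE (m, y) (over y S) \<longleftrightarrow> (n, z) \<in> over (res c m y) (pull_sieve K m S)"
    unfolding pull_sieve_def using res_mem[OF base m refl y] by auto
qed

text \<open>Arrows into \<open>(t, y)\<close> are the arrows into \<open>t\<close> labelled by
  \<open>y\<close>, so sieves at the two stages correspond, and pulling back merely restricts the
  label. Each axiom is thereby reduced to its counterpart for the base.\<close>

lemma site_KE: "grothendieck_site KE JE"
  unfolding grothendieck_site_def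
proof (intro conjI ballI allI impI category_KE)
  show "sieve KE v S'" if "v \<in> Obj KE" "S' \<in> JE v" for v S'
    using that sieve_over covering_sieve by (cases v) (auto simp: JE_iff)
  show "{f \<in> Arr KE. Cod KE f = v} \<in> JE v" if v: "v \<in> Obj KE" for v
  proof (cases v)
    case (Pair t y)
    have "{f \<in> Arr KE. Cod KE f = v} = over y (into t)" using v unfolding Pair over_def by auto
    then show ?thesis using into_covers[of t] v unfolding Pair by simp
  qed
  show "pull_sieve KE f S' \<in> JE (Dom KE f)" if f: "f \<in> Arr KE" and S: "S' \<in> JE (Cod KE f)" for f S'
  proof (cases f)
    case (Pair m y)
    then show ?thesis using f S pull_covers[of m] by (auto simp: JE_iff pull_over)
  qed
  fix v S' R' assume v: "v \<in> Obj KE" and S: "S' \<in> JE v"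
    and R: "sieve KE v R' \<and> (\<forall>f\<in>S'. pull_sieve KE f R' \<in> JE (Dom KE f))"
  obtain t y where ty: "v = (t, y)" by (cases v)
  have t: "t \<in> Obj K" and y: "y \<in> el c t" using v unfolding ty by auto
  obtain S0 where S0: "S0 \<in> J t" "S' = over y S0" using S unfolding ty JE_iff by blast
  \<comment> \<open>Every arrow of a sieve at \<open>(t, y)\<close> carries the label
    \<open>y\<close>, so the sieve is recovered from its underlying arrows.\<close>
  define R0 where "R0 = {m. (m, y) \<in> R'}"
  have Rsub: "m \<in> Arr K \<and> Cod K m = t \<and> z = y" if "(m, z) \<in> R'" for m z
    using R that unfolding sieve_def ty by auto
  then have R': "R' = over y R0" unfolding R0_def by auto
  have "R0 \<in> J t"
  proof (rule trans_covers[OF t S0(1)])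
    show "sieve K t R0"
      unfolding sieve_def
    proof (intro conjI ballI impI)
      show "R0 \<subseteq> {f \<in> Arr K. Cod K f = t}" using Rsub unfolding R0_def by auto
      fix m n assume m: "m \<in> R0" and n: "n \<in> Arr K" "Cod K n = Dom K m"
      have mR: "(m, y) \<in> R'" using m unfolding R0_def by simp
      have ma: "m \<in> Arr K" "Cod K m = t" using Rsub[OF mR] by simp_all
      have "\<forall>f\<in>R'. \<forall>g\<in>Arr KE. Cod KE g = Dom KE f \<longrightarrow> f \<cdot>\<^bsub>KE\<^esub> g \<in> R'"
        using conjunct1[OF R] unfolding sieve_def by (elim conjE)
      from bspec[OF bspec[OF this mR], of "(n, res c m y)"] have "(m, y) \<cdot>\<^bsub>KE\<^esub> (n, res c m y) \<in> R'"
        using n res_mem[OF base ma(1), of t y] ma y by simp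
      then show "m \<odot> n \<in> R0" unfolding R0_def by simp
    qed
    fix m assume m: "m \<in> S0"
    note ma = covering_arr[OF t S0(1) m]
    have "pull_sieve KE (m, y) R' \<in> JE (Dom KE (m, y))" using bspec[OF conjunct2[OF R], of "(m, y)"] S0(2) m by simp
    then show "pull_sieve K m R0 \<in> J (Dom K m)"
      using pull_over[OF ma(1), of y R0] ma(2) y unfolding R' by simp
  qed
  then show "R' \<in> JE v" unfolding ty R' by simp
qed

section \<open>The slice and its presentation by fibres\<close>

lemma slice_obj [simp]: "p \<in> Obj (slice D c) \<longleftrightarrow> p \<in> hom D (Dom D p) c"
  unfolding slice_def hom_def by auto

lemma slice_hom_iff: "F \<in> hom (slice D c) p q \<longleftrightarrow>
    (\<exists>f. F = (p, f, q) \<and> p \<in> hom D (Dom D p) c \<and> q \<in> hom D (Dom D q) c \<and> f \<in> hom D (Dom D p) (Dom D q) \<and> q \<cdot>\<^bsub>D\<^esub> f = p)"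
  unfolding slice_def hom_def by auto

lemma slice_comp [simp]: "(q', g, r) \<cdot>\<^bsub>slice D c\<^esub> (p, f, q) = (p, g \<cdot>\<^bsub>D\<^esub> f, r)"
  unfolding slice_def by simp

lemma slice_simps [simp]: "Dom (slice D c) (p, f, q) = p" "Cod (slice D c) (p, f, q) = q"
  "Id (slice D c) p = (p, Id D (Dom D p), p)"
  unfolding slice_def by simp_all

lemma slice_category: "category (slice D c)"
proof
  show "Dom (slice D c) f \<in> Obj (slice D c)" if "f \<in> Arr (slice D c)" for f
    using that unfolding slice_def by auto
  show "Cod (slice D c) f \<in> Obj (slice D c)" if "f \<in> Arr (slice D c)" for f
    using that unfolding slice_def by auto
  show "Id (slice D c) p \<in> hom (slice D c) p p" if p: "p \<in> Obj (slice D c)" for p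
  proof -
    have h: "p \<in> hom D (Dom D p) c" using p by simp
    then show ?thesis unfolding slice_hom_iff using homD[OF h] D.id_in D.id_right[OF h] by simp
  qed
  show "G \<cdot>\<^bsub>slice D c\<^esub> F \<in> hom (slice D c) p r"
    if F: "F \<in> hom (slice D c) p q" and G: "G \<in> hom (slice D c) q r" for F G p q r
  proof -
    obtain f g where f: "F = (p, f, q)" "p \<in> hom D (Dom D p) c" "f \<in> hom D (Dom D p) (Dom D q)" "q \<cdot>\<^bsub>D\<^esub> f = p"
      and g: "G = (q, g, r)" "r \<in> hom D (Dom D r) c" "g \<in> hom D (Dom D q) (Dom D r)" "r \<cdot>\<^bsub>D\<^esub> g = q"
      using F G unfolding slice_hom_iff by blast
    have "r \<cdot>\<^bsub>D\<^esub> (g \<cdot>\<^bsub>D\<^esub> f) = p" using D.comp_assoc[OF f(3) g(3) g(2)] g(4) f(4) by simp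
    then show ?thesis unfolding slice_hom_iff f(1) g(1) using f(2) g(2) D.comp_in[OF f(3) g(3)] by simp
  qed
  show "Id (slice D c) q \<cdot>\<^bsub>slice D c\<^esub> F = F" if "F \<in> hom (slice D c) p q" for F p q
    using that D.id_left unfolding slice_hom_iff by auto
  show "F \<cdot>\<^bsub>slice D c\<^esub> Id (slice D c) p = F" if "F \<in> hom (slice D c) p q" for F p q
    using that D.id_right unfolding slice_hom_iff by auto
  show "(H \<cdot>\<^bsub>slice D c\<^esub> G) \<cdot>\<^bsub>slice D c\<^esub> F = H \<cdot>\<^bsub>slice D c\<^esub> (G \<cdot>\<^bsub>slice D c\<^esub> F)"
    if F: "F \<in> hom (slice D c) p q" and G: "G \<in> hom (slice D c) q r" and H: "H \<in> hom (slice D c) r s" for F G H p q r s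
  proof -
    obtain f g h where f: "F = (p, f, q)" "f \<in> hom D (Dom D p) (Dom D q)" and g: "G = (q, g, r)" "g \<in> hom D (Dom D q) (Dom D r)"
      and h: "H = (r, h, s)" "h \<in> hom D (Dom D r) (Dom D s)"
      using F G H unfolding slice_hom_iff by blast
    show ?thesis unfolding f(1) g(1) h(1) slice_comp D.comp_assoc[OF f(2) g(2) h(2)] ..
  qed
qed

text \<open>The total space is the sum of the fibres over the points of the base, with its
  projection. It is again a sheaf, and it is small enough because the bound for the fibres is the
  same at all points over a stage.\<close>

lemma slice_represent:
  assumes P: "site.sheaf KE JE P r" and PU: "bounded_family (Obj KE) U \<pi>S P"
  shows "\<exists>p\<in>Obj (slice D c). \<exists>\<theta>. site.natural KE P r (elS p) (resS p) \<theta> \<and>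
    (\<forall>v\<in>Obj KE. bij_betw (\<theta> v) (P v) (elS p v))"
proof -
  interpret E: site KE JE by unfold_locales (rule site_KE)
  note p = E.sheaf_psh[OF P]
  define Q where "Q t = (SIGMA y:el c t. P (t, y))" for t
  define q where "q m z = (res c m (fst z), r (m, fst z) (snd z))" for m z
  have Qiff [simp]: "(y, x) \<in> Q t \<longleftrightarrow> y \<in> el c t \<and> x \<in> P (t, y)" for y x t unfolding Q_def by auto
  have qs [simp]: "q m (y, x) = (res c m y, r (m, y) x)" for m y x unfolding q_def by simp
  note rm = E.psh_mem[OF p, of "(m, y)" for m y, simplified]
  note ri = E.psh_id[OF p, of "(t, y)" for t y, simplified]
  note rc = E.psh_comp[OF p, of "(m, y)" "(n, res c m y)" for m n y, simplified]
  have Qp: "psh Q q"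
    unfolding psh_def
  proof (intro conjI ballI impI)
    show "q m z \<in> Q (Dom K m)" if m: "m \<in> Arr K" and z: "z \<in> Q (Cod K m)" for m z
      using z rm[of m "fst z" "snd z"] m res_mem[OF base m refl] by (cases z) simp
    show "q (Id K t) z = z" if t: "t \<in> Obj K" and z: "z \<in> Q t" for t z
      using z ri[of t "fst z" "snd z"] t res_id[OF base t] by (cases z) simp
    show "q (m \<odot> n) z = q n (q m z)" if m: "m \<in> Arr K" "n \<in> Arr K" "Cod K n = Dom K m" and z: "z \<in> Q (Cod K m)" for m n z
      using z rc[of m "fst z" n "snd z"] m res_comp[OF base m] res_mem[OF base m(1) refl] by (cases z) simp
  qed
  have Qs: "sheaf Q q"
    unfolding sheaf_def
  proof (intro conjI Qp ballI allI impI, elim conjE)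
    fix t S x assume t: "t \<in> Obj K" and S: "S \<in> J t" and x: "\<forall>m\<in>S. x m \<in> Q (Dom K m)"
      and xx: "\<forall>m\<in>S. \<forall>n\<in>Arr K. Cod K n = Dom K m \<longrightarrow> q n (x m) = x (m \<odot> n)"
    note Sa = covering_arr[OF t S]
    have x1: "fst (x m) \<in> el c (Dom K m)" "snd (x m) \<in> P (Dom K m, fst (x m))" if "m \<in> S" for m
      using bspec[OF x that] Qiff[of "fst (x m)" "snd (x m)"] by simp_all
    have x2: "res c n (fst (x m)) = fst (x (m \<odot> n))" "r (n, fst (x m)) (snd (x m)) = snd (x (m \<odot> n))"
      if "m \<in> S" "n \<in> Arr K" "Cod K n = Dom K m" for m n
      using xx[rule_format, OF that, symmetric] qs[of n "fst (x m)" "snd (x m)"] by simp_all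
    \<comment> \<open>The base points are glued first. Only when the point \<open>y\<close> is known
      do the second coordinates form a matching family at one stage \<open>(t, y)\<close>.\<close>
    have "\<exists>!y. y \<in> el c t \<and> (\<forall>m\<in>S. res c m y = fst (x m))"
      by (rule el_sheaf[OF base, unfolded sheaf_def, THEN conjunct2, rule_format, OF t S]) (use x1 x2 in blast)
    then obtain y where y: "y \<in> el c t" "\<And>m. m \<in> S \<Longrightarrow> res c m y = fst (x m)"
      and uy: "\<And>y'. y' \<in> el c t \<Longrightarrow> \<forall>m\<in>S. res c m y' = fst (x m) \<Longrightarrow> y' = y" by auto
    have tyO: "(t, y) \<in> Obj KE" and tyJ: "over y S \<in> JE (t, y)" using t y S by simp_all
    have "\<exists>!w. w \<in> P (t, y) \<and> (\<forall>f\<in>over y S. r f w = snd (x (fst f)))"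
    proof (rule P[unfolded E.sheaf_def, THEN conjunct2, rule_format, OF tyO tyJ], intro conjI ballI impI)
      show "snd (x (fst f)) \<in> P (Dom KE f)" if "f \<in> over y S" for f
        using that x1 y by (cases f) simp
      fix f g assume f: "f \<in> over y S" and g: "g \<in> Arr KE" "Cod KE g = Dom KE f"
      obtain m n where "f = (m, y)" "m \<in> S" "g = (n, res c m y)" "n \<in> Arr K" "Cod K n = Dom K m"
        using f g by (cases f; cases g) auto
      then show "r g (snd (x (fst f))) = snd (x (fst (f \<cdot>\<^bsub>KE\<^esub> g)))" using x2 y by simp
    qed
    then obtain w where w0: "w \<in> P (t, y) \<and> (\<forall>f\<in>over y S. r f w = snd (x (fst f)))"
      and uw0: "\<forall>w'. w' \<in> P (t, y) \<and> (\<forall>f\<in>over y S. r f w' = snd (x (fst f))) \<longrightarrow> w' = w" by (rule ex1E)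
    have w: "w \<in> P (t, y)" "r (m, y) w = snd (x m)" if "m \<in> S" for m
      using w0 bspec[OF conjunct2[OF w0], of "(m, y)"] that by simp_all
    have wP: "w \<in> P (t, y)" using w0 by blast
    have uw: "w' = w" if "w' \<in> P (t, y)" "\<And>m. m \<in> S \<Longrightarrow> r (m, y) w' = snd (x m)" for w'
      by (rule uw0[rule_format], intro conjI ballI) (use that in \<open>auto simp: over_def\<close>)
    show "\<exists>!z. z \<in> Q t \<and> (\<forall>m\<in>S. q m z = x m)"
    proof (rule ex1I[of _ "(y, w)"])
      show "(y, w) \<in> Q t \<and> (\<forall>m\<in>S. q m (y, w) = x m)" using y wP w(2) by simp
      fix z assume z: "z \<in> Q t \<and> (\<forall>m\<in>S. q m z = x m)"
      obtain y' w' where z': "z = (y', w')" by (cases z)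
      have xm: "x m = (res c m y', r (m, y') w')" if "m \<in> S" for m using z z' that by simp
      have yy: "y' = y" by (rule uy) (use z z' xm in simp_all)
      have "w' = w" by (rule uw) (use z z' yy xm in simp_all)
      then show "z = (y, w)" using z' yy by simp
    qed
  qed
  have bQ: "bounded Q"
  proof -
    obtain \<beta> where \<beta>: "\<forall>b. \<beta> b \<in> U" "\<forall>v\<in>Obj KE. P v \<lesssim> \<beta> (\<pi>S v)" by (rule bounded_familyE[OF PU])
    have "bounded (\<lambda>t. el c t \<times> \<beta> (\<pi> t))"
      by (rule bounded_family_Times[OF universe el_bounded[OF base]])
        (rule bounded_familyI[of U \<beta>], use \<beta>(1) in \<open>simp_all add: small_mem\<close>)
    then show ?thesis
    proof (rule bounded_family_lepoll)
      fix t assume t: "t \<in> Obj K"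
      \<comment> \<open>\<open>\<pi>S\<close> forgets \<open>y\<close>, so one set bounds all fibres
        over \<open>t\<close>, and the sum embeds in a binary product.\<close>
      have "P (t, y) \<lesssim> \<beta> (\<pi> t)" if "y \<in> el c t" for y
        using bspec[OF \<beta>(2), of "(t, y)"] t that by (simp add: \<pi>S_def)
      then show "Q t \<lesssim> el c t \<times> \<beta> (\<pi> t)" unfolding Q_def by (intro Sigma_lepoll_mono) simp_all
    qed
  qed
  obtain X \<theta> where X: "X \<in> Obj D" and \<theta>: "natural Q q (el X) (res X) \<theta>"
    and bij: "\<And>t. t \<in> Obj K \<Longrightarrow> bij_betw (\<theta> t) (Q t) (el X t)"
    by (rule realise[OF Qs bQ], rule that; (assumption | blast))
  define i where "i t = the_inv_into (Q t) (\<theta> t)" for t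
  have i1: "i t z \<in> Q t" and i2: "\<theta> t (i t z) = z" if "t \<in> Obj K" "z \<in> el X t" for t z
    using bij[OF that(1)] that(2) unfolding i_def bij_betw_def
    by (auto intro!: the_inv_into_into f_the_inv_into_f)
  have i3: "i t (\<theta> t w) = w" if "t \<in> Obj K" "w \<in> Q t" for t w
    using bij[OF that(1)] that(2) unfolding i_def bij_betw_def by (simp add: the_inv_into_f_f)
  have ir: "i (Dom K m) (res X m z) = q m (i (Cod K m) z)" if "m \<in> Arr K" "z \<in> el X (Cod K m)" for m z
  proof -
    have "res X m z = \<theta> (Dom K m) (q m (i (Cod K m) z))"
      using natural_res[OF \<theta> that(1) i1] i2 that by simp
    then show ?thesis using i3 psh_mem[OF Qp that(1) i1] that by simp
  qed
  have "natural (el X) (res X) (el c) (res c) (\<lambda>t z. fst (i t z))"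
    unfolding natural_def
  proof (intro conjI ballI)
    show "fst (i t z) \<in> el c t" if "t \<in> Obj K" "z \<in> el X t" for t z
      using i1[OF that] Qiff[of "fst (i t z)" "snd (i t z)"] by simp
    show "fst (i (Dom K m) (res X m z)) = res c m (fst (i (Cod K m) z))" if "m \<in> Arr K" "z \<in> el X (Cod K m)" for m z
      unfolding ir[OF that] q_def by simp
  qed
  from full[OF X base this] obtain f where f: "f \<in> hom D X c" "\<forall>t\<in>Obj K. \<forall>z\<in>el X t. app f t z = fst (i t z)" by blast
  have fX: "Dom D f = X" using homD[OF f(1)] by simp
  have \<theta>X: "\<theta> t (y, x) \<in> el X t" "app f t (\<theta> t (y, x)) = y" if "t \<in> Obj K" "y \<in> el c t" "x \<in> P (t, y)" for t y x
    using natural_mem[OF \<theta> that(1), of "(y, x)"] f(2) i3[OF that(1), of "(y, x)"] that by simp_all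
  define \<theta>' where "\<theta>' v x = \<theta> (fst v) (snd v, x)" for v x
  have "E.natural P r (elS f) (resS f) \<theta>'"
    unfolding E.natural_def
  proof (intro conjI ballI)
    show "\<theta>' v x \<in> elS f v" if "v \<in> Obj KE" "x \<in> P v" for v x
      using that \<theta>X unfolding \<theta>'_def by (cases v) (simp add: fX)
    show "\<theta>' (Dom KE n) (r n x) = resS f n (\<theta>' (Cod KE n) x)" if "n \<in> Arr KE" "x \<in> P (Cod KE n)" for n x
    proof (cases n)
      case (Pair m y)
      then show ?thesis using that natural_res[OF \<theta>, of m "(y, x)"] unfolding \<theta>'_def by (simp add: fX)
    qed
  qed
  moreover have "bij_betw (\<theta>' v) (P v) (elS f v)" if v: "v \<in> Obj KE" for v
  proof (cases v)
    case (Pair t y)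
    have t: "t \<in> Obj K" and y: "y \<in> el c t" using v unfolding Pair by auto
    show ?thesis
      unfolding bij_betw_def
    proof (intro conjI inj_onI subset_antisym subsetI)
      fix x x' assume x: "x \<in> P v" "x' \<in> P v" and e: "\<theta>' v x = \<theta>' v x'"
      have "(y, x) = (y, x')"
        using inj_onD[OF bij_betw_imp_inj_on[OF bij[OF t]], of "(y, x)" "(y, x')"] e x y unfolding \<theta>'_def Pair by simp
      then show "x = x'" by simp
    next
      fix z assume "z \<in> \<theta>' v ` P v"
      then show "z \<in> elS f v" using \<theta>X[OF t y] unfolding \<theta>'_def Pair by (auto simp: fX)
    next
      fix z assume "z \<in> elS f v"
      then have z: "z \<in> el X t" "fst (i t z) = y" using f(2) t unfolding Pair by (auto simp: fX)
      have "i t z = (y, snd (i t z))" using z(2) by (simp add: prod_eq_iff)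
      then have "z = \<theta>' v (snd (i t z))" "snd (i t z) \<in> P v"
        using i2[OF t z(1)] i1[OF t z(1)] Qiff[of "fst (i t z)" "snd (i t z)"] z(2) unfolding \<theta>'_def Pair by simp_all
      then show "z \<in> \<theta>' v ` P v" by blast
    qed
  qed
  ultimately show ?thesis using f(1) fX by (intro bexI[of _ f]) auto
qed

text \<open>Gluing takes place in the total object. The result lies over the prescribed point
  because equality in \<open>c\<close> is local.\<close>

lemma slice_sheaf:
  assumes p: "p \<in> Obj (slice D c)"
  shows "site.sheaf KE JE (elS p) (resS p)"
proof -
  interpret E: site KE JE by unfold_locales (rule site_KE)
  define X where "X = Dom D p"
  have ph: "p \<in> hom D X c" using p X_def by simp
  have X: "X \<in> Obj D" using homD[OF ph] by blast
  have ps: "E.psh (elS p) (resS p)"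
    unfolding E.psh_def
  proof (intro conjI ballI impI)
    show "resS p n x \<in> elS p (Dom KE n)" if "n \<in> Arr KE" "x \<in> elS p (Cod KE n)" for n x
      using that res_mem[OF X _ refl] app_res[OF ph _ refl] by (cases n) (simp add: X_def)
    show "resS p (Id KE v) x = x" if "v \<in> Obj KE" "x \<in> elS p v" for v x
      using that res_id[OF X] by (cases v) (simp add: X_def)
    show "resS p (n \<cdot>\<^bsub>KE\<^esub> n') x = resS p n' (resS p n x)"
      if "n \<in> Arr KE" "n' \<in> Arr KE" "Cod KE n' = Dom KE n" "x \<in> elS p (Cod KE n)" for n n' x
      using that res_comp[OF X] by (cases n; cases n') (simp add: X_def)
  qed
  show ?thesis
    unfolding E.sheaf_def
  proof (intro conjI ps ballI allI impI, elim conjE)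
    fix v S' x assume v: "v \<in> Obj KE" and S': "S' \<in> JE v" and x: "\<forall>n\<in>S'. x n \<in> elS p (Dom KE n)"
      and xx: "\<forall>n\<in>S'. \<forall>n'\<in>Arr KE. Cod KE n' = Dom KE n \<longrightarrow> resS p n' (x n) = x (n \<cdot>\<^bsub>KE\<^esub> n')"
    obtain t y where ty: "v = (t, y)" by (cases v)
    have t: "t \<in> Obj K" and y: "y \<in> el c t" using v unfolding ty by auto
    obtain S where S: "S \<in> J t" "S' = over y S" using S' unfolding ty JE_iff by blast
    note Sa = covering_arr[OF t S(1)]
    have x1: "x (m, y) \<in> el X (Dom K m)" "app p (Dom K m) (x (m, y)) = res c m y" if "m \<in> S" for m
      using bspec[OF x, of "(m, y)"] that S(2) by (simp_all add: X_def)
    have x2: "res X n (x (m, y)) = x (m \<odot> n, y)" if "m \<in> S" "n \<in> Arr K" "Cod K n = Dom K m" for m n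
      using bspec[OF bspec[OF xx, of "(m, y)"], of "(n, res c m y)"] that S(2) res_mem[OF base Sa[OF that(1)] y] by (simp add: X_def)
    have "\<exists>!z. z \<in> el X t \<and> (\<forall>m\<in>S. res X m z = x (m, y))"
      by (rule el_sheaf[OF X, unfolded sheaf_def, THEN conjunct2, rule_format, OF t S(1)]) (use x1 x2 in blast)
    then obtain z where z: "z \<in> el X t" "\<And>m. m \<in> S \<Longrightarrow> res X m z = x (m, y)"
      and uz: "\<And>z'. z' \<in> el X t \<Longrightarrow> \<forall>m\<in>S. res X m z' = x (m, y) \<Longrightarrow> z' = z" by auto
    have "app p t z = y"
    proof (rule el_eqI[OF base t app_mem[OF ph t z(1)] y], unfold cov_def, rule bexI[OF _ S(1)], rule ballI)
      fix m assume m: "m \<in> S"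
      show "res c m (app p t z) = res c m y"
        using app_res[OF ph Sa[OF m] z(1)] z(2)[OF m] x1[OF m] by simp
    qed
    show "\<exists>!z. z \<in> elS p v \<and> (\<forall>n\<in>S'. resS p n z = x n)"
    proof (rule ex1I[of _ z])
      show "z \<in> elS p v \<and> (\<forall>n\<in>S'. resS p n z = x n)"
        unfolding ty S(2) over_def using z \<open>app p t z = y\<close> by (auto simp: X_def)
      fix z' assume z': "z' \<in> elS p v \<and> (\<forall>n\<in>S'. resS p n z' = x n)"
      show "z' = z"
        by (rule uz) (use z' in \<open>auto simp: ty S(2) over_def X_def\<close>)
    qed
  qed
qed

lemma slice_sheaf_cat: "sheaf_cat KE JE (slice D c) U elS resS appS \<pi>S"
proof -
  interpret E: site KE JE by unfold_locales (rule site_KE)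
  show ?thesis
  proof (rule sheaf_cat.intro, rule E.site_axioms, rule sheaf_cat_axioms.intro, rule slice_category, rule universe)
    fix \<beta> :: "'b \<Rightarrow> 'u set" assume \<beta>: "\<And>b. \<beta> b \<in> U"
    obtain \<gamma> where \<gamma>: "\<forall>b. \<gamma> b \<in> U" "\<forall>t\<in>Obj K. (\<Pi>\<^sub>E m\<in>into t. \<beta> (\<pi> (Dom K m))) \<lesssim> \<gamma> (\<pi> t)"
      by (rule bounded_familyE[OF into_bound[of \<beta>, OF \<beta>]])
    show "bounded_family (Obj KE) U \<pi>S (\<lambda>v. \<Pi>\<^sub>E m\<in>E.into v. \<beta> (\<pi>S (Dom KE m)))"
    proof (rule bounded_familyI[of U \<gamma>])
      show "small U (\<gamma> b)" for b using \<gamma>(1) by (simp add: small_mem)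
      fix v assume v: "v \<in> Obj KE"
      obtain t y where ty: "v = (t, y)" by (cases v)
      have t: "t \<in> Obj K" and y: "y \<in> el c t" using v unfolding ty by auto
      \<comment> \<open>Functions on the arrows into \<open>(t, y)\<close> are functions on the
        arrows into \<open>t\<close>, since the label is fixed; so the bound for the base serves for
        every \<open>y\<close>.\<close>
      let ?F = "\<lambda>f. \<lambda>m\<in>into t. f (m, y)"
      have "(\<Pi>\<^sub>E m\<in>E.into v. \<beta> (\<pi>S (Dom KE m))) \<lesssim> (\<Pi>\<^sub>E m\<in>into t. \<beta> (\<pi> (Dom K m)))"
        unfolding lepoll_def
      proof (intro exI conjI)
        show "inj_on ?F (\<Pi>\<^sub>E m\<in>E.into v. \<beta> (\<pi>S (Dom KE m)))"
        proof (rule inj_onI)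
          fix f g assume f: "f \<in> (\<Pi>\<^sub>E m\<in>E.into v. \<beta> (\<pi>S (Dom KE m)))" and g: "g \<in> (\<Pi>\<^sub>E m\<in>E.into v. \<beta> (\<pi>S (Dom KE m)))"
            and e: "?F f = ?F g"
          show "f = g"
          proof (rule PiE_ext[OF f g])
            fix n assume n: "n \<in> E.into v"
            obtain m where m: "n = (m, y)" "m \<in> into t" using n unfolding ty by (cases n) auto
            show "f n = g n" using fun_cong[OF e, of m] m by simp
          qed
        qed
        show "?F ` (\<Pi>\<^sub>E m\<in>E.into v. \<beta> (\<pi>S (Dom KE m))) \<subseteq> (\<Pi>\<^sub>E m\<in>into t. \<beta> (\<pi> (Dom K m)))"
        proof (clarify, rule PiE_I)
          fix f m assume f: "f \<in> (\<Pi>\<^sub>E m\<in>E.into v. \<beta> (\<pi>S (Dom KE m)))" and m: "m \<in> into t"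
          have "(m, y) \<in> E.into v" using m y unfolding ty by simp
          then show "?F f m \<in> \<beta> (\<pi> (Dom K m))" using PiE_mem[OF f, of "(m, y)"] m unfolding \<pi>S_def by simp
        qed (simp del: into_iff)
      qed
      also have "\<dots> \<lesssim> \<gamma> (\<pi> t)" using \<gamma>(2) t by blast
      finally show "(\<Pi>\<^sub>E m\<in>E.into v. \<beta> (\<pi>S (Dom KE m))) \<lesssim> \<gamma> (\<pi>S v)" unfolding \<pi>S_def ty by simp
    qed
  next
    fix p assume p: "p \<in> Obj (slice D c)"
    then have X: "Dom D p \<in> Obj D" using homD[of p "Dom D p" c] by simp
    obtain \<beta> where \<beta>: "\<forall>b. \<beta> b \<in> U" "\<forall>t\<in>Obj K. el (Dom D p) t \<lesssim> \<beta> (\<pi> t)"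
      by (rule bounded_familyE[OF el_bounded[OF X]])
    show "bounded_family (Obj KE) U \<pi>S (elS p)"
    proof (rule bounded_familyI[of U \<beta>])
      show "small U (\<beta> b)" for b using \<beta>(1) by (simp add: small_mem)
      fix v assume v: "v \<in> Obj KE"
      have "elS p v \<lesssim> el (Dom D p) (fst v)" by (rule subset_imp_lepoll) (cases v, auto)
      moreover have "el (Dom D p) (fst v) \<lesssim> \<beta> (\<pi>S v)"
        using bspec[OF \<beta>(2), of "fst v"] v by (cases v) (simp add: \<pi>S_def)
      ultimately show "elS p v \<lesssim> \<beta> (\<pi>S v)" by (rule lepoll_trans)
    qed
  next
    show "E.sheaf (elS p) (resS p)" if "p \<in> Obj (slice D c)" for p by (rule slice_sheaf[OF that])
  next
    fix F p q assume "F \<in> hom (slice D c) p q"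
    then obtain f where f: "F = (p, f, q)" "f \<in> hom D (Dom D p) (Dom D q)" "q \<in> hom D (Dom D q) c" "q \<cdot>\<^bsub>D\<^esub> f = p"
      unfolding slice_hom_iff by blast
    note e = comp_app_eq[OF f(4,2,3)]
    show "E.natural (elS p) (resS p) (elS q) (resS q) (appS F)"
      unfolding E.natural_def f(1)
    proof (intro conjI ballI)
      show "appS (p, f, q) v x \<in> elS q v" if "v \<in> Obj KE" "x \<in> elS p v" for v x
        using that app_mem[OF f(2)] e by (cases v) simp
      show "appS (p, f, q) (Dom KE n) (resS p n x) = resS q n (appS (p, f, q) (Cod KE n) x)"
        if "n \<in> Arr KE" "x \<in> elS p (Cod KE n)" for n x
        using that app_res[OF f(2) _ refl] by (cases n) simp
    qed
  next
    fix p v x assume "p \<in> Obj (slice D c)" "v \<in> Obj KE" "x \<in> elS p v"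
    then show "appS (Id (slice D c) p) v x = x"
      using homD[of p "Dom D p" c] app_id by (cases v) simp
  next
    fix F p q G r v x assume F: "F \<in> hom (slice D c) p q" and G: "G \<in> hom (slice D c) q r"
      and v: "v \<in> Obj KE" and x: "x \<in> elS p v"
    obtain f g where f: "F = (p, f, q)" "f \<in> hom D (Dom D p) (Dom D q)" and g: "G = (q, g, r)" "g \<in> hom D (Dom D q) (Dom D r)"
      using F G unfolding slice_hom_iff by blast
    show "appS (G \<cdot>\<^bsub>slice D c\<^esub> F) v x = appS G v (appS F v x)"
      unfolding f(1) g(1) using app_comp[OF f(2) g(2)] v x by (cases v) simp
  next
    fix F p q G assume F: "F \<in> hom (slice D c) p q" and G: "G \<in> hom (slice D c) p q"
      and e: "\<And>v x. v \<in> Obj KE \<Longrightarrow> x \<in> elS p v \<Longrightarrow> appS F v x = appS G v x"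
    obtain f g where f: "F = (p, f, q)" "f \<in> hom D (Dom D p) (Dom D q)" and g: "G = (p, g, q)" "g \<in> hom D (Dom D p) (Dom D q)"
      and p: "p \<in> hom D (Dom D p) c"
      using F G unfolding slice_hom_iff by blast
    have "f = g"
    proof (rule faithful[OF f(2) g(2)])
      fix t x assume t: "t \<in> Obj K" and x: "x \<in> el (Dom D p) t"
      \<comment> \<open>An element of the total object is visible at the stage marked by its own
        image in \<open>c\<close>; so agreement on fibres is agreement everywhere.\<close>
      show "app f t x = app g t x"
        using e[of "(t, app p t x)" x] app_mem[OF p t x] t x unfolding f(1) g(1) by simp
    qed
    then show "F = G" using f g by simp
  next
    fix p q \<phi> assume p': "p \<in> Obj (slice D c)" and q': "q \<in> Obj (slice D c)"
      and \<phi>: "E.natural (elS p) (resS p) (elS q) (resS q) \<phi>"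
    have p: "p \<in> hom D (Dom D p) c" and q: "q \<in> hom D (Dom D q) c" using p' q' by simp_all
    have X: "Dom D p \<in> Obj D" and Y: "Dom D q \<in> Obj D" using homD[OF p] homD[OF q] by auto
    \<comment> \<open>A family of maps between fibres becomes a map of total objects by applying, to
      each element, the map of the fibre in which it lies.\<close>
    define \<psi> where "\<psi> t x = \<phi> (t, app p t x) x" for t x
    have \<psi>q: "\<psi> t x \<in> el (Dom D q) t" "app q t (\<psi> t x) = app p t x" if "t \<in> Obj K" "x \<in> el (Dom D p) t" for t x
      using E.natural_mem[OF \<phi>, of "(t, app p t x)" x] that app_mem[OF p that] unfolding \<psi>_def by simp_all
    have "natural (el (Dom D p)) (res (Dom D p)) (el (Dom D q)) (res (Dom D q)) \<psi>"
      unfolding natural_def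
    proof (intro conjI ballI)
      show "\<psi> t x \<in> el (Dom D q) t" if "t \<in> Obj K" "x \<in> el (Dom D p) t" for t x using \<psi>q that by blast
      show "\<psi> (Dom K m) (res (Dom D p) m x) = res (Dom D q) m (\<psi> (Cod K m) x)"
        if m: "m \<in> Arr K" and x: "x \<in> el (Dom D p) (Cod K m)" for m x
        using E.natural_res[OF \<phi>, of "(m, app p (Cod K m) x)" x] m x app_mem[OF p _ x] app_res[OF p m refl x]
        unfolding \<psi>_def by simp
    qed
    from full[OF X Y this] obtain f where f: "f \<in> hom D (Dom D p) (Dom D q)" "\<forall>t\<in>Obj K. \<forall>x\<in>el (Dom D p) t. app f t x = \<psi> t x"
      by blast
    have "q \<cdot>\<^bsub>D\<^esub> f = p"
      by (rule faithful[OF D.comp_in[OF f(1) q] p]) (simp add: app_comp[OF f(1) q] f(2) \<psi>q)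
    then have "(p, f, q) \<in> hom (slice D c) p q" unfolding slice_hom_iff using p q f by simp
    moreover have "appS (p, f, q) v x = \<phi> v x" if "v \<in> Obj KE" "x \<in> elS p v" for v x
      using that f(2) unfolding \<psi>_def by (cases v) auto
    ultimately show "\<exists>f\<in>hom (slice D c) p q. \<forall>v\<in>Obj KE. \<forall>x\<in>elS p v. appS f v x = \<phi> v x" by blast
  next
    fix P :: "'t \<times> 'u \<Rightarrow> 'u set" and r assume "E.sheaf P r" "bounded_family (Obj KE) U \<pi>S P"
    then show "\<exists>p\<in>Obj (slice D c). \<exists>\<theta>. E.natural P r (elS p) (resS p) \<theta> \<and> (\<forall>v\<in>Obj KE. bij_betw (\<theta> v) (P v) (elS p v))"
      by (rule slice_represent)
  qed
qed

sublocale S: sheaf_cat KE JE "slice D c" U elS resS appS \<pi>S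
  by (rule slice_sheaf_cat)

end

section \<open>Internal coproducts of groups\<close>

context slice_base
begin

definition proj :: "('o, 'a) group_data \<Rightarrow> 'a" where
  "proj G = pr2 D (gobj G) c"

lemma proj_hom:
  assumes "is_group_object D G"
  shows "proj G \<in> hom D (prd D (gobj G) c) c" "Dom D (proj G) = prd D (gobj G) c"
  using pr2_hom[OF group_obj[OF assms] base] homD[OF pr2_hom[OF group_obj[OF assms] base]] unfolding proj_def by simp_all

lemma times_group_simps:
  assumes G: "is_group_object D G"
  defines "p \<equiv> proj G"
  defines "k \<equiv> pr1 D (gobj G) c"
  defines "u \<equiv> mid (pr1 (slice D c) p p)"
  defines "v \<equiv> mid (pr2 (slice D c) p p)"
  defines "t0 \<equiv> terminal (slice D c)"
  shows "gobj (times_group D c G) = p"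
    "gmult (times_group D c G) = (prd (slice D c) p p, pair D (gmult G \<cdot>\<^bsub>D\<^esub> pair D (k \<cdot>\<^bsub>D\<^esub> u) (k \<cdot>\<^bsub>D\<^esub> v)) (p \<cdot>\<^bsub>D\<^esub> u), p)"
    "gunit (times_group D c G) = (t0, pair D (gunit G \<cdot>\<^bsub>D\<^esub> bang D (Dom D t0)) t0, p)"
    "ginv (times_group D c G) = (p, pair D (ginv G \<cdot>\<^bsub>D\<^esub> k) p, p)"
  unfolding times_group_def Let_def proj_def p_def k_def u_def v_def t0_def by simp_all

lemma pair_over:
  assumes G: "is_group_object D G" and f: "f \<in> hom D X (gobj G)" and g: "g \<in> hom D X c"
  shows "proj G \<cdot>\<^bsub>D\<^esub> pair D f g = g" "(g, pair D f g, proj G) \<in> hom (slice D c) g (proj G)"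
proof -
  note p = proj_hom[OF G] and ph = pair_hom[OF f g]
  have gd: "Dom D g = X" using homD[OF g] by simp
  show 1: "proj G \<cdot>\<^bsub>D\<^esub> pair D f g = g"
  proof (rule faithful[OF D.comp_in[OF ph p(1)] g])
    fix t x assume t: "t \<in> Obj K" and x: "x \<in> el X t"
    show "app (proj G \<cdot>\<^bsub>D\<^esub> pair D f g) t x = app g t x"
      unfolding app_comp[OF ph p(1) t x] pair_app[OF f g t x] unfolding proj_def
      by (rule pr2_tup[OF group_obj[OF G] base t app_mem[OF f t x] app_mem[OF g t x]])
  qed
  show "(g, pair D f g, proj G) \<in> hom (slice D c) g (proj G)"
    unfolding slice_hom_iff using 1 g p ph gd by simp
qed

text \<open>The fibre of the projection over any point is a copy of the group itself, which is why
  the laws transfer unchanged.\<close>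

lemma elS_proj:
  assumes G: "is_group_object D G" and t: "t \<in> Obj K" and y: "y \<in> el c t"
  shows "z \<in> elS (proj G) (t, y) \<longleftrightarrow> (\<exists>a\<in>el (gobj G) t. z = tup (gobj G) c t a y)"
proof -
  note O = group_obj[OF G]
  show ?thesis
  proof
    assume "z \<in> elS (proj G) (t, y)"
    then have z: "z \<in> el (prd D (gobj G) c) t" "app (pr2 D (gobj G) c) t z = y" using proj_hom[OF G] unfolding proj_def by auto
    obtain a b where ab: "a \<in> el (gobj G) t" "b \<in> el c t" "z = tup (gobj G) c t a b" by (rule prd_elE[OF O base t z(1)])
    then have "b = y" using z(2) pr2_tup[OF O base t ab(1,2)] by simp
    then show "\<exists>a\<in>el (gobj G) t. z = tup (gobj G) c t a y" using ab by blast
  next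
    assume "\<exists>a\<in>el (gobj G) t. z = tup (gobj G) c t a y"
    then obtain a where a: "a \<in> el (gobj G) t" "z = tup (gobj G) c t a y" by blast
    show "z \<in> elS (proj G) (t, y)"
      using tup_mem[OF O base t a(1) y] pr2_tup[OF O base t a(1) y] a(2) proj_hom(2)[OF G] unfolding proj_def by simp
  qed
qed

text \<open>Products and the terminal object of the slice are chosen independently of those of the
  base category, so the operations are computed through the projections of the chosen cones only. On
  elements they are the operations of \<open>G\<close> with the point \<open>y\<close> carried
  along.\<close>

lemma
  assumes G: "is_group_object D G"
  shows times_group_typed: "S.group_typed (times_group D c G)"
    and times_group_mul: "t \<in> Obj K \<Longrightarrow> y \<in> el c t \<Longrightarrow> a \<in> el (gobj G) t \<Longrightarrow> b \<in> el (gobj G) t \<Longrightarrow>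
      S.gmul (times_group D c G) (t, y) (tup (gobj G) c t a y) (tup (gobj G) c t b y) = tup (gobj G) c t (gmul G t a b) y"
    and times_group_one: "t \<in> Obj K \<Longrightarrow> y \<in> el c t \<Longrightarrow>
      S.gone (times_group D c G) (t, y) = tup (gobj G) c t (gone G t) y"
    and times_group_inv: "t \<in> Obj K \<Longrightarrow> y \<in> el c t \<Longrightarrow> a \<in> el (gobj G) t \<Longrightarrow>
      S.gin (times_group D c G) (t, y) (tup (gobj G) c t a y) = tup (gobj G) c t (gin G t a) y"
proof -
  define p where "p = proj G"
  define k where "k = pr1 D (gobj G) c"
  define pp where "pp = prd (slice D c) p p"
  define u where "u = mid (pr1 (slice D c) p p)"
  define v where "v = mid (pr2 (slice D c) p p)"
  define t0 where "t0 = terminal (slice D c)"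
  note O = group_obj[OF G] and ty = group_typedD[OF group_object_typed[OF G]]
  note simps = times_group_simps[OF G, folded p_def, folded k_def u_def v_def t0_def pp_def]
  note ph = proj_hom[OF G, folded p_def]
  have P: "p \<in> Obj (slice D c)" using ph by simp
  have k: "k \<in> hom D (prd D (gobj G) c) (gobj G)" unfolding k_def by (rule pr1_hom[OF O base])
  have pph: "pp \<in> hom D (Dom D pp) c" using S.prd_obj[OF P P] unfolding pp_def by simp
  \<comment> \<open>The projections in the slice are triples; their middle components are arrows of
    \<open>D\<close> on the total object of the fibre product, and the outer ones record that they
    lie over \<open>c\<close>.\<close>
  have u1: "pr1 (slice D c) p p = (pp, u, p)" and u: "u \<in> hom D (Dom D pp) (prd D (gobj G) c)" and pu: "p \<cdot>\<^bsub>D\<^esub> u = pp"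
    using S.pr1_hom[OF P P] ph(2) unfolding slice_hom_iff u_def pp_def[symmetric] by (auto simp: mid_def)
  have v1: "pr2 (slice D c) p p = (pp, v, p)" and v: "v \<in> hom D (Dom D pp) (prd D (gobj G) c)"
    using S.pr2_hom[OF P P] ph(2) unfolding slice_hom_iff v_def pp_def[symmetric] by (auto simp: mid_def)
  note ku = D.comp_in[OF u k] and kv = D.comp_in[OF v k]
  have m: "gmult G \<cdot>\<^bsub>D\<^esub> pair D (k \<cdot>\<^bsub>D\<^esub> u) (k \<cdot>\<^bsub>D\<^esub> v) \<in> hom D (Dom D pp) (gobj G)"
    by (rule D.comp_in[OF pair_hom[OF ku kv] ty(2)])
  have t0h: "t0 \<in> hom D (Dom D t0) c" using S.terminal_obj unfolding t0_def by simp
  note T0 = homD[OF t0h]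
  have e: "gunit G \<cdot>\<^bsub>D\<^esub> bang D (Dom D t0) \<in> hom D (Dom D t0) (gobj G)"
    by (rule D.comp_in[OF bang_hom ty(3)]) (use T0 in simp)
  have i: "ginv G \<cdot>\<^bsub>D\<^esub> k \<in> hom D (prd D (gobj G) c) (gobj G)" by (rule D.comp_in[OF k ty(4)])
  show "S.group_typed (times_group D c G)"
    unfolding S.group_typed_def simps pu
    using P pair_over(2)[OF G m pph, folded p_def] pair_over(2)[OF G e t0h, folded p_def] pair_over(2)[OF G i ph(1), folded p_def]
    unfolding pp_def t0_def by blast
  show "S.gmul (times_group D c G) (t, y) (tup (gobj G) c t a y) (tup (gobj G) c t b y) = tup (gobj G) c t (gmul G t a b) y"
    if t: "t \<in> Obj K" and y: "y \<in> el c t" and a: "a \<in> el (gobj G) t" and b: "b \<in> el (gobj G) t" for t y a b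
  proof -
    have ty': "(t, y) \<in> Obj KE" using t y by simp
    let ?a = "tup (gobj G) c t a y" let ?b = "tup (gobj G) c t b y"
    have ab: "?a \<in> elS p (t, y)" "?b \<in> elS p (t, y)" using elS_proj[OF G t y] a b unfolding p_def by blast+
    define w where "w = S.tup p p (t, y) ?a ?b"
    have w: "w \<in> el (Dom D pp) t" "app pp t w = y"
      using S.tup_mem[OF P P ty' ab] unfolding w_def pp_def by simp_all
    have uw: "app u t w = ?a" using S.pr1_tup[OF P P ty' ab] unfolding u1 w_def by simp
    have vw: "app v t w = ?b" using S.pr2_tup[OF P P ty' ab] unfolding v1 w_def by simp
    have "app (k \<cdot>\<^bsub>D\<^esub> u) t w = a" "app (k \<cdot>\<^bsub>D\<^esub> v) t w = b"
      unfolding app_comp[OF u k t w(1)] app_comp[OF v k t w(1)] uw vw unfolding k_def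
      by (rule pr1_tup[OF O base t a y], rule pr1_tup[OF O base t b y])
    then have mw: "app (gmult G \<cdot>\<^bsub>D\<^esub> pair D (k \<cdot>\<^bsub>D\<^esub> u) (k \<cdot>\<^bsub>D\<^esub> v)) t w = gmul G t a b"
      unfolding gmul_def app_comp[OF pair_hom[OF ku kv] ty(2) t w(1)] pair_app[OF ku kv t w(1)] by simp
    show ?thesis
      unfolding S.gmul_def simps pu w_def[symmetric] appS_simp pair_app[OF m pph t w(1)] mw w(2) ..
  qed
  show "S.gone (times_group D c G) (t, y) = tup (gobj G) c t (gone G t) y" if t: "t \<in> Obj K" and y: "y \<in> el c t" for t y
  proof -
    have ty': "(t, y) \<in> Obj KE" using t y by simp
    define w where "w = S.pt (t, y)"
    have w: "w \<in> el (Dom D t0) t" "app t0 t w = y" using S.pt_mem[OF ty'] unfolding w_def t0_def by simp_all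
    have b: "bang D (Dom D t0) \<in> hom D (Dom D t0) (terminal D)" by (rule bang_hom) (use T0 in simp)
    have ba: "app (bang D (Dom D t0)) t w = pt t" by (rule bang_app) (use T0 t w in simp_all)
    have ew: "app (gunit G \<cdot>\<^bsub>D\<^esub> bang D (Dom D t0)) t w = gone G t"
      unfolding gone_def app_comp[OF b ty(3) t w(1)] ba ..
    show ?thesis
      unfolding S.gone_def simps w_def[symmetric] appS_simp pair_app[OF e t0h t w(1)] ew w(2) ..
  qed
  show "S.gin (times_group D c G) (t, y) (tup (gobj G) c t a y) = tup (gobj G) c t (gin G t a) y"
    if t: "t \<in> Obj K" and y: "y \<in> el c t" and a: "a \<in> el (gobj G) t" for t y a
  proof -
    note w = tup_mem[OF O base t a y]
    have ka: "app (ginv G \<cdot>\<^bsub>D\<^esub> k) t (tup (gobj G) c t a y) = gin G t a"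
      unfolding gin_def app_comp[OF k ty(4) t w] unfolding k_def pr1_tup[OF O base t a y] ..
    have pa: "app p t (tup (gobj G) c t a y) = y" unfolding p_def proj_def by (rule pr2_tup[OF O base t a y])
    show ?thesis
      unfolding S.gin_def simps appS_simp pair_app[OF i ph(1) t w] ka pa ..
  qed
qed

lemma times_group_object:
  assumes G: "is_group_object D G"
  shows "is_group_object (slice D c) (times_group D c G)"
proof -
  have o: "gobj (times_group D c G) = proj G" by (rule times_group_simps(1)[OF G])
  note Gt = group_object_typed[OF G]
  note mul = times_group_mul[OF G] and one = times_group_one[OF G] and inv = times_group_inv[OF G]
  have all: "(\<forall>v\<in>Obj KE. Q v) \<longleftrightarrow> (\<forall>t\<in>Obj K. \<forall>y\<in>el c t. Q (t, y))" for Q by (auto simp: KE_def)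
  have allp: "(\<forall>z\<in>elS (proj G) (t, y). Q z) \<longleftrightarrow> (\<forall>a\<in>el (gobj G) t. Q (tup (gobj G) c t a y))"
    if "t \<in> Obj K" "y \<in> el c t" for Q t y unfolding Ball_def elS_proj[OF G that] by blast
  note mem = gmul_mem[OF Gt] gone_mem[OF Gt] gin_mem[OF Gt]
  have "S.group_laws (times_group D c G)"
    unfolding S.group_laws_def o all
    by (simp add: allp mul one inv mem gmul_assoc[OF G] gmul_one_left[OF G] gmul_one_right[OF G] gmul_inv_left[OF G] gmul_inv_right[OF G])
  then show ?thesis unfolding S.group_object_iff using times_group_typed[OF G] by blast
qed

section \<open>Functoriality of the product with the base\<close>

lemma times_arrow:
  assumes G: "is_group_object D G" and L: "is_group_object D L" and f: "group_hom D G L f"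
  shows "(times_group D c G, (proj G, prd_map D f (Id D c), proj L), times_group D c L)
      \<in> hom (Grp (slice D c)) (times_group D c G) (times_group D c L)"
proof -
  note fh = group_hom_hom[OF f G L] and i = D.id_in[OF base]
  note O = group_obj[OF G] and OL = group_obj[OF L]
  note h = prd_map_hom[OF fh i]
  have "proj L \<cdot>\<^bsub>D\<^esub> prd_map D f (Id D c) = proj G"
  proof (rule faithful[OF D.comp_in[OF h proj_hom(1)[OF L]] proj_hom(1)[OF G]])
    fix t z assume t: "t \<in> Obj K" and z: "z \<in> el (prd D (gobj G) c) t"
    obtain a y where a: "a \<in> el (gobj G) t" and y: "y \<in> el c t" and zz: "z = tup (gobj G) c t a y" by (rule prd_elE[OF O base t z])
    show "app (proj L \<cdot>\<^bsub>D\<^esub> prd_map D f (Id D c)) t z = app (proj G) t z"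
      unfolding app_comp[OF h proj_hom(1)[OF L] t z] unfolding zz prd_map_app[OF fh i t a y] app_id[OF base t y] unfolding proj_def
      using pr2_tup[OF OL base t app_mem[OF fh t a] y] pr2_tup[OF O base t a y] by simp
  qed
  then have ar: "(proj G, prd_map D f (Id D c), proj L) \<in> hom (slice D c) (proj G) (proj L)"
    unfolding slice_hom_iff using proj_hom[OF G] proj_hom[OF L] h by simp
  note GG = times_group_object[OF G] and LL = times_group_object[OF L]
  have "group_hom (slice D c) (times_group D c G) (times_group D c L) (proj G, prd_map D f (Id D c), proj L)"
    unfolding S.group_hom_iff[OF GG LL] times_group_simps(1)[OF G] times_group_simps(1)[OF L]
  proof (intro conjI ballI ar)
    fix w z z' assume w: "w \<in> Obj KE" and z: "z \<in> elS (proj G) w" "z' \<in> elS (proj G) w"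
    obtain t y where ty: "w = (t, y)" by (cases w)
    have t: "t \<in> Obj K" and y: "y \<in> el c t" using w unfolding ty by auto
    obtain a b where a: "a \<in> el (gobj G) t" "z = tup (gobj G) c t a y" and b: "b \<in> el (gobj G) t" "z' = tup (gobj G) c t b y"
      using z elS_proj[OF G t y] unfolding ty by blast
    note ab = gmul_mem[OF group_object_typed[OF G] t a(1) b(1)]
    show "appS (proj G, prd_map D f (Id D c), proj L) w (S.gmul (times_group D c G) w z z') =
        S.gmul (times_group D c L) w (appS (proj G, prd_map D f (Id D c), proj L) w z) (appS (proj G, prd_map D f (Id D c), proj L) w z')"
      unfolding ty a(2) b(2) appS_simp times_group_mul[OF G t y a(1) b(1)] prd_map_app[OF fh i t a(1) y]
        prd_map_app[OF fh i t b(1) y] prd_map_app[OF fh i t ab y] app_id[OF base t y]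
        times_group_mul[OF L t y app_mem[OF fh t a(1)] app_mem[OF fh t b(1)]] group_hom_mul[OF f G L t a(1) b(1)] ..
  qed
  then show ?thesis unfolding S.Grp_hom_iff using GG LL by blast
qed

lemma times_functor_simps [simp]:
  "fobj (times_functor D c) = times_group D c"
  "farr (times_functor D c) (G, f, L) = (times_group D c G, (proj G, prd_map D f (Id D c), proj L), times_group D c L)"
  unfolding times_functor_def proj_def by simp_all

lemma times_functor: "is_functor (Grp D) (Grp (slice D c)) (times_functor D c)"
  unfolding is_functor_def
proof (intro conjI ballI impI)
  note i = D.id_in[OF base]
  show "fobj (times_functor D c) G \<in> Obj (Grp (slice D c))" if "G \<in> Obj (Grp D)" for G
    using times_group_object that by simp
  show "farr (times_functor D c) F \<in> hom (Grp (slice D c)) (fobj (times_functor D c) (Dom (Grp D) F)) (fobj (times_functor D c) (Cod (Grp D) F))"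
    if F0: "F \<in> Arr (Grp D)" for F
  proof -
    obtain G f L where F: "F = (G, f, L)" and G: "is_group_object D G" and L: "is_group_object D L" and f: "group_hom D G L f"
      using F0 unfolding Grp_def by auto
    show ?thesis using times_arrow[OF G L f] unfolding F by simp
  qed
  show "farr (times_functor D c) (Id (Grp D) G) = Id (Grp (slice D c)) (fobj (times_functor D c) G)" if "G \<in> Obj (Grp D)" for G
  proof -
    have G: "is_group_object D G" using that by simp
    note O = group_obj[OF G] and P = prd_obj[OF group_obj[OF G] base]
    have "prd_map D (Id D (gobj G)) (Id D c) = Id D (prd D (gobj G) c)"
    proof (rule faithful[OF prd_map_hom[OF D.id_in[OF O] i] D.id_in[OF P]])
      fix t z assume t: "t \<in> Obj K" and z: "z \<in> el (prd D (gobj G) c) t"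
      obtain a y where a: "a \<in> el (gobj G) t" and y: "y \<in> el c t" and zz: "z = tup (gobj G) c t a y" by (rule prd_elE[OF O base t z])
      show "app (prd_map D (Id D (gobj G)) (Id D c)) t z = app (Id D (prd D (gobj G) c)) t z"
        unfolding app_id[OF P t z] unfolding zz prd_map_app[OF D.id_in[OF O] i t a y] app_id[OF O t a] app_id[OF base t y] ..
    qed
    then show ?thesis using times_group_simps(1)[OF G] proj_hom(2)[OF G] by simp
  qed
  show "farr (times_functor D c) (F' \<cdot>\<^bsub>Grp D\<^esub> F) = farr (times_functor D c) F' \<cdot>\<^bsub>Grp (slice D c)\<^esub> farr (times_functor D c) F"
    if F0: "F \<in> Arr (Grp D)" and F1: "F' \<in> Arr (Grp D)" and F2: "Dom (Grp D) F' = Cod (Grp D) F" for F F'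
  proof -
    obtain G f L where F: "F = (G, f, L)" and G: "is_group_object D G" and L: "is_group_object D L" and f: "group_hom D G L f"
      using F0 unfolding Grp_def by auto
    obtain M g where F': "F' = (L, g, M)" and M: "is_group_object D M" and g: "group_hom D L M g"
      using F1 F2 unfolding Grp_def F by auto
    note fh = group_hom_hom[OF f G L] and gh = group_hom_hom[OF g L M] and O = group_obj[OF G]
    note gf = D.comp_in[OF fh gh]
    note hf = prd_map_hom[OF fh i] and hg = prd_map_hom[OF gh i]
    have "prd_map D (g \<cdot>\<^bsub>D\<^esub> f) (Id D c) = prd_map D g (Id D c) \<cdot>\<^bsub>D\<^esub> prd_map D f (Id D c)"
    proof (rule faithful[OF prd_map_hom[OF gf i] D.comp_in[OF hf hg]])
      fix t z assume t: "t \<in> Obj K" and z: "z \<in> el (prd D (gobj G) c) t"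
      obtain a y where a: "a \<in> el (gobj G) t" and y: "y \<in> el c t" and zz: "z = tup (gobj G) c t a y" by (rule prd_elE[OF O base t z])
      show "app (prd_map D (g \<cdot>\<^bsub>D\<^esub> f) (Id D c)) t z = app (prd_map D g (Id D c) \<cdot>\<^bsub>D\<^esub> prd_map D f (Id D c)) t z"
        unfolding app_comp[OF hf hg t z] unfolding zz prd_map_app[OF gf i t a y] prd_map_app[OF fh i t a y] app_id[OF base t y]
          prd_map_app[OF gh i t app_mem[OF fh t a] y] app_comp[OF fh gh t a] ..
    qed
    then show ?thesis unfolding F F' by simp
  qed
qed

text \<open>The generators are all elements of the total object of \<open>H\<close>, and
  multiplication is imposed only within a fibre. Elements over different points are thus related
  freely, as in a coproduct of groups. Generation in the required sense is then the local generation
  by terms that every universal group has.\<close>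

lemma universal_arrow:
  assumes H: "is_group_object (slice D c) H"
  shows "\<exists>G\<in>Obj (Grp D). \<exists>\<eta>\<in>hom (Grp (slice D c)) H (times_group D c G).
    generates D G (canonical_map D c G \<eta>) \<and>
    (\<forall>L\<in>Obj (Grp D). \<forall>F\<in>hom (Grp (slice D c)) H (times_group D c L).
      \<exists>!g. g \<in> hom (Grp D) G L \<and> farr (times_functor D c) g \<cdot>\<^bsub>Grp (slice D c)\<^esub> \<eta> = F)"
proof -
  define h where "h = gobj H"
  define X where "X = Dom D h"
  have h: "h \<in> hom D X c" using S.group_obj[OF H] unfolding h_def X_def by simp
  have X: "X \<in> Obj D" using homD[OF h] by blast
  note i = D.id_in[OF base]
  note Hmul = S.gmul_mem[OF S.group_object_typed[OF H], folded h_def]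
  \<comment> \<open>A map from the total object to \<open>L\<close> that is multiplicative on each
    fibre is the same as a homomorphism over \<open>c\<close> from \<open>H\<close> to the product
    of \<open>L\<close> with \<open>c\<close>; the tests are thus the arrows to be factored.\<close>
  define \<T> where "\<T> = {(L, \<phi>). is_group_object D L \<and> natural (el X) (res X) (el (gobj L)) (res (gobj L)) \<phi> \<and>
    (\<forall>t\<in>Obj K. \<forall>y\<in>el c t. \<forall>x\<in>elS h (t, y). \<forall>x'\<in>elS h (t, y).
      \<phi> t (S.gmul H (t, y) x x') = gmul L t (\<phi> t x) (\<phi> t x'))}"
  have tests: "is_group_object D L" "natural (el X) (res X) (el (gobj L)) (res (gobj L)) \<phi>" if "(L, \<phi>) \<in> \<T>" for L \<phi>
    using that unfolding \<T>_def by auto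
  have Xel: "x \<in> elS h (t, y) \<longleftrightarrow> x \<in> el X t \<and> app h t x = y" for x t y unfolding X_def by simp
  show ?thesis
  proof (rule universal_group_arrow[OF X tests])
    fix G k assume G: "is_group_object D G" and k: "k \<in> hom D X (gobj G)"
      and gen: "locally_generates (el X) G (app k)"
      and eqs: "\<And>t w w'. t \<in> Obj K \<Longrightarrow> set_gterm w \<subseteq> el X t \<Longrightarrow> set_gterm w' \<subseteq> el X t \<Longrightarrow>
        (\<And>L \<phi>. (L, \<phi>) \<in> \<T> \<Longrightarrow> gev L t (\<phi> t) w = gev L t (\<phi> t) w') \<Longrightarrow> gev G t (app k t) w = gev G t (app k t) w'"
      and univ: "\<And>L \<phi>. (L, \<phi>) \<in> \<T> \<Longrightarrow> \<exists>f. group_hom D G L f \<and> (\<forall>t\<in>Obj K. \<forall>x\<in>el X t. app f t (app k t x) = \<phi> t x)"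
    note O = group_obj[OF G] and GG = times_group_object[OF G]
    define n where "n = (h, pair D k h, proj G)"
    define \<eta> where "\<eta> = (H, n, times_group D c G)"
    note kh = pair_hom[OF k h]
    have na: "app (pair D k h) t x = tup (gobj G) c t (app k t x) y" if "t \<in> Obj K" "x \<in> elS h (t, y)" for t x y
      using pair_app[OF k h that(1)] that(2) unfolding Xel by simp
    have "group_hom (slice D c) H (times_group D c G) n"
      unfolding S.group_hom_iff[OF H GG] times_group_simps(1)[OF G] h_def[symmetric]
    proof (intro conjI ballI)
      show "n \<in> hom (slice D c) h (proj G)" unfolding n_def by (rule pair_over(2)[OF G k h])
      fix v x x' assume v: "v \<in> Obj KE" and x: "x \<in> elS h v" and x': "x' \<in> elS h v"
      obtain t y where ty: "v = (t, y)" by (cases v)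
      have t: "t \<in> Obj K" and y: "y \<in> el c t" using v unfolding ty by auto
      note xx = Hmul[OF v x x']
      have xX: "x \<in> el X t" "x' \<in> el X t" "S.gmul H (t, y) x x' \<in> el X t" using x x' xx unfolding ty Xel by auto
      \<comment> \<open>The product of two elements of one fibre and the formal product of their
        generators agree in all tests, so \<open>n\<close> is a homomorphism on each fibre.\<close>
      have "gev G t (app k t) (Gen (S.gmul H (t, y) x x')) = gev G t (app k t) (Mul (Gen x) (Gen x'))"
      proof (rule eqs[OF t])
        fix L \<phi> assume "(L, \<phi>) \<in> \<T>"
        then show "gev L t (\<phi> t) (Gen (S.gmul H (t, y) x x')) = gev L t (\<phi> t) (Mul (Gen x) (Gen x'))"
          using t y x x' unfolding \<T>_def ty by simp
      qed (use xX in simp_all)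
      then have km: "app k t (S.gmul H (t, y) x x') = gmul G t (app k t x) (app k t x')" by simp
      show "appS n v (S.gmul H v x x') = S.gmul (times_group D c G) v (appS n v x) (appS n v x')"
        unfolding ty n_def appS_simp na[OF t x[unfolded ty]] na[OF t x'[unfolded ty]] na[OF t xx[unfolded ty]] km
          times_group_mul[OF G t y app_mem[OF k t xX(1)] app_mem[OF k t xX(2)]] ..
    qed
    then have \<eta>: "\<eta> \<in> hom (Grp (slice D c)) H (times_group D c G)" unfolding \<eta>_def S.Grp_hom_iff using H GG by blast
    have "canonical_map D c G \<eta> = k"
    proof -
      note p1 = pr1_hom[OF O base]
      have "pr1 D (gobj G) c \<cdot>\<^bsub>D\<^esub> pair D k h = k"
      proof (rule faithful[OF D.comp_in[OF kh p1] k])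
        fix t x assume t: "t \<in> Obj K" and x: "x \<in> el X t"
        show "app (pr1 D (gobj G) c \<cdot>\<^bsub>D\<^esub> pair D k h) t x = app k t x"
          unfolding app_comp[OF kh p1 t x] pair_app[OF k h t x] by (rule pr1_tup[OF O base t app_mem[OF k t x] app_mem[OF h t x]])
      qed
      then show ?thesis unfolding canonical_map_def \<eta>_def n_def mid_def by simp
    qed
    then have g: "generates D G (canonical_map D c G \<eta>)" using generatesI[OF G k gen] by simp
    have u: "\<exists>!g. g \<in> hom (Grp D) G L \<and> farr (times_functor D c) g \<cdot>\<^bsub>Grp (slice D c)\<^esub> \<eta> = F"
      if L': "L \<in> Obj (Grp D)" and F': "F \<in> hom (Grp (slice D c)) H (times_group D c L)" for L F
    proof -
      have L: "is_group_object D L" using L' by simp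
      note OL = group_obj[OF L] and LL = times_group_object[OF L] and PL = proj_hom[OF L]
      obtain F1 where F: "F = (H, F1, times_group D c L)" and F1: "group_hom (slice D c) H (times_group D c L) F1"
        using F' unfolding S.Grp_hom_iff by blast
      note F1h = S.group_hom_hom[OF F1 H LL, folded h_def, unfolded times_group_simps(1)[OF L]]
      obtain f where F1f: "F1 = (h, f, proj L)" and f: "f \<in> hom D X (prd D (gobj L) c)" and pf: "proj L \<cdot>\<^bsub>D\<^esub> f = h"
        using F1h PL(2) unfolding slice_hom_iff X_def by auto
      \<comment> \<open>The transpose of \<open>F\<close> consists of its first coordinates; the
        second coordinate is forced, because \<open>F\<close> lies over \<open>c\<close>.\<close>
      define \<phi> where "\<phi> t x = app (pr1 D (gobj L) c) t (app f t x)" for t x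
      note p1 = pr1_hom[OF OL base]
      have \<phi>m: "\<phi> t x \<in> el (gobj L) t" if "t \<in> Obj K" "x \<in> el X t" for t x
        unfolding \<phi>_def by (rule app_mem[OF p1 that(1) app_mem[OF f that]])
      have f\<phi>: "app f t x = tup (gobj L) c t (\<phi> t x) (app h t x)" if "t \<in> Obj K" "x \<in> el X t" for t x
        using prd_eta[OF OL base that(1) app_mem[OF f that]] comp_app_eq[OF pf f PL(1) that] unfolding \<phi>_def proj_def by simp
      have \<phi>n: "natural (el X) (res X) (el (gobj L)) (res (gobj L)) \<phi>"
        unfolding natural_def
      proof (intro conjI ballI)
        show "\<phi> t x \<in> el (gobj L) t" if "t \<in> Obj K" "x \<in> el X t" for t x by (rule \<phi>m[OF that])
        show "\<phi> (Dom K m) (res X m x) = res (gobj L) m (\<phi> (Cod K m) x)" if m: "m \<in> Arr K" and x: "x \<in> el X (Cod K m)" for m x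
          unfolding \<phi>_def app_res[OF f m refl x] by (rule app_res[OF p1 m refl app_mem[OF f arr_cod[OF m] x]])
      qed
      have \<phi>mul: "\<phi> t (S.gmul H (t, y) x x') = gmul L t (\<phi> t x) (\<phi> t x')"
        if t: "t \<in> Obj K" and y: "y \<in> el c t" and x: "x \<in> elS h (t, y)" and x': "x' \<in> elS h (t, y)" for t y x x'
      proof -
        have ty: "(t, y) \<in> Obj KE" using t y by simp
        note xx = Hmul[OF ty x x']
        have xX: "x \<in> el X t" "x' \<in> el X t" "S.gmul H (t, y) x x' \<in> el X t"
          and hx: "app h t x = y" "app h t x' = y" "app h t (S.gmul H (t, y) x x') = y" using x x' xx unfolding Xel by auto
        have "appS F1 (t, y) (S.gmul H (t, y) x x') = S.gmul (times_group D c L) (t, y) (appS F1 (t, y) x) (appS F1 (t, y) x')"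
          using S.group_hom_mul[OF F1 H LL ty] x x' unfolding h_def by blast
        then have "tup (gobj L) c t (\<phi> t (S.gmul H (t, y) x x')) y = tup (gobj L) c t (gmul L t (\<phi> t x) (\<phi> t x')) y"
          unfolding F1f appS_simp f\<phi>[OF t xX(1)] f\<phi>[OF t xX(2)] f\<phi>[OF t xX(3)] hx
            times_group_mul[OF L t y \<phi>m[OF t xX(1)] \<phi>m[OF t xX(2)]] .
        from arg_cong[OF this, of "app (pr1 D (gobj L) c) t"] show ?thesis
          unfolding pr1_tup[OF OL base t \<phi>m[OF t xX(3)] y]
            pr1_tup[OF OL base t gmul_mem[OF group_object_typed[OF L] t \<phi>m[OF t xX(1)] \<phi>m[OF t xX(2)]] y] .
      qed
      have "(L, \<phi>) \<in> \<T>" unfolding \<T>_def using L \<phi>n \<phi>mul by blast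
      from univ[OF this] obtain g where g: "group_hom D G L g" "\<forall>t\<in>Obj K. \<forall>x\<in>el X t. app g t (app k t x) = \<phi> t x" by blast
      have comp: "farr (times_functor D c) (G, g', L) \<cdot>\<^bsub>Grp (slice D c)\<^esub> \<eta> = (H, (h, prd_map D g' (Id D c) \<cdot>\<^bsub>D\<^esub> pair D k h, proj L), times_group D c L)" for g'
        unfolding \<eta>_def n_def by simp
      have ca: "app (prd_map D g' (Id D c) \<cdot>\<^bsub>D\<^esub> pair D k h) t x = tup (gobj L) c t (app g' t (app k t x)) (app h t x)"
        if g': "group_hom D G L g'" and t: "t \<in> Obj K" and x: "x \<in> el X t" for g' t x
      proof -
        note gh = group_hom_hom[OF g' G L]
        show ?thesis
          unfolding app_comp[OF kh prd_map_hom[OF gh i] t x] pair_app[OF k h t x]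
            prd_map_app[OF gh i t app_mem[OF k t x] app_mem[OF h t x]] app_id[OF base t app_mem[OF h t x]] ..
      qed
      show ?thesis
      proof (rule ex1I[of _ "(G, g, L)"], intro conjI)
        show "(G, g, L) \<in> hom (Grp D) G L" unfolding Grp_hom_iff using G L g by blast
        have "prd_map D g (Id D c) \<cdot>\<^bsub>D\<^esub> pair D k h = f"
        proof (rule faithful[OF D.comp_in[OF kh prd_map_hom[OF group_hom_hom[OF g(1) G L] i]] f])
          fix t x assume t: "t \<in> Obj K" and x: "x \<in> el X t"
          show "app (prd_map D g (Id D c) \<cdot>\<^bsub>D\<^esub> pair D k h) t x = app f t x"
            unfolding ca[OF g(1) t x] f\<phi>[OF t x] using g(2) t x by simp
        qed
        then show "farr (times_functor D c) (G, g, L) \<cdot>\<^bsub>Grp (slice D c)\<^esub> \<eta> = F" unfolding comp F F1f by simp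
        fix g'' assume "g'' \<in> hom (Grp D) G L \<and> farr (times_functor D c) g'' \<cdot>\<^bsub>Grp (slice D c)\<^esub> \<eta> = F"
        then obtain g' where g': "g'' = (G, g', L)" "group_hom D G L g'"
          and e: "farr (times_functor D c) (G, g', L) \<cdot>\<^bsub>Grp (slice D c)\<^esub> \<eta> = F" unfolding Grp_hom_iff by blast
        have e': "prd_map D g' (Id D c) \<cdot>\<^bsub>D\<^esub> pair D k h = f" using e unfolding comp F F1f by simp
        have "g' = g"
        proof (rule group_hom_cancel[OF G L g'(2) g(1) gen app_natural[OF k]])
          fix t x assume t: "t \<in> Obj K" and x: "x \<in> el X t"
          have "tup (gobj L) c t (app g' t (app k t x)) (app h t x) = tup (gobj L) c t (\<phi> t x) (app h t x)"
            using ca[OF g'(2) t x] f\<phi>[OF t x] unfolding e' by simp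
          from arg_cong[OF this, of "app (pr1 D (gobj L) c) t"]
          have "app g' t (app k t x) = \<phi> t x"
            unfolding pr1_tup[OF OL base t \<phi>m[OF t x] app_mem[OF h t x]]
              pr1_tup[OF OL base t app_mem[OF group_hom_hom[OF g'(2) G L] t app_mem[OF k t x]] app_mem[OF h t x]] .
          then show "app g' t (app k t x) = app g t (app k t x)" using g(2) t x by simp
        qed
        then show "g'' = (G, g, L)" using g' by simp
      qed
    qed
    show ?thesis
      by (rule bexI[of _ G], rule bexI[OF _ \<eta>]) (use g u G in simp_all)
  qed
qed

lemma internal_coproducts:
  "\<exists>colim \<eta>. left_adjoint (Grp (slice D c)) (Grp D) colim (times_functor D c) \<eta> \<and>
    (\<forall>H\<in>Obj (Grp (slice D c)). generates D (fobj colim H) (canonical_map D c (fobj colim H) (\<eta> H)))"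
proof (rule left_adjoint_if_universal_arrows[OF S.Grp_category Grp_category times_functor,
    where Q = "\<lambda>H G \<eta>. generates D G (canonical_map D c G \<eta>)"])
  fix H assume "H \<in> Obj (Grp (slice D c))"
  then have "is_group_object (slice D c) H" by simp
  from universal_arrow[OF this]
  show "\<exists>L\<in>Obj (Grp D). \<exists>\<eta>\<in>hom (Grp (slice D c)) H (fobj (times_functor D c) L).
      generates D L (canonical_map D c L \<eta>) \<and>
      (\<forall>Y\<in>Obj (Grp D). \<forall>f\<in>hom (Grp (slice D c)) H (fobj (times_functor D c) Y).
        \<exists>!g. g \<in> hom (Grp D) L Y \<and> farr (times_functor D c) g \<cdot>\<^bsub>Grp (slice D c)\<^esub> \<eta> = f)"
    unfolding times_functor_simps(1) .
qed

end

theorem (in sheaf_cat) sheaf_cat_bass_serre: "bass_serre D"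
  unfolding bass_serre_def
proof (intro conjI ballI allI impI)
  show "category D" by (rule D_category)
  have slice: "slice_base K J D U el res app \<pi> c" if "c \<in> Obj D" for c
    by unfold_locales (rule that)
  show "locally_action_barr_exact D"
    unfolding locally_action_barr_exact_def
  proof
    fix c assume "c \<in> Obj D"
    then interpret slice_base K J D U el res app \<pi> c by (rule slice)
    show "action_barr_exact (slice D c)" by (rule S.action_barr_exact)
  qed
  show "\<exists>T. is_terminal D T" by (rule terminal_exists)
  show "has_coequalisers D" by (rule coequalisers)
  show "has_coequalisers (Grp D)" by (rule Grp_coequalisers)
  fix c assume c: "c \<in> Obj D"
  show "is_coequaliser D (prd_map D (Id D c) f) (prd_map D (Id D c) g) (prd_map D (Id D c) q)"
    if "is_coequaliser D f g q" for f g q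
    by (rule product_preserves_coequaliser[OF c that])
  interpret slice_base K J D U el res app \<pi> c by (rule slice[OF c])
  show "\<exists>colim \<eta>. left_adjoint (Grp (slice D c)) (Grp D) colim (times_functor D c) \<eta> \<and>
    (\<forall>H\<in>Obj (Grp (slice D c)). generates D (fobj colim H) (canonical_map D c (fobj colim H) (\<eta> H)))"
    by (rule internal_coproducts)
qed

section \<open>The category of sheaves on a small site\<close>

lemma category_opposite: "category C \<Longrightarrow> category (opposite C)"
proof -
  assume "category C"
  then interpret category C .
  have h: "hom (opposite C) A B = hom C B A" for A B unfolding hom_def opposite_def by auto
  show ?thesis
  proof
    show "(k \<cdot>\<^bsub>opposite C\<^esub> g) \<cdot>\<^bsub>opposite C\<^esub> f = k \<cdot>\<^bsub>opposite C\<^esub> (g \<cdot>\<^bsub>opposite C\<^esub> f)"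
      if "f \<in> hom (opposite C) W X" "g \<in> hom (opposite C) X Y" "k \<in> hom (opposite C) Y Z" for f g k W X Y Z
      using that comp_assoc[of k Z Y g X f W] unfolding h by (simp add: opposite_def)
  qed (use dom_in cod_in id_in comp_in id_left id_right in \<open>auto simp: h\<close>, simp_all add: opposite_def)
qed

lemma category_full_subcategory: "category C \<Longrightarrow> category (full_subcategory C S)"
proof -
  assume "category C"
  then interpret category C .
  have h: "f \<in> hom (full_subcategory C S) A B \<longleftrightarrow> f \<in> hom C A B \<and> A \<in> S \<and> B \<in> S" for A B f
    unfolding hom_def full_subcategory_def by auto
  have s: "Comp (full_subcategory C S) = Comp C" "Id (full_subcategory C S) = Id C"
    "Obj (full_subcategory C S) = Obj C \<inter> S"
    unfolding full_subcategory_def by simp_all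
  show ?thesis
  proof
    show "Dom (full_subcategory C S) f \<in> Obj (full_subcategory C S)" if "f \<in> Arr (full_subcategory C S)" for f
      using that dom_in unfolding full_subcategory_def by simp
    show "Cod (full_subcategory C S) f \<in> Obj (full_subcategory C S)" if "f \<in> Arr (full_subcategory C S)" for f
      using that cod_in unfolding full_subcategory_def by simp
    show "Id (full_subcategory C S) A \<in> hom (full_subcategory C S) A A" if "A \<in> Obj (full_subcategory C S)" for A
      using that id_in unfolding h s by simp
    show "Comp (full_subcategory C S) g f \<in> hom (full_subcategory C S) X Z"
      if "f \<in> hom (full_subcategory C S) X Y" "g \<in> hom (full_subcategory C S) Y Z" for f g X Y Z
      using that comp_in unfolding h s by blast
    show "Comp (full_subcategory C S) (Id (full_subcategory C S) Y) f = f" if "f \<in> hom (full_subcategory C S) X Y" for f X Y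
      using that id_left unfolding h s by blast
    show "Comp (full_subcategory C S) f (Id (full_subcategory C S) X) = f" if "f \<in> hom (full_subcategory C S) X Y" for f X Y
      using that id_right unfolding h s by blast
    show "Comp (full_subcategory C S) (Comp (full_subcategory C S) k g) f = Comp (full_subcategory C S) k (Comp (full_subcategory C S) g f)"
      if "f \<in> hom (full_subcategory C S) W X" "g \<in> hom (full_subcategory C S) X Y" "k \<in> hom (full_subcategory C S) Y Z" for f g k W X Y Z
      using that comp_assoc unfolding h s by blast
  qed
qed

lemma functor_category_obj: "F \<in> Obj (functor_category C E) \<longleftrightarrow>
    is_functor C E F \<and> fobj F \<in> extensional (Obj C) \<and> farr F \<in> extensional (Arr C)"
  unfolding functor_category_def Let_def by simp

lemma functor_category_hom: "A \<in> hom (functor_category C E) F G \<longleftrightarrow>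
    (\<exists>\<eta>. A = (F, \<eta>, G) \<and> F \<in> Obj (functor_category C E) \<and> G \<in> Obj (functor_category C E) \<and>
      nat_trans C E F G \<eta> \<and> \<eta> \<in> extensional (Obj C))"
  unfolding hom_def functor_category_def Let_def by auto

lemma functor_category_comp: "(G', \<theta>, H) \<cdot>\<^bsub>functor_category C E\<^esub> (F, \<eta>, G) = (F, (\<lambda>A\<in>Obj C. \<theta> A \<cdot>\<^bsub>E\<^esub> \<eta> A), H)"
  unfolding functor_category_def Let_def by simp

lemma functor_category_id: "Id (functor_category C E) F = (F, (\<lambda>A\<in>Obj C. Id E (fobj F A)), F)"
  unfolding functor_category_def Let_def by simp

lemma nat_transD:
  assumes "nat_trans C E F G \<eta>"
  shows "A \<in> Obj C \<Longrightarrow> \<eta> A \<in> hom E (fobj F A) (fobj G A)"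
    and "f \<in> Arr C \<Longrightarrow> \<eta> (Cod C f) \<cdot>\<^bsub>E\<^esub> farr F f = farr G f \<cdot>\<^bsub>E\<^esub> \<eta> (Dom C f)"
  using assms unfolding nat_trans_def by simp_all

lemma is_functorD:
  assumes "is_functor C E F"
  shows "A \<in> Obj C \<Longrightarrow> fobj F A \<in> Obj E"
    and "f \<in> Arr C \<Longrightarrow> farr F f \<in> hom E (fobj F (Dom C f)) (fobj F (Cod C f))"
    and "A \<in> Obj C \<Longrightarrow> farr F (Id C A) = Id E (fobj F A)"
    and "f \<in> Arr C \<Longrightarrow> g \<in> Arr C \<Longrightarrow> Dom C g = Cod C f \<Longrightarrow> farr F (g \<cdot>\<^bsub>C\<^esub> f) = farr F g \<cdot>\<^bsub>E\<^esub> farr F f"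
  using assms unfolding is_functor_def by simp_all

lemma category_functor_category:
  assumes C: "category C" and E: "category E"
  shows "category (functor_category C E)"
proof -
  interpret C: category C by (rule C)
  interpret E: category E by (rule E)
  let ?F = "functor_category C E"
  show ?thesis
  proof
    show "Dom ?F f \<in> Obj ?F" if "f \<in> Arr ?F" for f using that unfolding functor_category_def Let_def by auto
    show "Cod ?F f \<in> Obj ?F" if "f \<in> Arr ?F" for f using that unfolding functor_category_def Let_def by auto
    show "Id ?F A \<in> hom ?F A A" if A: "A \<in> Obj ?F" for A
    proof -
      have fA: "is_functor C E A" using A unfolding functor_category_obj by blast
      have "nat_trans C E A A (\<lambda>X\<in>Obj C. Id E (fobj A X))"
        unfolding nat_trans_def
        using is_functorD(1)[OF fA] E.id_in E.id_left[OF is_functorD(2)[OF fA]] E.id_right[OF is_functorD(2)[OF fA]] C.dom_in C.cod_in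
        by simp
      then show ?thesis unfolding functor_category_hom functor_category_id using A by simp
    qed
    show "B \<cdot>\<^bsub>?F\<^esub> A \<in> hom ?F X Z" if A': "A \<in> hom ?F X Y" and B': "B \<in> hom ?F Y Z" for A B X Y Z
    proof -
      obtain \<eta> where A: "A = (X, \<eta>, Y)" "nat_trans C E X Y \<eta>" and O: "X \<in> Obj ?F" "Y \<in> Obj ?F"
        using A' unfolding functor_category_hom by blast
      obtain \<theta> where B: "B = (Y, \<theta>, Z)" "nat_trans C E Y Z \<theta>" and OZ: "Z \<in> Obj ?F"
        using B' unfolding functor_category_hom by blast
      have fX: "is_functor C E X" and fY: "is_functor C E Y" and fZ: "is_functor C E Z" using O OZ unfolding functor_category_obj by auto
      note n = nat_transD[OF A(2)] and m = nat_transD[OF B(2)]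
      have "nat_trans C E X Z (\<lambda>A\<in>Obj C. \<theta> A \<cdot>\<^bsub>E\<^esub> \<eta> A)"
        unfolding nat_trans_def
      proof (intro conjI ballI)
        show "(\<lambda>A\<in>Obj C. \<theta> A \<cdot>\<^bsub>E\<^esub> \<eta> A) V \<in> hom E (fobj X V) (fobj Z V)" if V: "V \<in> Obj C" for V
          using E.comp_in[OF n(1)[OF V] m(1)[OF V]] V by simp
        fix f assume f: "f \<in> Arr C"
        note d = C.dom_in[OF f] and c = C.cod_in[OF f]
        have "(\<theta> (Cod C f) \<cdot>\<^bsub>E\<^esub> \<eta> (Cod C f)) \<cdot>\<^bsub>E\<^esub> farr X f = \<theta> (Cod C f) \<cdot>\<^bsub>E\<^esub> (farr Y f \<cdot>\<^bsub>E\<^esub> \<eta> (Dom C f))"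
          unfolding n(2)[OF f, symmetric] by (rule E.comp_assoc[OF is_functorD(2)[OF fX f] n(1)[OF c] m(1)[OF c]])
        also have "\<dots> = (farr Z f \<cdot>\<^bsub>E\<^esub> \<theta> (Dom C f)) \<cdot>\<^bsub>E\<^esub> \<eta> (Dom C f)"
          unfolding m(2)[OF f, symmetric] by (rule E.comp_assoc[OF n(1)[OF d] is_functorD(2)[OF fY f] m(1)[OF c], symmetric])
        also have "\<dots> = farr Z f \<cdot>\<^bsub>E\<^esub> (\<theta> (Dom C f) \<cdot>\<^bsub>E\<^esub> \<eta> (Dom C f))"
          by (rule E.comp_assoc[OF n(1)[OF d] m(1)[OF d] is_functorD(2)[OF fZ f]])
        finally show "(\<lambda>A\<in>Obj C. \<theta> A \<cdot>\<^bsub>E\<^esub> \<eta> A) (Cod C f) \<cdot>\<^bsub>E\<^esub> farr X f = farr Z f \<cdot>\<^bsub>E\<^esub> (\<lambda>A\<in>Obj C. \<theta> A \<cdot>\<^bsub>E\<^esub> \<eta> A) (Dom C f)"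
          using d c by simp
      qed
      then show ?thesis unfolding A(1) B(1) functor_category_comp functor_category_hom using O OZ by simp
    qed
    show "Id ?F Y \<cdot>\<^bsub>?F\<^esub> A = A" if A': "A \<in> hom ?F X Y" for A X Y
    proof -
      obtain \<eta> where A: "A = (X, \<eta>, Y)" "nat_trans C E X Y \<eta>" "\<eta> \<in> extensional (Obj C)"
        using A' unfolding functor_category_hom by blast
      have "(\<lambda>V\<in>Obj C. (\<lambda>V\<in>Obj C. Id E (fobj Y V)) V \<cdot>\<^bsub>E\<^esub> \<eta> V) = \<eta>"
        by (rule extensionalityI[OF _ A(3)]) (use E.id_left[OF nat_transD(1)[OF A(2)]] in simp_all)
      then show ?thesis unfolding A(1) functor_category_id functor_category_comp by simp
    qed
    show "A \<cdot>\<^bsub>?F\<^esub> Id ?F X = A" if A': "A \<in> hom ?F X Y" for A X Y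
    proof -
      obtain \<eta> where A: "A = (X, \<eta>, Y)" "nat_trans C E X Y \<eta>" "\<eta> \<in> extensional (Obj C)"
        using A' unfolding functor_category_hom by blast
      have "(\<lambda>V\<in>Obj C. \<eta> V \<cdot>\<^bsub>E\<^esub> (\<lambda>V\<in>Obj C. Id E (fobj X V)) V) = \<eta>"
        by (rule extensionalityI[OF _ A(3)]) (use E.id_right[OF nat_transD(1)[OF A(2)]] in simp_all)
      then show ?thesis unfolding A(1) functor_category_id functor_category_comp by simp
    qed
    show "(D \<cdot>\<^bsub>?F\<^esub> B) \<cdot>\<^bsub>?F\<^esub> A = D \<cdot>\<^bsub>?F\<^esub> (B \<cdot>\<^bsub>?F\<^esub> A)"
      if A': "A \<in> hom ?F W X" and B': "B \<in> hom ?F X Y" and D': "D \<in> hom ?F Y Z" for A B D W X Y Z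
    proof -
      obtain \<eta> where A: "A = (W, \<eta>, X)" "nat_trans C E W X \<eta>" using A' unfolding functor_category_hom by blast
      obtain \<theta> where B: "B = (X, \<theta>, Y)" "nat_trans C E X Y \<theta>" using B' unfolding functor_category_hom by blast
      obtain \<zeta> where D: "D = (Y, \<zeta>, Z)" "nat_trans C E Y Z \<zeta>" using D' unfolding functor_category_hom by blast
      show ?thesis
        unfolding A(1) B(1) D(1) functor_category_comp
        using E.comp_assoc[OF nat_transD(1)[OF A(2)] nat_transD(1)[OF B(2)] nat_transD(1)[OF D(2)]]
        by (auto intro!: restrict_ext)
    qed
  qed
qed

lemma set_cat_hom: "f \<in> hom (set_cat U) A B \<longleftrightarrow> A \<in> U \<and> B \<in> U \<and> (\<exists>g \<in> A \<rightarrow>\<^sub>E B. f = (A, g, B))"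
  unfolding hom_def set_cat_def by auto

lemma set_cat_simps: "Obj (set_cat U) = U" "Id (set_cat U) A = (A, (\<lambda>x\<in>A. x), A)"
  "(B', g, D) \<cdot>\<^bsub>set_cat U\<^esub> (A, f, B) = (A, compose A g f, D)"
  unfolding set_cat_def by simp_all

lemma category_set_cat: "category (set_cat U)"
proof
  show "Dom (set_cat U) f \<in> Obj (set_cat U)" if "f \<in> Arr (set_cat U)" for f using that unfolding set_cat_def by auto
  show "Cod (set_cat U) f \<in> Obj (set_cat U)" if "f \<in> Arr (set_cat U)" for f using that unfolding set_cat_def by auto
  show "Id (set_cat U) A \<in> hom (set_cat U) A A" if "A \<in> Obj (set_cat U)" for A
    using that unfolding set_cat_hom set_cat_simps by auto
  show "g \<cdot>\<^bsub>set_cat U\<^esub> f \<in> hom (set_cat U) X Z"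
    if "f \<in> hom (set_cat U) X Y" "g \<in> hom (set_cat U) Y Z" for f g X Y Z
    using that unfolding set_cat_hom by (auto simp: set_cat_simps compose_def PiE_iff)
  show "Id (set_cat U) Y \<cdot>\<^bsub>set_cat U\<^esub> f = f" if "f \<in> hom (set_cat U) X Y" for f X Y
    using that unfolding set_cat_hom by (auto simp: set_cat_simps Id_compose PiE_def)
  show "f \<cdot>\<^bsub>set_cat U\<^esub> Id (set_cat U) X = f" if "f \<in> hom (set_cat U) X Y" for f X Y
    using that unfolding set_cat_hom by (auto simp: set_cat_simps compose_Id PiE_def)
  show "(h \<cdot>\<^bsub>set_cat U\<^esub> g) \<cdot>\<^bsub>set_cat U\<^esub> f = h \<cdot>\<^bsub>set_cat U\<^esub> (g \<cdot>\<^bsub>set_cat U\<^esub> f)"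
    if "f \<in> hom (set_cat U) W X" "g \<in> hom (set_cat U) X Y" "h \<in> hom (set_cat U) Y Z" for f g h W X Y Z
    using that unfolding set_cat_hom by (auto simp: set_cat_simps compose_assoc PiE_def)
qed

lemma mid_simp [simp]: "mid (a, b, c) = b"
  unfolding mid_def by simp

section \<open>Sheaves of small sets as an instance of the general setting\<close>

locale small_site = site I J
  for I :: "('o, 'a) cat" and J :: "'o \<Rightarrow> 'a set set" +
  fixes U :: "'u set set"
  assumes U: "set_universe U" and products: "has_products U (Arr I)"
begin

abbreviation "ShU \<equiv> Sh I J U"
abbreviation "PshU \<equiv> functor_category (opposite I) (set_cat U)"

definition "sh_el F i = fobj F i"
definition "sh_res F m = mid (farr F m)"
text \<open>The inner \<open>mid\<close> extracts the family of components from an arrow of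
  presheaves, the outer one the function from the component at \<open>i\<close>.\<close>

definition "sh_app A i = mid (mid A i)"

lemma op_simps [simp]: "Obj (opposite I) = Obj I" "Arr (opposite I) = Arr I" "Dom (opposite I) = Cod I" "Cod (opposite I) = Dom I"
  "Id (opposite I) = Id I" "g \<cdot>\<^bsub>opposite I\<^esub> f = f \<cdot>\<^bsub>I\<^esub> g"
  unfolding opposite_def by simp_all

lemma Sh_category: "category ShU"
  unfolding Sh_def
  by (intro category_full_subcategory category_functor_category category_opposite category_set_cat K.category_axioms)

lemma Sh_obj: "F \<in> Obj ShU \<longleftrightarrow> F \<in> Obj PshU \<and> is_sheaf I J F"
  unfolding Sh_def full_subcategory_def by simp

lemma Sh_hom: "A \<in> hom ShU F G \<longleftrightarrow> A \<in> hom PshU F G \<and> is_sheaf I J F \<and> is_sheaf I J G"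
  unfolding Sh_def full_subcategory_def hom_def by auto

lemma Sh_comp: "B \<cdot>\<^bsub>ShU\<^esub> A = B \<cdot>\<^bsub>PshU\<^esub> A"
  unfolding Sh_def full_subcategory_def by simp

lemma Sh_id: "Id ShU F = Id PshU F"
  unfolding Sh_def full_subcategory_def by simp

lemma Psh_objD:
  assumes F: "F \<in> Obj PshU"
  shows Psh_U: "i \<in> Obj I \<Longrightarrow> fobj F i \<in> U"
    and Psh_res: "m \<in> Arr I \<Longrightarrow> farr F m = (fobj F (Cod I m), sh_res F m, fobj F (Dom I m))"
    and Psh_res_mem: "m \<in> Arr I \<Longrightarrow> sh_res F m \<in> fobj F (Cod I m) \<rightarrow>\<^sub>E fobj F (Dom I m)"
    and Psh_psh: "psh (sh_el F) (sh_res F)"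
proof -
  have f: "is_functor (opposite I) (set_cat U) F" using F unfolding functor_category_obj by blast
  note d = is_functorD[OF f, unfolded op_simps]
  show 1: "i \<in> Obj I \<Longrightarrow> fobj F i \<in> U" for i using d(1) unfolding set_cat_simps .
  show 2: "farr F m = (fobj F (Cod I m), sh_res F m, fobj F (Dom I m))" if "m \<in> Arr I" for m
    using d(2)[OF that] unfolding set_cat_hom sh_res_def by auto
  show 3: "sh_res F m \<in> fobj F (Cod I m) \<rightarrow>\<^sub>E fobj F (Dom I m)" if "m \<in> Arr I" for m
    using d(2)[OF that] unfolding set_cat_hom sh_res_def by auto
  show "psh (sh_el F) (sh_res F)"
    unfolding psh_def sh_el_def
  proof (intro conjI ballI impI)
    show "sh_res F m x \<in> fobj F (Dom I m)" if "m \<in> Arr I" "x \<in> fobj F (Cod I m)" for m x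
      using 3[OF that(1)] that(2) by auto
    show "sh_res F (Id I t) x = x" if "t \<in> Obj I" "x \<in> fobj F t" for t x
      using d(3)[OF that(1)] that(2) unfolding sh_res_def set_cat_simps by simp
    show "sh_res F (m \<cdot>\<^bsub>I\<^esub> n) x = sh_res F n (sh_res F m x)"
      if mn: "m \<in> Arr I" "n \<in> Arr I" "Cod I n = Dom I m" and x: "x \<in> fobj F (Cod I m)" for m n x
    proof -
      have "farr F (m \<cdot>\<^bsub>I\<^esub> n) = farr F n \<cdot>\<^bsub>set_cat U\<^esub> farr F m" using d(4)[OF mn] .
      then have "sh_res F (m \<cdot>\<^bsub>I\<^esub> n) = compose (fobj F (Cod I m)) (sh_res F n) (sh_res F m)"
        unfolding 2[OF mn(1)] 2[OF mn(2)] set_cat_simps sh_res_def[of F "m \<cdot>\<^bsub>I\<^esub> n"] by simp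
      then show ?thesis using x by (simp add: compose_eq)
    qed
  qed
qed

lemma sheaf_iff_is_sheaf: "sheaf (sh_el F) (sh_res F) \<longleftrightarrow> psh (sh_el F) (sh_res F) \<and> is_sheaf I J F"
  unfolding sheaf_def is_sheaf_def sh_el_def sh_res_def by (rule refl)

lemma Sh_sheaf:
  assumes "F \<in> Obj ShU"
  shows "sheaf (sh_el F) (sh_res F)"
  unfolding sheaf_iff_is_sheaf using assms Psh_psh unfolding Sh_obj by simp

lemma Psh_homD:
  assumes "A \<in> hom PshU F G"
  obtains \<eta> where "A = (F, \<eta>, G)" "F \<in> Obj PshU" "G \<in> Obj PshU" "\<eta> \<in> extensional (Obj I)"
    "\<And>i. i \<in> Obj I \<Longrightarrow> \<eta> i = (fobj F i, sh_app A i, fobj G i)"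
    "\<And>i. i \<in> Obj I \<Longrightarrow> sh_app A i \<in> fobj F i \<rightarrow>\<^sub>E fobj G i"
    "natural (sh_el F) (sh_res F) (sh_el G) (sh_res G) (sh_app A)"
proof -
  obtain \<eta> where A: "A = (F, \<eta>, G)" and F: "F \<in> Obj PshU" and G: "G \<in> Obj PshU"
    and n: "nat_trans (opposite I) (set_cat U) F G \<eta>" and e: "\<eta> \<in> extensional (Obj I)"
    using assms unfolding functor_category_hom by auto
  note d = nat_transD[OF n, unfolded op_simps]
  have 1: "\<eta> i = (fobj F i, sh_app A i, fobj G i)" "sh_app A i \<in> fobj F i \<rightarrow>\<^sub>E fobj G i" if "i \<in> Obj I" for i
    using d(1)[OF that] unfolding set_cat_hom sh_app_def A by auto
  have "natural (sh_el F) (sh_res F) (sh_el G) (sh_res G) (sh_app A)"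
    unfolding natural_def sh_el_def
  proof (intro conjI ballI)
    show "sh_app A t x \<in> fobj G t" if "t \<in> Obj I" "x \<in> fobj F t" for t x using 1(2)[OF that(1)] that(2) by auto
    fix m x assume m: "m \<in> Arr I" and x: "x \<in> fobj F (Cod I m)"
    have "\<eta> (Dom I m) \<cdot>\<^bsub>set_cat U\<^esub> farr F m = farr G m \<cdot>\<^bsub>set_cat U\<^esub> \<eta> (Cod I m)" using d(2)[OF m] .
    then have "compose (fobj F (Cod I m)) (sh_app A (Dom I m)) (sh_res F m) =
        compose (fobj F (Cod I m)) (sh_res G m) (sh_app A (Cod I m))"
      unfolding 1(1)[OF arr_dom[OF m]] 1(1)[OF arr_cod[OF m]] Psh_res[OF F m] Psh_res[OF G m] set_cat_simps by simp
    from fun_cong[OF this, of x] show "sh_app A (Dom I m) (sh_res F m x) = sh_res G m (sh_app A (Cod I m) x)"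
      using x by (simp add: compose_eq)
  qed
  then show ?thesis using that A F G e 1 by blast
qed

lemma Sh_full:
  assumes F: "F \<in> Obj ShU" and G: "G \<in> Obj ShU" and \<phi>: "natural (sh_el F) (sh_res F) (sh_el G) (sh_res G) \<phi>"
  shows "\<exists>A\<in>hom ShU F G. \<forall>t\<in>Obj I. \<forall>x\<in>sh_el F t. sh_app A t x = \<phi> t x"
proof -
  have F': "F \<in> Obj PshU" and G': "G \<in> Obj PshU" using F G unfolding Sh_obj by auto
  \<comment> \<open>Components and their functions are cut down to the carriers, as the extensional
    encoding of arrows demands; outside the carriers \<open>\<phi>\<close> is unconstrained.\<close>
  define \<eta> where "\<eta> = (\<lambda>i\<in>Obj I. (fobj F i, (\<lambda>x\<in>fobj F i. \<phi> i x), fobj G i))"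
  have "nat_trans (opposite I) (set_cat U) F G \<eta>"
    unfolding nat_trans_def op_simps
  proof (intro conjI ballI)
    show "\<eta> i \<in> hom (set_cat U) (fobj F i) (fobj G i)" if i: "i \<in> Obj I" for i
      unfolding set_cat_hom \<eta>_def
      using Psh_U[OF F' i] Psh_U[OF G' i] natural_mem[OF \<phi> i] i unfolding sh_el_def by auto
    fix m assume m: "m \<in> Arr I"
    note d = arr_dom[OF m] and c = arr_cod[OF m]
    have "compose (fobj F (Cod I m)) (\<lambda>x\<in>fobj F (Dom I m). \<phi> (Dom I m) x) (sh_res F m) =
        compose (fobj F (Cod I m)) (sh_res G m) (\<lambda>x\<in>fobj F (Cod I m). \<phi> (Cod I m) x)"
      unfolding compose_def
      by (rule restrict_ext) (use natural_res[OF \<phi> m] Psh_res_mem[OF F' m] in \<open>auto simp: sh_el_def\<close>)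
    then show "\<eta> (Dom I m) \<cdot>\<^bsub>set_cat U\<^esub> farr F m = farr G m \<cdot>\<^bsub>set_cat U\<^esub> \<eta> (Cod I m)"
      unfolding Psh_res[OF F' m] Psh_res[OF G' m] \<eta>_def using d c by (simp add: set_cat_simps)
  qed
  then have "(F, \<eta>, G) \<in> hom ShU F G"
    unfolding Sh_hom functor_category_hom using F G F' G' by (simp add: Sh_obj \<eta>_def)
  moreover have "sh_app (F, \<eta>, G) t x = \<phi> t x" if "t \<in> Obj I" "x \<in> sh_el F t" for t x
    using that unfolding sh_app_def \<eta>_def sh_el_def by simp
  ultimately show ?thesis by blast
qed

text \<open>The sets \<open>P t\<close> already lie in \<open>U\<close>, so the functor keeps the
  same values. The transport along identities only accounts for the restriction maps having been
  made extensional.\<close>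

lemma Sh_represent:
  assumes P: "sheaf P r" and PU: "\<And>t. t \<in> Obj I \<Longrightarrow> P t \<in> U"
  shows "\<exists>F\<in>Obj ShU. \<exists>\<theta>. natural P r (sh_el F) (sh_res F) \<theta> \<and> (\<forall>t\<in>Obj I. bij_betw (\<theta> t) (P t) (sh_el F t))"
proof -
  note p = sheaf_psh[OF P]
  define F where "F = \<lparr>fobj = (\<lambda>i\<in>Obj I. P i), farr = (\<lambda>m\<in>Arr I. (P (Cod I m), (\<lambda>x\<in>P (Cod I m). r m x), P (Dom I m)))\<rparr>"
  have Fo [simp]: "fobj F i = P i" if "i \<in> Obj I" for i using that unfolding F_def by simp
  have Fa [simp]: "farr F m = (P (Cod I m), (\<lambda>x\<in>P (Cod I m). r m x), P (Dom I m))" if "m \<in> Arr I" for m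
    using that unfolding F_def by simp
  have "is_functor (opposite I) (set_cat U) F"
    unfolding is_functor_def op_simps set_cat_simps
  proof (intro conjI ballI impI)
    show "fobj F i \<in> U" if "i \<in> Obj I" for i using that PU by simp
    show "farr F m \<in> hom (set_cat U) (fobj F (Cod I m)) (fobj F (Dom I m))" if m: "m \<in> Arr I" for m
      unfolding set_cat_hom using PU psh_mem[OF p m] m by auto
    show "farr F (Id I i) = (fobj F i, \<lambda>x\<in>fobj F i. x, fobj F i)" if i: "i \<in> Obj I" for i
      using i psh_id[OF p i] by (auto intro!: restrict_ext)
    show "farr F (m \<cdot>\<^bsub>I\<^esub> n) = farr F n \<cdot>\<^bsub>set_cat U\<^esub> farr F m" if mn: "m \<in> Arr I" "n \<in> Arr I" "Cod I n = Dom I m" for m n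
      using mn psh_comp[OF p mn] psh_mem[OF p mn(1)] by (auto simp: set_cat_simps compose_def intro!: restrict_ext)
  qed
  moreover have "fobj F \<in> extensional (Obj I)" "farr F \<in> extensional (Arr I)" unfolding F_def by simp_all
  ultimately have FO: "F \<in> Obj PshU" unfolding functor_category_obj by simp
  have id: "natural P r (sh_el F) (sh_res F) (\<lambda>t x. x)"
    unfolding natural_def sh_el_def sh_res_def by simp
  have bij: "bij_betw (\<lambda>x. x) (P t) (sh_el F t)" if "t \<in> Obj I" for t
    unfolding sh_el_def using that by (simp add: bij_betw_def)
  have "sheaf (sh_el F) (sh_res F)" by (rule sheaf_transport[OF P id bij])
  then have "is_sheaf I J F" unfolding sheaf_iff_is_sheaf by simp
  then have "F \<in> Obj ShU" using FO unfolding Sh_obj by blast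
  then show ?thesis using id bij by blast
qed

lemma Sh_sheaf_cat: "sheaf_cat I J ShU U sh_el sh_res sh_app (\<lambda>i. i)"
proof (rule sheaf_cat.intro, rule site_axioms, rule sheaf_cat_axioms.intro, rule Sh_category, rule U)
  have sub: "B \<in> U" if "B \<lesssim> A" "A \<in> U" for A B using U that unfolding set_universe_def by blast
  obtain N where N: "N \<in> U" using U unfolding set_universe_def by blast
  \<comment> \<open>A bound must take values in \<open>U\<close> at every index; the empty set is
    the default at indices that are not objects.\<close>
  have emp: "{} \<in> U" by (rule sub[OF _ N]) simp
  have bd: "bounded_family (Obj I) U (\<lambda>i. i) P" if P: "\<And>t. t \<in> Obj I \<Longrightarrow> P t \<in> U" for P :: "'o \<Rightarrow> 'u set"
    by (rule bounded_familyI[of U "\<lambda>i. if i \<in> Obj I then P i else {}"])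
      (use P emp in \<open>auto intro: small_mem\<close>)
  show "bounded_family (Obj I) U (\<lambda>i. i) (\<lambda>t. \<Pi>\<^sub>E m\<in>into t. \<beta> (Dom I m))" if \<beta>: "\<And>b. \<beta> b \<in> U" for \<beta>
  proof -
    have "\<exists>B\<in>U. B \<approx> (\<Pi>\<^sub>E m\<in>into t. \<beta> (Dom I m))" for t
    proof -
      \<comment> \<open>This is the point where products indexed by arrows of the site enter. Later
        constructions see them only through \<open>into_bound\<close>.\<close>
      have "into t \<subseteq> Arr I" unfolding into_def by blast
      from has_products_subset[OF U products this] show ?thesis using \<beta> unfolding has_products_def by simp
    qed
    then have "\<forall>t. \<exists>B. B \<in> U \<and> (\<Pi>\<^sub>E m\<in>into t. \<beta> (Dom I m)) \<lesssim> B"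
      by (meson eqpoll_imp_lepoll eqpoll_sym)
    from choice[OF this] show ?thesis unfolding bounded_family_def by blast
  qed
  show "bounded_family (Obj I) U (\<lambda>i. i) (sh_el F)" if "F \<in> Obj ShU" for F
    by (rule bd) (use that Psh_U in \<open>auto simp: Sh_obj sh_el_def\<close>)
  show "sheaf (sh_el F) (sh_res F)" if "F \<in> Obj ShU" for F by (rule Sh_sheaf[OF that])
  show "natural (sh_el F) (sh_res F) (sh_el G) (sh_res G) (sh_app A)" if "A \<in> hom ShU F G" for A F G
  proof -
    have "A \<in> hom PshU F G" using that unfolding Sh_hom by simp
    then show ?thesis by (rule Psh_homD)
  qed
  show "sh_app (Id ShU F) t x = x" if "F \<in> Obj ShU" "t \<in> Obj I" "x \<in> sh_el F t" for F t x
    using that unfolding Sh_id functor_category_id sh_app_def sh_el_def by (simp add: set_cat_simps)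
  show "sh_app (B \<cdot>\<^bsub>ShU\<^esub> A) t x = sh_app B t (sh_app A t x)"
    if A': "A \<in> hom ShU F G" and B': "B \<in> hom ShU G H" and t: "t \<in> Obj I" and x: "x \<in> sh_el F t" for A B F G H t x
  proof -
    have "A \<in> hom PshU F G" using A' unfolding Sh_hom by blast
    then obtain \<eta> where A: "A = (F, \<eta>, G)" "\<eta> t = (fobj F t, sh_app A t, fobj G t)" by (rule Psh_homD) (use t in blast)
    have "B \<in> hom PshU G H" using B' unfolding Sh_hom by blast
    then obtain \<theta> where B: "B = (G, \<theta>, H)" "\<theta> t = (fobj G t, sh_app B t, fobj H t)" by (rule Psh_homD) (use t in blast)
    have "mid (mid (B \<cdot>\<^bsub>ShU\<^esub> A) t) = mid (\<theta> t \<cdot>\<^bsub>set_cat U\<^esub> \<eta> t)"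
      unfolding Sh_comp A(1) B(1) functor_category_comp using t by simp
    also have "\<dots> = compose (fobj F t) (sh_app B t) (sh_app A t)" unfolding A(2) B(2) set_cat_simps by simp
    finally show ?thesis using x unfolding sh_app_def[of "B \<cdot>\<^bsub>ShU\<^esub> A"] sh_el_def by (simp add: compose_eq)
  qed
  show "A = B" if A': "A \<in> hom ShU F G" and B': "B \<in> hom ShU F G"
    and eq: "\<And>t x. t \<in> Obj I \<Longrightarrow> x \<in> sh_el F t \<Longrightarrow> sh_app A t x = sh_app B t x" for A B F G
  proof -
    have A0: "A \<in> hom PshU F G" and B0: "B \<in> hom PshU F G" using A' B' unfolding Sh_hom by auto
    obtain \<eta> where A: "A = (F, \<eta>, G)" "\<eta> \<in> extensional (Obj I)" "\<And>i. i \<in> Obj I \<Longrightarrow> \<eta> i = (fobj F i, sh_app A i, fobj G i)"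
      "\<And>i. i \<in> Obj I \<Longrightarrow> sh_app A i \<in> fobj F i \<rightarrow>\<^sub>E fobj G i" by (rule Psh_homD[OF A0]) blast
    obtain \<theta> where B: "B = (F, \<theta>, G)" "\<theta> \<in> extensional (Obj I)" "\<And>i. i \<in> Obj I \<Longrightarrow> \<theta> i = (fobj F i, sh_app B i, fobj G i)"
      "\<And>i. i \<in> Obj I \<Longrightarrow> sh_app B i \<in> fobj F i \<rightarrow>\<^sub>E fobj G i" by (rule Psh_homD[OF B0]) blast
    have "\<eta> = \<theta>"
    proof (rule extensionalityI[OF A(2) B(2)])
      fix i assume i: "i \<in> Obj I"
      have "sh_app A i = sh_app B i"
        by (rule PiE_ext[OF A(4)[OF i] B(4)[OF i]]) (use eq[OF i] in \<open>simp add: sh_el_def\<close>)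
      then show "\<eta> i = \<theta> i" using A(3)[OF i] B(3)[OF i] by simp
    qed
    then show ?thesis using A(1) B(1) by simp
  qed
  show "\<exists>A\<in>hom ShU F G. \<forall>t\<in>Obj I. \<forall>x\<in>sh_el F t. sh_app A t x = \<phi> t x"
    if "F \<in> Obj ShU" "G \<in> Obj ShU" "natural (sh_el F) (sh_res F) (sh_el G) (sh_res G) \<phi>" for F G \<phi>
    by (rule Sh_full[OF that])
  show "\<exists>F\<in>Obj ShU. \<exists>\<theta>. natural P r (sh_el F) (sh_res F) \<theta> \<and> (\<forall>t\<in>Obj I. bij_betw (\<theta> t) (P t) (sh_el F t))"
    if P: "sheaf P r" and b: "bounded_family (Obj I) U (\<lambda>i. i) P" for P :: "'o \<Rightarrow> 'u set" and r
  proof (rule Sh_represent[OF P])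
    \<comment> \<open>With \<open>\<pi>\<close> the identity a bound is simply one member of
      \<open>U\<close> per stage, and downward closure of \<open>U\<close> puts \<open>P t\<close>
      itself into \<open>U\<close>.\<close>
    show "P t \<in> U" if "t \<in> Obj I" for t
      using b sub that unfolding bounded_family_def by blast
  qed
qed

end

theorem proposition5p8:
  fixes I :: "('o, 'a) cat" and J :: "'o \<Rightarrow> 'a set set" and U :: "'u set set"
  assumes "grothendieck_site I J"
    and "set_universe U"
    and "has_products U (Arr I)"
  shows "bass_serre (Sh I J U)"
proof -
  interpret small_site I J U by unfold_locales (rule assms)+
  interpret sheaf_cat I J "Sh I J U" U sh_el sh_res sh_app "\<lambda>i. i" by (rule Sh_sheaf_cat)
  show ?thesis by (rule sheaf_cat_bass_serre)
qed

end
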